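(* Let $T,\mu>0$, $Q^{1/2}\in\mathcal L_2^1$ and $\xi\in H^2$ (nonrandom), with the zero-mode condition $\hat\xi_0=0$ and $Q^{1/2}\mathbf 1=0$. Let $\psi$ be the solution of the deterministic KdV equation with $\psi(0)=\xi$ and $\chi$ the solution of the linearized fluctuation equation. For step sizes $\tau=T/N$, $N\in\mathbb N$, and $t_n=n\tau$, let $\psi_n$ ($0\le n\le N$) be nonrandom zero-mean real functions such that, for some sufficiently small $\tau_0>0$ and some $\beta\in(\tfrac12,1]$: $\psi_n^{(1)}\in L^\infty$ uniformly in $n$ (and $\tau\in(0,\tau_0)$), and $\max_n\|\psi(t_n)-\psi_n\|\le C'\tau^\beta$ for all $\tau\in(0,\tau_0)$, with $C'$ independent of $\tau$. Let $\chi_n$ be defined by $\chi_0=0$ and $$\chi_{n+1}=e^{-\tau\partial_x^3}\chi_n+\tfrac{2\mu}{3}\big(e^{-\tau\partial_x^3}\partial_x^{-1}\psi_n\big)\big(e^{-\tau\partial_x^3}\partial_x^{-1}\chi_n\big)-\tfrac{2\mu}{3}e^{-\tau\partial_x^3}\big[(\partial_x^{-1}\psi_n)(\partial_x^{-1}\chi_n)\big]+\int_{t_n}^{t_{n+1}}e^{-(t_{n+1}-s)\partial_x^3}Q^{1/2}dW(s).$$ Then there is a constant $C$ independent of $\tau$ such that for all $\tau\in(0,\tau_0)$ $$\max_{0\le n\le N}\|\chi(t_n)-\chi_n\|_{L^2(\Omega;L^2)}\le C\,\tau^{\min(\frac12,\beta-\frac12)} .$$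
   Context: $\mathbb T=[-\pi,\pi]$ with periodic boundary conditions; $L^2=L^2(\mathbb T;\mathbb R)$ with norm $\|\cdot\|$; $f=\frac1{\sqrt{2\pi}}\sum_{\ell\in\mathbb Z}\hat f_\ell e^{i\ell x}$; $\|f\|_{H^s}^2=\sum_\ell(1+\ell^2)^s|\hat f_\ell|^2$. For $j\in\mathbb N_0$, $f^{(j)}(x):=\frac1{\sqrt{2\pi}}\sum_\ell|\ell|^j|\hat f_\ell|e^{i\ell x}$. $\partial_x^{-1}f:=\frac1{\sqrt{2\pi}}\sum_{\ell\ne0}\frac1{i\ell}\hat f_\ell e^{i\ell x}$. $\mathcal L_2^\sigma$: Hilbert--Schmidt operators from $L^2$ to $H^\sigma$. $\|Y\|_{L^2(\Omega;L^2)}=(\mathbb E\|Y\|^2)^{1/2}$. $W=\sum_k\beta_ke_k$ is a cylindrical Wiener process on $L^2$ on a complete filtered probability space; $Q^{1/2}$ is the square root of a covariance (nonnegative self-adjoint) operator $Q$ on $L^2$; $\mathbf 1$ is the constant function $1$. $S(t)=e^{-t\partial_x^3}$ is the Airy group. Deterministic KdV: $\dot\psi=-\partial_x^3\psi+\mu\partial_x(\psi^2)$, $\psi(0)=\xi$; for $\xi\in H^2$ it has a unique solution $\psi\in C([0,T];H^2)$. Linearized fluctuation equation: $d\chi=(-\partial_x^3\chi+2\mu\partial_x(\psi\chi))dt+Q^{1/2}dW$, $\chi(0)=0$, in mild form $\chi(t)=2\mu\int_0^tS(t-s)\partial_x(\psi(s)\chi(s))ds+\int_0^tS(t-s)Q^{1/2}dW(s)$,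 $\chi\in C([0,T];H^1)$ a.s. *)

theory Defs
  imports "HOL-Probability.Probability"
begin

section \<open>The real Hilbert space \<open>L\<^sup>2\<close> of the torus\<close>

text \<open>
  The torus is the interval from \<open>-\<pi>\<close> to \<open>\<pi>\<close> with Lebesgue measure; periodicity enters through
  Fourier series only. The type below consists of classes, modulo equality almost everywhere, of
  real square integrable functions.
\<close>

abbreviation torus :: "real measure" where
  "torus \<equiv> lebesgue_on {-pi..pi}"

definition sq_int :: "(real \<Rightarrow> real) \<Rightarrow> bool" where
  "sq_int f \<longleftrightarrow> f \<in> borel_measurable torus \<and> integrable torus (\<lambda>x. (f x)\<^sup>2)"

definition l2_rel :: "(real \<Rightarrow> real) \<Rightarrow> (real \<Rightarrow> real) \<Rightarrow> bool" where
  "l2_rel f g \<longleftrightarrow> sq_int f \<and> sq_int g \<and> (AE x in torus. f x = g x)"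

lemma sq_int_meas [measurable_dest]: "sq_int f \<Longrightarrow> f \<in> borel_measurable torus"
  by (simp add: sq_int_def)

lemma sq_int_mult_integrable:
  assumes "sq_int f" "sq_int g"
  shows "integrable torus (\<lambda>x. f x * g x)"
proof (rule Bochner_Integration.integrable_bound)
  show "integrable torus (\<lambda>x. (f x)\<^sup>2 + (g x)\<^sup>2)"
    using assms by (auto simp: sq_int_def)
  show "(\<lambda>x. f x * g x) \<in> borel_measurable torus"
    using assms by (auto simp: sq_int_def)
  have "\<bar>a * b\<bar> \<le> a\<^sup>2 + b\<^sup>2" for a b :: real
  proof -
    have "0 \<le> (\<bar>a\<bar> - \<bar>b\<bar>)\<^sup>2" by simp
    then have "2 * (\<bar>a\<bar> * \<bar>b\<bar>) \<le> a\<^sup>2 + b\<^sup>2"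
      by (simp add: power2_diff)
    moreover have "0 \<le> \<bar>a\<bar> * \<bar>b\<bar>" by simp
    ultimately show ?thesis unfolding abs_mult by linarith
  qed
  then show "AE x in torus. norm (f x * g x) \<le> norm ((f x)\<^sup>2 + (g x)\<^sup>2)"
    by simp
qed

lemma sq_int_add:
  assumes "sq_int f" "sq_int g"
  shows "sq_int (\<lambda>x. f x + g x)"
proof -
  have "integrable torus (\<lambda>x. (f x)\<^sup>2 + (g x)\<^sup>2 + 2 * (f x * g x))"
    using assms sq_int_mult_integrable[OF assms] by (auto simp: sq_int_def)
  then show ?thesis
    using assms by (auto simp: sq_int_def power2_sum algebra_simps)
qed

lemma sq_int_scale: "sq_int f \<Longrightarrow> sq_int (\<lambda>x. c * f x)"
  by (auto simp: sq_int_def power_mult_distrib)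

lemma sq_int_const: "sq_int (\<lambda>x. c)"
  by (auto simp: sq_int_def)

lemma sq_int_continuous:
  assumes "continuous_on {-pi..pi} f"
  shows "sq_int f"
  unfolding sq_int_def
proof
  show "f \<in> borel_measurable torus"
    using assms by (intro continuous_imp_measurable_on_sets_lebesgue) auto
  have "set_integrable lebesgue {-pi..pi} (\<lambda>x. (f x)\<^sup>2)"
    using assms by (intro absolutely_integrable_continuous_real continuous_intros)
  then show "integrable torus (\<lambda>x. (f x)\<^sup>2)"
    by (simp add: set_integrable_def integrable_restrict_space)
qed

quotient_type l2_torus = "real \<Rightarrow> real" / partial: l2_rel
proof (rule part_equivpI)
  show "\<exists>f. l2_rel f f"
    using sq_int_const[of 0] by (auto simp: l2_rel_def)
  show "symp l2_rel"
    by (auto simp: symp_def l2_rel_def)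
  show "transp l2_rel"
    unfolding transp_def l2_rel_def by auto
qed

instantiation l2_torus :: real_inner
begin

lift_definition zero_l2_torus :: l2_torus is "\<lambda>x. 0"
  by (simp add: l2_rel_def sq_int_const)

lift_definition plus_l2_torus :: "l2_torus \<Rightarrow> l2_torus \<Rightarrow> l2_torus" is "\<lambda>f g x. f x + g x"
  unfolding l2_rel_def using sq_int_add by auto

lift_definition scaleR_l2_torus :: "real \<Rightarrow> l2_torus \<Rightarrow> l2_torus" is "\<lambda>c f x. c * f x"
  unfolding l2_rel_def using sq_int_scale by auto

lift_definition inner_l2_torus :: "l2_torus \<Rightarrow> l2_torus \<Rightarrow> real"
  is "\<lambda>f g. \<integral>x. f x * g x \<partial>torus"
  unfolding l2_rel_def by (intro integral_cong_AE) (auto simp: sq_int_def)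

definition uminus_l2_torus :: "l2_torus \<Rightarrow> l2_torus" where
  "uminus_l2_torus f = (-1) *\<^sub>R f"

definition minus_l2_torus :: "l2_torus \<Rightarrow> l2_torus \<Rightarrow> l2_torus" where
  "minus_l2_torus f g = f + (-1) *\<^sub>R g"

definition norm_l2_torus :: "l2_torus \<Rightarrow> real" where
  "norm_l2_torus f = sqrt (inner f f)"

definition sgn_l2_torus :: "l2_torus \<Rightarrow> l2_torus" where
  "sgn_l2_torus f = inverse (norm f) *\<^sub>R f"

definition dist_l2_torus :: "l2_torus \<Rightarrow> l2_torus \<Rightarrow> real" where
  "dist_l2_torus f g = norm (f - g)"

definition uniformity_l2_torus :: "(l2_torus \<times> l2_torus) filter" where
  "uniformity_l2_torus = (INF e\<in>{0 <..}. principal {(x, y). dist x y < e})"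

definition open_l2_torus :: "l2_torus set \<Rightarrow> bool" where
  "open_l2_torus U = (\<forall>x\<in>U. eventually (\<lambda>(x', y). x' = x \<longrightarrow> y \<in> U) uniformity)"

instance
proof
  fix f g h :: l2_torus and a b :: real and U :: "l2_torus set"
  show "f + g + h = f + (g + h)"
    by transfer (auto simp: l2_rel_def algebra_simps intro!: sq_int_add)
  show "f + g = g + f"
    by transfer (auto simp: l2_rel_def algebra_simps intro!: sq_int_add)
  show "0 + f = f"
    by transfer (auto simp: l2_rel_def)
  show "- f + f = 0"
    unfolding uminus_l2_torus_def by transfer (auto simp: l2_rel_def sq_int_const)
  show "f - g = f + - g"
    by (simp add: minus_l2_torus_def uminus_l2_torus_def)
  show "a *\<^sub>R (f + g) = a *\<^sub>R f + a *\<^sub>R g"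
    by transfer (auto simp: l2_rel_def distrib_left intro!: sq_int_add sq_int_scale)
  show "(a + b) *\<^sub>R f = a *\<^sub>R f + b *\<^sub>R f"
    by transfer (auto simp: l2_rel_def distrib_right intro!: sq_int_add sq_int_scale)
  show "a *\<^sub>R b *\<^sub>R f = (a * b) *\<^sub>R f"
    by transfer (auto simp: l2_rel_def mult.assoc intro!: sq_int_scale)
  show "1 *\<^sub>R f = f"
    by transfer (auto simp: l2_rel_def)
  show "dist f g = norm (f - g)" by (simp add: dist_l2_torus_def)
  show "sgn f = inverse (norm f) *\<^sub>R f" by (simp add: sgn_l2_torus_def)
  show "norm f = sqrt (inner f f)" by (simp add: norm_l2_torus_def)
  show "uniformity = (INF e\<in>{0 <..}. principal {(x, y :: l2_torus). dist x y < e})"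
    by (simp add: uniformity_l2_torus_def)
  show "open U = (\<forall>x\<in>U. eventually (\<lambda>(x', y). x' = x \<longrightarrow> y \<in> U) uniformity)"
    by (simp add: open_l2_torus_def)
  show "inner f g = inner g f"
    by transfer (simp add: mult.commute)
  show "inner (f + g) h = inner f h + inner g h"
    by transfer (simp add: l2_rel_def distrib_right sq_int_mult_integrable)
  show "inner (a *\<^sub>R f) g = a * inner f g"
    by transfer (simp add: mult.assoc)
  show "0 \<le> inner f f"
    by transfer simp
  show "inner f f = 0 \<longleftrightarrow> f = 0"
  proof transfer
    fix f assume "l2_rel f f"
    then have f: "sq_int f" by (simp add: l2_rel_def)
    have "(\<integral>x. f x * f x \<partial>torus) = 0 \<longleftrightarrow> (AE x in torus. f x * f x = 0)"
      using sq_int_mult_integrable[OF f f] by (intro integral_nonneg_eq_0_iff_AE) auto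
    then show "(\<integral>x. f x * f x \<partial>torus) = 0 \<longleftrightarrow> l2_rel f (\<lambda>x. 0)"
      using f by (simp add: l2_rel_def sq_int_const)
  qed
qed

end

lift_definition l2_one :: l2_torus is "\<lambda>x. 1"
  by (simp add: l2_rel_def sq_int_const)

text \<open>
  The pointwise product, with value \<open>0\<close> (a totalisation) in case it is not square integrable;
  it is whenever one of the factors is bounded, for instance in \<open>H\<^sup>1\<close>.
\<close>

lift_definition l2_mult :: "l2_torus \<Rightarrow> l2_torus \<Rightarrow> l2_torus" (infixl \<open>\<odot>\<close> 70)
  is "\<lambda>f g. if sq_int (\<lambda>x. f x * g x) then (\<lambda>x. f x * g x) else (\<lambda>x. 0)"
proof -
  fix f f' g g' assume "l2_rel f f'" "l2_rel g g'"
  then have meas: "f \<in> borel_measurable torus" "f' \<in> borel_measurable torus"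
      "g \<in> borel_measurable torus" "g' \<in> borel_measurable torus"
    and eq: "AE x in torus. f x * g x = f' x * g' x"
    by (auto simp: l2_rel_def sq_int_def)
  have "integrable torus (\<lambda>x. (f x * g x)\<^sup>2) \<longleftrightarrow> integrable torus (\<lambda>x. (f' x * g' x)\<^sup>2)"
    using meas eq by (intro integrable_cong_AE) auto
  then have "sq_int (\<lambda>x. f x * g x) \<longleftrightarrow> sq_int (\<lambda>x. f' x * g' x)"
    using meas by (auto simp: sq_int_def)
  then show "l2_rel (if sq_int (\<lambda>x. f x * g x) then (\<lambda>x. f x * g x) else (\<lambda>x. 0))
      (if sq_int (\<lambda>x. f' x * g' x) then (\<lambda>x. f' x * g' x) else (\<lambda>x. 0))"
    using eq by (auto simp: l2_rel_def sq_int_const)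
qed

text \<open>\<open>f\<close> lies in \<open>L\<^sup>\<infinity>\<close> with norm at most \<open>K\<close>.\<close>

lift_definition Linf_le :: "l2_torus \<Rightarrow> real \<Rightarrow> bool"
  is "\<lambda>f K. AE x in torus. \<bar>f x\<bar> \<le> K"
  unfolding l2_rel_def by (auto simp: fun_eq_iff elim: eventually_elim2)


section \<open>Fourier series\<close>

lift_definition fcoeff :: "l2_torus \<Rightarrow> int \<Rightarrow> complex"
  is "\<lambda>f l. (\<integral>x. of_real (f x) * exp (- (\<i> * of_int l * of_real x)) \<partial>torus) / of_real (sqrt (2 * pi))"
proof (rule ext)
  fix f g and l :: int assume "l2_rel f g"
  then have meas: "f \<in> borel_measurable torus" "g \<in> borel_measurable torus"
    and eq: "AE x in torus. f x = g x"
    by (auto simp: l2_rel_def sq_int_def)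
  have [measurable]: "(\<lambda>x. exp (- (\<i> * of_int l * complex_of_real x))) \<in> borel_measurable torus"
    by (intro continuous_imp_measurable_on_sets_lebesgue continuous_intros) auto
  have "(\<integral>x. of_real (f x) * exp (- (\<i> * of_int l * of_real x)) \<partial>torus)
      = (\<integral>x. of_real (g x) * exp (- (\<i> * of_int l * of_real x)) \<partial>torus)"
    using meas eq by (intro integral_cong_AE) auto
  then show "(\<integral>x. of_real (f x) * exp (- (\<i> * of_int l * of_real x)) \<partial>torus) / of_real (sqrt (2 * pi))
      = (\<integral>x. of_real (g x) * exp (- (\<i> * of_int l * of_real x)) \<partial>torus) / of_real (sqrt (2 * pi))"
    by simp
qed

text \<open>
  For conjugate symmetric coefficients, \<open>c (-l) = cnj (c l)\<close>, the symmetric partial sum is real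
  and the \<open>Re\<close> only adjusts its type. All coefficients used below are of this kind.
\<close>

lift_definition fourier_partial_sum :: "(int \<Rightarrow> complex) \<Rightarrow> nat \<Rightarrow> l2_torus"
  is "\<lambda>c n x. Re ((\<Sum>l=-int n..int n. c l * exp (\<i> * of_int l * of_real x)) / of_real (sqrt (2 * pi)))"
  unfolding l2_rel_def by (auto intro!: sq_int_continuous continuous_intros)

text \<open>
  The limit is taken in \<open>L\<^sup>2\<close>. It exists if and only if the (conjugate symmetric) coefficients
  are square summable.
\<close>

definition fourier_series :: "(int \<Rightarrow> complex) \<Rightarrow> l2_torus" where
  "fourier_series c = lim (fourier_partial_sum c)"

definition fourier_mult :: "(int \<Rightarrow> complex) \<Rightarrow> l2_torus \<Rightarrow> l2_torus" where
  "fourier_mult m f = fourier_series (\<lambda>l. m l * fcoeff f l)"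

definition Dx :: "l2_torus \<Rightarrow> l2_torus" where
  "Dx = fourier_mult (\<lambda>l. \<i> * of_int l)"

definition Dx_inv :: "l2_torus \<Rightarrow> l2_torus" where
  "Dx_inv = fourier_mult (\<lambda>l. if l = 0 then 0 else 1 / (\<i> * of_int l))"

text \<open>The Airy group \<open>S(t) = exp (- t \<partial>\<^sub>x\<^sup>3)\<close>.\<close>

definition airy :: "real \<Rightarrow> l2_torus \<Rightarrow> l2_torus" where
  "airy t = fourier_mult (\<lambda>l. exp (- of_real t * (\<i> * of_int l) ^ 3))"

text \<open>
  The function \<open>f\<^sup>(\<^sup>j\<^sup>)\<close>. Note the moduli on the Fourier coefficients: this is not the usual
  derivative. It is an \<open>L\<^sup>2\<close> function if and only if \<open>f\<close> is in \<open>H\<^sup>j\<close>.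
\<close>

definition abs_deriv :: "nat \<Rightarrow> l2_torus \<Rightarrow> l2_torus" where
  "abs_deriv j f = fourier_series (\<lambda>l. of_real (\<bar>of_int l\<bar> ^ j * cmod (fcoeff f l)))"


section \<open>Sobolev spaces\<close>

definition in_H :: "real \<Rightarrow> l2_torus \<Rightarrow> bool" where
  "in_H s f \<longleftrightarrow> (\<lambda>l. (1 + (of_int l)\<^sup>2) powr s * (cmod (fcoeff f l))\<^sup>2) summable_on UNIV"

definition H_norm :: "real \<Rightarrow> l2_torus \<Rightarrow> real" where
  "H_norm s f = sqrt (\<Sum>\<^sub>\<infinity>l. (1 + (of_int l)\<^sup>2) powr s * (cmod (fcoeff f l))\<^sup>2)"

definition continuous_on_H :: "real \<Rightarrow> real set \<Rightarrow> (real \<Rightarrow> l2_torus) \<Rightarrow> bool" where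
  "continuous_on_H s A u \<longleftrightarrow> (\<forall>t\<in>A. in_H s (u t)) \<and>
     (\<forall>t\<in>A. ((\<lambda>r. H_norm s (u r - u t)) \<longlongrightarrow> 0) (at t within A))"


section \<open>Operators\<close>

definition orthonormal_basis :: "(nat \<Rightarrow> l2_torus) \<Rightarrow> bool" where
  "orthonormal_basis e \<longleftrightarrow>
     (\<forall>j k. inner (e j) (e k) = (if j = k then 1 else 0)) \<and> closure (span (range e)) = UNIV"

definition nonneg_selfadjoint :: "(l2_torus \<Rightarrow> l2_torus) \<Rightarrow> bool" where
  "nonneg_selfadjoint A \<longleftrightarrow> bounded_linear A \<and>
     (\<forall>f g. inner (A f) g = inner f (A g)) \<and> (\<forall>f. 0 \<le> inner (A f) f)"

definition is_op_sqrt :: "(l2_torus \<Rightarrow> l2_torus) \<Rightarrow> (l2_torus \<Rightarrow> l2_torus) \<Rightarrow> bool" where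
  "is_op_sqrt R Q \<longleftrightarrow> nonneg_selfadjoint R \<and> R \<circ> R = Q"

text \<open>
  Hilbert--Schmidt operators from \<open>L\<^sup>2\<close> to \<open>H\<^sup>s\<close>; the condition does not depend on the basis.
\<close>

definition hilbert_schmidt :: "real \<Rightarrow> (l2_torus \<Rightarrow> l2_torus) \<Rightarrow> bool" where
  "hilbert_schmidt s A \<longleftrightarrow> bounded_linear A \<and> (\<exists>e. orthonormal_basis e \<and>
     (\<forall>k. in_H s (A (e k))) \<and> summable (\<lambda>k. (H_norm s (A (e k)))\<^sup>2))"


section \<open>Cylindrical Wiener process and stochastic integral\<close>

definition complete_filtered_prob_space :: "'w measure \<Rightarrow> (real \<Rightarrow> 'w measure) \<Rightarrow> bool" where
  "complete_filtered_prob_space M F \<longleftrightarrow> prob_space M \<and> complete_measure M \<and>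
     (\<forall>t\<ge>0. subalgebra M (F t)) \<and> (\<forall>s\<ge>0. \<forall>t\<ge>s. sets (F s) \<subseteq> sets (F t)) \<and>
     null_sets M \<subseteq> sets (F 0)"

definition brownian_motion ::
  "'w measure \<Rightarrow> (real \<Rightarrow> 'w measure) \<Rightarrow> (real \<Rightarrow> 'w \<Rightarrow> real) \<Rightarrow> bool" where
  "brownian_motion M F b \<longleftrightarrow>
     (\<forall>t\<ge>0. b t \<in> borel_measurable (F t)) \<and>
     (AE \<omega> in M. b 0 \<omega> = 0) \<and>
     (AE \<omega> in M. continuous_on {0..} (\<lambda>t. b t \<omega>)) \<and>
     (\<forall>s\<ge>0. \<forall>t>s.
        distributed M lborel (\<lambda>\<omega>. b t \<omega> - b s \<omega>) (normal_density 0 (sqrt (t - s))) \<and>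
        prob_space.indep_set M (sets (F s))
          {(\<lambda>\<omega>. b t \<omega> - b s \<omega>) -` A \<inter> space M | A. A \<in> sets borel})"

text \<open>
  The cylindrical Wiener process \<open>W = (\<Sum>k. \<beta> k e k)\<close> is represented by the pair of
  \<open>\<beta>\<close> and \<open>e\<close>, since the series does not converge in \<open>L\<^sup>2\<close>.
\<close>

definition cylindrical_wiener ::
  "'w measure \<Rightarrow> (real \<Rightarrow> 'w measure) \<Rightarrow> (nat \<Rightarrow> real \<Rightarrow> 'w \<Rightarrow> real) \<Rightarrow> (nat \<Rightarrow> l2_torus) \<Rightarrow> bool" where
  "cylindrical_wiener M F \<beta> e \<longleftrightarrow> orthonormal_basis e \<and>
     (\<forall>k. brownian_motion M F (\<beta> k)) \<and>
     prob_space.indep_vars M (\<lambda>k. Pi\<^sub>M {0..} (\<lambda>t. borel)) (\<lambda>k \<omega>. \<lambda>t\<in>{0..}. \<beta> k t \<omega>) UNIV"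

definition is_partition :: "real \<Rightarrow> real \<Rightarrow> nat \<Rightarrow> (nat \<Rightarrow> real) \<Rightarrow> bool" where
  "is_partition a b m p \<longleftrightarrow> p 0 = a \<and> p m = b \<and> (\<forall>i<m. p i \<le> p (Suc i))"

definition step_fun :: "nat \<Rightarrow> (nat \<Rightarrow> real) \<Rightarrow> (nat \<Rightarrow> l2_torus) \<Rightarrow> real \<Rightarrow> l2_torus" where
  "step_fun m p v s = (\<Sum>i<m. indicator {p i<..p (Suc i)} s *\<^sub>R v i)"

definition step_integral ::
  "(real \<Rightarrow> 'w \<Rightarrow> real) \<Rightarrow> nat \<Rightarrow> (nat \<Rightarrow> real) \<Rightarrow> (nat \<Rightarrow> l2_torus) \<Rightarrow> 'w \<Rightarrow> l2_torus" where
  "step_integral b m p v \<omega> = (\<Sum>i<m. (b (p (Suc i)) \<omega> - b (p i) \<omega>) *\<^sub>R v i)"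

text \<open>Convergence in \<open>L\<^sup>2(\<Omega>; L\<^sup>2)\<close>.\<close>

definition tendsto_L2 ::
  "'w measure \<Rightarrow> (nat \<Rightarrow> 'w \<Rightarrow> l2_torus) \<Rightarrow> ('w \<Rightarrow> l2_torus) \<Rightarrow> bool" where
  "tendsto_L2 M Y Z \<longleftrightarrow>
     (\<lambda>j. \<integral>\<^sup>+\<omega>. ennreal ((norm (Z \<omega> - Y j \<omega>))\<^sup>2) \<partial>M) \<longlonglongrightarrow> 0"

text \<open>
  \<open>I\<close> is (a version of) the Wiener integral over \<open>[a, c]\<close> of the nonrandom function \<open>f\<close> with respect
  to the scalar Brownian motion \<open>b\<close>: the limit of the integrals of approximating step functions.
\<close>

definition has_wiener_integral ::
  "'w measure \<Rightarrow> (real \<Rightarrow> 'w \<Rightarrow> real) \<Rightarrow> real \<Rightarrow> real \<Rightarrow> (real \<Rightarrow> l2_torus) \<Rightarrow> ('w \<Rightarrow> l2_torus) \<Rightarrow> bool" where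
  "has_wiener_integral M b a c f I \<longleftrightarrow>
     f \<in> borel_measurable (restrict_space lborel {a..c}) \<and> I \<in> borel_measurable M \<and>
     (\<exists>m p v. (\<forall>j. is_partition a c (m j) (p j)) \<and>
        (\<lambda>j. \<integral>\<^sup>+s\<in>{a..c}. ennreal ((norm (f s - step_fun (m j) (p j) (v j) s))\<^sup>2) \<partial>lborel) \<longlonglongrightarrow> 0 \<and>
        tendsto_L2 M (\<lambda>j. step_integral b (m j) (p j) (v j)) I)"

text \<open>
  \<open>I\<close> is (a version of) the stochastic integral over \<open>[a, c]\<close> of the nonrandom operator valued
  function \<open>\<Phi>\<close> with respect to \<open>W\<close>, that is, the sum over \<open>k\<close> of the integrals of
  \<open>\<Phi>(s) (e k)\<close> with respect to \<open>\<beta> k\<close>.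
\<close>

definition has_stoch_integral ::
  "'w measure \<Rightarrow> (nat \<Rightarrow> real \<Rightarrow> 'w \<Rightarrow> real) \<Rightarrow> (nat \<Rightarrow> l2_torus) \<Rightarrow> real \<Rightarrow> real \<Rightarrow>
   (real \<Rightarrow> l2_torus \<Rightarrow> l2_torus) \<Rightarrow> ('w \<Rightarrow> l2_torus) \<Rightarrow> bool" where
  "has_stoch_integral M \<beta> e a c \<Phi> I \<longleftrightarrow> I \<in> borel_measurable M \<and>
     (\<exists>J. (\<forall>k. has_wiener_integral M (\<beta> k) a c (\<lambda>s. \<Phi> s (e k)) (J k)) \<and>
        tendsto_L2 M (\<lambda>n \<omega>. \<Sum>k<n. J k \<omega>) I)"

definition in_L2_Omega :: "'w measure \<Rightarrow> ('w \<Rightarrow> l2_torus) \<Rightarrow> bool" where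
  "in_L2_Omega M Y \<longleftrightarrow> Y \<in> borel_measurable M \<and> integrable M (\<lambda>\<omega>. (norm (Y \<omega>))\<^sup>2)"

definition L2_Omega_norm :: "'w measure \<Rightarrow> ('w \<Rightarrow> l2_torus) \<Rightarrow> real" where
  "L2_Omega_norm M Y = sqrt (\<integral>\<omega>. (norm (Y \<omega>))\<^sup>2 \<partial>M)"


section \<open>The equations and the scheme\<close>

text \<open>
  Since \<open>\<psi>\<close> takes values in \<open>H\<^sup>2\<close> only, \<open>\<partial>\<^sub>x\<^sup>3 \<psi>\<close> is in general not a function, and the equation
  is understood in the sense of distributions, that is, for each Fourier coefficient.
\<close>

definition kdv_solution :: "real \<Rightarrow> real \<Rightarrow> l2_torus \<Rightarrow> (real \<Rightarrow> l2_torus) \<Rightarrow> bool" where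
  "kdv_solution T \<mu> \<xi> \<psi> \<longleftrightarrow> \<psi> 0 = \<xi> \<and> continuous_on_H 2 {0..T} \<psi> \<and>
     (\<forall>l. \<forall>t\<in>{0..T}.
        ((\<lambda>r. fcoeff (\<psi> r) l) has_vector_derivative
           - ((\<i> * of_int l) ^ 3 * fcoeff (\<psi> t) l)
           + of_real \<mu> * (\<i> * of_int l * fcoeff (\<psi> t \<odot> \<psi> t) l)) (at t within {0..T}))"

definition fluctuation_solution ::
  "'w measure \<Rightarrow> (nat \<Rightarrow> real \<Rightarrow> 'w \<Rightarrow> real) \<Rightarrow> (nat \<Rightarrow> l2_torus) \<Rightarrow> real \<Rightarrow> real \<Rightarrow>
   (l2_torus \<Rightarrow> l2_torus) \<Rightarrow> (real \<Rightarrow> l2_torus) \<Rightarrow> (real \<Rightarrow> 'w \<Rightarrow> l2_torus) \<Rightarrow> bool" where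
  "fluctuation_solution M \<beta> e T \<mu> Qh \<psi> chi \<longleftrightarrow>
     (\<forall>t\<in>{0..T}. chi t \<in> borel_measurable M) \<and>
     (AE \<omega> in M. continuous_on_H 1 {0..T} (\<lambda>t. chi t \<omega>)) \<and>
     (AE \<omega> in M. chi 0 \<omega> = 0) \<and>
     (\<forall>t\<in>{0..T}. \<exists>J. has_stoch_integral M \<beta> e 0 t (\<lambda>s. airy (t - s) \<circ> Qh) J \<and>
        (AE \<omega> in M. chi t \<omega> =
           (2 * \<mu>) *\<^sub>R integral {0..t} (\<lambda>s. airy (t - s) (Dx (\<psi> s \<odot> chi s \<omega>))) + J \<omega>))"

text \<open>
  One run of the scheme with \<open>N\<close> steps of size \<open>\<tau>\<close>, where \<open>p n\<close> approximates \<open>\<psi>\<close> at time \<open>n \<tau>\<close>.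
\<close>

definition fluctuation_scheme ::
  "'w measure \<Rightarrow> (nat \<Rightarrow> real \<Rightarrow> 'w \<Rightarrow> real) \<Rightarrow> (nat \<Rightarrow> l2_torus) \<Rightarrow> real \<Rightarrow>
   (l2_torus \<Rightarrow> l2_torus) \<Rightarrow> real \<Rightarrow> nat \<Rightarrow> (nat \<Rightarrow> l2_torus) \<Rightarrow> (nat \<Rightarrow> 'w \<Rightarrow> l2_torus) \<Rightarrow> bool" where
  "fluctuation_scheme M \<beta> e \<mu> Qh \<tau> N p X \<longleftrightarrow>
     (AE \<omega> in M. X 0 \<omega> = 0) \<and>
     (\<forall>n<N. \<exists>J. has_stoch_integral M \<beta> e (real n * \<tau>) (real (Suc n) * \<tau>)
          (\<lambda>s. airy (real (Suc n) * \<tau> - s) \<circ> Qh) J \<and>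
        (AE \<omega> in M. X (Suc n) \<omega> =
           airy \<tau> (X n \<omega>)
           + (2 * \<mu> / 3) *\<^sub>R (airy \<tau> (Dx_inv (p n)) \<odot> airy \<tau> (Dx_inv (X n \<omega>)))
           - (2 * \<mu> / 3) *\<^sub>R airy \<tau> (Dx_inv (p n) \<odot> Dx_inv (X n \<omega>))
           + J \<omega>))"

end

theory Submission
  imports Defs
begin

text \<open>
  In the frame moving with the Airy group the linear equation becomes \<open>dx = 2 \<mu> N(s, f, x) ds + noise\<close>, where
  \<open>N(s, f, x) = S(-s) \<partial>\<^sub>x (S(s) f S(s) x)\<close>, and the scheme replaces the integral of \<open>N\<close> over a step by
  \<open>B(p, x) = \<integral> N(s, p, x) ds\<close> with frozen arguments, which can be integrated exactly. For zero-mean functions the oscillating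
  phases give \<open>\<parallel>B(g, v)\<parallel> \<le> \<tau>\<^sup>1\<^sup>/\<^sup>2 \<parallel>g\<parallel>\<^bsub>\<ell>\<^sup>1\<^esub> \<parallel>v\<parallel>\<close>, in terms of the \<open>\<ell>\<^sup>1\<close> norm of the Fourier coefficients, without loss of a derivative, and the
  antisymmetry of the leading part makes \<open>v + 2 \<mu> B(p, v)\<close> stable with constant \<open>1 + O(\<tau>)\<close> as soon as the coefficients of
  \<open>p'\<close> are summable; for the approximations of \<open>\<psi>\<close> this holds because the coefficients of \<open>p\<^sup>(\<^sup>1\<^sup>)\<close> are nonnegative and
  \<open>p\<^sup>(\<^sup>1\<^sup>)\<close> is bounded. The local error has mean square
  \<open>O(\<tau>\<^sup>3 + \<tau> \<parallel>\<psi>(t\<^sub>n) - \<psi>\<^sub>n\<parallel>\<^sup>2)\<close>, given a bound for the second moment of the fluctuation in \<open>H\<^sup>1\<close>.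
\<close>

text \<open>The zero-mode conditions enter through the phase \<open>3 k j (k - j)\<close>. Apart
  from \<open>k = 0\<close>, where the derivative kills the term, it vanishes only if one of the two
  factors contributes its zero mode. Elsewhere an integration in time gains
  \<open>|k j (k - j)|\<close>; the geometric mean of this gain and the trivial bound by the length
  of the interval pays for the derivative and leaves the square root of the length. The defects of
  different steps are estimated separately. A defect of mean square \<open>\<tau> ^ 3\<close> costs
  a factor \<open>1 / \<tau>\<close> in Young's inequality and is summed over
  \<open>T / \<tau>\<close> steps, which leaves \<tau>, hence the rate 1/2; an error
  \<open>D\<close> in the approximation of \<psi> leaves \<open>D\<^sup>2 / \<tau>\<close>, hence
  the rate \<beta> - 1/2. The fluctuation takes values in \<open>H\<^sup>1\<close> only, so
  differentiating its \<open>H\<^sup>1\<close> norm would require derivatives that it does not have.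
  For the recursion with exact \<psi>, a step is a deterministic bounded linear map followed by
  noise orthogonal to the past; deterministic stability then bounds the second moment, uniformly in
  the step size, and the bound survives the limit.\<close>

abbreviation wave :: "int \<Rightarrow> real \<Rightarrow> complex" where
  "wave l x \<equiv> exp (\<i> * of_int l * of_real x)"

abbreviation msq :: "'a measure \<Rightarrow> ('a \<Rightarrow> 'b::real_normed_vector) \<Rightarrow> ennreal" where
  "msq N X \<equiv> \<integral>\<^sup>+\<omega>. ennreal ((norm (X \<omega>))\<^sup>2) \<partial>N"

section \<open>Representatives, norms and completeness\<close>

lemma l2_torus_cases:
  obtains g where "sq_int g" "f = abs_l2_torus g"
proof -
  have "l2_rel (rep_l2_torus f) (rep_l2_torus f)" by (metis Quotient3_l2_torus Quotient3_rep_reflp)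
  moreover have "abs_l2_torus (rep_l2_torus f) = f" by (rule Quotient3_abs_rep[OF Quotient3_l2_torus])
  ultimately show ?thesis using that by (metis l2_rel_def)
qed

lemma abs_l2_eq_iff: "sq_int f \<Longrightarrow> sq_int g \<Longrightarrow> abs_l2_torus f = abs_l2_torus g \<longleftrightarrow> (AE x in torus. f x = g x)"
  using Quotient3_rel[OF Quotient3_l2_torus, of f g] by (auto simp: l2_rel_def)

lemma inner_abs_l2:
  assumes "sq_int f" "sq_int g"
  shows "inner (abs_l2_torus f) (abs_l2_torus g) = (\<integral>x. f x * g x \<partial>torus)"
  using assms by (intro inner_l2_torus.abs_eq) (auto simp: l2_rel_def)

lemma norm_abs_l2: "sq_int f \<Longrightarrow> (norm (abs_l2_torus f))\<^sup>2 = (\<integral>x. (f x)\<^sup>2 \<partial>torus)"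
  by (simp only: power2_norm_eq_inner inner_abs_l2) (simp add: power2_eq_square)

lemma add_abs_l2:
  "sq_int f \<Longrightarrow> sq_int g \<Longrightarrow> abs_l2_torus f + abs_l2_torus g = abs_l2_torus (\<lambda>x. f x + g x)"
  by (intro plus_l2_torus.abs_eq) (auto simp: l2_rel_def)

lemma scaleR_abs_l2: "sq_int f \<Longrightarrow> c *\<^sub>R abs_l2_torus f = abs_l2_torus (\<lambda>x. c * f x)"
  by (intro scaleR_l2_torus.abs_eq) (auto simp: l2_rel_def)

lemma sq_int_diff: "sq_int f \<Longrightarrow> sq_int g \<Longrightarrow> sq_int (\<lambda>x. f x - g x)"
  using sq_int_add[of f "\<lambda>x. (-1) * g x"] sq_int_scale[of g "-1"] by simp

lemma diff_abs_l2:
  assumes "sq_int f" "sq_int g"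
  shows "abs_l2_torus f - abs_l2_torus g = abs_l2_torus (\<lambda>x. f x - g x)"
proof -
  have "abs_l2_torus f - abs_l2_torus g = abs_l2_torus f + (-1) *\<^sub>R abs_l2_torus g" by simp
  also have "\<dots> = abs_l2_torus (\<lambda>x. f x + (-1) * g x)"
    by (subst scaleR_abs_l2, fact, subst add_abs_l2) (use assms sq_int_scale[of g "-1"] in auto)
  finally show ?thesis by simp
qed

lemma sq_int_abs: "sq_int f \<Longrightarrow> sq_int (\<lambda>x. \<bar>f x\<bar>)" by (auto simp: sq_int_def)

lemma norm_l2_one: "(norm l2_one)\<^sup>2 = 2 * pi"
proof -
  have "l2_one = abs_l2_torus (\<lambda>x. 1)" by (simp add: l2_one_def)
  then show ?thesis using norm_abs_l2[OF sq_int_const[of 1]] by (simp add: measure_restrict_space)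
qed

text \<open>Cauchy-Schwarz against the constant 1, whose norm is \<open>sqrt (2 * pi)\<close>.
  Smallness in mean square becomes smallness in the mean, which can be summed to give convergence
  almost everywhere.\<close>

lemma nn_integral_abs_le_norm:
  assumes "sq_int f"
  shows "(\<integral>\<^sup>+x. ennreal \<bar>f x\<bar> \<partial>torus) \<le> ennreal (sqrt (2 * pi) * norm (abs_l2_torus f))"
proof -
  have one: "l2_one = abs_l2_torus (\<lambda>x. 1)" by (simp add: l2_one_def)
  have i: "integrable torus (\<lambda>x. \<bar>f x\<bar>)"
    using sq_int_mult_integrable[OF sq_int_abs[OF assms] sq_int_const[of 1]] by (simp only: mult_1_right)
  have "(\<integral>x. \<bar>f x\<bar> \<partial>torus) = inner (abs_l2_torus (\<lambda>x. \<bar>f x\<bar>)) l2_one"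
    unfolding one by (simp only: inner_abs_l2[OF sq_int_abs[OF assms] sq_int_const] mult_1_right)
  also have "\<dots> \<le> norm (abs_l2_torus (\<lambda>x. \<bar>f x\<bar>)) * norm l2_one" by (rule norm_cauchy_schwarz)
  also have "norm (abs_l2_torus (\<lambda>x. \<bar>f x\<bar>)) = norm (abs_l2_torus f)"
    using norm_abs_l2[OF assms] norm_abs_l2[OF sq_int_abs[OF assms]]
    by - (rule power2_eq_imp_eq, simp_all only: power2_abs norm_ge_zero)
  also have "norm l2_one = sqrt (2*pi)" using norm_l2_one by (metis norm_ge_zero real_sqrt_unique)
  finally have "(\<integral>x. \<bar>f x\<bar> \<partial>torus) \<le> sqrt (2 * pi) * norm (abs_l2_torus f)" by (simp add: mult.commute)
  then show ?thesis by (subst nn_integral_eq_integral[OF i]) (auto intro: ennreal_leI)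
qed

lemma nn_integral_sq_abs_l2:
  "sq_int f \<Longrightarrow> (\<integral>\<^sup>+x. ennreal ((f x)\<^sup>2) \<partial>torus) = ennreal ((norm (abs_l2_torus f))\<^sup>2)"
  by (subst norm_abs_l2) (auto simp: sq_int_def nn_integral_eq_integral)

text \<open>The Riesz-Fischer argument: along a rapidly convergent subsequence the increments are
  summable almost everywhere, and Fatou's lemma identifies the pointwise limit with the limit in
  norm. Completeness gives the limits behind \<open>fourier_series\<close> and the integrals of
  continuous functions with values in \<open>l2_torus\<close>.\<close>

lemma Cauchy_convergent_l2_torus:
  fixes X :: "nat \<Rightarrow> l2_torus"
  assumes "Cauchy X"
  shows "convergent X"
proof -
  define g where "g n = (SOME g. sq_int g \<and> X n = abs_l2_torus g)" for n
  have g: "sq_int (g n)" "X n = abs_l2_torus (g n)" for n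
    using someI_ex[of "\<lambda>g. sq_int g \<and> X n = abs_l2_torus g"] l2_torus_cases[of "X n"] unfolding g_def by metis+
  have "\<exists>r. strict_mono r \<and> (\<forall>n. norm (X (r (Suc n)) - X (r n)) < (1/2)^n)"
  proof -
    have "\<exists>m. \<forall>i\<ge>m. \<forall>j\<ge>m. norm (X i - X j) < (1/2)^n" for n :: nat using \<open>Cauchy X\<close> CauchyD[of X "(1/2)^n"] by simp
    then obtain m where m: "\<And>n i j. i \<ge> m n \<Longrightarrow> j \<ge> m n \<Longrightarrow> norm (X i - X j) < (1/2)^n" by metis
    define r where "r = rec_nat (m 0) (\<lambda>n k. max (Suc k) (m (Suc n)))"
    have r: "r (Suc n) > r n" "r n \<ge> m n" for n by (auto simp: r_def) (cases n; simp)
    show ?thesis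
    proof (intro exI[of _ r] conjI allI strict_monoI_Suc r(1))
      fix n show "norm (X (r (Suc n)) - X (r n)) < (1/2)^n" using r(1)[of n] r(2)[of n] by (intro m) auto
    qed
  qed
  then obtain r where r: "strict_mono r" and rX: "\<And>n. norm (X (r (Suc n)) - X (r n)) < (1/2)^n" by auto
  define h where "h n = g (r n)" for n
  have h: "sq_int (h n)" "X (r n) = abs_l2_torus (h n)" for n using g by (auto simp: h_def)
  have [measurable]: "h n \<in> borel_measurable torus" for n using h(1) by (auto simp: sq_int_def)
  have diff: "norm (X (r m) - X (r n)) \<le> 2 * (1/2)^n" if "m \<ge> n" for m n
  proof -
    \<comment> \<open>The right side is the geometric sum of \<open>(1/2) ^ i\<close> from
      \<open>n\<close> to \<open>m - 1\<close>; keeping the subtracted term is what makes the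
      induction close.\<close>
    have "norm (X (r m) - X (r n)) \<le> 2 * (1/2)^n - 2 * (1/2)^m" using that
    proof (induction m rule: dec_induct)
      case (step m)
      have "norm (X (r (Suc m)) - X (r n)) \<le> norm (X (r (Suc m)) - X (r m)) + norm (X (r m) - X (r n))"
        using norm_triangle_ineq[of "X (r (Suc m)) - X (r m)" "X (r m) - X (r n)"] by simp
      then show ?case using step rX[of m] by simp
    qed simp
    then show ?thesis by (smt (verit) zero_le_power half_gt_zero_iff)
  qed
  have "AE x in torus. summable (\<lambda>n. h (Suc n) x - h n x)"
  proof -
    have "(\<integral>\<^sup>+x. (\<Sum>n. ennreal \<bar>h (Suc n) x - h n x\<bar>) \<partial>torus)
        = (\<Sum>n. \<integral>\<^sup>+x. ennreal \<bar>h (Suc n) x - h n x\<bar> \<partial>torus)" by (rule nn_integral_suminf) auto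
    also have "\<dots> \<le> (\<Sum>n. ennreal (sqrt (2 * pi) * (1/2)^n))"
    proof (rule suminf_le)
      fix n
      have "(\<integral>\<^sup>+x. ennreal \<bar>h (Suc n) x - h n x\<bar> \<partial>torus) \<le> ennreal (sqrt (2*pi) * norm (X (r (Suc n)) - X (r n)))"
        unfolding h(2) using h(1) by (subst diff_abs_l2) (auto intro!: nn_integral_abs_le_norm sq_int_diff)
      also have "\<dots> \<le> ennreal (sqrt (2 * pi) * (1/2)^n)" using rX[of n] by (intro ennreal_leI mult_left_mono) auto
      finally show "(\<integral>\<^sup>+x. ennreal \<bar>h (Suc n) x - h n x\<bar> \<partial>torus) \<le> ennreal (sqrt (2 * pi) * (1/2)^n)" .
    qed auto
    also have "\<dots> = ennreal (\<Sum>n. sqrt (2 * pi) * (1/2)^n)" by (intro suminf_ennreal2 summable_mult summable_geometric) auto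
    finally have fin: "(\<integral>\<^sup>+x. (\<Sum>n. ennreal \<bar>h (Suc n) x - h n x\<bar>) \<partial>torus) \<noteq> \<infinity>" by (auto simp: top_unique)
    have "AE x in torus. (\<Sum>n. ennreal \<bar>h (Suc n) x - h n x\<bar>) \<noteq> \<infinity>" by (rule nn_integral_PInf_AE) (use fin in auto)
    then show ?thesis
    proof (rule AE_mp, intro AE_I2 impI)
      fix x assume "(\<Sum>n. ennreal \<bar>h (Suc n) x - h n x\<bar>) \<noteq> \<infinity>"
      then have "summable (\<lambda>n. \<bar>h (Suc n) x - h n x\<bar>)" by (simp add: summable_suminf_not_top)
      then show "summable (\<lambda>n. h (Suc n) x - h n x)" by (rule summable_rabs_cancel)
    qed
  qed
  then have conv: "AE x in torus. convergent (\<lambda>n. h n x)"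
  proof (rule AE_mp, intro AE_I2 impI)
    fix x assume "summable (\<lambda>n. h (Suc n) x - h n x)"
    then have "convergent (\<lambda>n. \<Sum>k<n. h (Suc k) x - h k x)" by (simp add: summable_iff_convergent)
    then have "convergent (\<lambda>n. h n x - h 0 x)" by (subst (asm) sum_lessThan_telescope)
    then show "convergent (\<lambda>n. h n x)" using convergent_add[OF _ convergent_const[of "h 0 x"]] by fastforce
  qed
  define H where "H x = lim (\<lambda>n. h n x)" for x
  have [measurable]: "H \<in> borel_measurable torus" unfolding H_def by measurable
  have lim: "AE x in torus. (\<lambda>n. h n x) \<longlonglongrightarrow> H x" using conv by (auto simp: H_def convergent_LIMSEQ_iff)
  \<comment> \<open>Fatou's lemma in the second index, with \<open>h n\<close> fixed. The same bound
    shows that the limit is square integrable and that it is the limit in norm.\<close>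
  have bound: "(\<integral>\<^sup>+x. ennreal ((h n x - H x)\<^sup>2) \<partial>torus) \<le> ennreal ((2 * (1/2)^n)\<^sup>2)" for n
  proof -
    have "(\<integral>\<^sup>+x. ennreal ((h n x - H x)\<^sup>2) \<partial>torus) = (\<integral>\<^sup>+x. liminf (\<lambda>m. ennreal ((h n x - h m x)\<^sup>2)) \<partial>torus)"
    proof (rule nn_integral_cong_AE, use lim in eventually_elim)
      fix x assume "(\<lambda>n. h n x) \<longlonglongrightarrow> H x"
      then have "(\<lambda>m. ennreal ((h n x - h m x)\<^sup>2)) \<longlonglongrightarrow> ennreal ((h n x - H x)\<^sup>2)" by (intro tendsto_ennrealI tendsto_intros)
      then show "ennreal ((h n x - H x)\<^sup>2) = liminf (\<lambda>m. ennreal ((h n x - h m x)\<^sup>2))" by (intro lim_imp_Liminf[symmetric]) auto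
    qed
    also have "\<dots> \<le> liminf (\<lambda>m. \<integral>\<^sup>+x. ennreal ((h n x - h m x)\<^sup>2) \<partial>torus)" by (rule nn_integral_liminf) auto
    also have "\<dots> \<le> liminf (\<lambda>m. ennreal ((2 * (1/2)^n)\<^sup>2))"
    proof (rule Liminf_mono, rule eventually_sequentiallyI[of n])
      fix m assume "m \<ge> n"
      have "(\<integral>\<^sup>+x. ennreal ((h n x - h m x)\<^sup>2) \<partial>torus) = ennreal ((norm (X (r n) - X (r m)))\<^sup>2)"
        unfolding h(2) using h(1) by (subst diff_abs_l2) (auto intro!: nn_integral_sq_abs_l2 sq_int_diff)
      also have "\<dots> \<le> ennreal ((2 * (1/2)^n)\<^sup>2)"
        using diff[OF \<open>m \<ge> n\<close>] by (intro ennreal_leI power_mono) (auto simp: norm_minus_commute)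
      finally show "(\<integral>\<^sup>+x. ennreal ((h n x - h m x)\<^sup>2) \<partial>torus) \<le> ennreal ((2 * (1/2)^n)\<^sup>2)" .
    qed
    finally show ?thesis by (simp add: Liminf_const)
  qed
  have sqd: "sq_int (\<lambda>x. h n x - H x)" for n unfolding sq_int_def using bound[of n]
    by (auto intro!: integrableI_nonneg simp: le_less_trans)
  have sqH: "sq_int H" using sq_int_diff[OF h(1)[of 0] sqd[of 0]] by simp
  have "norm (X (r n) - abs_l2_torus H) \<le> 2 * (1/2)^n" for n
  proof -
    have "ennreal ((norm (X (r n) - abs_l2_torus H))\<^sup>2) \<le> ennreal ((2 * (1/2)^n)\<^sup>2)" unfolding h(2) using h(1) sqH sqd bound[of n]
      by (subst diff_abs_l2) (auto simp: nn_integral_sq_abs_l2[symmetric])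
    then have "(norm (X (r n) - abs_l2_torus H))\<^sup>2 \<le> (2 * (1/2)^n)\<^sup>2" by (subst (asm) ennreal_le_iff) auto
    then show ?thesis by (rule power2_le_imp_le) simp
  qed
  moreover have "(\<lambda>n. 2 * (1/2)^n) \<longlonglongrightarrow> (0::real)" by (rule tendsto_mult_right_zero) (rule LIMSEQ_power_zero, simp)
  ultimately have "(\<lambda>n. X (r n) - abs_l2_torus H) \<longlonglongrightarrow> 0" by (rule Lim_null_comparison[OF always_eventually[OF allI]])
  then have "(X \<circ> r) \<longlonglongrightarrow> abs_l2_torus H" by (simp add: LIM_zero_iff o_def)
  then show "convergent X" using \<open>Cauchy X\<close> r by (meson Cauchy_converges_subseq convergentI)
qed

instance l2_torus :: banach by standard (rule Cauchy_convergent_l2_torus)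

section \<open>Fourier coefficients and partial sums\<close>

definition l2_cos :: "int \<Rightarrow> l2_torus" where
  "l2_cos l = abs_l2_torus (\<lambda>x. cos (of_int l * x))"

definition l2_sin :: "int \<Rightarrow> l2_torus" where
  "l2_sin l = abs_l2_torus (\<lambda>x. sin (of_int l * x))"

lemma sq_int_cos: "sq_int (\<lambda>x. cos (of_int l * x))" and sq_int_sin: "sq_int (\<lambda>x. sin (of_int l * x))"
  by (auto intro!: sq_int_continuous continuous_intros)

lemma sq_int_integrable: "sq_int f \<Longrightarrow> integrable torus f" using sq_int_mult_integrable[OF _ sq_int_const[of 1], of f] by simp

lemma exp_measurable_torus [measurable]: "(\<lambda>x. exp (\<i> * of_int l * complex_of_real x)) \<in> borel_measurable torus"
  by (intro continuous_imp_measurable_on_sets_lebesgue continuous_intros) auto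

lemma exp_minus_measurable_torus [measurable]:
  "(\<lambda>x. exp (- (\<i> * of_int l * complex_of_real x))) \<in> borel_measurable torus"
  by (intro continuous_imp_measurable_on_sets_lebesgue continuous_intros) auto

lemma integrable_mult_bounded_torus:
  fixes f :: "real \<Rightarrow> complex"
  assumes "integrable torus f" "g \<in> borel_measurable torus" "\<And>x. cmod (g x) \<le> C"
  shows "integrable torus (\<lambda>x. f x * g x)"
proof (rule Bochner_Integration.integrable_bound[where f = "\<lambda>x. C * cmod (f x)"])
  show "integrable torus (\<lambda>x. C * cmod (f x))" using assms by auto
  show "(\<lambda>x. f x * g x) \<in> borel_measurable torus" using assms by auto
  have "0 \<le> C" using assms(3)[of 0] norm_ge_zero order_trans by blast
  then show "AE x in torus. cmod (f x * g x) \<le> norm (C * cmod (f x))"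
    using assms(3) by (intro AE_I2) (simp add: norm_mult abs_mult mult.commute[of C] mult_left_mono)
qed

lemma integrable_mult_exp:
  fixes f :: "real \<Rightarrow> complex"
  shows "integrable torus f \<Longrightarrow> integrable torus (\<lambda>x. f x * wave l x)"
  by (rule integrable_mult_bounded_torus[where C = 1]) (auto simp: norm_exp_eq_Re)

lemma fcoeff_abs_l2:
  assumes "sq_int f"
  shows "fcoeff (abs_l2_torus f) l
    = (\<integral>x. of_real (f x) * exp (- (\<i> * of_int l * of_real x)) \<partial>torus) / of_real (sqrt (2 * pi))"
  using assms by (subst fcoeff.abs_eq) (auto simp: l2_rel_def)

text \<open>The space is real and contains no complex exponentials. In terms of inner products with
  cosines and sines, linearity and boundedness of a coefficient come for free.\<close>

lemma fcoeff_eq_inner: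
  "fcoeff f l = (of_real (inner f (l2_cos l)) - \<i> * of_real (inner f (l2_sin l))) / of_real (sqrt (2 * pi))"
proof -
  obtain g where g: "sq_int g" "f = abs_l2_torus g" by (rule l2_torus_cases)
  have i: "integrable torus (\<lambda>x. g x * cos (of_int l * x))" "integrable torus (\<lambda>x. g x * sin (of_int l * x))"
    using g(1) by (auto intro!: sq_int_mult_integrable sq_int_cos sq_int_sin)
  have "(\<integral>x. of_real (g x) * exp (- (\<i> * of_int l * of_real x)) \<partial>torus)
     = (\<integral>x. of_real (g x * cos (of_int l * x)) - \<i> * of_real (g x * sin (of_int l * x)) \<partial>torus)"
    by (intro Bochner_Integration.integral_cong) (auto simp: complex_eq_iff exp_eq_polar cis.code Re_exp Im_exp)
  also have "\<dots> = of_real (\<integral>x. g x * cos (of_int l * x) \<partial>torus) - \<i> * of_real (\<integral>x. g x * sin (of_int l * x) \<partial>torus)"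
    using i by (subst Bochner_Integration.integral_diff) (auto intro!: integrable_of_real integrable_mult_right
        simp: integral_of_real simp del: of_real_mult)
  finally show ?thesis unfolding g(2) l2_cos_def l2_sin_def
    by (simp only: fcoeff_abs_l2[OF g(1)] inner_abs_l2[OF g(1) sq_int_cos] inner_abs_l2[OF g(1) sq_int_sin])
qed

lemma bounded_linear_fcoeff: "bounded_linear (\<lambda>f. fcoeff f l)" unfolding fcoeff_eq_inner divide_inverse
  by (intro bounded_linear_mult_const bounded_linear_sub bounded_linear_const_mult
      bounded_linear_compose[OF bounded_linear_of_real] bounded_linear_inner_left)

lemmas fcoeff_add = linear_add[OF bounded_linear.linear[OF bounded_linear_fcoeff]]
lemmas fcoeff_diff = linear_diff[OF bounded_linear.linear[OF bounded_linear_fcoeff]]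
lemmas fcoeff_minus = linear_neg[OF bounded_linear.linear[OF bounded_linear_fcoeff]]
lemmas fcoeff_0 [simp] = linear_0[OF bounded_linear.linear[OF bounded_linear_fcoeff]]
lemmas fcoeff_sum = linear_sum[OF bounded_linear.linear[OF bounded_linear_fcoeff]]

lemma fcoeff_scaleR: "fcoeff (c *\<^sub>R f) l = of_real c * fcoeff f l"
  using linear_scale[OF bounded_linear.linear[OF bounded_linear_fcoeff[of l]], of c f] by (simp add: scaleR_conv_of_real)

lemma fcoeff_cnj: "fcoeff f (- l) = cnj (fcoeff f l)"
proof -
  have "l2_cos (-l) = l2_cos l" by (simp add: l2_cos_def)
  moreover have "l2_sin (-l) = - l2_sin l"
  proof -
    have "- l2_sin l = (-1) *\<^sub>R l2_sin l" by simp
    also have "\<dots> = l2_sin (-l)" unfolding l2_sin_def by (subst scaleR_abs_l2[OF sq_int_sin]) simp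
    finally show ?thesis by simp
  qed
  ultimately show ?thesis by (simp add: fcoeff_eq_inner)
qed

definition conj_sym :: "(int \<Rightarrow> complex) \<Rightarrow> bool" where
  "conj_sym c \<longleftrightarrow> (\<forall>l. c (- l) = cnj (c l))"

lemma conj_sym_fcoeff: "conj_sym (fcoeff f)" by (simp add: conj_sym_def fcoeff_cnj)

lemma partial_sum_sq_int:
  "sq_int (\<lambda>x. Re ((\<Sum>l=-int n..int n. c l * wave l x) / of_real (sqrt (2 * pi))))"
  by (auto intro!: sq_int_continuous continuous_intros)

lemma fourier_partial_sum_abs: "fourier_partial_sum c n = abs_l2_torus
   (\<lambda>x. Re ((\<Sum>l=-int n..int n. c l * wave l x) / of_real (sqrt (2 * pi))))" by (rule fourier_partial_sum.abs_eq)

lemma inner_partial_sum: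
  "inner f (fourier_partial_sum c n) = Re (\<Sum>l=-int n..int n. c l * cnj (fcoeff f l))"
proof -
  obtain g where g: "sq_int g" "f = abs_l2_torus g" by (rule l2_torus_cases)
  let ?s = "complex_of_real (sqrt (2 * pi))"
  let ?C = "\<lambda>x. (\<Sum>l=-int n..int n. c l * wave l x) / ?s"
  have ig: "integrable torus (\<lambda>x. complex_of_real (g x))" using sq_int_integrable[OF g(1)] by simp
  have ie: "integrable torus (\<lambda>x. of_real (g x) * wave l x)" for l using integrable_mult_exp[OF ig] .
  have "inner f (fourier_partial_sum c n) = (\<integral>x. g x * Re (?C x) \<partial>torus)"
    unfolding g(2) fourier_partial_sum_abs by (rule inner_abs_l2[OF g(1) partial_sum_sq_int])
  also have "(\<lambda>x. g x * Re (?C x)) =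
      (\<lambda>x. Re (\<Sum>l=-int n..int n. c l / ?s * (of_real (g x) * wave l x)))"
  proof
    fix x
    have "of_real (g x) * ?C x = (\<Sum>l=-int n..int n. c l / ?s * (of_real (g x) * wave l x))"
      unfolding sum_divide_distrib sum_distrib_left by (intro sum.cong refl) (simp add: mult_ac)
    moreover have "g x * Re (?C x) = Re (of_real (g x) * ?C x)"
      by (simp only: Re_complex_of_real Im_complex_of_real times_complex.sel mult_zero_left diff_zero)
    ultimately show "g x * Re (?C x) = Re (\<Sum>l=-int n..int n. c l / ?s * (of_real (g x) * wave l x))" by metis
  qed
  also have "(\<integral>x. Re (\<Sum>l=-int n..int n. c l / ?s * (of_real (g x) * wave l x)) \<partial>torus) = Re (\<integral>x. (\<Sum>l=-int n..int n. c l / ?s * (of_real (g x) * wave l x)) \<partial>torus)"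
    using ie by (intro integral_Re) auto
  also have "(\<integral>x. (\<Sum>l=-int n..int n. c l / ?s * (of_real (g x) * wave l x)) \<partial>torus)
     = (\<Sum>l=-int n..int n. c l * fcoeff f (- l))" using ie unfolding g(2) fcoeff_abs_l2[OF g(1)]
    by (subst Bochner_Integration.integral_sum) (auto simp: mult_ac)
  finally show ?thesis by (simp add: fcoeff_cnj)
qed

lemma integral_exp_torus:
  "(\<integral>x. wave l x \<partial>torus) = (if l = 0 then 2 * pi else 0)"
proof -
  have int: "integrable torus (\<lambda>x. wave l x)"
    using integrable_mult_exp[of "\<lambda>x. 1"] sq_int_integrable[OF sq_int_const[of 1]] by auto
  have "(\<integral>x. wave l x \<partial>torus) = integral {-pi..pi} (\<lambda>x. wave l x)" by (rule lebesgue_integral_eq_integral[OF int]) auto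
  also have "\<dots> = (if l = 0 then 2 * pi else 0)"
  proof (cases "l = 0")
    case False
    have "((\<lambda>x. wave l x) has_integral
        (exp (\<i> * of_int l * of_real pi) / (\<i> * of_int l) - exp (\<i> * of_int l * of_real (-pi)) / (\<i> * of_int l))) {-pi..pi}"
      using False
    proof (intro fundamental_theorem_of_calculus)
      fix x :: real
      have "((\<lambda>z. exp (\<i> * of_int l * z) / (\<i> * of_int l)) has_field_derivative wave l x) (at (of_real x))"
        using False by (auto intro!: derivative_eq_intros)
      then show "((\<lambda>x. wave l x / (\<i> * of_int l)) has_vector_derivative
          wave l x) (at x within {-pi..pi})" by (rule has_vector_derivative_real_field)
    qed simp
    moreover have "exp (\<i> * of_int l * of_real pi) = exp (\<i> * of_int l * of_real (-pi))"
    proof -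
      have "exp (\<i> * of_int l * of_real pi) = exp (\<i> * of_int l * of_real (-pi)) * exp (2 * of_int l * of_real pi * \<i>)"
        by (subst exp_add[symmetric], rule arg_cong[of _ _ exp]) (simp add: algebra_simps)
      moreover have "exp (2 * of_int l * complex_of_real pi * \<i>) = 1" using exp_integer_2pi[of "of_int l"] by simp
      ultimately show ?thesis by (simp only: mult_1_right)
    qed
    ultimately show ?thesis using False by (simp add: integral_unique)
  qed (simp add: scaleR_conv_of_real)
  finally show ?thesis .
qed

lemma fcoeff_partial_sum:
  assumes "conj_sym c"
  shows "fcoeff (fourier_partial_sum c n) l = (if \<bar>l\<bar> \<le> int n then c l else 0)"
proof -
  let ?s = "complex_of_real (sqrt (2 * pi))"
  let ?C = "\<lambda>x. (\<Sum>l=-int n..int n. c l * wave l x) / ?s"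
  \<comment> \<open>Conjugate symmetry makes the symmetric sum real, so that the \<open>Re\<close>
    in the definition of the partial sums loses nothing.\<close>
  have real: "complex_of_real (Re (?C x)) = ?C x" for x
  proof -
    have "cnj (?C x) = ?C x"
    proof -
      have "cnj (\<Sum>l=-int n..int n. c l * wave l x)
         = (\<Sum>l=-int n..int n. c (-l) * exp (\<i> * of_int (-l) * of_real x))" using assms by (simp add: conj_sym_def exp_cnj)
      also have "\<dots> = (\<Sum>l=-int n..int n. c l * wave l x)" by (rule sum.reindex_bij_witness[of _ uminus uminus]) auto
      finally show ?thesis by (simp only: complex_cnj_divide complex_cnj_complex_of_real)
    qed
    then show ?thesis by (simp only: of_real_Re Reals_cnj_iff)
  qed
  have ie: "integrable torus (\<lambda>x. wave l x)" for l
    using integrable_mult_exp[of "\<lambda>x. 1" l] sq_int_integrable[OF sq_int_const[of 1]] by auto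
  have s2: "?s * ?s = 2 * pi" by (simp flip: of_real_mult)
  have "fcoeff (fourier_partial_sum c n) l = (\<integral>x. ?C x * exp (- (\<i> * of_int l * of_real x)) \<partial>torus) / ?s"
    unfolding fourier_partial_sum_abs by (subst fcoeff_abs_l2[OF partial_sum_sq_int]) (simp only: real)
  also have "(\<lambda>x. ?C x * exp (- (\<i> * of_int l * of_real x))) =
     (\<lambda>x. (\<Sum>m=-int n..int n. c m / ?s * exp (\<i> * of_int (m - l) * of_real x)))" unfolding sum_divide_distrib sum_distrib_right
    by (intro ext sum.cong refl) (simp add: algebra_simps exp_diff exp_minus divide_inverse)
  also have "(\<integral>x. (\<Sum>m=-int n..int n. c m / ?s * exp (\<i> * of_int (m - l) * of_real x)) \<partial>torus)
     = (\<Sum>m=-int n..int n. c m / ?s * (if m - l = 0 then 2 * pi else 0))"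
    using ie by (subst Bochner_Integration.integral_sum) (auto simp: integral_exp_torus simp del: of_int_diff)
  also have "\<dots> / ?s = (\<Sum>m=-int n..int n. if m = l then c m else 0)"
    unfolding sum_divide_distrib using s2 by (intro sum.cong) (auto simp: field_simps)
  also have "\<dots> = (if \<bar>l\<bar> \<le> int n then c l else 0)" by auto
  finally show ?thesis .
qed

text \<open>Links unordered summation, in which all estimates are made, with the symmetric partial
  sums that define \<open>fourier_series\<close>.\<close>

lemma filterlim_symmetric_intervals:
  "filterlim (\<lambda>n. {-int n..int n}) (finite_subsets_at_top UNIV) sequentially" unfolding filterlim_finite_subsets_at_top
proof (intro allI impI)
  fix X :: "int set" assume X: "finite X \<and> X \<subseteq> UNIV"
  obtain N where N: "\<And>x. x \<in> X \<Longrightarrow> \<bar>x\<bar> \<le> int N"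
  proof -
    have "\<bar>x\<bar> \<le> int (nat (\<Sum>x\<in>X. \<bar>x\<bar>))" if "x \<in> X" for x using member_le_sum[of x X "\<lambda>x. \<bar>x\<bar>"] that X by (simp add: sum_nonneg)
    then show ?thesis using that by blast
  qed
  show "\<forall>\<^sub>F n in sequentially. finite {- int n..int n} \<and> X \<subseteq> {- int n..int n} \<and> {- int n..int n} \<subseteq> UNIV"
    using eventually_ge_at_top[of N] by eventually_elim (use N in fastforce)
qed

lemma has_sum_imp_symmetric_limit:
  assumes "(f has_sum S) (UNIV :: int set)"
  shows "(\<lambda>n. \<Sum>l=-int n..int n. f l) \<longlonglongrightarrow> S" using filterlim_compose[OF assms[unfolded has_sum_def] filterlim_symmetric_intervals] .

lemma norm_partial_sum:
  assumes "conj_sym c"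
  shows "(norm (fourier_partial_sum c n))\<^sup>2 = (\<Sum>l=-int n..int n. (cmod (c l))\<^sup>2)"
proof -
  have "(norm (fourier_partial_sum c n))\<^sup>2 = Re (\<Sum>l=-int n..int n. c l * cnj (if \<bar>l\<bar> \<le> int n then c l else 0))"
    unfolding power2_norm_eq_inner inner_partial_sum fcoeff_partial_sum[OF assms] ..
  also have "(\<Sum>l=-int n..int n. c l * cnj (if \<bar>l\<bar> \<le> int n then c l else 0)) = (\<Sum>l=-int n..int n. of_real ((cmod (c l))\<^sup>2))"
    by (intro sum.cong) (auto simp: complex_norm_square simp del: of_real_power)
  finally show ?thesis by simp
qed

lemma fourier_partial_sum_diff:
  "fourier_partial_sum c n - fourier_partial_sum d n = fourier_partial_sum (\<lambda>l. c l - d l) n"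
  unfolding fourier_partial_sum_abs diff_abs_l2[OF partial_sum_sq_int partial_sum_sq_int]
  by (intro arg_cong[of _ _ abs_l2_torus] ext)
     (simp only: minus_complex.sel(1)[symmetric] sum_subtractf left_diff_distrib diff_divide_distrib)

lemma norm_diff_partial_sum:
  assumes "conj_sym c" "n \<le> m"
  shows "(norm (fourier_partial_sum c m - fourier_partial_sum c n))\<^sup>2
    = (\<Sum>l=-int m..int m. (cmod (c l))\<^sup>2) - (\<Sum>l=-int n..int n. (cmod (c l))\<^sup>2)"
proof -
  \<comment> \<open>With truncated coefficients the shorter sum becomes a sum over the longer range,
    and the difference is again a single partial sum.\<close>
  have "fourier_partial_sum c n = fourier_partial_sum (\<lambda>l. if \<bar>l\<bar> \<le> int n then c l else 0) m" unfolding fourier_partial_sum_abs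
    by (intro arg_cong[of _ _ abs_l2_torus] ext arg_cong[of _ _ Re] arg_cong2[of _ _ _ _ "(/)"] refl
        sum.mono_neutral_cong_left) (use assms in auto)
  then have "(norm (fourier_partial_sum c m - fourier_partial_sum c n))\<^sup>2
    = (norm (fourier_partial_sum (\<lambda>l. c l - (if \<bar>l\<bar> \<le> int n then c l else 0)) m))\<^sup>2" by (simp only: fourier_partial_sum_diff)
  also have "\<dots> = (\<Sum>l=-int m..int m. (cmod (c l - (if \<bar>l\<bar> \<le> int n then c l else 0)))\<^sup>2)"
    using assms by (intro norm_partial_sum) (auto simp: conj_sym_def)
  also have "\<dots> = (\<Sum>l=-int m..int m. (cmod (c l))\<^sup>2 - (if \<bar>l\<bar> \<le> int n then (cmod (c l))\<^sup>2 else 0))" by (intro sum.cong) auto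
  also have "\<dots> = (\<Sum>l=-int m..int m. (cmod (c l))\<^sup>2) - (\<Sum>l=-int m..int m. if \<bar>l\<bar> \<le> int n then (cmod (c l))\<^sup>2 else 0)"
    by (rule sum_subtractf)
  also have "(\<Sum>l=-int m..int m. if \<bar>l\<bar> \<le> int n then (cmod (c l))\<^sup>2 else 0) = (\<Sum>l=-int n..int n. (cmod (c l))\<^sup>2)"
    by (rule sum.mono_neutral_cong_right) (use assms in auto)
  finally show ?thesis .
qed

definition sq_summable :: "(int \<Rightarrow> complex) \<Rightarrow> bool" where
  "sq_summable c \<longleftrightarrow> (\<lambda>l. (cmod (c l))\<^sup>2) summable_on UNIV"

lemma fourier_series_limit:
  assumes "conj_sym c" "sq_summable c"
  shows "fourier_partial_sum c \<longlonglongrightarrow> fourier_series c"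
proof -
  let ?s = "\<lambda>n. \<Sum>l=-int n..int n. (cmod (c l))\<^sup>2"
  have "?s \<longlonglongrightarrow> (\<Sum>\<^sub>\<infinity>l. (cmod (c l))\<^sup>2)"
    using assms(2) by (intro has_sum_imp_symmetric_limit has_sum_infsum) (simp add: sq_summable_def)
  then have "Cauchy ?s" by (rule LIMSEQ_imp_Cauchy)
  have "Cauchy (fourier_partial_sum c)"
  proof (rule CauchyI)
    fix e :: real assume "0 < e"
    then obtain M where M: "\<And>m n. m \<ge> M \<Longrightarrow> n \<ge> M \<Longrightarrow> norm (?s m - ?s n) < e\<^sup>2" using CauchyD[OF \<open>Cauchy ?s\<close>, of "e\<^sup>2"] by auto
    have *: "norm (fourier_partial_sum c m - fourier_partial_sum c n) < e" if "n \<ge> M" "m \<ge> n" for m n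
    proof -
      have "(norm (fourier_partial_sum c m - fourier_partial_sum c n))\<^sup>2 < e\<^sup>2"
        unfolding norm_diff_partial_sum[OF assms(1) that(2)] using M[of m n] that by simp
      then show ?thesis using \<open>0 < e\<close> by (simp add: power_less_imp_less_base)
    qed
    show "\<exists>M. \<forall>m\<ge>M. \<forall>n\<ge>M. norm (fourier_partial_sum c m - fourier_partial_sum c n) < e"
    proof (intro exI[of _ M] allI impI)
      fix m n assume "M \<le> m" "M \<le> n"
      then show "norm (fourier_partial_sum c m - fourier_partial_sum c n) < e"
        using *[of n m] *[of m n] by (cases "m \<ge> n") (auto simp: norm_minus_commute)
    qed
  qed
  then show ?thesis unfolding fourier_series_def by (simp add: Cauchy_convergent_iff convergent_LIMSEQ_iff)
qed

lemma fcoeff_fourier_series: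
  assumes "conj_sym c" "sq_summable c"
  shows "fcoeff (fourier_series c) l = c l"
proof -
  have "(\<lambda>n. fcoeff (fourier_partial_sum c n) l) \<longlonglongrightarrow> fcoeff (fourier_series c) l"
    by (rule bounded_linear.tendsto[OF bounded_linear_fcoeff fourier_series_limit[OF assms]])
  moreover have "(\<lambda>n. fcoeff (fourier_partial_sum c n) l) \<longlonglongrightarrow> c l"
  proof (rule tendsto_eventually)
    show "\<forall>\<^sub>F n in sequentially. fcoeff (fourier_partial_sum c n) l = c l" using eventually_ge_at_top[of "nat \<bar>l\<bar>"]
      by eventually_elim (simp add: fcoeff_partial_sum[OF assms(1)])
  qed
  ultimately show ?thesis by (rule LIMSEQ_unique)
qed

lemma bessel_finite: "(\<Sum>l=-int n..int n. (cmod (fcoeff f l))\<^sup>2) \<le> (norm f)\<^sup>2"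
proof -
  let ?p = "fourier_partial_sum (fcoeff f) n"
  let ?S = "\<Sum>l=-int n..int n. (cmod (fcoeff f l))\<^sup>2"
  have "inner f ?p = ?S" unfolding inner_partial_sum by (simp add: complex_norm_square[symmetric])
  moreover have "(norm ?p)\<^sup>2 = ?S" by (rule norm_partial_sum[OF conj_sym_fcoeff])
  moreover have "(norm (f - ?p))\<^sup>2 = (norm f)\<^sup>2 - 2 * inner f ?p + (norm ?p)\<^sup>2"
    unfolding power2_norm_eq_inner by (simp add: inner_diff inner_commute)
  ultimately show ?thesis using zero_le_power2[of "norm (f - ?p)"] by simp
qed

lemma sq_summable_fcoeff: "sq_summable (fcoeff f)" unfolding sq_summable_def
proof (rule nonneg_bdd_above_summable_on)
  show "bdd_above (sum (\<lambda>l. (cmod (fcoeff f l))\<^sup>2) ` {F. F \<subseteq> UNIV \<and> finite F})"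
  proof (rule bdd_aboveI2)
    fix F :: "int set" assume "F \<in> {F. F \<subseteq> UNIV \<and> finite F}"
    then have "finite F" by simp
    then have "\<forall>\<^sub>F n in sequentially. F \<subseteq> {-int n..int n}"
      using filterlim_symmetric_intervals unfolding filterlim_finite_subsets_at_top by auto
    then obtain n where "F \<subseteq> {-int n..int n}" unfolding eventually_sequentially by blast
    then have "sum (\<lambda>l. (cmod (fcoeff f l))\<^sup>2) F \<le> (\<Sum>l=-int n..int n. (cmod (fcoeff f l))\<^sup>2)" by (intro sum_mono2) auto
    then show "sum (\<lambda>l. (cmod (fcoeff f l))\<^sup>2) F \<le> (norm f)\<^sup>2" using bessel_finite order_trans by blast
  qed
qed simp

lemma sq_int_mult_bounded:
  assumes "sq_int f" "h \<in> borel_measurable torus" "\<And>x. \<bar>h x\<bar> \<le> C"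
  shows "sq_int (\<lambda>x. f x * h x)" unfolding sq_int_def
proof
  show m: "(\<lambda>x. f x * h x) \<in> borel_measurable torus" using assms by (auto simp: sq_int_def)
  show "integrable torus (\<lambda>x. (f x * h x)\<^sup>2)"
  proof (rule Bochner_Integration.integrable_bound[where f = "\<lambda>x. C\<^sup>2 * (f x)\<^sup>2"])
    have "(h x)\<^sup>2 \<le> C\<^sup>2" for x using assms(3)[of x] by (meson abs_ge_zero abs_le_square_iff order_trans abs_ge_self)
    then show "AE x in torus. norm ((f x * h x)\<^sup>2) \<le> norm (C\<^sup>2 * (f x)\<^sup>2)"
      by (intro AE_I2) (simp add: power_mult_distrib mult.commute[of "C\<^sup>2"] mult_left_mono)
  qed (use assms m in \<open>auto simp: sq_int_def\<close>)
qed

section \<open>Completeness of the trigonometric system\<close>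

definition ortho_trig :: "(real \<Rightarrow> real) \<Rightarrow> bool" where
  "ortho_trig f \<longleftrightarrow> sq_int f \<and> (\<forall>l. fcoeff (abs_l2_torus f) l = 0)"

lemma ortho_trig_integral:
  assumes "ortho_trig f"
  shows "(\<integral>x. of_real (f x) * wave l x \<partial>torus) = 0" using assms fcoeff_abs_l2[of f "-l"] by (auto simp: ortho_trig_def)

lemma ortho_trigI:
  assumes "sq_int f" "\<And>l. (\<integral>x. of_real (f x) * wave l x \<partial>torus) = 0"
  shows "ortho_trig f" using assms(2)[of "- l" for l] by (simp add: ortho_trig_def fcoeff_abs_l2[OF assms(1)] assms(1))

lemma integrable_of_real_mult_exp:
  "sq_int f \<Longrightarrow> integrable torus (\<lambda>x. of_real (f x) * wave l x)" by (rule integrable_mult_exp) (auto dest: sq_int_integrable)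

text \<open>Multiplication by a cosine or a sine of frequency one shifts frequencies by one, and
  orthogonality to all of them survives the shift.\<close>

lemma ortho_trig_mult_cos_sin:
  assumes "ortho_trig f"
  shows "ortho_trig (\<lambda>x. f x * cos x)" "ortho_trig (\<lambda>x. f x * sin x)"
proof -
  have f: "sq_int f" using assms by (simp add: ortho_trig_def)
  have c: "sq_int (\<lambda>x. f x * cos x)" "sq_int (\<lambda>x. f x * sin x)"
    by (rule sq_int_mult_bounded[OF f, where C = 1]; use sq_int_cos[of 1] sq_int_sin[of 1] in \<open>simp add: sq_int_def\<close>)+
  note i = integrable_of_real_mult_exp[OF f]
  note z = ortho_trig_integral[OF assms]
  show "ortho_trig (\<lambda>x. f x * cos x)"
  proof (rule ortho_trigI[OF c(1)])
    fix l
    have "(\<lambda>x. of_real (f x * cos x) * wave l x) = (\<lambda>x.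
      (of_real (f x) * exp (\<i> * of_int (l+1) * of_real x) + of_real (f x) * exp (\<i> * of_int (l-1) * of_real x)) / 2)"
      by (intro ext) (simp add: cos_of_real[symmetric] cos_exp_eq exp_add[symmetric] algebra_simps exp_minus exp_diff divide_simps)
    then show "(\<integral>x. of_real (f x * cos x) * wave l x \<partial>torus) = 0" using i z by (simp del: of_int_add of_int_diff)
  qed
  show "ortho_trig (\<lambda>x. f x * sin x)"
  proof (rule ortho_trigI[OF c(2)])
    fix l
    have "(\<lambda>x. of_real (f x * sin x) * wave l x) = (\<lambda>x.
      (of_real (f x) * exp (\<i> * of_int (l+1) * of_real x) - of_real (f x) * exp (\<i> * of_int (l-1) * of_real x)) / (2 * \<i>))"
      by (intro ext) (simp add: sin_of_real[symmetric] sin_exp_eq exp_add[symmetric] algebra_simps exp_minus exp_diff divide_simps)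
    then show "(\<integral>x. of_real (f x * sin x) * wave l x \<partial>torus) = 0" using i z by (simp del: of_int_add of_int_diff)
  qed
qed

lemma ortho_trig_comb:
  assumes "ortho_trig f" "ortho_trig g"
  shows "ortho_trig (\<lambda>x. a * f x + b * g x)"
proof (rule ortho_trigI)
  have f: "sq_int f" and g: "sq_int g" using assms by (auto simp: ortho_trig_def)
  then show "sq_int (\<lambda>x. a * f x + b * g x)" by (intro sq_int_add sq_int_scale)
  fix l
  have "(\<lambda>x. of_real (a * f x + b * g x) * wave l x) =
     (\<lambda>x. of_real a * (of_real (f x) * wave l x)
        + of_real b * (of_real (g x) * wave l x))" by (simp add: algebra_simps)
  then show "(\<integral>x. of_real (a * f x + b * g x) * wave l x \<partial>torus) = 0"
    using integrable_of_real_mult_exp[OF f] integrable_of_real_mult_exp[OF g]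
      ortho_trig_integral[OF assms(1)] ortho_trig_integral[OF assms(2)] by simp
qed

text \<open>A real linear function of \<open>cis x\<close> is a combination of \<open>cos x\<close>
  and \<open>sin x\<close>. The claim is made for all \<open>f\<close> so that the second factor of
  a product can act on the function already multiplied by the first.\<close>

lemma ortho_trig_mult_polynomial:
  assumes "real_polynomial_function p" "ortho_trig f"
  shows "ortho_trig (\<lambda>x. f x * p (cis x))" using assms
proof (induction p arbitrary: f)
  case (linear p)
  have "p (cis x) = cos x * p 1 + sin x * p \<i>" for x
  proof -
    have "cis x = cos x *\<^sub>R 1 + sin x *\<^sub>R \<i>" by (simp add: complex_eq_iff)
    then show ?thesis
      using linear_add[OF bounded_linear.linear[OF linear(1)]] linear_scale[OF bounded_linear.linear[OF linear(1)]] by simp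
  qed
  then show ?case using ortho_trig_comb[OF ortho_trig_mult_cos_sin[OF linear(2)], of "p 1" "p \<i>"] by (simp add: algebra_simps)
next
  case (const c)
  then show ?case using ortho_trig_comb[of f f c 0] by (simp add: mult.commute)
next
  case (add p q)
  then show ?case using ortho_trig_comb[of "\<lambda>x. f x * p (cis x)" "\<lambda>x. f x * q (cis x)" 1 1] by (simp add: distrib_left)
next
  case (mult p q)
  then show ?case using mult(4)[OF mult(3)[OF mult(5)]] by (simp add: mult_ac)
qed

lemma ortho_trig_integral_real:
  assumes "ortho_trig f"
  shows "(\<integral>x. f x \<partial>torus) = 0" using ortho_trig_integral[OF assms, of 0] by simp

text \<open>Stone-Weierstrass is used on the circle, because the polynomials in \<open>cis x\<close>
  are dense among the periodic continuous functions only. Uniform approximation suffices, as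
  \<open>f\<close> is integrable.\<close>

lemma ortho_trig_continuous:
  assumes f: "ortho_trig f" and h: "continuous_on (sphere 0 1) (h :: complex \<Rightarrow> real)"
  shows "(\<integral>x. f x * h (cis x) \<partial>torus) = 0"
proof -
  have sf: "sq_int f" using f by (simp add: ortho_trig_def)
  have fi: "integrable torus (\<lambda>x. \<bar>f x\<bar>)" using sq_int_integrable[OF sf] by simp
  have cont: "continuous_on UNIV (\<lambda>x. h (cis x))" by (rule continuous_on_compose2[OF h]) (auto intro!: continuous_intros)
  then have hi: "integrable torus (\<lambda>x. f x * h (cis x))"
    by (intro sq_int_mult_integrable sf sq_int_continuous) (auto intro: continuous_on_subset)
  define I where "I = (\<integral>x. \<bar>f x\<bar> \<partial>torus)"
  have "I \<ge> 0" by (simp add: I_def)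
  have "\<bar>\<integral>x. f x * h (cis x) \<partial>torus\<bar> \<le> e" if "e > 0" for e
  proof -
    have "0 < e / (I + 1)" using that \<open>I \<ge> 0\<close> by simp
    then obtain p where p: "real_polynomial_function p" "\<And>z. z \<in> sphere 0 1 \<Longrightarrow> \<bar>h z - p z\<bar> < e / (I + 1)"
      using Stone_Weierstrass_real_polynomial_function[OF compact_sphere h] by metis
    have o: "ortho_trig (\<lambda>x. f x * p (cis x))" by (rule ortho_trig_mult_polynomial[OF p(1) f])
    then have pi: "integrable torus (\<lambda>x. f x * p (cis x))" by (auto simp: ortho_trig_def intro: sq_int_integrable)
    have "\<bar>\<integral>x. f x * h (cis x) \<partial>torus\<bar> = \<bar>\<integral>x. f x * h (cis x) - f x * p (cis x) \<partial>torus\<bar>"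
      using hi pi ortho_trig_integral_real[OF o] by simp
    also have "\<dots> \<le> (\<integral>x. \<bar>f x * h (cis x) - f x * p (cis x)\<bar> \<partial>torus)" by (rule integral_abs_bound)
    also have "\<dots> \<le> (\<integral>x. \<bar>f x\<bar> * (e / (I + 1)) \<partial>torus)"
    proof (rule integral_mono)
      show "integrable torus (\<lambda>x. \<bar>f x * h (cis x) - f x * p (cis x)\<bar>)" using hi pi by auto
      fix x
      have "\<bar>f x * h (cis x) - f x * p (cis x)\<bar> = \<bar>f x\<bar> * \<bar>h (cis x) - p (cis x)\<bar>"
        by (simp add: abs_mult[symmetric] right_diff_distrib)
      also have "\<dots> \<le> \<bar>f x\<bar> * (e / (I + 1))" using p(2)[of "cis x"] by (intro mult_left_mono) auto
      finally show "\<bar>f x * h (cis x) - f x * p (cis x)\<bar> \<le> \<bar>f x\<bar> * (e / (I + 1))" .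
    qed (use fi in auto)
    also have "\<dots> = I * (e / (I + 1))" using fi by (simp add: I_def)
    also have "\<dots> \<le> e" using \<open>I \<ge> 0\<close> that by (simp add: field_simps)
    finally show ?thesis .
  qed
  then have "\<bar>\<integral>x. f x * h (cis x) \<partial>torus\<bar> \<le> 0" by (rule field_le_epsilon) simp
  then show ?thesis by simp
qed

lemma ortho_trig_compact:
  assumes f: "ortho_trig f" and K: "compact K" "K \<subseteq> {-pi<..<pi}"
  shows "(\<integral>x. f x * indicator K x \<partial>torus) = 0"
proof (cases "K = {}")
  case False
  have sf: "sq_int f" using f by (simp add: ortho_trig_def)
  let ?C = "cis ` K"
  have C: "closed ?C" "?C \<noteq> {}" using K False by (auto intro!: compact_imp_closed compact_continuous_image continuous_intros)
  define h where "h n z = max 0 (1 - real n * infdist z ?C)" for n and z :: complex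
  have h: "continuous_on A (h n)" for n A unfolding h_def by (intro continuous_intros)
  have h01: "0 \<le> h n z" "h n z \<le> 1" for n z by (auto simp: h_def infdist_nonneg)
  have lim: "(\<lambda>n. h n z) \<longlonglongrightarrow> indicator ?C z" for z
  proof (cases "z \<in> ?C")
    case True
    then show ?thesis by (simp add: h_def)
  next
    case False
    then have "infdist z ?C > 0" using C by (metis in_closed_iff_infdist_zero infdist_nonneg order_le_less)
    then obtain N :: nat where N: "real N * infdist z ?C > 1" using reals_Archimedean3 by blast
    have "\<forall>\<^sub>F n in sequentially. h n z = 0" using eventually_ge_at_top[of N]
    proof eventually_elim
      case (elim n)
      then have "real N * infdist z ?C \<le> real n * infdist z ?C" by (intro mult_right_mono infdist_nonneg) auto
      then show ?case using N by (simp add: h_def)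
    qed
    then show ?thesis using False by (simp add: tendsto_eventually)
  qed
  have ind: "indicator ?C (cis x) = (indicator K x :: real)" if "x \<in> {-pi<..<pi}" for x
  proof -
    have "x = y" if "cis x = cis y" "y \<in> K" for y
      using that K \<open>x \<in> {-pi<..<pi}\<close> Arg_cis[of x] Arg_cis[of y] by (auto simp: subset_iff)
    then have "cis x \<in> ?C \<longleftrightarrow> x \<in> K" by auto
    then show ?thesis by (simp add: indicator_def)
  qed
  have fi: "integrable torus (\<lambda>x. \<bar>f x\<bar>)" using sq_int_integrable[OF sf] by simp
  have nz: "AE x in lebesgue. x \<noteq> c" for c :: real using AE_lborel_singleton[of c] by (rule AE_completion)
  have bd: "AE x in torus. x \<noteq> -pi" "AE x in torus. x \<noteq> pi" "AE x in torus. x \<in> {-pi..pi}"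
    using nz[of pi] nz[of "-pi"] by (auto simp: AE_restrict_space_iff elim: eventually_mono)
  have "(\<lambda>n. \<integral>x. f x * h n (cis x) \<partial>torus) \<longlonglongrightarrow> (\<integral>x. f x * indicator K x \<partial>torus)"
  proof (rule integral_dominated_convergence[where w = "\<lambda>x. \<bar>f x\<bar>"])
    have hm: "(\<lambda>x. h n (cis x)) \<in> borel_measurable torus" for n
      by (intro continuous_imp_measurable_on_sets_lebesgue continuous_on_compose2[OF h[of UNIV n]])
         (auto intro!: continuous_intros)
    have [measurable]: "f \<in> borel_measurable torus" using sf by (simp add: sq_int_def)
    show "(\<lambda>x. f x * h n (cis x)) \<in> borel_measurable torus" for n using hm by measurable
    have "K \<in> sets lebesgue" using K(1) by (simp add: lmeasurable_compact fmeasurableD)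
    moreover have "K \<inter> {-pi..pi} = K" using K(2) by auto
    ultimately have "K \<in> sets torus" by (metis Int_commute sets_restrict_space image_eqI)
    then show "(\<lambda>x. f x * indicator K x) \<in> borel_measurable torus" by measurable
    show "AE x in torus. (\<lambda>n. f x * h n (cis x)) \<longlonglongrightarrow> f x * indicator K x" using bd
    proof eventually_elim
      case (elim x)
      then have "x \<in> {-pi<..<pi}" by auto
      then show ?case using tendsto_mult[OF tendsto_const lim[of "cis x"]] ind[of x] by simp
    qed
    show "AE x in torus. norm (f x * h n (cis x)) \<le> \<bar>f x\<bar>" for n using h01 by (intro AE_I2) (simp add: abs_mult mult_left_le)
  qed (use fi in auto)
  moreover have "(\<integral>x. f x * h n (cis x) \<partial>torus) = 0" for n by (rule ortho_trig_continuous[OF f h])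
  ultimately show ?thesis by (simp add: LIMSEQ_const_iff)
qed simp

text \<open>On a compact subset of the set where \<open>f\<close> is positive, the integral of
  \<open>f\<close> vanishes, so the subset is null; inner regularity passes this on to the whole
  set. Applied to \<open>f\<close> and \<open>- f\<close> it shows that \<open>f\<close>
  vanishes.\<close>

lemma ortho_trig_AE_le:
  assumes f: "ortho_trig f"
  shows "AE x in torus. f x \<le> 0"
proof -
  have sf: "sq_int f" using f by (simp add: ortho_trig_def)
  have fi: "integrable torus f" by (rule sq_int_integrable[OF sf])
  have [measurable]: "f \<in> borel_measurable torus" using sf by (simp add: sq_int_def)
  define S where "S = {x \<in> {-pi<..<pi}. f x > 0}"
  have S: "S \<in> sets lebesgue"
  proof -
    have "{x \<in> space torus. f x > 0} \<in> sets torus" by measurable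
    then have "{x \<in> {-pi..pi}. f x > 0} \<in> sets lebesgue" by (simp add: sets_restrict_space_iff space_restrict_space)
    moreover have "{-pi<..<pi} \<in> sets lebesgue" by simp
    moreover have "S = {x \<in> {-pi..pi}. f x > 0} \<inter> {-pi<..<pi}" by (auto simp: S_def)
    ultimately show ?thesis by (metis sets.Int)
  qed
  have le: "emeasure lebesgue S \<le> ennreal e" if e: "e > 0" for e
  proof -
    obtain K where K: "closed K" "K \<subseteq> S" "emeasure lebesgue (S - K) < ennreal e" by (rule sets_lebesgue_inner_closed[OF S e])
    have KI: "K \<subseteq> {-pi<..<pi}" "K \<subseteq> {-pi..pi}" using K(2) by (auto simp: S_def)
    then have "bounded K" using bounded_closed_interval bounded_subset by blast
    then have cK: "compact K" using K(1) by (simp add: compact_eq_bounded_closed)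
    have Ks: "K \<in> sets lebesgue" using cK by (simp add: lmeasurable_compact fmeasurableD)
    then have Kt: "K \<in> sets torus" using KI(2) by (simp add: sets_restrict_space_iff)
    have "AE x in torus. f x * indicator K x = 0"
    proof (rule integral_nonneg_eq_0_iff_AE[THEN iffD1])
      show "integrable torus (\<lambda>x. f x * indicator K x)" using fi Kt by (intro integrable_real_mult_indicator) auto
      show "AE x in torus. 0 \<le> f x * indicator K x" using K(2) by (intro AE_I2) (auto simp: S_def indicator_def less_imp_le)
      show "(\<integral>x. f x * indicator K x \<partial>torus) = 0" by (rule ortho_trig_compact[OF f cK KI(1)])
    qed
    then have "AE x in torus. x \<notin> K" by eventually_elim (use K(2) in \<open>auto simp: S_def indicator_def split: if_splits\<close>)
    then have "emeasure torus K = 0" by (simp add: AE_iff_null_sets[OF Kt] null_setsD1)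
    then have "emeasure lebesgue K = 0" using KI(2) by (simp add: emeasure_restrict_space)
    moreover have "emeasure lebesgue S \<le> emeasure lebesgue K + emeasure lebesgue (S - K)"
      using emeasure_subadditive[of K lebesgue "S - K"] Ks S K(2) by (metis Diff_partition sets.Diff)
    ultimately show ?thesis using K(3) by simp
  qed
  have "emeasure lebesgue S \<le> 0" by (rule ennreal_le_epsilon) (simp add: le)
  then have "emeasure lebesgue S = 0" by simp
  then have "AE x in lebesgue. x \<notin> S" using S by (intro AE_not_in) auto
  moreover have "AE x in lebesgue. x \<noteq> -pi" "AE x in lebesgue. x \<noteq> pi" by (auto intro: AE_lborel_singleton[THEN AE_completion])
  ultimately show ?thesis unfolding AE_restrict_space_iff[of "{-pi..pi}" lebesgue, simplified]
    by eventually_elim (auto simp: S_def not_le less_le)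
qed

theorem fcoeff_eq_0_imp:
  assumes "\<And>l. fcoeff f l = 0"
  shows "f = 0"
proof -
  obtain g where g: "sq_int g" "f = abs_l2_torus g" by (rule l2_torus_cases)
  have o: "ortho_trig g" using assms g by (simp add: ortho_trig_def)
  have "ortho_trig (\<lambda>x. - g x)" using ortho_trig_comb[OF o o, of "-1" 0] by simp
  then have "AE x in torus. - g x \<le> 0" by (rule ortho_trig_AE_le)
  with ortho_trig_AE_le[OF o] have "AE x in torus. g x = 0" by eventually_elim simp
  then have "abs_l2_torus g = abs_l2_torus (\<lambda>x. 0)" using g sq_int_const[of 0] by (subst abs_l2_eq_iff) auto
  then show ?thesis by (simp add: g(2) zero_l2_torus_def)
qed

lemma fcoeff_inject: "(\<And>l. fcoeff f l = fcoeff g l) \<Longrightarrow> f = g" using fcoeff_eq_0_imp[of "f - g"] by (simp add: fcoeff_diff)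

lemma fourier_series_fcoeff: "fourier_series (fcoeff f) = f"
  by (rule fcoeff_inject) (rule fcoeff_fourier_series[OF conj_sym_fcoeff sq_summable_fcoeff])

lemma fourier_partial_sum_tendsto: "fourier_partial_sum (fcoeff f) \<longlonglongrightarrow> f"
  using fourier_series_limit[OF conj_sym_fcoeff sq_summable_fcoeff, of f] by (simp add: fourier_series_fcoeff)

theorem parseval: "((\<lambda>l. (cmod (fcoeff f l))\<^sup>2) has_sum (norm f)\<^sup>2) UNIV"
proof -
  have s: "((\<lambda>l. (cmod (fcoeff f l))\<^sup>2) has_sum (\<Sum>\<^sub>\<infinity>l. (cmod (fcoeff f l))\<^sup>2)) UNIV"
    using sq_summable_fcoeff[of f] unfolding sq_summable_def by (rule has_sum_infsum)
  have "(\<lambda>n. (norm (fourier_partial_sum (fcoeff f) n))\<^sup>2) \<longlonglongrightarrow> (norm f)\<^sup>2" by (intro tendsto_intros fourier_partial_sum_tendsto)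
  then have "(\<lambda>n. \<Sum>l=-int n..int n. (cmod (fcoeff f l))\<^sup>2) \<longlonglongrightarrow> (norm f)\<^sup>2" by (simp add: norm_partial_sum[OF conj_sym_fcoeff])
  with has_sum_imp_symmetric_limit[OF s] have "(\<Sum>\<^sub>\<infinity>l. (cmod (fcoeff f l))\<^sup>2) = (norm f)\<^sup>2" by (rule LIMSEQ_unique)
  with s show ?thesis by simp
qed

section \<open>Weighted norms of Fourier coefficients\<close>

text \<open>Sums with values in \<open>ennreal\<close> are integrals for the counting measure.
  Interchange, reindexing and monotonicity then hold without summability conditions, and finiteness
  is checked only where a genuine sum is wanted.\<close>

abbreviation esum :: "('a \<Rightarrow> ennreal) \<Rightarrow> ennreal" where
  "esum f \<equiv> nn_integral (count_space UNIV) f"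

lemma esum_eq_infsum:
  fixes g :: "'a \<Rightarrow> real"
  assumes "\<And>x. 0 \<le> g x" "g summable_on UNIV"
  shows "esum (\<lambda>x. ennreal (g x)) = ennreal (\<Sum>\<^sub>\<infinity>x. g x)"
proof -
  have "Infinite_Sum.abs_summable_on g UNIV" using assms by simp
  then have s: "Infinite_Set_Sum.abs_summable_on g UNIV" using abs_summable_equivalent[of g UNIV] by blast
  then have "integrable (count_space UNIV) g" by (simp add: Infinite_Set_Sum.abs_summable_on_def)
  then have "esum (\<lambda>x. ennreal (g x)) = ennreal (\<integral>x. g x \<partial>count_space UNIV)" using assms by (intro nn_integral_eq_integral) auto
  also have "(\<integral>x. g x \<partial>count_space UNIV) = infsetsum g UNIV" by (simp add: infsetsum_def)
  also have "\<dots> = infsum g UNIV" using s by (rule infsetsum_infsum)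
  finally show ?thesis .
qed

lemma esum_has_sum:
  fixes g :: "'a \<Rightarrow> real"
  assumes "\<And>x. 0 \<le> g x" "(g has_sum S) UNIV"
  shows "esum (\<lambda>x. ennreal (g x)) = ennreal S"
  using esum_eq_infsum[OF assms(1) has_sum_imp_summable[OF assms(2)]] infsumI[OF assms(2)] by simp

lemma esum_finite_imp_summable:
  fixes g :: "'a \<Rightarrow> real"
  assumes "\<And>x. 0 \<le> g x" "esum (\<lambda>x. ennreal (g x)) < \<infinity>"
  shows "g summable_on UNIV"
proof -
  have "integrable (count_space UNIV) g" using assms by (intro integrableI_nonneg) auto
  then have "Infinite_Set_Sum.abs_summable_on g UNIV" by (simp add: Infinite_Set_Sum.abs_summable_on_def)
  then have "Infinite_Sum.abs_summable_on g UNIV" using abs_summable_equivalent[of g UNIV] by blast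
  then show ?thesis using assms by simp
qed

lemma summable_on_iff_esum_finite:
  fixes g :: "'a \<Rightarrow> real"
  assumes "\<And>x. 0 \<le> g x"
  shows "g summable_on UNIV \<longleftrightarrow> esum (\<lambda>x. ennreal (g x)) < \<infinity>"
proof
  assume "g summable_on UNIV"
  then show "esum (\<lambda>x. ennreal (g x)) < \<infinity>" by (subst esum_eq_infsum[OF assms]) auto
qed (rule esum_finite_imp_summable[OF assms])

lemma esum_finite_imp_abs_summable:
  "esum (\<lambda>x. ennreal (norm (f x))) < \<infinity> \<Longrightarrow> (\<lambda>x. norm (f x)) summable_on UNIV" by (rule esum_finite_imp_summable) auto

lemma esum_finite_imp_summable_on:
  fixes f :: "'a \<Rightarrow> 'b::banach"
  shows "esum (\<lambda>x. ennreal (norm (f x))) < \<infinity> \<Longrightarrow> f summable_on UNIV"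
  by (rule abs_summable_summable) (rule esum_finite_imp_abs_summable)

lemma norm_infsum_le_esum:
  fixes f :: "'a \<Rightarrow> 'b::real_normed_vector"
  shows "ennreal (norm (\<Sum>\<^sub>\<infinity>x. f x)) \<le> esum (\<lambda>x. ennreal (norm (f x)))"
proof (cases "esum (\<lambda>x. ennreal (norm (f x))) < \<infinity>")
  case True
  then have s: "(\<lambda>x. norm (f x)) summable_on UNIV" by (rule esum_finite_imp_abs_summable)
  have "norm (\<Sum>\<^sub>\<infinity>x. f x) \<le> (\<Sum>\<^sub>\<infinity>x. norm (f x))" by (rule norm_infsum_bound[OF s])
  then show ?thesis using esum_eq_infsum[OF _ s] by (simp add: ennreal_leI)
qed (simp add: not_less top_unique)

lemma esum_reindex: "bij h \<Longrightarrow> esum (\<lambda>x. f (h x)) = esum f" by (rule nn_integral_bij_count_space)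

lemma bij_int_minus: "bij (\<lambda>j::int. k - j)" by (rule bij_betwI[where g = "\<lambda>j. k - j"]) auto

lemma bij_int_plus: "bij (\<lambda>j::int. j + k)" by (rule bij_betwI[where g = "\<lambda>j. j - k"]) auto

lemma esum_cmult: "esum (\<lambda>x. c * f x) = c * esum f" by (rule nn_integral_cmult) simp

lemma esum_multc: "esum (\<lambda>x. f x * c) = esum f * c" by (rule nn_integral_multc) simp

lemma esum_add: "esum (\<lambda>x. f x + g x) = esum f + esum g" by (rule nn_integral_add) auto

lemma esum_mono: "(\<And>x. f x \<le> g x) \<Longrightarrow> esum f \<le> esum g" by (rule nn_integral_mono) auto

lemma esum_swap:
  fixes f :: "'a::countable \<Rightarrow> 'b::countable \<Rightarrow> ennreal"
  shows "esum (\<lambda>x. esum (\<lambda>y. f x y)) = esum (\<lambda>y. esum (\<lambda>x. f x y))" by (rule nn_integral_count_space_nn_integral) auto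

lemma esum_Cauchy_Schwarz: "(esum (\<lambda>x. f x * g x))\<^sup>2 \<le> esum (\<lambda>x. (f x)\<^sup>2) * esum (\<lambda>x. (g x)\<^sup>2)"
  by (rule Cauchy_Schwarz_nn_integral) auto

lemma ennreal_square_le_cancel: "(a::ennreal)\<^sup>2 \<le> b\<^sup>2 \<Longrightarrow> a \<le> b"
proof (cases b)
  case b: (real r)
  assume le: "a\<^sup>2 \<le> b\<^sup>2"
  show ?thesis
  proof (cases a)
    case (real q)
    then show ?thesis using le b by (auto simp: ennreal_power intro!: ennreal_leI power2_le_imp_le)
  next
    case top
    then show ?thesis using le b by (simp add: ennreal_power top_unique)
  qed
qed simp

definition econv :: "(int \<Rightarrow> ennreal) \<Rightarrow> (int \<Rightarrow> ennreal) \<Rightarrow> int \<Rightarrow> ennreal" where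
  "econv a b k = esum (\<lambda>j. a j * b (k - j))"

lemma econv_commute: "econv a b = econv b a"
proof
  fix k
  have "econv a b k = esum (\<lambda>j. a (k - j) * b (k - (k - j)))"
    unfolding econv_def by (rule esum_reindex[OF bij_int_minus, symmetric])
  then show "econv a b k = econv b a k" by (simp add: econv_def mult.commute)
qed

lemma econv_mono: "(\<And>j. a j \<le> a' j) \<Longrightarrow> (\<And>j. b j \<le> b' j) \<Longrightarrow> econv a b k \<le> econv a' b' k"
  unfolding econv_def by (intro esum_mono mult_mono) auto

lemma econv_Cauchy_Schwarz: "(econv a b k)\<^sup>2 \<le> esum (\<lambda>j. (a j)\<^sup>2) * esum (\<lambda>j. (b j)\<^sup>2)"
proof -
  have "(econv a b k)\<^sup>2 \<le> esum (\<lambda>j. (a j)\<^sup>2) * esum (\<lambda>j. (b (k - j))\<^sup>2)" unfolding econv_def by (rule esum_Cauchy_Schwarz)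
  also have "esum (\<lambda>j. (b (k - j))\<^sup>2) = esum (\<lambda>j. (b j)\<^sup>2)" by (rule esum_reindex[OF bij_int_minus])
  finally show ?thesis .
qed

text \<open>Cauchy-Schwarz after splitting the weight into two square roots. The roots are taken in
  the reals, which is why the weights are finite.\<close>

lemma esum_weighted_Cauchy_Schwarz:
  fixes a :: "'a \<Rightarrow> ennreal"
  assumes "\<And>x. a x < \<infinity>"
  shows "(esum (\<lambda>x. a x * b x))\<^sup>2 \<le> esum a * esum (\<lambda>x. a x * (b x)\<^sup>2)"
proof -
  define r where "r x = ennreal (sqrt (enn2real (a x)))" for x
  have r: "(r x)\<^sup>2 = a x" "r x * r x = a x" for x
    using assms[of x] by (auto simp: r_def power2_eq_square ennreal_mult[symmetric] less_top)
  have "(esum (\<lambda>x. r x * (r x * b x)))\<^sup>2 \<le> esum (\<lambda>x. (r x)\<^sup>2) * esum (\<lambda>x. (r x * b x)\<^sup>2)" by (rule esum_Cauchy_Schwarz)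
  then show ?thesis by (simp add: power_mult_distrib r mult.assoc[symmetric])
qed

text \<open>Cauchy-Schwarz with the weight \<open>a\<close> at each \<open>k\<close>, then
  interchange of the sums and translation invariance of the second factor.\<close>

theorem young_l1_l2:
  assumes "\<And>j. a j < \<infinity>"
  shows "esum (\<lambda>k. (econv a b k)\<^sup>2) \<le> (esum a)\<^sup>2 * esum (\<lambda>k. (b k)\<^sup>2)"
proof -
  have "esum (\<lambda>k. (econv a b k)\<^sup>2) \<le> esum (\<lambda>k. esum a * esum (\<lambda>j. a j * (b (k - j))\<^sup>2))"
    unfolding econv_def by (intro esum_mono esum_weighted_Cauchy_Schwarz assms)
  also have "\<dots> = esum a * esum (\<lambda>k. esum (\<lambda>j. a j * (b (k - j))\<^sup>2))" by (rule esum_cmult)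
  also have "esum (\<lambda>k. esum (\<lambda>j. a j * (b (k - j))\<^sup>2)) = esum (\<lambda>j. esum (\<lambda>k. a j * (b (k - j))\<^sup>2))" by (rule esum_swap)
  also have "\<dots> = esum (\<lambda>j. a j * esum (\<lambda>k. (b k)\<^sup>2))"
    using esum_reindex[OF bij_int_plus, of "\<lambda>k. (b k)\<^sup>2"] by (simp add: esum_cmult diff_conv_add_uminus del: add_uminus_conv_diff)
  also have "\<dots> = esum a * esum (\<lambda>k. (b k)\<^sup>2)" by (rule esum_multc)
  finally show ?thesis by (simp add: power2_eq_square mult.assoc)
qed

definition nl1 :: "(int \<Rightarrow> complex) \<Rightarrow> ennreal" where
  "nl1 c = esum (\<lambda>k. ennreal (cmod (c k)))"

text \<open>Quadratic norms are kept squared and extended real, so that no statement has to assume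
  membership in a Sobolev space; the weights 1, \<open>jb\<close> and \<open>jb\<^sup>2\<close> give
  \<open>L\<^sup>2\<close>, \<open>H\<^sup>1\<close> and \<open>H\<^sup>2\<close>.\<close>

definition wl2 :: "(int \<Rightarrow> real) \<Rightarrow> (int \<Rightarrow> complex) \<Rightarrow> ennreal" where
  "wl2 w c = esum (\<lambda>k. ennreal (w k * (cmod (c k))\<^sup>2))"

abbreviation nl2 :: "(int \<Rightarrow> complex) \<Rightarrow> ennreal" where
  "nl2 \<equiv> wl2 (\<lambda>_. 1)"

lemma nl2_fcoeff: "nl2 (fcoeff f) = ennreal ((norm f)\<^sup>2)" unfolding wl2_def using esum_has_sum[OF _ parseval[of f]] by simp

lemma nl2_alt: "nl2 c = esum (\<lambda>k. (ennreal (cmod (c k)))\<^sup>2)" by (simp add: wl2_def ennreal_power)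

lemma sq_summable_iff: "sq_summable c \<longleftrightarrow> nl2 c < \<infinity>" unfolding sq_summable_def wl2_def by (subst summable_on_iff_esum_finite) auto

lemma norm_eq_of_fcoeff_cmod: "(\<And>l. cmod (fcoeff f l) = cmod (fcoeff g l)) \<Longrightarrow> norm f = norm g"
proof -
  assume "\<And>l. cmod (fcoeff f l) = cmod (fcoeff g l)"
  then have "ennreal ((norm f)\<^sup>2) = ennreal ((norm g)\<^sup>2)" by (simp add: nl2_fcoeff[symmetric] wl2_def)
  then show ?thesis by simp
qed

lemma fcoeff_fourier_mult:
  assumes "conj_sym m" "sq_summable (\<lambda>l. m l * fcoeff f l)"
  shows "fcoeff (fourier_mult m f) l = m l * fcoeff f l" unfolding fourier_mult_def
  by (rule fcoeff_fourier_series) (use assms in \<open>auto simp: conj_sym_def fcoeff_cnj\<close>)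

lemma sq_summable_bounded_mult:
  assumes "\<And>l. cmod (m l) \<le> C" "sq_summable c"
  shows "sq_summable (\<lambda>l. m l * c l)" unfolding sq_summable_def
proof (rule summable_on_comparison_test[OF summable_on_cmult_right[OF assms(2)[unfolded sq_summable_def], of "C\<^sup>2"]])
  fix l
  have "(cmod (m l))\<^sup>2 \<le> C\<^sup>2" using assms(1)[of l] by (intro power_mono) auto
  then show "(cmod (m l * c l))\<^sup>2 \<le> C\<^sup>2 * (cmod (c l))\<^sup>2" by (simp add: norm_mult power_mult_distrib mult_right_mono)
qed simp

lemma fcoeff_fourier_mult_bounded:
  assumes "conj_sym m" "\<And>l. cmod (m l) \<le> C"
  shows "fcoeff (fourier_mult m f) l = m l * fcoeff f l"
  using assms by (intro fcoeff_fourier_mult sq_summable_bounded_mult sq_summable_fcoeff) auto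

section \<open>The Airy group, the antiderivative and Sobolev norms\<close>

lemma airy_symbol: "exp (- of_real t * (\<i> * of_int l) ^ 3) = cis (t * of_int l ^ 3)"
proof -
  have "(\<i> * of_int l) ^ 3 = - \<i> * complex_of_int l ^ 3" by (simp add: power_mult_distrib power3_eq_cube[of \<i>])
  then show ?thesis by (simp add: cis_conv_exp mult_ac)
qed

lemma fcoeff_airy: "fcoeff (airy t f) l = cis (t * of_int l ^ 3) * fcoeff f l" unfolding airy_def airy_symbol
  by (rule fcoeff_fourier_mult_bounded[where C = 1]) (auto simp: conj_sym_def cis_cnj)

lemma airy_0: "airy 0 f = f" by (rule fcoeff_inject) (simp add: fcoeff_airy)

lemma airy_airy: "airy s (airy t f) = airy (s + t) f"
  by (rule fcoeff_inject) (simp add: fcoeff_airy cis_mult[symmetric] distrib_right mult.assoc)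

lemma norm_airy: "norm (airy t f) = norm f" by (rule norm_eq_of_fcoeff_cmod) (simp add: fcoeff_airy norm_mult)

lemma bounded_linear_airy: "bounded_linear (airy t)" by (rule bounded_linear_intro[where K = 1])
     (auto intro!: fcoeff_inject simp: fcoeff_airy fcoeff_add fcoeff_scaleR norm_airy algebra_simps)

lemmas airy_diff = linear_diff[OF bounded_linear.linear[OF bounded_linear_airy]]
lemmas airy_add = linear_add[OF bounded_linear.linear[OF bounded_linear_airy]]
lemmas airy_zero [simp] = linear_0[OF bounded_linear.linear[OF bounded_linear_airy]]
lemmas airy_scaleR = linear_scale[OF bounded_linear.linear[OF bounded_linear_airy]]

lemma fcoeff_Dx_inv: "fcoeff (Dx_inv f) l = (if l = 0 then 0 else 1 / (\<i> * of_int l)) * fcoeff f l" unfolding Dx_inv_def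
proof (rule fcoeff_fourier_mult_bounded[where C = 1])
  show "conj_sym (\<lambda>l. if l = 0 then 0 else 1 / (\<i> * of_int l))" by (auto simp: conj_sym_def)
  fix l :: int
  show "cmod (if l = 0 then 0 else 1 / (\<i> * of_int l)) \<le> 1" by (auto simp: norm_divide norm_mult divide_simps)
qed

lemma bounded_linear_Dx_inv: "bounded_linear Dx_inv"
proof (rule bounded_linear_intro[where K = 1])
  fix f :: l2_torus
  have "nl2 (fcoeff (Dx_inv f)) \<le> nl2 (fcoeff f)" unfolding wl2_def
  proof (intro esum_mono ennreal_leI mult_left_mono power_mono)
    fix l
    have "cmod (fcoeff (Dx_inv f) l) \<le> 1 * cmod (fcoeff f l)" unfolding fcoeff_Dx_inv norm_mult
      by (intro mult_right_mono) (auto simp: norm_divide norm_mult divide_simps)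
    then show "cmod (fcoeff (Dx_inv f) l) \<le> cmod (fcoeff f l)" by simp
  qed auto
  then show "norm (Dx_inv f) \<le> norm f * 1" by (simp add: nl2_fcoeff ennreal_le_iff power2_le_iff_abs_le)
qed (auto intro!: fcoeff_inject simp: fcoeff_Dx_inv fcoeff_add fcoeff_scaleR algebra_simps)

text \<open>For coefficients that are not square summable the limit that defines \<open>Dx f\<close>
  does not exist, and \<open>lim\<close> has an unspecified value.\<close>

lemma fcoeff_Dx:
  assumes "sq_summable (\<lambda>l. \<i> * of_int l * fcoeff f l)"
  shows "fcoeff (Dx f) l = \<i> * of_int l * fcoeff f l"
  unfolding Dx_def by (rule fcoeff_fourier_mult[OF _ assms]) (simp add: conj_sym_def)

text \<open>The square of the Japanese bracket: the powers of \<open>jb\<close> weight the squared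
  Sobolev norms, and \<open>sqrt (jb k)\<close> stands for one derivative.\<close>

definition jb :: "int \<Rightarrow> real" where "jb k = 1 + (of_int k)\<^sup>2"

abbreviation hl2 :: "(int \<Rightarrow> complex) \<Rightarrow> ennreal" where
  "hl2 \<equiv> wl2 (\<lambda>k. (jb k)\<^sup>2)"

abbreviation mh1 :: "'a measure \<Rightarrow> ('a \<Rightarrow> l2_torus) \<Rightarrow> ennreal" where
  "mh1 N Y \<equiv> \<integral>\<^sup>+\<omega>. wl2 jb (fcoeff (Y \<omega>)) \<partial>N"

lemma jb_ge_1: "1 \<le> jb k" and jb_pos: "0 < jb k" and jb_minus [simp]: "jb (- k) = jb k" by (auto simp: jb_def add_pos_nonneg)

lemma in_H_iff: "in_H s f \<longleftrightarrow> wl2 (\<lambda>k. jb k powr s) (fcoeff f) < \<infinity>"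
  unfolding in_H_def wl2_def jb_def by (subst summable_on_iff_esum_finite) auto

lemma in_H_nat_iff: "in_H (real n) f \<longleftrightarrow> wl2 (\<lambda>k. jb k ^ n) (fcoeff f) < \<infinity>" by (simp add: in_H_iff powr_realpow[OF jb_pos])

lemma H_norm_nat: "in_H (real n) f \<Longrightarrow> ennreal ((H_norm (real n) f)\<^sup>2) = wl2 (\<lambda>k. jb k ^ n) (fcoeff f)"
  unfolding H_norm_def wl2_def in_H_def jb_def[symmetric] powr_realpow[OF jb_pos]
  by (subst esum_eq_infsum) (auto simp: infsum_nonneg less_imp_le[OF jb_pos])

lemma in_H_1_iff: "in_H 1 f \<longleftrightarrow> wl2 jb (fcoeff f) < \<infinity>" and
  in_H_2_iff: "in_H 2 f \<longleftrightarrow> hl2 (fcoeff f) < \<infinity>" and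
  H_norm_1: "in_H 1 f \<Longrightarrow> ennreal ((H_norm 1 f)\<^sup>2) = wl2 jb (fcoeff f)" and
  H_norm_2: "in_H 2 f \<Longrightarrow> ennreal ((H_norm 2 f)\<^sup>2) = hl2 (fcoeff f)"
  using in_H_nat_iff[of 1 f] in_H_nat_iff[of 2 f] H_norm_nat[of 1 f] H_norm_nat[of 2 f] by simp_all

lemma esum_mult_fcoeff_le:
  "esum (\<lambda>l. ennreal (cmod (fcoeff f l * cnj (fcoeff h l)))) \<le> ennreal (norm f * norm h)"
proof (rule ennreal_square_le_cancel)
  have "(esum (\<lambda>l. ennreal (cmod (fcoeff f l * cnj (fcoeff h l)))))\<^sup>2
    = (esum (\<lambda>l. ennreal (cmod (fcoeff f l)) * ennreal (cmod (fcoeff h l))))\<^sup>2" by (simp add: norm_mult ennreal_mult)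
  also have "\<dots> \<le> nl2 (fcoeff f) * nl2 (fcoeff h)" unfolding nl2_alt by (rule esum_Cauchy_Schwarz)
  also have "\<dots> = (ennreal (norm f * norm h))\<^sup>2" by (simp add: nl2_fcoeff ennreal_mult[symmetric] ennreal_power power_mult_distrib)
  finally show "(esum (\<lambda>l. ennreal (cmod (fcoeff f l * cnj (fcoeff h l)))))\<^sup>2 \<le> (ennreal (norm f * norm h))\<^sup>2" .
qed

text \<open>The polarised Parseval identity. The sum converges absolutely by Cauchy-Schwarz, so its
  value may be found along symmetric partial sums, where it is the inner product of \<open>h\<close>
  with the truncation of \<open>f\<close>.\<close>

theorem inner_has_sum:
  "((\<lambda>l. fcoeff f l * cnj (fcoeff h l)) has_sum of_real (inner f h)) UNIV"
proof -
  let ?a = "\<lambda>l. fcoeff f l * cnj (fcoeff h l)"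
  have s: "?a summable_on UNIV"
    by (rule esum_finite_imp_summable_on) (use esum_mult_fcoeff_le[of f h] in \<open>simp add: le_less_trans\<close>)
  then have hs: "(?a has_sum infsum ?a UNIV) UNIV" by (rule has_sum_infsum)
  have "(\<lambda>n. \<Sum>l=-int n..int n. ?a l) \<longlonglongrightarrow> infsum ?a UNIV" by (rule has_sum_imp_symmetric_limit[OF hs])
  moreover have "(\<Sum>l=-int n..int n. ?a l) = of_real (inner h (fourier_partial_sum (fcoeff f) n))" for n
  proof -
    have "cnj (\<Sum>l=-int n..int n. ?a l) = (\<Sum>l=-int n..int n. ?a (- l))" by (simp add: fcoeff_cnj)
    also have "\<dots> = (\<Sum>l=-int n..int n. ?a l)" by (rule sum.reindex_bij_witness[of _ uminus uminus]) auto
    finally show ?thesis unfolding inner_partial_sum by (simp only: of_real_Re Reals_cnj_iff)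
  qed
  moreover have "(\<lambda>n. complex_of_real (inner h (fourier_partial_sum (fcoeff f) n))) \<longlonglongrightarrow> of_real (inner h f)"
    by (intro tendsto_intros fourier_partial_sum_tendsto)
  ultimately have "infsum ?a UNIV = of_real (inner h f)" by (simp add: LIMSEQ_unique)
  with hs show ?thesis by (simp add: inner_commute)
qed

lemma fourier_partial_sum_eq_sum:
  "fourier_partial_sum c n = (\<Sum>l=-int n..int n.
     (Re (c l) / sqrt (2 * pi)) *\<^sub>R l2_cos l - (Im (c l) / sqrt (2 * pi)) *\<^sub>R l2_sin l)"
proof -
  have e: "wave l x = Complex (cos (of_int l * x)) (sin (of_int l * x))" for l x by (simp add: complex_eq_iff Re_exp Im_exp)
  have t: "a *\<^sub>R l2_cos l - b *\<^sub>R l2_sin l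
      = abs_l2_torus (\<lambda>x. a * cos (of_int l * x) - b * sin (of_int l * x))" for a b l unfolding l2_cos_def l2_sin_def
    by (simp add: scaleR_abs_l2 sq_int_cos sq_int_sin diff_abs_l2 sq_int_scale)
  have s: "(\<Sum>l\<in>A. a l *\<^sub>R l2_cos l - b l *\<^sub>R l2_sin l)
      = abs_l2_torus (\<lambda>x. \<Sum>l\<in>A. a l * cos (of_int l * x) - b l * sin (of_int l * x))" if "finite A" for A a b using that
  proof (induction A)
    case empty
    then show ?case by (simp add: zero_l2_torus_def)
  next
    case (insert l A)
    have q: "sq_int (\<lambda>x. \<Sum>l\<in>A. a l * cos (of_int l * x) - b l * sin (of_int l * x))"
      "sq_int (\<lambda>x. a l * cos (of_int l * x) - b l * sin (of_int l * x))" by (auto intro!: sq_int_continuous continuous_intros)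
    show ?case using insert q by (simp add: t add_abs_l2)
  qed
  show ?thesis unfolding s[OF finite_atLeastAtMost_int] fourier_partial_sum_abs e
    by (simp add: sum_divide_distrib sum_subtractf diff_divide_distrib)
qed

lemma sum_le_esum:
  assumes "finite A"
  shows "(\<Sum>k\<in>A. f k) \<le> esum f"
proof -
  have "(\<Sum>k\<in>A. f k) = nn_integral (count_space A) f" using assms by (rule nn_integral_count_space_finite[symmetric])
  also have "\<dots> = esum (\<lambda>k. f k * indicator A k)"
    by (cases "A = UNIV") (auto simp: nn_integral_restrict_space[symmetric] restrict_count_space)
  also have "\<dots> \<le> esum f" by (intro esum_mono) (auto split: split_indicator)
  finally show ?thesis .
qed

section \<open>Products and convolutions of coefficients\<close>

lemma sq_int_partial_bound:
  assumes "nl1 (fcoeff f) \<le> ennreal C" "0 \<le> C"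
  shows "\<bar>Re ((\<Sum>l=-int n..int n. fcoeff f l * wave l x) / of_real (sqrt (2 * pi)))\<bar> \<le> C / sqrt (2 * pi)"
proof -
  have "ennreal (\<Sum>l=-int n..int n. cmod (fcoeff f l)) \<le> nl1 (fcoeff f)"
    unfolding nl1_def using sum_le_esum[of "{-int n..int n}" "\<lambda>l. ennreal (cmod (fcoeff f l))"] by (simp add: sum_ennreal)
  also note assms(1)
  finally have C: "(\<Sum>l=-int n..int n. cmod (fcoeff f l)) \<le> C" using assms(2) by (simp add: ennreal_le_iff)
  have "\<bar>Re ((\<Sum>l=-int n..int n. fcoeff f l * wave l x) / of_real (sqrt (2 * pi)))\<bar>
    \<le> cmod ((\<Sum>l=-int n..int n. fcoeff f l * wave l x) / of_real (sqrt (2 * pi)))" by (rule abs_Re_le_cmod)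
  also have "\<dots> = cmod (\<Sum>l=-int n..int n. fcoeff f l * wave l x) / sqrt (2 * pi)" by (simp add: norm_divide)
  also have "\<dots> \<le> (\<Sum>l=-int n..int n. cmod (fcoeff f l * wave l x)) / sqrt (2 * pi)" by (intro divide_right_mono norm_sum) auto
  also have "\<dots> = (\<Sum>l=-int n..int n. cmod (fcoeff f l)) / sqrt (2 * pi)" by (simp add: norm_mult norm_exp_eq_Re)
  also have "\<dots> \<le> C / sqrt (2 * pi)" by (intro divide_right_mono C) auto
  finally show ?thesis .
qed

text \<open>The partial sums stay below the bound, hence the positive part of the excess of
  \<open>g\<close> is dominated by the distance of \<open>g\<close> to its partial sums, which tends
  to 0 in norm. The lower bound follows from the same statement for \<open>- g\<close>.\<close>

lemma AE_le_of_nl1: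
  assumes "nl1 (fcoeff (abs_l2_torus g)) \<le> ennreal C" "0 \<le> C" "sq_int g"
  shows "AE x in torus. g x \<le> C / sqrt (2 * pi)"
proof -
  let ?f = "abs_l2_torus g"
  let ?D = "C / sqrt (2 * pi)"
  define s where "s n x = Re ((\<Sum>l=-int n..int n. fcoeff ?f l * wave l x) / of_real (sqrt (2 * pi)))" for n x
  have s: "sq_int (s n)" "abs_l2_torus (s n) = fourier_partial_sum (fcoeff ?f) n" for n
    unfolding s_def by (rule partial_sum_sq_int) (rule fourier_partial_sum_abs[symmetric])
  have sb: "\<bar>s n x\<bar> \<le> ?D" for n x unfolding s_def by (rule sq_int_partial_bound[OF assms(1,2)])
  have [measurable]: "g \<in> borel_measurable torus" using assms(3) by (simp add: sq_int_def)
  have le: "(\<integral>\<^sup>+x. ennreal ((max 0 (g x - ?D))\<^sup>2) \<partial>torus) \<le> ennreal ((norm (?f - fourier_partial_sum (fcoeff ?f) n))\<^sup>2)" for n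
  proof -
    have "(\<integral>\<^sup>+x. ennreal ((max 0 (g x - ?D))\<^sup>2) \<partial>torus) \<le> (\<integral>\<^sup>+x. ennreal ((g x - s n x)\<^sup>2) \<partial>torus)"
    proof (intro nn_integral_mono ennreal_leI)
      fix x
      show "(max 0 (g x - ?D))\<^sup>2 \<le> (g x - s n x)\<^sup>2" using sb[of n x] by (cases "g x \<le> ?D") (auto simp: max_def intro!: power_mono)
    qed
    also have "\<dots> = ennreal ((norm (?f - fourier_partial_sum (fcoeff ?f) n))\<^sup>2)"
      unfolding s(2)[symmetric] diff_abs_l2[OF assms(3) s(1)] by (intro nn_integral_sq_abs_l2 sq_int_diff assms s)
    finally show ?thesis .
  qed
  have "(\<lambda>n. ennreal ((norm (?f - fourier_partial_sum (fcoeff ?f) n))\<^sup>2)) \<longlonglongrightarrow> ennreal ((norm (?f - ?f))\<^sup>2)"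
    by (intro tendsto_ennrealI tendsto_intros fourier_partial_sum_tendsto)
  then have "(\<integral>\<^sup>+x. ennreal ((max 0 (g x - ?D))\<^sup>2) \<partial>torus) \<le> ennreal ((norm (?f - ?f))\<^sup>2)"
    by (rule LIMSEQ_le_const) (use le in auto)
  then have "(\<integral>\<^sup>+x. ennreal ((max 0 (g x - ?D))\<^sup>2) \<partial>torus) = 0" by simp
  then have "AE x in torus. ennreal ((max 0 (g x - ?D))\<^sup>2) = 0" by (subst (asm) nn_integral_0_iff_AE) auto
  then show ?thesis by eventually_elim (auto simp: max_def split: if_splits)
qed

text \<open>Absolutely summable coefficients make \<open>f\<close> bounded. This is the condition
  under which \<open>\<odot>\<close> is the true product and not its default value 0.\<close>

lemma sq_int_mult_of_nl1:
  assumes "nl1 (fcoeff (abs_l2_torus f)) < \<infinity>" "sq_int f" "sq_int g"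
  shows "sq_int (\<lambda>x. f x * g x)"
proof -
  obtain C where C: "nl1 (fcoeff (abs_l2_torus f)) = ennreal C" "0 \<le> C"
    using assms(1) by (cases "nl1 (fcoeff (abs_l2_torus f))") auto
  have m: "abs_l2_torus (\<lambda>x. - f x) = - abs_l2_torus f" using scaleR_abs_l2[OF assms(2), of "-1"] by simp
  have mf: "sq_int (\<lambda>x. - f x)" using sq_int_scale[OF assms(2), of "-1"] by simp
  have "nl1 (fcoeff (abs_l2_torus (\<lambda>x. - f x))) \<le> ennreal C" unfolding m using C by (simp add: nl1_def fcoeff_minus)
  from AE_le_of_nl1[OF this C(2) mf] AE_le_of_nl1[OF eq_refl[OF C(1)] C(2) assms(2)]
  have b: "AE x in torus. \<bar>f x\<bar> \<le> C / sqrt (2 * pi)" by eventually_elim auto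
  have [measurable]: "f \<in> borel_measurable torus" "g \<in> borel_measurable torus" using assms by (auto simp: sq_int_def)
  show ?thesis unfolding sq_int_def
  proof
    show "integrable torus (\<lambda>x. (f x * g x)\<^sup>2)"
    proof (rule Bochner_Integration.integrable_bound[where f = "\<lambda>x. (C / sqrt (2 * pi))\<^sup>2 * (g x)\<^sup>2"])
      show "AE x in torus. norm ((f x * g x)\<^sup>2) \<le> norm ((C / sqrt (2 * pi))\<^sup>2 * (g x)\<^sup>2)" using b
      proof eventually_elim
        case (elim x)
        then have "(f x)\<^sup>2 \<le> (C / sqrt (2 * pi))\<^sup>2" by (metis abs_ge_zero order_trans power2_abs power_mono)
        then show ?case by (simp add: power_mult_distrib mult_right_mono del: power_divide)
      qed
    qed (use assms in \<open>auto simp: sq_int_def\<close>)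
  qed measurable
qed

definition sconv :: "(int \<Rightarrow> complex) \<Rightarrow> (int \<Rightarrow> complex) \<Rightarrow> int \<Rightarrow> complex" where
  "sconv c d k = (\<Sum>\<^sub>\<infinity>j. c j * d (k - j))"

lemma fcoeff_abs_mult_cos_sin:
  assumes g: "sq_int g"
  shows "sq_int (\<lambda>x. g x * cos (of_int k * x))" "sq_int (\<lambda>x. g x * sin (of_int k * x))"
    "fcoeff (abs_l2_torus (\<lambda>x. g x * cos (of_int k * x))) l
      = (fcoeff (abs_l2_torus g) (l - k) + fcoeff (abs_l2_torus g) (l + k)) / 2"
    "fcoeff (abs_l2_torus (\<lambda>x. g x * sin (of_int k * x))) l
      = (fcoeff (abs_l2_torus g) (l - k) - fcoeff (abs_l2_torus g) (l + k)) / (2 * \<i>)"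
proof -
  show c: "sq_int (\<lambda>x. g x * cos (of_int k * x))" and s: "sq_int (\<lambda>x. g x * sin (of_int k * x))"
    by (rule sq_int_mult_bounded[OF g, where C = 1]; use sq_int_cos[of k] sq_int_sin[of k] in \<open>simp add: sq_int_def\<close>)+
  have i: "integrable torus (\<lambda>x. of_real (g x) * exp (- (\<i> * of_int l * of_real x)))" for l
    using integrable_of_real_mult_exp[OF g, of "-l"] by simp
  have e: "exp (- (\<i> * of_int (l-k) * complex_of_real x)) = exp (- (\<i> * of_int l * of_real x)) * exp (\<i> * of_int k * of_real x)"
    "exp (- (\<i> * of_int (l+k) * complex_of_real x)) = exp (- (\<i> * of_int l * of_real x)) * exp (- (\<i> * of_int k * of_real x))" for x
    by (simp_all add: exp_add[symmetric] algebra_simps)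
  have ce: "complex_of_real (cos (of_int k * x)) = (exp (\<i> * of_int k * of_real x) + exp (- (\<i> * of_int k * of_real x))) / 2"
    and se: "complex_of_real (sin (of_int k * x)) = (exp (\<i> * of_int k * of_real x) - exp (- (\<i> * of_int k * of_real x))) / (2 * \<i>)" for x
    using cos_exp_eq[of "of_int k * of_real x"] sin_exp_eq[of "of_int k * of_real x"]
    by (simp_all add: cos_of_real[symmetric] sin_of_real[symmetric] mult_ac)
  have "(\<lambda>x. of_real (g x * cos (of_int k * x)) * exp (- (\<i> * of_int l * of_real x))) = (\<lambda>x.
      (of_real (g x) * exp (- (\<i> * of_int (l-k) * of_real x)) + of_real (g x) * exp (- (\<i> * of_int (l+k) * of_real x))) / 2)"
    unfolding of_real_mult ce e by (intro ext) (simp add: field_simps)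
  then show "fcoeff (abs_l2_torus (\<lambda>x. g x * cos (of_int k * x))) l
      = (fcoeff (abs_l2_torus g) (l - k) + fcoeff (abs_l2_torus g) (l + k)) / 2"
    using i[of "l - k"] i[of "l + k"] by (simp add: fcoeff_abs_l2 c g add_divide_distrib mult.commute[of "of_real (sqrt (2 * pi))"] del: of_int_add of_int_diff)
  have "(\<lambda>x. of_real (g x * sin (of_int k * x)) * exp (- (\<i> * of_int l * of_real x))) = (\<lambda>x.
      (of_real (g x) * exp (- (\<i> * of_int (l-k) * of_real x)) - of_real (g x) * exp (- (\<i> * of_int (l+k) * of_real x))) / (2 * \<i>))"
    unfolding of_real_mult se e by (intro ext) (simp add: field_simps)
  then show "fcoeff (abs_l2_torus (\<lambda>x. g x * sin (of_int k * x))) l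
      = (fcoeff (abs_l2_torus g) (l - k) - fcoeff (abs_l2_torus g) (l + k)) / (2 * \<i>)"
    using i[of "l - k"] i[of "l + k"] by (simp add: fcoeff_abs_l2 s g diff_divide_distrib right_diff_distrib mult.commute[of "of_real (sqrt (2 * pi))"] del: of_int_add of_int_diff)
qed

text \<open>The coefficient of the product at \<open>k\<close> pairs \<open>f\<close> with
  \<open>g\<close> times the cosine and the sine of frequency \<open>k\<close>. By the polarised
  Parseval identity the two pairings combine to an exponential, which shifts the coefficients of
  \<open>g\<close> by \<open>k\<close>.\<close>

theorem fcoeff_mult:
  assumes "nl1 (fcoeff f) < \<infinity>"
  shows "fcoeff (f \<odot> g) k = sconv (fcoeff f) (fcoeff g) k / of_real (sqrt (2 * pi))"
proof -
  obtain F where F: "sq_int F" "f = abs_l2_torus F" by (rule l2_torus_cases)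
  obtain G where G: "sq_int G" "g = abs_l2_torus G" by (rule l2_torus_cases)
  have FG: "sq_int (\<lambda>x. F x * G x)" using sq_int_mult_of_nl1 assms F G by auto
  have p: "f \<odot> g = abs_l2_torus (\<lambda>x. F x * G x)"
    unfolding F(2) G(2) using FG F G by (subst l2_mult.abs_eq) (auto simp: l2_rel_def)
  let ?c = "abs_l2_torus (\<lambda>x. G x * cos (of_int k * x))"
  let ?s = "abs_l2_torus (\<lambda>x. G x * sin (of_int k * x))"
  note cs = fcoeff_abs_mult_cos_sin[OF G(1), of k]
  have ic: "inner (f \<odot> g) (l2_cos k) = inner f ?c"
    unfolding p l2_cos_def unfolding F(2) by (simp add: inner_abs_l2 FG F sq_int_cos cs mult.assoc)
  have is': "inner (f \<odot> g) (l2_sin k) = inner f ?s"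
    unfolding p l2_sin_def unfolding F(2) by (simp add: inner_abs_l2 FG F sq_int_sin cs mult.assoc)
  have "((\<lambda>l. fcoeff f l * cnj (fcoeff ?c l) + (- \<i>) * (fcoeff f l * cnj (fcoeff ?s l)))
     has_sum (of_real (inner f ?c) + (- \<i>) * of_real (inner f ?s))) UNIV" by (intro has_sum_add has_sum_cmult_right inner_has_sum)
  moreover have "fcoeff f l * cnj (fcoeff ?c l) + (- \<i>) * (fcoeff f l * cnj (fcoeff ?s l)) = fcoeff f l * fcoeff g (k - l)" for l
    unfolding cs(3,4) G(2)[symmetric] using fcoeff_cnj[of g "l - k"] by (simp add: field_simps)
  ultimately have "sconv (fcoeff f) (fcoeff g) k = of_real (inner f ?c) - \<i> * of_real (inner f ?s)"
    unfolding sconv_def by (intro infsumI) simp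
  then show ?thesis unfolding fcoeff_eq_inner ic is' by simp
qed

lemma norm_sconv_le_econv:
  "ennreal (cmod (sconv c d k)) \<le> econv (\<lambda>j. ennreal (cmod (c j))) (\<lambda>j. ennreal (cmod (d j))) k"
  unfolding sconv_def econv_def using norm_infsum_le_esum[of "\<lambda>j. c j * d (k - j)"] by (simp add: norm_mult ennreal_mult)

lemma econv_fcoeff_le:
  "econv (\<lambda>j. ennreal (cmod (fcoeff f j))) (\<lambda>j. ennreal (cmod (fcoeff g j))) k \<le> ennreal (norm f * norm g)"
proof (rule ennreal_square_le_cancel)
  have "(econv (\<lambda>j. ennreal (cmod (fcoeff f j))) (\<lambda>j. ennreal (cmod (fcoeff g j))) k)\<^sup>2
      \<le> nl2 (fcoeff f) * nl2 (fcoeff g)" unfolding nl2_alt by (rule econv_Cauchy_Schwarz)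
  also have "\<dots> = (ennreal (norm f * norm g))\<^sup>2" by (simp add: nl2_fcoeff ennreal_mult[symmetric] ennreal_power power_mult_distrib)
  finally show "(econv (\<lambda>j. ennreal (cmod (fcoeff f j))) (\<lambda>j. ennreal (cmod (fcoeff g j))) k)\<^sup>2
     \<le> (ennreal (norm f * norm g))\<^sup>2" .
qed

lemma sconv_fcoeff_abs_summable:
  "(\<lambda>j. norm (fcoeff f j * fcoeff g (k - j))) summable_on UNIV"
proof (rule esum_finite_imp_abs_summable)
  have "esum (\<lambda>j. ennreal (norm (fcoeff f j * fcoeff g (k - j)))) \<le> ennreal (norm f * norm g)"
    using econv_fcoeff_le[of f g k] by (simp add: econv_def norm_mult ennreal_mult)
  then show "esum (\<lambda>j. ennreal (norm (fcoeff f j * fcoeff g (k - j)))) < \<infinity>" by (simp add: le_less_trans)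
qed

lemma sconv_fcoeff_summable: "(\<lambda>j. fcoeff f j * fcoeff g (k - j)) summable_on UNIV"
  by (rule abs_summable_summable[OF sconv_fcoeff_abs_summable])

text \<open>At a fixed frequency the convolution is continuous on all of \<open>L\<^sup>2\<close>,
  even for pairs whose product is not square integrable. Continuity and measurability of the
  nonlinear terms are therefore treated one coefficient at a time.\<close>

lemma bounded_bilinear_sconv: "bounded_bilinear (\<lambda>f g. sconv (fcoeff f) (fcoeff g) k)"
proof
  fix f f' g g' :: l2_torus and r :: real
  show "sconv (fcoeff (f + f')) (fcoeff g) k = sconv (fcoeff f) (fcoeff g) k + sconv (fcoeff f') (fcoeff g) k"
    unfolding sconv_def fcoeff_add distrib_right by (intro infsum_add sconv_fcoeff_summable)
  show "sconv (fcoeff f) (fcoeff (g + g')) k = sconv (fcoeff f) (fcoeff g) k + sconv (fcoeff f) (fcoeff g') k"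
    unfolding sconv_def fcoeff_add distrib_left by (intro infsum_add sconv_fcoeff_summable)
  show "sconv (fcoeff (r *\<^sub>R f)) (fcoeff g) k = r *\<^sub>R sconv (fcoeff f) (fcoeff g) k"
    unfolding sconv_def fcoeff_scaleR mult.assoc scaleR_conv_of_real by (rule infsum_cmult_right) (rule sconv_fcoeff_summable)
  show "sconv (fcoeff f) (fcoeff (r *\<^sub>R g)) k = r *\<^sub>R sconv (fcoeff f) (fcoeff g) k"
    unfolding sconv_def fcoeff_scaleR scaleR_conv_of_real mult.left_commute[of _ "of_real r"]
    by (rule infsum_cmult_right) (rule sconv_fcoeff_summable)
next
  have "norm (sconv (fcoeff f) (fcoeff g) k) \<le> norm f * norm g * 1" for f g
    using order_trans[OF norm_sconv_le_econv econv_fcoeff_le[of f g k]] by (simp add: ennreal_le_iff)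
  then show "\<exists>K. \<forall>f g. norm (sconv (fcoeff f) (fcoeff g) k) \<le> norm f * norm g * K" by blast
qed

lemma nl2_sconv_le_nl1:
  "nl2 (sconv c d) \<le> (nl1 c)\<^sup>2 * nl2 d" "nl2 (sconv c d) \<le> nl2 c * (nl1 d)\<^sup>2"
proof -
  let ?c = "\<lambda>j. ennreal (cmod (c j))" and ?d = "\<lambda>j. ennreal (cmod (d j))"
  have *: "nl2 (sconv c d) \<le> esum (\<lambda>k. (econv ?c ?d k)\<^sup>2)"
    unfolding nl2_alt by (intro esum_mono power_mono norm_sconv_le_econv) auto
  also have "\<dots> \<le> (esum ?c)\<^sup>2 * esum (\<lambda>k. (?d k)\<^sup>2)" by (rule young_l1_l2) auto
  finally show "nl2 (sconv c d) \<le> (nl1 c)\<^sup>2 * nl2 d" by (simp add: nl1_def nl2_alt)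
  note *
  also have "esum (\<lambda>k. (econv ?c ?d k)\<^sup>2) = esum (\<lambda>k. (econv ?d ?c k)\<^sup>2)" by (simp only: econv_commute[of ?c ?d])
  also have "\<dots> \<le> (esum ?d)\<^sup>2 * esum (\<lambda>k. (?c k)\<^sup>2)" by (rule young_l1_l2) auto
  finally show "nl2 (sconv c d) \<le> nl2 c * (nl1 d)\<^sup>2" by (simp add: nl1_def nl2_alt mult.commute)
qed

lemma bounded_linear_l2_mult:
  assumes "nl1 (fcoeff f) < \<infinity>"
  shows "bounded_linear (\<lambda>g. f \<odot> g)"
proof -
  obtain C where C: "nl1 (fcoeff f) = ennreal C" "0 \<le> C" using assms by (cases "nl1 (fcoeff f)") auto
  show ?thesis
  proof (rule bounded_linear_intro[where K = C])
    fix g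
    have "nl2 (fcoeff (f \<odot> g)) \<le> nl2 (sconv (fcoeff f) (fcoeff g))" unfolding wl2_def fcoeff_mult[OF assms]
    proof (intro esum_mono ennreal_leI mult_left_mono power_mono)
      have "1 \<le> sqrt (2 * pi)" using pi_ge_two by simp
      then show "cmod (sconv (fcoeff f) (fcoeff g) k / of_real (sqrt (2 * pi))) \<le> cmod (sconv (fcoeff f) (fcoeff g) k)" for k
        using mult_left_mono[of 1 "sqrt (2*pi)" "cmod (sconv (fcoeff f) (fcoeff g) k)"] by (simp add: norm_divide divide_le_eq)
    qed auto
    also have "\<dots> \<le> (nl1 (fcoeff f))\<^sup>2 * nl2 (fcoeff g)" by (rule nl2_sconv_le_nl1)
    also have "\<dots> = ennreal ((norm g * C)\<^sup>2)"
      using C by (simp add: nl2_fcoeff ennreal_mult[symmetric] ennreal_power power_mult_distrib mult.commute)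
    finally have "ennreal ((norm (f \<odot> g))\<^sup>2) \<le> ennreal ((norm g * C)\<^sup>2)" by (simp only: nl2_fcoeff)
    then have "(norm (f \<odot> g))\<^sup>2 \<le> (norm g * C)\<^sup>2" by (subst (asm) ennreal_le_iff) auto
    then show "norm (f \<odot> g) \<le> norm g * C" by (rule power2_le_imp_le) (use C in simp)
  next
    note b = bounded_bilinear_sconv
    fix g g' show "f \<odot> (g + g') = f \<odot> g + f \<odot> g'" by (rule fcoeff_inject)
         (simp add: fcoeff_mult[OF assms] bounded_bilinear.add_right[OF b] fcoeff_add add_divide_distrib)
  next
    note b = bounded_bilinear_sconv
    fix g and r :: real show "f \<odot> (r *\<^sub>R g) = r *\<^sub>R (f \<odot> g)" by (rule fcoeff_inject)
         (simp add: fcoeff_mult[OF assms] bounded_bilinear.scaleR_right[OF b] fcoeff_scaleR scaleR_conv_of_real)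
  qed
qed

section \<open>Continuity in time, measurability and Bessel potentials\<close>

lemma airy_partial_sum:
  "airy t (fourier_partial_sum (fcoeff u) n) = fourier_partial_sum (\<lambda>l. cis (t * of_int l ^ 3) * fcoeff u l) n"
  by (rule fcoeff_inject)
     (simp add: fcoeff_airy fcoeff_partial_sum conj_sym_fcoeff conj_sym_def cis_cnj fcoeff_cnj)

text \<open>Strong continuity of the group: for trigonometric polynomials the continuity is
  explicit, and since \<open>airy t\<close> is an isometry the partial sums converge uniformly in
  \<open>t\<close>.\<close>

lemma continuous_on_airy_time: "continuous_on A (\<lambda>t. airy t u)"
proof (rule uniform_limit_theorem)
  show "\<forall>\<^sub>F n in sequentially. continuous_on A (\<lambda>t. airy t (fourier_partial_sum (fcoeff u) n))"
    unfolding airy_partial_sum unfolding fourier_partial_sum_eq_sum by (intro always_eventually allI continuous_intros) auto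
  show "uniform_limit A (\<lambda>n t. airy t (fourier_partial_sum (fcoeff u) n)) (\<lambda>t. airy t u) sequentially"
  proof (rule uniform_limitI)
    fix e :: real assume "0 < e"
    have "\<forall>\<^sub>F n in sequentially. dist (fourier_partial_sum (fcoeff u) n) u < e"
      using fourier_partial_sum_tendsto \<open>0 < e\<close> by (rule tendstoD)
    then show "\<forall>\<^sub>F n in sequentially. \<forall>t\<in>A. dist (airy t (fourier_partial_sum (fcoeff u) n)) (airy t u) < e"
      by eventually_elim (simp add: dist_norm airy_diff[symmetric] norm_airy)
  qed
qed simp

lemma tendsto_airy:
  assumes "(g \<longlongrightarrow> a) F" "(u \<longlongrightarrow> v) F"
  shows "((\<lambda>s. airy (g s) (u s)) \<longlongrightarrow> airy a v) F"
proof (rule LIM_zero_cancel, rule tendsto_0_le[where K = 1])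
  have "isCont (\<lambda>t. airy t v) a" using continuous_on_airy_time[of UNIV v] by (simp add: continuous_on_eq_continuous_at)
  then have "((\<lambda>s. airy (g s) v) \<longlongrightarrow> airy a v) F" by (rule isCont_tendsto_compose[OF _ assms(1)])
  then have "((\<lambda>s. norm (u s - v) + norm (airy (g s) v - airy a v)) \<longlongrightarrow> norm (v - v) + norm (airy a v - airy a v)) F"
    by (intro tendsto_intros assms)
  then show "((\<lambda>s. norm (u s - v) + norm (airy (g s) v - airy a v)) \<longlongrightarrow> 0) F" by simp
  have "norm (airy (g s) (u s) - airy a v) \<le> norm (u s - v) + norm (airy (g s) v - airy a v)" for s
  proof -
    have "airy (g s) (u s) - airy a v = airy (g s) (u s - v) + (airy (g s) v - airy a v)" by (simp add: airy_diff)
    then show ?thesis using norm_triangle_ineq[of "airy (g s) (u s - v)"] norm_airy by metis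
  qed
  then show "\<forall>\<^sub>F s in F. norm (airy (g s) (u s) - airy a v) \<le> norm (norm (u s - v) + norm (airy (g s) v - airy a v)) * 1"
    by (intro always_eventually) (auto intro: order_trans)
qed

lemma continuous_on_airy:
  "continuous_on A g \<Longrightarrow> continuous_on A u \<Longrightarrow> continuous_on A (\<lambda>s. airy (g s) (u s))"
  unfolding continuous_on_def by (auto intro: tendsto_airy)

lemma continuous_on_fcoeff: "continuous_on A u \<Longrightarrow> continuous_on A (\<lambda>s. fcoeff (u s) k)"
  by (rule bounded_linear.continuous_on[OF bounded_linear_fcoeff])

lemma measurable_fcoeff: "Y \<in> borel_measurable M \<Longrightarrow> (\<lambda>\<omega>. fcoeff (Y \<omega>) k) \<in> borel_measurable M"
  using measurable_compose[OF _ borel_measurable_continuous_onI[OF continuous_on_fcoeff[OF continuous_on_id]]] .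

text \<open>A random element of \<open>l2_torus\<close> is the pointwise limit of its partial sums,
  and these depend continuously on finitely many coefficients. Sums and limits of random elements
  can thus be checked on complex coordinates.\<close>

lemma measurable_l2_from_fcoeff:
  assumes "\<And>k. (\<lambda>\<omega>. fcoeff (Y \<omega>) k) \<in> borel_measurable M"
  shows "Y \<in> borel_measurable M"
proof (rule borel_measurable_LIMSEQ_metric[where f = "\<lambda>n \<omega>. fourier_partial_sum (fcoeff (Y \<omega>)) n"])
  fix n
  have c: "continuous_on UNIV (\<lambda>c :: int \<Rightarrow> complex. fourier_partial_sum c n)" unfolding fourier_partial_sum_eq_sum
    by (intro continuous_intros continuous_on_product_coordinates) auto
  have m: "(\<lambda>\<omega>. fcoeff (Y \<omega>)) \<in> borel_measurable M" by (rule measurable_coordinatewise_then_product) (rule assms)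
  show "(\<lambda>\<omega>. fourier_partial_sum (fcoeff (Y \<omega>)) n) \<in> borel_measurable M"
    using measurable_compose[OF m borel_measurable_continuous_onI[OF c]] .
qed (rule fourier_partial_sum_tendsto)

text \<open>The Bessel potential of order \<open>s\<close>, an isometry from
  \<open>H\<^sup>s\<close> to \<open>L\<^sup>2\<close>. It turns \<open>continuous_on_H\<close> into
  ordinary continuity in norm, so that compactness and integration become available.\<close>

definition Lam :: "real \<Rightarrow> l2_torus \<Rightarrow> l2_torus" where
  "Lam s = fourier_mult (\<lambda>k. of_real (jb k powr (s / 2)))"

lemma sq_summable_Lam: "in_H s f \<Longrightarrow> sq_summable (\<lambda>k. of_real (jb k powr (s / 2)) * fcoeff f k)"
proof -
  have "(jb k powr (s / 2))\<^sup>2 = jb k powr s" for k using powr_add[of "jb k" "s/2" "s/2"] by (simp add: power2_eq_square)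
  then show "in_H s f \<Longrightarrow> sq_summable (\<lambda>k. of_real (jb k powr (s / 2)) * fcoeff f k)"
    by (simp add: in_H_def sq_summable_def norm_mult power_mult_distrib jb_def)
qed

lemma fcoeff_Lam:
  assumes "in_H s f"
  shows "fcoeff (Lam s f) k = of_real (jb k powr (s / 2)) * fcoeff f k"
  unfolding Lam_def by (rule fcoeff_fourier_mult[OF _ sq_summable_Lam[OF assms]]) (simp add: conj_sym_def)

lemma norm_Lam:
  assumes "in_H s f"
  shows "norm (Lam s f) = H_norm s f"
proof -
  have "(jb k powr (s / 2))\<^sup>2 = jb k powr s" for k using powr_add[of "jb k" "s/2" "s/2"] by (simp add: power2_eq_square)
  then have "((\<lambda>k. (1 + (of_int k)\<^sup>2) powr s * (cmod (fcoeff f k))\<^sup>2) has_sum (norm (Lam s f))\<^sup>2) UNIV"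
    using parseval[of "Lam s f"] by (simp add: fcoeff_Lam[OF assms] norm_mult power_mult_distrib jb_def)
  then show ?thesis unfolding H_norm_def by (simp add: infsumI)
qed

lemma in_H_diff:
  assumes "in_H s f" "in_H s g"
  shows "in_H s (f - g)" unfolding in_H_def
proof (rule summable_on_comparison_test)
  show "(\<lambda>l. 2 * ((1 + (of_int l)\<^sup>2) powr s * (cmod (fcoeff f l))\<^sup>2) + 2 * ((1 + (of_int l)\<^sup>2) powr s * (cmod (fcoeff g l))\<^sup>2))
      summable_on UNIV" using assms unfolding in_H_def by (intro summable_on_add summable_on_cmult_right)
  fix l :: int
  have "(cmod (fcoeff f l - fcoeff g l))\<^sup>2 \<le> (cmod (fcoeff f l) + cmod (fcoeff g l))\<^sup>2"
    by (intro power_mono norm_triangle_ineq4) auto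
  also have "\<dots> \<le> 2 * (cmod (fcoeff f l))\<^sup>2 + 2 * (cmod (fcoeff g l))\<^sup>2"
    using sum_squares_bound[of "cmod (fcoeff f l)" "cmod (fcoeff g l)"] by (simp add: power2_sum)
  finally have "(1 + (of_int l)\<^sup>2) powr s * (cmod (fcoeff f l - fcoeff g l))\<^sup>2 \<le>
      (1 + (of_int l)\<^sup>2) powr s * (2 * (cmod (fcoeff f l))\<^sup>2 + 2 * (cmod (fcoeff g l))\<^sup>2)" by (intro mult_left_mono) auto
  then show "(1 + (of_int l)\<^sup>2) powr s * (cmod (fcoeff (f - g) l))\<^sup>2
     \<le> 2 * ((1 + (of_int l)\<^sup>2) powr s * (cmod (fcoeff f l))\<^sup>2) + 2 * ((1 + (of_int l)\<^sup>2) powr s * (cmod (fcoeff g l))\<^sup>2)"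
    by (simp add: fcoeff_diff algebra_simps)
qed auto

lemma Lam_diff: "in_H s f \<Longrightarrow> in_H s g \<Longrightarrow> Lam s (f - g) = Lam s f - Lam s g"
  by (rule fcoeff_inject) (simp add: fcoeff_Lam in_H_diff fcoeff_diff algebra_simps)

lemma continuous_on_H_Lam:
  assumes "continuous_on_H s A u"
  shows "continuous_on A (\<lambda>t. Lam s (u t))" unfolding continuous_on_def
proof
  fix t assume t: "t \<in> A"
  have "((\<lambda>r. norm (Lam s (u r) - Lam s (u t))) \<longlongrightarrow> 0) (at t within A)"
  proof (rule Lim_transform_eventually)
    show "((\<lambda>r. H_norm s (u r - u t)) \<longlongrightarrow> 0) (at t within A)" using assms t by (simp add: continuous_on_H_def)
    show "\<forall>\<^sub>F r in at t within A. H_norm s (u r - u t) = norm (Lam s (u r) - Lam s (u t))" unfolding eventually_at_filter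
      by (rule always_eventually)
         (use assms t in \<open>auto simp: continuous_on_H_def Lam_diff[symmetric] norm_Lam in_H_diff\<close>)
  qed
  then show "((\<lambda>r. Lam s (u r)) \<longlongrightarrow> Lam s (u t)) (at t within A)" by (simp add: tendsto_norm_zero_iff LIM_zero_iff)
qed

section \<open>The bilinear term in the moving frame\<close>

abbreviation r2p :: complex where "r2p \<equiv> of_real (sqrt (2 * pi))"

text \<open>
  \<open>NN s g v\<close> are the Fourier coefficients of \<open>S(-s) \<partial>\<^sub>x (S(s) g S(s) v)\<close>, and \<open>BB a c g v\<close> those of its integral over
  \<open>[a, c]\<close>. The phases combine through \<open>k\<^sup>3 - j\<^sup>3 - (k - j)\<^sup>3 = 3 k j (k - j)\<close>.
\<close>

definition NN :: "real \<Rightarrow> l2_torus \<Rightarrow> l2_torus \<Rightarrow> int \<Rightarrow> complex" where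
  "NN s g v k = cis (- (s * of_int k ^ 3)) * (\<i> * of_int k / r2p) * sconv (fcoeff (airy s g)) (fcoeff (airy s v)) k"

definition JJ :: "real \<Rightarrow> real \<Rightarrow> int \<Rightarrow> complex" where
  "JJ a c m = integral {a..c} (\<lambda>s. cis (- (3 * s * of_int m)))"

definition BB :: "real \<Rightarrow> real \<Rightarrow> l2_torus \<Rightarrow> l2_torus \<Rightarrow> int \<Rightarrow> complex" where
  "BB a c g v k = (\<i> * of_int k / r2p) * (\<Sum>\<^sub>\<infinity>j. JJ a c (k * j * (k - j)) * (fcoeff g j * fcoeff v (k - j)))"

lemma NN_eq:
  "NN s g v k = (\<i> * of_int k / r2p) *
     (\<Sum>\<^sub>\<infinity>j. cis (- (3 * s * of_int (k * j * (k - j)))) * (fcoeff g j * fcoeff v (k - j)))"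
proof -
  have "cis (- (s * of_int k ^ 3)) * sconv (fcoeff (airy s g)) (fcoeff (airy s v)) k
    = (\<Sum>\<^sub>\<infinity>j. cis (- (s * of_int k ^ 3)) * (fcoeff (airy s g) j * fcoeff (airy s v) (k - j)))"
    unfolding sconv_def by (rule infsum_cmult_right[symmetric]) (rule sconv_fcoeff_summable)
  also have "\<dots> = (\<Sum>\<^sub>\<infinity>j. cis (- (3 * s * of_int (k * j * (k - j)))) * (fcoeff g j * fcoeff v (k - j)))"
  proof (rule infsum_cong)
    fix j
    have "- (s * of_int k ^ 3) + s * of_int j ^ 3 + s * of_int (k - j) ^ 3 = - (3 * s * of_int (k * j * (k - j)))"
      by (simp add: algebra_simps power3_eq_cube)
    then have "cis (- (3 * s * of_int (k * j * (k - j))))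
      = cis (- (s * of_int k ^ 3)) * cis (s * of_int j ^ 3) * cis (s * of_int (k - j) ^ 3)" by (simp only: cis_mult)
    then show "cis (- (s * of_int k ^ 3)) * (fcoeff (airy s g) j * fcoeff (airy s v) (k - j))
      = cis (- (3 * s * of_int (k * j * (k - j)))) * (fcoeff g j * fcoeff v (k - j))"
      by (simp add: fcoeff_airy del: of_int_mult of_int_diff)
  qed
  finally show ?thesis by (simp add: NN_def mult_ac)
qed

lemma bounded_bilinear_cmult:
  fixes p :: "'a::real_normed_vector \<Rightarrow> 'b::real_normed_vector \<Rightarrow> 'c::real_normed_algebra"
  assumes "bounded_bilinear p"
  shows "bounded_bilinear (\<lambda>x y. c * p x y)"
proof -
  obtain K where K: "\<And>x y. norm (p x y) \<le> norm x * norm y * K" using bounded_bilinear.bounded[OF assms] by blast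
  show ?thesis
  proof
    have "norm (c * p x y) \<le> norm x * norm y * (norm c * K)" for x y
      using order_trans[OF norm_mult_ineq mult_left_mono[OF K norm_ge_zero]] by (simp add: mult_ac)
    then show "\<exists>K. \<forall>x y. norm (c * p x y) \<le> norm x * norm y * K" by blast
  qed (simp_all add: bounded_bilinear.add_left[OF assms] bounded_bilinear.add_right[OF assms]
      bounded_bilinear.scaleR_left[OF assms] bounded_bilinear.scaleR_right[OF assms] distrib_left)
qed

lemma bounded_bilinear_NN: "bounded_bilinear (\<lambda>g v. NN s g v k)" unfolding NN_def
  by (intro bounded_bilinear_cmult bounded_bilinear.comp[OF bounded_bilinear_sconv] bounded_linear_airy)

lemma continuous_on_NN:
  assumes "continuous_on A t" "continuous_on A g" "continuous_on A v"
  shows "continuous_on A (\<lambda>s. NN (t s) (g s) (v s) k)" unfolding NN_def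
  by (intro continuous_intros assms bounded_bilinear.continuous_on[OF bounded_bilinear_sconv] continuous_on_airy) auto

text \<open>The Weierstrass test over finite subsets gives uniform convergence, which commutes with
  the integral. For the bilinear term the majorant is free of time because the phases have modulus
  one.\<close>

lemma integral_infsum:
  fixes F :: "'i \<Rightarrow> real \<Rightarrow> complex"
  assumes cont: "\<And>j. continuous_on {a..c} (F j)"
    and bd: "\<And>j s. s \<in> {a..c} \<Longrightarrow> cmod (F j s) \<le> m j" and m: "m summable_on UNIV"
  shows "integral {a..c} (\<lambda>s. \<Sum>\<^sub>\<infinity>j. F j s) = (\<Sum>\<^sub>\<infinity>j. integral {a..c} (F j))"
proof -
  let ?S = "\<lambda>X s. \<Sum>j\<in>X. F j s"
  have u: "uniform_limit {a..c} ?S (\<lambda>s. \<Sum>\<^sub>\<infinity>j. F j s) (finite_subsets_at_top UNIV)"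
    by (rule Weierstrass_m_test_general[where M = m]) (use bd m in auto)
  obtain I L where I: "\<And>X. (?S X has_integral I X) {a..c}" and L: "((\<lambda>s. \<Sum>\<^sub>\<infinity>j. F j s) has_integral L) {a..c}"
    and lim: "(I \<longlongrightarrow> L) (finite_subsets_at_top UNIV)" by (rule uniform_limit_integral[OF u]) (auto intro!: continuous_intros cont)
  have "I X = (\<Sum>j\<in>X. integral {a..c} (F j))" if "finite X" for X
  proof -
    have "(?S X has_integral (\<Sum>j\<in>X. integral {a..c} (F j))) {a..c}"
      using that by (intro has_integral_sum integrable_integral integrable_continuous_real cont) auto
    then show ?thesis using I has_integral_unique by blast
  qed
  then have "((\<lambda>X. \<Sum>j\<in>X. integral {a..c} (F j)) \<longlongrightarrow> L) (finite_subsets_at_top UNIV)"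
    by (intro Lim_transform_eventually[OF lim] eventually_finite_subsets_at_top_weakI) auto
  then have "((\<lambda>j. integral {a..c} (F j)) has_sum L) UNIV" by (simp add: has_sum_def)
  then show ?thesis using L by (simp add: infsumI integral_unique)
qed

lemma BB_eq_integral: "BB a c g v k = integral {a..c} (\<lambda>s. NN s g v k)"
proof -
  have "integral {a..c} (\<lambda>s. \<Sum>\<^sub>\<infinity>j. cis (- (3 * s * of_int (k * j * (k - j)))) * (fcoeff g j * fcoeff v (k - j)))
    = (\<Sum>\<^sub>\<infinity>j. integral {a..c} (\<lambda>s. cis (- (3 * s * of_int (k * j * (k - j)))) * (fcoeff g j * fcoeff v (k - j))))"
    by (rule integral_infsum[where m = "\<lambda>j. norm (fcoeff g j * fcoeff v (k - j))"])
       (use sconv_fcoeff_abs_summable[of g v k] in \<open>auto intro!: continuous_intros simp: norm_mult\<close>)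
  then show ?thesis unfolding NN_eq integral_mult_right integral_mult_left BB_def JJ_def by simp
qed

lemma norm_JJ_le: "a \<le> c \<Longrightarrow> cmod (JJ a c m) \<le> c - a"
proof -
  assume "a \<le> c"
  then have "cmod (JJ a c m) \<le> 1 * (c - a)" unfolding JJ_def by (intro integral_bound) (auto intro!: continuous_intros)
  then show ?thesis by simp
qed

lemma JJ_eq:
  assumes "a \<le> c" "m \<noteq> 0"
  shows "JJ a c m = (cis (- (3 * c * of_int m)) - cis (- (3 * a * of_int m))) / (- 3 * \<i> * of_int m)"
proof -
  let ?z = "- 3 * \<i> * complex_of_int m"
  have z: "?z \<noteq> 0" using assms by simp
  have "((\<lambda>s. cis (- (3 * s * of_int m))) has_integral
     (cis (- (3 * c * of_int m)) / ?z - cis (- (3 * a * of_int m)) / ?z)) {a..c}"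
  proof (intro fundamental_theorem_of_calculus assms)
    fix x :: real
    have e: "cis (- (3 * s * of_int m)) = exp (?z * of_real s)" for s by (simp add: cis_conv_exp mult_ac)
    have "((\<lambda>s. exp (?z * s) / ?z) has_field_derivative exp (?z * of_real x)) (at (of_real x))"
      using z by (auto intro!: derivative_eq_intros)
    then show "((\<lambda>s. cis (- (3 * s * of_int m)) / ?z) has_vector_derivative cis (- (3 * x * of_int m))) (at x within {a..c})"
      unfolding e by (rule has_vector_derivative_real_field)
  qed
  then show ?thesis unfolding JJ_def by (simp add: integral_unique diff_divide_distrib)
qed

lemma norm_JJ_le_inverse:
  assumes "a \<le> c" "m \<noteq> 0"
  shows "cmod (JJ a c m) \<le> 2 / (3 * \<bar>of_int m\<bar>)"
proof -
  have "cmod (JJ a c m) = cmod (cis (- (3 * c * of_int m)) - cis (- (3 * a * of_int m))) / (3 * \<bar>of_int m\<bar>)"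
    unfolding JJ_eq[OF assms] by (simp add: norm_divide norm_mult)
  also have "\<dots> \<le> (cmod (cis (- (3 * c * of_int m))) + cmod (cis (- (3 * a * of_int m)))) / (3 * \<bar>of_int m\<bar>)"
    by (intro divide_right_mono norm_triangle_ineq4) auto
  finally show ?thesis by simp
qed

lemma abs_add_le_mult_int: "j \<noteq> 0 \<Longrightarrow> m \<noteq> 0 \<Longrightarrow> \<bar>j + m\<bar> \<le> 2 * \<bar>j\<bar> * \<bar>m :: int\<bar>"
proof -
  assume "j \<noteq> 0" "m \<noteq> 0"
  then have "1 \<le> \<bar>j\<bar>" "1 \<le> \<bar>m\<bar>" by auto
  then have "0 \<le> (\<bar>j\<bar> - 1) * \<bar>m\<bar>" "0 \<le> (\<bar>m\<bar> - 1) * \<bar>j\<bar>" by auto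
  then show ?thesis by (simp add: algebra_simps)
qed

text \<open>Here the oscillation is spent entirely on the derivative, with no smallness left. This
  makes the double series in \<open>energy\<close> absolutely summable, so that it may be
  rearranged.\<close>

lemma norm_mult_JJ_le_1:
  assumes "a \<le> c" "j \<noteq> 0" "k - j \<noteq> 0"
  shows "\<bar>of_int k\<bar> * cmod (JJ a c (k * j * (k - j))) \<le> 1"
proof (cases "k = 0")
  case False
  let ?p = "\<bar>of_int j :: real\<bar> * \<bar>of_int (k - j)\<bar>"
  have "j * (k - j) \<noteq> 0" using assms by simp
  then have "1 \<le> \<bar>j * (k - j)\<bar>" by linarith
  then have "1 \<le> \<bar>j\<bar> * \<bar>k - j\<bar>" by (simp only: abs_mult)
  then have p: "1 \<le> ?p" by (metis of_int_1_le_iff of_int_abs of_int_mult)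
  have "\<bar>of_int k\<bar> * cmod (JJ a c (k * j * (k - j))) \<le> \<bar>of_int k\<bar> * (2 / (3 * \<bar>of_int (k * j * (k - j))\<bar>))"
    using assms False by (intro mult_left_mono norm_JJ_le_inverse) auto
  also have "\<dots> = 2 / (3 * ?p)" using False by (simp add: abs_mult)
  also have "\<dots> \<le> 1" using p by (simp add: divide_le_eq)
  finally show ?thesis .
qed simp

text \<open>In the square of the integral one factor is bounded by the length of the interval and
  the other by the inverse frequency. What remains is \<open>|k| / (|j| |k - j|)\<close>, at most 2
  because \<open>k\<close> is the sum of two nonzero integers; the resulting 4/3 is absorbed by the
  normalisation \<open>2 * pi\<close>.\<close>

lemma norm_mult_JJ_le_sqrt:
  assumes "a \<le> c" "j \<noteq> 0" "k - j \<noteq> 0"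
  shows "\<bar>of_int k\<bar> / sqrt (2 * pi) * cmod (JJ a c (k * j * (k - j))) \<le> sqrt (c - a)"
proof (cases "k = 0")
  case False
  let ?p = "\<bar>of_int j :: real\<bar> * \<bar>of_int (k - j)\<bar>"
  let ?J = "cmod (JJ a c (k * j * (k - j)))"
  have "j * (k - j) \<noteq> 0" using assms by simp
  then have "1 \<le> \<bar>j * (k - j)\<bar>" by linarith
  then have "1 \<le> \<bar>j\<bar> * \<bar>k - j\<bar>" by (simp only: abs_mult)
  then have p: "1 \<le> ?p" by (metis of_int_1_le_iff of_int_abs of_int_mult)
  have "\<bar>k\<bar> \<le> 2 * (\<bar>j\<bar> * \<bar>k - j\<bar>)" using abs_add_le_mult_int[of j "k - j"] assms by simp
  then have "of_int \<bar>k\<bar> \<le> (of_int (2 * (\<bar>j\<bar> * \<bar>k - j\<bar>)) :: real)" by (simp only: of_int_le_iff)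
  then have kp: "\<bar>of_int k\<bar> \<le> 2 * ?p" by simp
  have "(of_int k)\<^sup>2 * ?J\<^sup>2 \<le> (of_int k)\<^sup>2 * ((c - a) * (2 / (3 * \<bar>of_int (k * j * (k - j))\<bar>)))" unfolding power2_eq_square[of ?J]
    using assms False by (intro mult_left_mono mult_mono norm_JJ_le norm_JJ_le_inverse) auto
  also have "\<dots> = (c - a) * ((2 / 3) * (\<bar>of_int k\<bar> / ?p))"
  proof -
    have alg: "K * K * ((c - a) * (2 / (3 * (K * p)))) = (c - a) * ((2 / 3) * (K / p))" if "K \<noteq> 0" "p \<noteq> 0" for K p :: real
      using that by (simp add: field_simps)
    have "\<bar>of_int k :: real\<bar> \<noteq> 0" "?p \<noteq> 0" using False p by (simp, linarith)
    from alg[OF this] have "\<bar>of_int k\<bar> * \<bar>of_int k\<bar> * ((c - a) * (2 / (3 * (\<bar>of_int k\<bar> * ?p)))) = (c - a) * ((2 / 3) * (\<bar>of_int k\<bar> / ?p))" .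
    moreover have "\<bar>of_int (k * j * (k - j))\<bar> = \<bar>of_int k :: real\<bar> * ?p" by (simp add: abs_mult mult.assoc)
    moreover have "(of_int k)\<^sup>2 = \<bar>of_int k\<bar> * \<bar>of_int k :: real\<bar>" by (simp add: power2_eq_square)
    ultimately show ?thesis by (simp only:)
  qed
  also have "\<dots> \<le> (c - a) * ((2 / 3) * 2)" using kp p assms by (intro mult_left_mono) (auto simp: divide_le_eq)
  also have "\<dots> \<le> (c - a) * (2 * pi)" using assms pi_ge_two by (intro mult_left_mono) auto
  finally have "(of_int k)\<^sup>2 * ?J\<^sup>2 \<le> (c - a) * (2 * pi)" .
  then have "sqrt ((of_int k)\<^sup>2 * ?J\<^sup>2) \<le> sqrt ((c - a) * (2 * pi))" by (rule real_sqrt_le_mono)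
  then have "\<bar>of_int k\<bar> * ?J \<le> sqrt (c - a) * sqrt (2 * pi)" by (simp add: real_sqrt_mult)
  then show ?thesis by (simp add: divide_le_eq)
qed (use assms in simp)

abbreviation ac :: "l2_torus \<Rightarrow> int \<Rightarrow> ennreal" where
  "ac f \<equiv> (\<lambda>j. ennreal (cmod (fcoeff f j)))"

lemma norm_BB_le:
  assumes "a \<le> c" "fcoeff g 0 = 0" "fcoeff v 0 = 0"
  shows "ennreal (cmod (BB a c g v k)) \<le> ennreal (sqrt (c - a)) * econv (ac g) (ac v) k"
proof -
  have "BB a c g v k = (\<Sum>\<^sub>\<infinity>j. (\<i> * of_int k / r2p) * (JJ a c (k * j * (k - j)) * (fcoeff g j * fcoeff v (k - j))))"
    unfolding BB_def
  proof (rule infsum_cmult_right[symmetric], rule abs_summable_summable)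
    show "(\<lambda>j. norm (JJ a c (k * j * (k - j)) * (fcoeff g j * fcoeff v (k - j)))) summable_on UNIV"
    proof (rule Infinite_Sum.abs_summable_on_comparison_test'[OF summable_on_cmult_right[OF sconv_fcoeff_abs_summable]])
      fix j show "norm (JJ a c (k * j * (k - j)) * (fcoeff g j * fcoeff v (k - j))) \<le> (c - a) * norm (fcoeff g j * fcoeff v (k - j))"
        unfolding norm_mult[of "JJ _ _ _"] using assms by (intro mult_right_mono norm_JJ_le) auto
    qed
  qed
  then have "ennreal (cmod (BB a c g v k)) \<le>
      esum (\<lambda>j. ennreal (cmod ((\<i> * of_int k / r2p) * (JJ a c (k * j * (k - j)) * (fcoeff g j * fcoeff v (k - j))))))"
    by (metis norm_infsum_le_esum)
  also have "\<dots> \<le> esum (\<lambda>j. ennreal (sqrt (c - a)) * (ac g j * ac v (k - j)))"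
  proof (intro esum_mono)
    fix j
    have "cmod ((\<i> * of_int k / r2p) * (JJ a c (k * j * (k - j)) * (fcoeff g j * fcoeff v (k - j))))
      \<le> sqrt (c - a) * (cmod (fcoeff g j) * cmod (fcoeff v (k - j)))"
    \<comment> \<open>Without oscillation there is no gain, but in these terms a zero mode of
      \<open>g\<close> or \<open>v\<close> occurs as a factor.\<close>
    proof (cases "j = 0 \<or> k - j = 0")
      case False
      have "cmod ((\<i> * of_int k / r2p) * (JJ a c (k * j * (k - j)) * (fcoeff g j * fcoeff v (k - j))))
        = (\<bar>of_int k\<bar> / sqrt (2 * pi) * cmod (JJ a c (k * j * (k - j)))) * (cmod (fcoeff g j) * cmod (fcoeff v (k - j)))"
        by (simp add: norm_mult norm_divide)
      also have "\<dots> \<le> sqrt (c - a) * (cmod (fcoeff g j) * cmod (fcoeff v (k - j)))"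
        using False assms by (intro mult_right_mono norm_mult_JJ_le_sqrt) auto
      finally show ?thesis .
    qed (use assms in auto)
    then show "ennreal (cmod ((\<i> * of_int k / r2p) * (JJ a c (k * j * (k - j)) * (fcoeff g j * fcoeff v (k - j)))))
      \<le> ennreal (sqrt (c - a)) * (ac g j * ac v (k - j))" using assms by (simp add: ennreal_mult[symmetric] ennreal_leI)
  qed
  also have "\<dots> = ennreal (sqrt (c - a)) * econv (ac g) (ac v) k" unfolding econv_def by (rule esum_cmult)
  finally show ?thesis .
qed

text \<open>Either factor may take the \<open>\<ell>\<^sup>1\<close> norm. The first form serves
  stability; the second asks only the norm in \<open>L\<^sup>2\<close> of \<open>g\<close>, the only
  norm in which the approximations of \<psi> are known to converge.\<close>

theorem nl2_BB_le:
  assumes "a \<le> c" "fcoeff g 0 = 0" "fcoeff v 0 = 0"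
  shows "nl2 (BB a c g v) \<le> ennreal (c - a) * ((nl1 (fcoeff g))\<^sup>2 * nl2 (fcoeff v))"
    and "nl2 (BB a c g v) \<le> ennreal (c - a) * (nl2 (fcoeff g) * (nl1 (fcoeff v))\<^sup>2)"
proof -
  have "nl2 (BB a c g v) \<le> esum (\<lambda>k. (ennreal (sqrt (c - a)) * econv (ac g) (ac v) k)\<^sup>2)"
    unfolding nl2_alt by (intro esum_mono power_mono norm_BB_le assms) auto
  also have "\<dots> = ennreal (c - a) * esum (\<lambda>k. (econv (ac g) (ac v) k)\<^sup>2)"
    using assms by (simp add: power_mult_distrib ennreal_power esum_cmult)
  finally have *: "nl2 (BB a c g v) \<le> ennreal (c - a) * esum (\<lambda>k. (econv (ac g) (ac v) k)\<^sup>2)" .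
  have "esum (\<lambda>k. (econv (ac g) (ac v) k)\<^sup>2) \<le> (nl1 (fcoeff g))\<^sup>2 * nl2 (fcoeff v)"
    unfolding nl1_def nl2_alt by (rule young_l1_l2) auto
  then show "nl2 (BB a c g v) \<le> ennreal (c - a) * ((nl1 (fcoeff g))\<^sup>2 * nl2 (fcoeff v))"
    by (rule order_trans[OF * mult_left_mono]) auto
  have "esum (\<lambda>k. (econv (ac v) (ac g) k)\<^sup>2) \<le> (nl1 (fcoeff v))\<^sup>2 * nl2 (fcoeff g)"
    unfolding nl1_def nl2_alt by (rule young_l1_l2) auto
  then show "nl2 (BB a c g v) \<le> ennreal (c - a) * (nl2 (fcoeff g) * (nl1 (fcoeff v))\<^sup>2)"
    by (intro order_trans[OF * mult_left_mono]) (auto simp: econv_commute[of "ac g"] mult.commute)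
qed

definition Cjb :: ennreal where "Cjb = esum (\<lambda>k. ennreal (1 / jb k))"

lemma Cjb_finite: "Cjb < \<infinity>"
proof -
  have "summable (\<lambda>n. 1 / (1 + (real n)\<^sup>2))"
  proof (rule summable_comparison_test'[where N = 1])
    show "summable (\<lambda>n. 1 / (real n)\<^sup>2)" using inverse_power_summable[of 2, where 'a = real] by (simp add: inverse_eq_divide)
    fix n :: nat assume "1 \<le> n"
    then have "1 / (1 + (real n)\<^sup>2) \<le> 1 / (real n)\<^sup>2" by (intro frac_le) auto
    then show "norm (1 / (1 + (real n)\<^sup>2)) \<le> 1 / (real n)\<^sup>2" by simp
  qed
  then have fin: "(\<Sum>n. ennreal (1 / (1 + (real n)\<^sup>2))) < \<infinity>" by (subst suminf_ennreal2) auto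
  have "Cjb \<le> esum (\<lambda>k. ennreal (1 / jb k) * indicator (range int) k + ennreal (1 / jb k) * indicator (range (\<lambda>n. - int n)) k)"
    unfolding Cjb_def
  proof (intro esum_mono)
    fix k :: int
    have "k \<in> range int \<or> k \<in> range (\<lambda>n. - int n)" by (cases k rule: int_cases2) auto
    then show "ennreal (1 / jb k) \<le> ennreal (1 / jb k) * indicator (range int) k + ennreal (1 / jb k) * indicator (range (\<lambda>n. - int n)) k"
      by (auto simp: indicator_def)
  qed
  also have "\<dots> = esum (\<lambda>k. ennreal (1 / jb k) * indicator (range int) k) + esum (\<lambda>k. ennreal (1 / jb k) * indicator (range (\<lambda>n. - int n)) k)"
    by (rule esum_add)
  also have "esum (\<lambda>k. ennreal (1 / jb k) * indicator (range int) k) = (\<integral>\<^sup>+k. ennreal (1 / jb k) \<partial>count_space (range int))"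
    by (subst nn_integral_count_space_indicator[of "range int"]) auto
  also have "\<dots> = (\<integral>\<^sup>+n. ennreal (1 / jb (int n)) \<partial>count_space UNIV)"
    by (rule nn_integral_bij_count_space[symmetric]) (auto simp: bij_betw_def inj_on_def)
  also have "esum (\<lambda>k. ennreal (1 / jb k) * indicator (range (\<lambda>n. - int n)) k) = (\<integral>\<^sup>+k. ennreal (1 / jb k) \<partial>count_space (range (\<lambda>n. - int n)))"
    by (subst nn_integral_count_space_indicator[of "range (\<lambda>n. - int n)"]) auto
  also have "\<dots> = (\<integral>\<^sup>+n. ennreal (1 / jb (- int n)) \<partial>count_space UNIV)"
    by (rule nn_integral_bij_count_space[symmetric]) (auto simp: bij_betw_def inj_on_def)
  finally have "Cjb \<le> (\<Sum>n. ennreal (1 / (1 + (real n)\<^sup>2))) + (\<Sum>n. ennreal (1 / (1 + (real n)\<^sup>2)))"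
    by (simp add: nn_integral_count_space_nat jb_def)
  also have "\<dots> < \<infinity>" using fin by simp
  finally show ?thesis .
qed

definition cjb :: real where "cjb = enn2real Cjb"

lemma Cjb_eq: "Cjb = ennreal cjb" and cjb_nonneg: "0 \<le> cjb" using Cjb_finite by (auto simp: cjb_def)

text \<open>The norm of the Wiener algebra for one derivative; it is the norm of the coefficient
  function that governs stability in \<open>L\<^sup>2\<close>.\<close>

definition nl1w :: "(int \<Rightarrow> complex) \<Rightarrow> ennreal" where
  "nl1w c = esum (\<lambda>k. ennreal (sqrt (jb k) * cmod (c k)))"

text \<open>Cauchy-Schwarz against \<open>1 / sqrt (jb k)\<close>, which is square summable: one
  derivative is lost in passing from square sums to absolute sums, so \<open>H\<^sup>2\<close> is
  what controls \<open>nl1w\<close>.\<close>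

lemma nl1w_sq_le: "(nl1w c)\<^sup>2 \<le> Cjb * hl2 c"
proof -
  have "nl1w c = esum (\<lambda>k. ennreal (1 / sqrt (jb k)) * ennreal (jb k * cmod (c k)))" unfolding nl1w_def
  proof (intro nn_integral_cong)
    fix k
    have "s * x = (1 / s) * (s * s * x)" if "0 < s" for s x :: real using that by simp
    from this[of "sqrt (jb k)" "cmod (c k)"]
    have "sqrt (jb k) * cmod (c k) = (1 / sqrt (jb k)) * (jb k * cmod (c k))" using jb_pos[of k] by simp
    then show "ennreal (sqrt (jb k) * cmod (c k)) = ennreal (1 / sqrt (jb k)) * ennreal (jb k * cmod (c k))"
      using jb_pos[of k] by (simp add: ennreal_mult[symmetric])
  qed
  then have "(nl1w c)\<^sup>2 \<le> esum (\<lambda>k. (ennreal (1 / sqrt (jb k)))\<^sup>2) * esum (\<lambda>k. (ennreal (jb k * cmod (c k)))\<^sup>2)"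
    by (simp only: esum_Cauchy_Schwarz)
  also have "\<dots> = Cjb * hl2 c"
    using jb_pos by (simp add: Cjb_def wl2_def ennreal_power power_divide power_mult_distrib less_imp_le)
  finally show ?thesis .
qed

lemma nl1_sq_le: "(nl1 c)\<^sup>2 \<le> Cjb * wl2 jb c"
proof -
  have "nl1 c = esum (\<lambda>k. ennreal (1 / sqrt (jb k)) * ennreal (sqrt (jb k) * cmod (c k)))" unfolding nl1_def
  proof (intro nn_integral_cong)
    fix k
    have "sqrt (jb k) > 0" using jb_pos[of k] by simp
    then show "ennreal (cmod (c k)) = ennreal (1 / sqrt (jb k)) * ennreal (sqrt (jb k) * cmod (c k))"
      by (simp add: ennreal_mult[symmetric])
  qed
  then have "(nl1 c)\<^sup>2 \<le> esum (\<lambda>k. (ennreal (1 / sqrt (jb k)))\<^sup>2) * esum (\<lambda>k. (ennreal (sqrt (jb k) * cmod (c k)))\<^sup>2)"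
    by (simp only: esum_Cauchy_Schwarz)
  also have "\<dots> = Cjb * wl2 jb c"
    using jb_pos by (simp add: Cjb_def wl2_def ennreal_power power_divide power_mult_distrib less_imp_le)
  finally show ?thesis .
qed

lemma nl1_le_nl1w: "nl1 c \<le> nl1w c" unfolding nl1_def nl1w_def
proof (intro esum_mono ennreal_leI)
  fix k
  have "1 \<le> sqrt (jb k)" using jb_ge_1[of k] by simp
  then show "cmod (c k) \<le> sqrt (jb k) * cmod (c k)" using mult_right_mono[of 1 "sqrt (jb k)" "cmod (c k)"] by simp
qed

lemma wl2_mono: "(\<And>k. w k \<le> w' k) \<Longrightarrow> wl2 w c \<le> wl2 w' c" unfolding wl2_def by (intro esum_mono ennreal_leI mult_right_mono) auto

lemma wl2_mono_seq: "(\<And>k. cmod (c k) \<le> cmod (d k)) \<Longrightarrow> (\<And>k. 0 \<le> w k) \<Longrightarrow> wl2 w c \<le> wl2 w d"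
  unfolding wl2_def by (intro esum_mono ennreal_leI mult_left_mono power_mono) auto

lemma nl2_le_wl2_jb: "nl2 c \<le> wl2 jb c" by (rule wl2_mono) (rule jb_ge_1)

lemma wl2_jb_le_jb2: "wl2 jb c \<le> hl2 c"
proof (rule wl2_mono)
  fix k show "jb k \<le> (jb k)\<^sup>2" using mult_left_mono[OF jb_ge_1[of k], of "jb k"] jb_pos[of k] by (simp add: power2_eq_square)
qed

lemma wl2_cong_cmod: "(\<And>k. cmod (c k) = cmod (d k)) \<Longrightarrow> wl2 w c = wl2 w d" by (simp add: wl2_def)

lemma wl2_scale: "wl2 w (\<lambda>k. a * c k) = ennreal ((cmod a)\<^sup>2) * wl2 w c"
proof -
  have "ennreal (w k * (cmod (a * c k))\<^sup>2) = ennreal ((cmod a)\<^sup>2) * ennreal (w k * (cmod (c k))\<^sup>2)" for k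
    by (cases "0 \<le> w k") (auto simp: norm_mult power_mult_distrib ennreal_mult[symmetric] mult_ac ennreal_neg mult_nonneg_nonpos mult_nonneg_nonpos2)
  then show ?thesis by (simp add: wl2_def esum_cmult)
qed

lemma wl2_add_le:
  assumes w: "\<And>k. 0 \<le> w k"
  shows "wl2 w (\<lambda>k. c k + d k) \<le> 2 * (wl2 w c + wl2 w d)"
proof -
  have "wl2 w (\<lambda>k. c k + d k) \<le> esum (\<lambda>k. 2 * (ennreal (w k * (cmod (c k))\<^sup>2) + ennreal (w k * (cmod (d k))\<^sup>2)))"
    unfolding wl2_def
  proof (intro esum_mono)
    fix k
    have "(cmod (c k + d k))\<^sup>2 \<le> (cmod (c k) + cmod (d k))\<^sup>2" by (intro power_mono norm_triangle_ineq) auto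
    also have "\<dots> \<le> 2 * ((cmod (c k))\<^sup>2 + (cmod (d k))\<^sup>2)"
      using sum_squares_bound[of "cmod (c k)" "cmod (d k)"] by (simp add: power2_sum)
    finally have "w k * (cmod (c k + d k))\<^sup>2 \<le> w k * (2 * ((cmod (c k))\<^sup>2 + (cmod (d k))\<^sup>2))"
      using w by (intro mult_left_mono) auto
    then have "ennreal (w k * (cmod (c k + d k))\<^sup>2) \<le> ennreal (2 * (w k * (cmod (c k))\<^sup>2 + w k * (cmod (d k))\<^sup>2))"
      by (intro ennreal_leI) (simp add: algebra_simps)
    also have "\<dots> = 2 * (ennreal (w k * (cmod (c k))\<^sup>2) + ennreal (w k * (cmod (d k))\<^sup>2))"
      using w by (simp add: ennreal_mult ennreal_plus)
    finally show "ennreal (w k * (cmod (c k + d k))\<^sup>2) \<le> 2 * (ennreal (w k * (cmod (c k))\<^sup>2) + ennreal (w k * (cmod (d k))\<^sup>2))" .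
  qed
  also have "\<dots> = 2 * (wl2 w c + wl2 w d)" by (simp add: esum_cmult esum_add wl2_def)
  finally show ?thesis .
qed

section \<open>Product estimates with derivatives\<close>

lemma sqrt_jb_add_le: "sqrt (jb (j + m)) \<le> sqrt (jb j) + sqrt (jb m)"
proof (rule real_le_lsqrt)
  have "\<bar>of_int j\<bar> \<le> sqrt (jb j)" "\<bar>of_int m\<bar> \<le> sqrt (jb m)" by (auto simp: jb_def real_le_rsqrt)
  then have "\<bar>of_int j\<bar> * \<bar>of_int m\<bar> \<le> sqrt (jb j) * sqrt (jb m)" by (intro mult_mono) (auto simp: less_imp_le[OF jb_pos])
  then have "of_int j * of_int m \<le> sqrt (jb j) * sqrt (jb m)"
    using abs_ge_self[of "of_int j * of_int m :: real"] by (simp add: abs_mult)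
  then show "jb (j + m) \<le> (sqrt (jb j) + sqrt (jb m))\<^sup>2" using less_imp_le[OF jb_pos[of j]] less_imp_le[OF jb_pos[of m]]
    by (simp add: power2_sum) (simp add: jb_def power2_sum)
qed (auto simp: jb_pos less_imp_le)

abbreviation acw :: "l2_torus \<Rightarrow> int \<Rightarrow> ennreal" where
  "acw f \<equiv> (\<lambda>j. ennreal (sqrt (jb j) * cmod (fcoeff f j)))"

lemma sqrt_jb_econv_le:
  "ennreal (sqrt (jb k)) * econv (ac g) (ac v) k \<le> econv (acw g) (ac v) k + econv (ac g) (acw v) k"
  unfolding econv_def esum_cmult[symmetric] esum_add[symmetric]
proof (intro esum_mono)
  fix j
  let ?g = "cmod (fcoeff g j)" and ?v = "cmod (fcoeff v (k - j))"
  have "sqrt (jb k) * (?g * ?v) \<le> (sqrt (jb j) + sqrt (jb (k - j))) * (?g * ?v)"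
    using sqrt_jb_add_le[of j "k - j"] by (intro mult_right_mono) auto
  then have "ennreal (sqrt (jb k) * (?g * ?v)) \<le> ennreal (sqrt (jb j) * ?g * ?v + ?g * (sqrt (jb (k - j)) * ?v))"
    by (intro ennreal_leI) (simp add: algebra_simps)
  then show "ennreal (sqrt (jb k)) * (ac g j * ac v (k - j)) \<le> acw g j * ac v (k - j) + ac g j * acw v (k - j)"
    using jb_pos by (simp add: ennreal_mult ennreal_plus less_imp_le)
qed

lemma esum_sq_add_le:
  fixes a b :: "'a \<Rightarrow> ennreal"
  shows "esum (\<lambda>k. (a k + b k)\<^sup>2) \<le> 2 * (esum (\<lambda>k. (a k)\<^sup>2) + esum (\<lambda>k. (b k)\<^sup>2))"
proof -
  have "(x + y)\<^sup>2 \<le> 2 * (x\<^sup>2 + y\<^sup>2)" for x y :: ennreal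
  proof (cases x; cases y)
    fix r s :: real assume "x = ennreal r" "y = ennreal s" "0 \<le> r" "0 \<le> s"
    moreover have "(r + s)\<^sup>2 \<le> 2 * (r\<^sup>2 + s\<^sup>2)" using sum_squares_bound[of r s] by (simp add: power2_sum)
    ultimately show ?thesis by (simp add: ennreal_plus[symmetric] ennreal_power ennreal_mult[symmetric] ennreal_leI
          ennreal_numeral[symmetric] del: ennreal_plus ennreal_numeral)
  qed (auto simp: power2_eq_square ennreal_mult_top ennreal_top_mult)
  then have "esum (\<lambda>k. (a k + b k)\<^sup>2) \<le> esum (\<lambda>k. 2 * ((a k)\<^sup>2 + (b k)\<^sup>2))" by (intro esum_mono)
  then show ?thesis by (simp add: esum_cmult esum_add)
qed

lemma esum_acw_sq: "esum (\<lambda>k. (acw f k)\<^sup>2) = wl2 jb (fcoeff f)"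
  using jb_pos by (simp add: wl2_def ennreal_power power_mult_distrib less_imp_le)

lemma esum_ac_sq: "esum (\<lambda>k. (ac f k)\<^sup>2) = nl2 (fcoeff f)" by (simp add: nl2_alt)

text \<open>The weight at \<open>k\<close> is shared between \<open>j\<close> and
  \<open>k - j\<close>. The two versions differ in the term where it falls on \<open>g\<close>:
  either \<open>g\<close> is measured in \<open>H\<^sup>1\<close> and \<open>v\<close> by absolute
  sums, or \<open>g\<close> by weighted absolute sums and \<open>v\<close> in
  \<open>L\<^sup>2\<close>.\<close>

lemma weighted_young:
  "esum (\<lambda>k. (ennreal (sqrt (jb k)) * econv (ac g) (ac v) k)\<^sup>2)
    \<le> 2 * (wl2 jb (fcoeff g) * (nl1 (fcoeff v))\<^sup>2 + (nl1 (fcoeff g))\<^sup>2 * wl2 jb (fcoeff v))" (is "?L \<le> _")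
  "esum (\<lambda>k. (ennreal (sqrt (jb k)) * econv (ac g) (ac v) k)\<^sup>2)
    \<le> 2 * ((nl1w (fcoeff g))\<^sup>2 * nl2 (fcoeff v) + (nl1 (fcoeff g))\<^sup>2 * wl2 jb (fcoeff v))"
proof -
  have "?L \<le> esum (\<lambda>k. (econv (acw g) (ac v) k + econv (ac g) (acw v) k)\<^sup>2)" by (intro esum_mono power_mono sqrt_jb_econv_le) auto
  also have "\<dots> \<le> 2 * (esum (\<lambda>k. (econv (acw g) (ac v) k)\<^sup>2) + esum (\<lambda>k. (econv (ac g) (acw v) k)\<^sup>2))" by (rule esum_sq_add_le)
  finally have L: "?L \<le> 2 * (esum (\<lambda>k. (econv (acw g) (ac v) k)\<^sup>2) + esum (\<lambda>k. (econv (ac g) (acw v) k)\<^sup>2))" .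
  have 1: "esum (\<lambda>k. (econv (ac g) (acw v) k)\<^sup>2) \<le> (nl1 (fcoeff g))\<^sup>2 * wl2 jb (fcoeff v)"
    unfolding nl1_def esum_acw_sq[symmetric] by (rule young_l1_l2) auto
  have 2: "esum (\<lambda>k. (econv (acw g) (ac v) k)\<^sup>2) \<le> (nl1w (fcoeff g))\<^sup>2 * nl2 (fcoeff v)"
    unfolding nl1w_def esum_ac_sq[symmetric] by (rule young_l1_l2) auto
  have 3: "esum (\<lambda>k. (econv (acw g) (ac v) k)\<^sup>2) \<le> wl2 jb (fcoeff g) * (nl1 (fcoeff v))\<^sup>2"
    unfolding econv_commute[of "acw g"] nl1_def esum_acw_sq[symmetric]
    using young_l1_l2[of "ac v" "acw g"] by (simp add: mult.commute)
  show "?L \<le> 2 * (wl2 jb (fcoeff g) * (nl1 (fcoeff v))\<^sup>2 + (nl1 (fcoeff g))\<^sup>2 * wl2 jb (fcoeff v))"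
    by (rule order_trans[OF L]) (intro mult_left_mono add_mono 1 3, simp)
  show "?L \<le> 2 * ((nl1w (fcoeff g))\<^sup>2 * nl2 (fcoeff v) + (nl1 (fcoeff g))\<^sup>2 * wl2 jb (fcoeff v))"
    by (rule order_trans[OF L]) (intro mult_left_mono add_mono 1 2, simp)
qed

lemma cmod_fcoeff_airy [simp]: "cmod (fcoeff (airy s f) k) = cmod (fcoeff f k)" by (simp add: fcoeff_airy norm_mult)

lemma abs_le_sqrt_jb: "\<bar>of_int k\<bar> \<le> sqrt (jb k)" by (auto simp: jb_def real_le_rsqrt)

lemma norm_NN_le: "ennreal (cmod (NN s g v k)) \<le> ennreal (sqrt (jb k)) * econv (ac g) (ac v) k"
proof -
  have "cmod (NN s g v k) = \<bar>of_int k\<bar> / sqrt (2 * pi) * cmod (sconv (fcoeff (airy s g)) (fcoeff (airy s v)) k)"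
    by (simp add: NN_def norm_mult norm_divide)
  also have "\<dots> \<le> sqrt (jb k) * cmod (sconv (fcoeff (airy s g)) (fcoeff (airy s v)) k)"
  proof (intro mult_right_mono)
    have "1 \<le> sqrt (2 * pi)" using pi_ge_two by simp
    then have "\<bar>of_int k :: real\<bar> / sqrt (2 * pi) \<le> \<bar>of_int k\<bar> / 1" by (intro divide_left_mono) auto
    then show "\<bar>of_int k\<bar> / sqrt (2 * pi) \<le> sqrt (jb k)" using abs_le_sqrt_jb[of k] by simp
  qed auto
  finally have "ennreal (cmod (NN s g v k)) \<le> ennreal (sqrt (jb k)) * ennreal (cmod (sconv (fcoeff (airy s g)) (fcoeff (airy s v)) k))"
    using jb_pos by (simp add: ennreal_mult[symmetric] ennreal_leI less_imp_le)
  also have "\<dots> \<le> ennreal (sqrt (jb k)) * econv (ac g) (ac v) k"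
    using norm_sconv_le_econv[of "fcoeff (airy s g)" "fcoeff (airy s v)" k] by (intro mult_left_mono) auto
  finally show ?thesis .
qed

text \<open>No oscillation is involved, only that \<open>H\<^sup>1\<close> is an algebra. The bound
  holds at each time and so also applies when the arguments vary in time, at the price of a
  derivative on both.\<close>

theorem nl2_NN_le: "nl2 (NN s g v) \<le> 4 * Cjb * (wl2 jb (fcoeff g) * wl2 jb (fcoeff v))"
proof -
  have "nl2 (NN s g v) \<le> esum (\<lambda>k. (ennreal (sqrt (jb k)) * econv (ac g) (ac v) k)\<^sup>2)"
    unfolding nl2_alt by (intro esum_mono power_mono norm_NN_le) auto
  also have "\<dots> \<le> 2 * (wl2 jb (fcoeff g) * (nl1 (fcoeff v))\<^sup>2 + (nl1 (fcoeff g))\<^sup>2 * wl2 jb (fcoeff v))" by (rule weighted_young)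
  also have "\<dots> \<le> 2 * (wl2 jb (fcoeff g) * (Cjb * wl2 jb (fcoeff v)) + (Cjb * wl2 jb (fcoeff g)) * wl2 jb (fcoeff v))"
    by (intro mult_left_mono mult_right_mono add_mono nl1_sq_le) auto
  also have "\<dots> = 4 * Cjb * (wl2 jb (fcoeff g) * wl2 jb (fcoeff v))"
  proof -
    have "2 * (x * (c * y) + (c * x) * y) = 4 * c * (x * y)" for x y c :: ennreal
    proof -
      have "x * (c * y) + (c * x) * y = 2 * (c * (x * y))" by (simp add: mult_ac mult_2[symmetric] flip: mult_2)
      then show ?thesis by (simp add: mult.assoc[symmetric])
    qed
    then show ?thesis .
  qed
  finally show ?thesis .
qed

abbreviation acj :: "l2_torus \<Rightarrow> int \<Rightarrow> ennreal" where
  "acj f \<equiv> (\<lambda>j. ennreal (jb j * cmod (fcoeff f j)))"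

lemma esum_acj_sq: "esum (\<lambda>k. (acj f k)\<^sup>2) = hl2 (fcoeff f)"
  using jb_pos by (simp add: wl2_def ennreal_power power_mult_distrib less_imp_le)

lemma jb_add_le: "jb (j + m) \<le> 2 * (jb j + jb m)"
  using sum_squares_bound[of "of_int j :: real" "of_int m"] by (simp add: jb_def power2_sum)

lemma jb_econv_le: "ennreal (jb k) * econv (ac g) (ac v) k \<le> 2 * (econv (acj g) (ac v) k + econv (ac g) (acj v) k)"
  unfolding econv_def esum_cmult[symmetric] esum_add[symmetric]
proof (intro esum_mono)
  fix j
  let ?g = "cmod (fcoeff g j)" and ?v = "cmod (fcoeff v (k - j))"
  have "jb k * (?g * ?v) \<le> (2 * (jb j + jb (k - j))) * (?g * ?v)" using jb_add_le[of j "k - j"] by (intro mult_right_mono) auto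
  then have "ennreal (jb k * (?g * ?v)) \<le> ennreal (2 * (jb j * ?g * ?v + ?g * (jb (k - j) * ?v)))"
    by (intro ennreal_leI) (simp add: algebra_simps)
  then show "ennreal (jb k) * (ac g j * ac v (k - j)) \<le> 2 * (acj g j * ac v (k - j) + ac g j * acj v (k - j))"
    using jb_pos by (simp add: ennreal_mult ennreal_plus less_imp_le)
qed

text \<open>The previous estimate with one more derivative; it yields the regularity in time of the
  transported \<psi> in \<open>H\<^sup>1\<close>.\<close>

theorem wl2_NN_le:
  "wl2 jb (NN s g v) \<le> 16 * Cjb * (hl2 (fcoeff g) * hl2 (fcoeff v))"
proof -
  let ?W = "\<lambda>f. hl2 (fcoeff f)"
  have "wl2 jb (NN s g v) = esum (\<lambda>k. (ennreal (sqrt (jb k)) * ennreal (cmod (NN s g v k)))\<^sup>2)"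
    using jb_pos by (simp add: wl2_def ennreal_power power_mult_distrib less_imp_le ennreal_mult)
  also have "\<dots> \<le> esum (\<lambda>k. (ennreal (jb k) * econv (ac g) (ac v) k)\<^sup>2)"
  proof (intro esum_mono power_mono)
    fix k
    have "ennreal (sqrt (jb k)) * ennreal (cmod (NN s g v k)) \<le> ennreal (sqrt (jb k)) * (ennreal (sqrt (jb k)) * econv (ac g) (ac v) k)"
      by (intro mult_left_mono norm_NN_le) auto
    also have "\<dots> = ennreal (jb k) * econv (ac g) (ac v) k"
      using jb_pos by (simp add: mult.assoc[symmetric] ennreal_mult[symmetric] less_imp_le)
    finally show "ennreal (sqrt (jb k)) * ennreal (cmod (NN s g v k)) \<le> ennreal (jb k) * econv (ac g) (ac v) k" .
  qed simp
  also have "\<dots> \<le> esum (\<lambda>k. 4 * (econv (acj g) (ac v) k + econv (ac g) (acj v) k)\<^sup>2)"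
  proof (intro esum_mono)
    fix k
    have "(ennreal (jb k) * econv (ac g) (ac v) k)\<^sup>2 \<le> (2 * (econv (acj g) (ac v) k + econv (ac g) (acj v) k))\<^sup>2"
      by (intro power_mono jb_econv_le) auto
    moreover have "(2 * z)\<^sup>2 = 4 * z\<^sup>2" for z :: ennreal by (simp add: power_mult_distrib)
    ultimately show "(ennreal (jb k) * econv (ac g) (ac v) k)\<^sup>2 \<le> 4 * (econv (acj g) (ac v) k + econv (ac g) (acj v) k)\<^sup>2"
      by (simp only:)
  qed
  also have "\<dots> \<le> 4 * (2 * (esum (\<lambda>k. (econv (acj g) (ac v) k)\<^sup>2) + esum (\<lambda>k. (econv (ac g) (acj v) k)\<^sup>2)))"
    unfolding esum_cmult by (intro mult_left_mono esum_sq_add_le) auto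
  also have "\<dots> \<le> 4 * (2 * (?W g * (nl1 (fcoeff v))\<^sup>2 + (nl1 (fcoeff g))\<^sup>2 * ?W v))"
  proof (intro mult_left_mono add_mono)
    show "esum (\<lambda>k. (econv (ac g) (acj v) k)\<^sup>2) \<le> (nl1 (fcoeff g))\<^sup>2 * ?W v"
      unfolding nl1_def esum_acj_sq[symmetric] by (rule young_l1_l2) auto
    show "esum (\<lambda>k. (econv (acj g) (ac v) k)\<^sup>2) \<le> ?W g * (nl1 (fcoeff v))\<^sup>2"
      unfolding econv_commute[of "acj g"] nl1_def esum_acj_sq[symmetric]
      using young_l1_l2[of "ac v" "acj g"] by (simp add: mult.commute)
  qed auto
  also have "\<dots> \<le> 4 * (2 * (?W g * (Cjb * ?W v) + (Cjb * ?W g) * ?W v))"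
    by (intro mult_left_mono mult_right_mono add_mono order_trans[OF nl1_sq_le] wl2_jb_le_jb2) auto
  also have "\<dots> = 16 * Cjb * (?W g * ?W v)"
  proof -
    have "4 * (2 * (x * (c * y) + (c * x) * y)) = 16 * c * (x * y)" for x y c :: ennreal
    proof -
      have "x * (c * y) + (c * x) * y = 2 * (c * (x * y))" by (simp add: mult_ac mult_2[symmetric] flip: mult_2)
      then show ?thesis by (simp add: mult.assoc[symmetric])
    qed
    then show ?thesis .
  qed
  finally show ?thesis .
qed

lemma wl2_BB_le:
  assumes "a \<le> c" "fcoeff g 0 = 0" "fcoeff v 0 = 0"
  shows "wl2 jb (BB a c g v) \<le> ennreal (c - a) * (4 * ((nl1w (fcoeff g))\<^sup>2 * wl2 jb (fcoeff v)))"
proof -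
  have "wl2 jb (BB a c g v) = esum (\<lambda>k. (ennreal (sqrt (jb k)) * ennreal (cmod (BB a c g v k)))\<^sup>2)"
    using jb_pos by (simp add: wl2_def ennreal_power power_mult_distrib less_imp_le ennreal_mult)
  also have "\<dots> \<le> esum (\<lambda>k. ennreal (c - a) * (ennreal (sqrt (jb k)) * econv (ac g) (ac v) k)\<^sup>2)"
  proof (intro esum_mono)
    fix k
    have "(ennreal (sqrt (jb k)) * ennreal (cmod (BB a c g v k)))\<^sup>2 \<le>
      (ennreal (sqrt (jb k)) * (ennreal (sqrt (c - a)) * econv (ac g) (ac v) k))\<^sup>2"
      by (intro power_mono mult_left_mono norm_BB_le assms) auto
    also have "\<dots> = ennreal (c - a) * (ennreal (sqrt (jb k)) * econv (ac g) (ac v) k)\<^sup>2"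
      using assms by (simp add: power_mult_distrib ennreal_power mult_ac)
    finally show "(ennreal (sqrt (jb k)) * ennreal (cmod (BB a c g v k)))\<^sup>2 \<le>
      ennreal (c - a) * (ennreal (sqrt (jb k)) * econv (ac g) (ac v) k)\<^sup>2" .
  qed
  also have "\<dots> \<le> ennreal (c - a) * (2 * ((nl1w (fcoeff g))\<^sup>2 * nl2 (fcoeff v) + (nl1 (fcoeff g))\<^sup>2 * wl2 jb (fcoeff v)))"
    unfolding esum_cmult by (intro mult_left_mono weighted_young) auto
  also have "\<dots> \<le> ennreal (c - a) * (2 * ((nl1w (fcoeff g))\<^sup>2 * wl2 jb (fcoeff v) + (nl1w (fcoeff g))\<^sup>2 * wl2 jb (fcoeff v)))"
    by (intro mult_left_mono add_mono mult_mono nl2_le_wl2_jb power_mono nl1_le_nl1w) auto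
  also have "\<dots> = ennreal (c - a) * (4 * ((nl1w (fcoeff g))\<^sup>2 * wl2 jb (fcoeff v)))"
    by (simp add: mult_2[symmetric] mult.assoc[symmetric])
  finally show ?thesis .
qed

text \<open>The substitution of \<open>(j - k, j)\<close> for \<open>(k, j)\<close> moves the derivative from \<open>v\<close> to the commutator with the weight.\<close>

theorem energy:
  fixes w :: "int \<Rightarrow> real"
  assumes ac: "a \<le> c" and g0: "fcoeff g 0 = 0" and v0: "fcoeff v 0 = 0"
    and w: "\<And>k. 0 \<le> w k" "\<And>k. w (- k) = w k"
    and fin: "esum (\<lambda>k. ennreal (w k) * (ac v k * econv (ac g) (ac v) k)) < \<infinity>"
    and R: "esum (\<lambda>k. esum (\<lambda>j. ennreal \<bar>of_int k * w k - of_int (k - j) * w (k - j)\<bar> * (ac v k * (ac g j * ac v (k - j)))))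
       \<le> ennreal R" "0 \<le> R"
  shows "(\<lambda>k. of_real (w k) * cnj (fcoeff v k) * BB a c g v k) summable_on UNIV"
    and "\<bar>Re (\<Sum>\<^sub>\<infinity>k. of_real (w k) * cnj (fcoeff v k) * BB a c g v k)\<bar> \<le> (c - a) * R"
proof -
  \<comment> \<open>A single family over pairs, so that the sum over \<open>k\<close> of the pairing
    with \<open>BB\<close> and its rearrangement are both sums of \<open>F\<close>.\<close>
  define F where "F = (\<lambda>(k, j). of_real (w k) * cnj (fcoeff v k) *
     ((\<i> * of_int k / r2p) * (JJ a c (k * j * (k - j)) * (fcoeff g j * fcoeff v (k - j)))))"
  have sq1: "1 \<le> sqrt (2 * pi)" using pi_ge_two by simp
  have Fle: "ennreal (cmod (F (k, j))) \<le> ennreal (w k) * (ac v k * (ac g j * ac v (k - j)))" for k j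
  proof -
    have "cmod (F (k, j)) \<le> w k * (cmod (fcoeff v k) * (cmod (fcoeff g j) * cmod (fcoeff v (k - j))))"
    proof (cases "j = 0 \<or> k - j = 0")
      case False
      have "\<bar>of_int k\<bar> * cmod (JJ a c (k * j * (k - j))) \<le> 1" using False by (intro norm_mult_JJ_le_1 ac) auto
      then have "\<bar>of_int k\<bar> * cmod (JJ a c (k * j * (k - j))) / sqrt (2 * pi) \<le> 1"
        using order_trans[OF _ sq1] by (simp add: divide_le_eq)
      then have "(w k * cmod (fcoeff v k) * cmod (fcoeff g j) * cmod (fcoeff v (k - j))) * (\<bar>of_int k\<bar> * cmod (JJ a c (k * j * (k - j))) / sqrt (2 * pi))
        \<le> (w k * cmod (fcoeff v k) * cmod (fcoeff g j) * cmod (fcoeff v (k - j))) * 1" using w by (intro mult_left_mono) auto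
      then show ?thesis using w by (simp add: F_def norm_mult norm_divide mult_ac)
    qed (use g0 v0 w in \<open>auto simp: F_def\<close>)
    then show ?thesis using w by (simp add: ennreal_mult[symmetric] ennreal_leI)
  qed
  \<comment> \<open>The oscillation pays for the derivative here, and the summability is only
    qualitative; the smallness comes from the symmetrised terms below.\<close>
  have sF: "F summable_on UNIV"
  proof (rule esum_finite_imp_summable_on)
    have "esum (\<lambda>p. ennreal (cmod (F p))) = esum (\<lambda>k. esum (\<lambda>j. ennreal (cmod (F (k, j)))))"
      by (rule nn_integral_fst_count_space[symmetric])
    also have "\<dots> \<le> esum (\<lambda>k. esum (\<lambda>j. ennreal (w k) * (ac v k * (ac g j * ac v (k - j)))))" by (intro esum_mono Fle)
    also have "\<dots> = esum (\<lambda>k. ennreal (w k) * (ac v k * econv (ac g) (ac v) k))" by (simp add: esum_cmult econv_def)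
    finally show "esum (\<lambda>p. ennreal (cmod (F p))) < \<infinity>" using fin by (rule le_less_trans)
  qed
  have inner: "(\<Sum>\<^sub>\<infinity>j. F (k, j)) = of_real (w k) * cnj (fcoeff v k) * BB a c g v k" for k
    unfolding F_def BB_def prod.case by (simp only: infsum_cmult_right')
  have sF': "F summable_on Sigma UNIV (\<lambda>_. UNIV)" using sF by simp
  show "(\<lambda>k. of_real (w k) * cnj (fcoeff v k) * BB a c g v k) summable_on UNIV"
    using summable_on_Sigma_banach[of "\<lambda>k j. F (k, j)" UNIV "\<lambda>_. UNIV"] sF' by (simp add: inner)
  have tot: "(\<Sum>\<^sub>\<infinity>k. of_real (w k) * cnj (fcoeff v k) * BB a c g v k) = infsum F UNIV"
    using infsum_Sigma'_banach[of "\<lambda>k j. F (k, j)" UNIV "\<lambda>_. UNIV"] sF' by (simp add: inner)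
  \<comment> \<open>An involution that leaves the phase number \<open>k j (k - j)\<close> unchanged
    and, as \<open>g\<close> and \<open>v\<close> are real, exchanges the roles of the two
    coefficients of \<open>v\<close>. The factor \<open>k\<close> turns into
    \<open>-(k - j)\<close>, which produces the commutator.\<close>
  define \<sigma> where "\<sigma> = (\<lambda>(k :: int, j :: int). (j - k, j))"
  have bij: "bij_betw \<sigma> UNIV UNIV" by (rule bij_betwI[where g = \<sigma>]) (auto simp: \<sigma>_def)
  have re: "infsum (\<lambda>p. F (\<sigma> p)) UNIV = infsum F UNIV" by (rule infsum_reindex_bij_betw[OF bij])
  have sF\<sigma>: "(\<lambda>p. F (\<sigma> p)) summable_on UNIV" using sF summable_on_reindex_bij_betw[OF bij, of F] by simp
  have sum: "F (k, j) + F (\<sigma> (k, j)) = (\<i> / r2p) * JJ a c (k * j * (k - j)) *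
      of_real (of_int k * w k - of_int (k - j) * w (k - j)) * (cnj (fcoeff v k) * (fcoeff g j * fcoeff v (k - j)))" for k j
  proof -
    have e: "(j - k) * j * (j - k - j) = k * j * (k - j)" by (simp add: algebra_simps)
    have c1: "cnj (fcoeff v (j - k)) = fcoeff v (k - j)" using fcoeff_cnj[of v "j - k"] by simp
    have c2: "fcoeff v (j - k - j) = cnj (fcoeff v k)" using fcoeff_cnj[of v k] by simp
    have c3: "w (j - k) = w (k - j)" using w(2)[of "k - j"] by simp
    show ?thesis unfolding F_def \<sigma>_def prod.case e c1 c2 c3 by (simp add: field_simps)
  qed
  have "ennreal (cmod (infsum (\<lambda>p. F p + F (\<sigma> p)) UNIV)) \<le> esum (\<lambda>p. ennreal (cmod (F p + F (\<sigma> p))))"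
    by (rule norm_infsum_le_esum)
  also have "\<dots> = esum (\<lambda>k. esum (\<lambda>j. ennreal (cmod (F (k, j) + F (\<sigma> (k, j))))))" by (rule nn_integral_fst_count_space[symmetric])
  also have "\<dots> \<le> esum (\<lambda>k. esum (\<lambda>j. ennreal (c - a) * (ennreal \<bar>of_int k * w k - of_int (k - j) * w (k - j)\<bar> * (ac v k * (ac g j * ac v (k - j))))))"
  proof (intro esum_mono)
    fix k j
    let ?D = "\<bar>of_int k * w k - of_int (k - j) * w (k - j)\<bar>"
    let ?X = "?D * (cmod (fcoeff v k) * (cmod (fcoeff g j) * cmod (fcoeff v (k - j))))"
    have "cmod (F (k, j) + F (\<sigma> (k, j))) = (cmod (JJ a c (k * j * (k - j))) / sqrt (2 * pi)) * ?X"
      unfolding sum norm_mult norm_divide norm_of_real by (simp del: of_int_diff)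
    also have "\<dots> \<le> (c - a) * ?X"
    proof (intro mult_right_mono)
      have "cmod (JJ a c (k * j * (k - j))) / sqrt (2 * pi) \<le> cmod (JJ a c (k * j * (k - j))) / 1"
        using sq1 by (intro divide_left_mono) auto
      also have "\<dots> \<le> c - a" using norm_JJ_le[OF ac] by simp
      finally show "cmod (JJ a c (k * j * (k - j))) / sqrt (2 * pi) \<le> c - a" .
    qed auto
    finally show "ennreal (cmod (F (k, j) + F (\<sigma> (k, j)))) \<le> ennreal (c - a) * (ennreal ?D * (ac v k * (ac g j * ac v (k - j))))"
      using ac by (simp add: ennreal_mult[symmetric] ennreal_leI)
  qed
  also have "\<dots> \<le> ennreal (c - a) * ennreal R" unfolding esum_cmult by (intro mult_left_mono R) auto
  also have "\<dots> = ennreal ((c - a) * R)" using ac R(2) by (simp add: ennreal_mult)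
  finally have "cmod (infsum (\<lambda>p. F p + F (\<sigma> p)) UNIV) \<le> (c - a) * R" using ac R(2) by (subst (asm) ennreal_le_iff) auto
  moreover have "infsum (\<lambda>p. F p + F (\<sigma> p)) UNIV = infsum F UNIV + infsum F UNIV" using infsum_add[OF sF sF\<sigma>] re by simp
  \<comment> \<open>Both halves have the same sum, so the symmetrised series is twice the original.
    The resulting factor 1/2 is given away.\<close>
  ultimately have "2 * cmod (infsum F UNIV) \<le> (c - a) * R" by (simp add: mult_2[symmetric] norm_mult)
  moreover have "\<bar>Re (infsum F UNIV)\<bar> \<le> cmod (infsum F UNIV)" by (rule abs_Re_le_cmod)
  ultimately have "\<bar>Re (infsum F UNIV)\<bar> \<le> (c - a) * R" using norm_ge_zero[of "infsum F UNIV"] by linarith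
  then show "\<bar>Re (\<Sum>\<^sub>\<infinity>k. of_real (w k) * cnj (fcoeff v k) * BB a c g v k)\<bar> \<le> (c - a) * R" by (simp add: tot)
qed

section \<open>Stability of one step in \<open>L\<^sup>2\<close> and
  \<open>H\<^sup>1\<close>\<close>

lemma wl2_step_le:
  fixes w :: "int \<Rightarrow> real"
  assumes w: "\<And>k. 0 \<le> w k" and \<mu>: "0 \<le> \<mu>"
    and V: "wl2 w (fcoeff v) = ennreal V" "0 \<le> V"
    and B: "wl2 w b \<le> ennreal B" "0 \<le> B"
    and s: "(\<lambda>k. of_real (w k) * cnj (fcoeff v k) * b k) summable_on UNIV"
    and E: "\<bar>Re (\<Sum>\<^sub>\<infinity>k. of_real (w k) * cnj (fcoeff v k) * b k)\<bar> \<le> E"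
  shows "wl2 w (\<lambda>k. fcoeff v k + 2 * of_real \<mu> * b k) \<le> ennreal (V + 4 * \<mu> * E + 4 * \<mu>\<^sup>2 * B)"
proof -
  let ?p = "\<lambda>k. w k * (cmod (fcoeff v k))\<^sup>2" and ?q = "\<lambda>k. w k * (cmod (b k))\<^sup>2"
    and ?r = "\<lambda>k. Re (of_real (w k) * cnj (fcoeff v k) * b k)"
  have p: "?p summable_on UNIV" using V w by (intro esum_finite_imp_summable) (auto simp: wl2_def)
  have q: "?q summable_on UNIV" using B w by (intro esum_finite_imp_summable) (auto simp: wl2_def le_less_trans)
  have r: "(?r has_sum Re (\<Sum>\<^sub>\<infinity>k. of_real (w k) * cnj (fcoeff v k) * b k)) UNIV"
    using has_sum_bounded_linear[OF bounded_linear_Re has_sum_infsum[OF s]] by (simp add: o_def)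
  \<comment> \<open>In the expanded square only the cross term is critical: the quadratic term is
    already of the order of the interval, the cross term is so by \<open>energy\<close>.\<close>
  have eq: "w k * (cmod (fcoeff v k + 2 * of_real \<mu> * b k))\<^sup>2 = ?p k + 4 * \<mu> * ?r k + 4 * \<mu>\<^sup>2 * ?q k" for k
    unfolding cmod_power2 by (simp add: power2_eq_square algebra_simps)
  have "((\<lambda>k. w k * (cmod (fcoeff v k + 2 * of_real \<mu> * b k))\<^sup>2) has_sum
     (infsum ?p UNIV + 4 * \<mu> * Re (\<Sum>\<^sub>\<infinity>k. of_real (w k) * cnj (fcoeff v k) * b k) + 4 * \<mu>\<^sup>2 * infsum ?q UNIV)) UNIV"
    unfolding eq by (intro has_sum_add has_sum_cmult_right has_sum_infsum p q r)
  then have "wl2 w (\<lambda>k. fcoeff v k + 2 * of_real \<mu> * b k) =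
     ennreal (infsum ?p UNIV + 4 * \<mu> * Re (\<Sum>\<^sub>\<infinity>k. of_real (w k) * cnj (fcoeff v k) * b k) + 4 * \<mu>\<^sup>2 * infsum ?q UNIV)"
    unfolding wl2_def using w by (intro esum_has_sum) auto
  also have "\<dots> \<le> ennreal (V + 4 * \<mu> * E + 4 * \<mu>\<^sup>2 * B)"
  proof (intro ennreal_leI add_mono mult_left_mono)
    have "ennreal (infsum ?p UNIV) = ennreal V" using esum_eq_infsum[OF _ p] V w by (simp add: wl2_def)
    then show "infsum ?p UNIV \<le> V" using V(2) w by (simp add: infsum_nonneg)
    have "ennreal (infsum ?q UNIV) \<le> ennreal B" using esum_eq_infsum[OF _ q] B w by (simp add: wl2_def)
    then show "infsum ?q UNIV \<le> B" using B(2) by (simp add: ennreal_le_iff)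
    show "Re (\<Sum>\<^sub>\<infinity>k. of_real (w k) * cnj (fcoeff v k) * b k) \<le> E" using E by linarith
  qed (use \<mu> in auto)
  finally show ?thesis .
qed

lemma esum_mult_econv_sq_le:
  assumes "\<And>j. a j < \<infinity>"
  shows "(esum (\<lambda>k. c k * econv a b k))\<^sup>2 \<le> esum (\<lambda>k. (c k)\<^sup>2) * ((esum a)\<^sup>2 * esum (\<lambda>k. (b k)\<^sup>2))"
  by (rule order_trans[OF esum_Cauchy_Schwarz mult_left_mono[OF young_l1_l2]]) (use assms in auto)

lemma nl2_energy_le:
  "esum (\<lambda>k. ac v k * econv (acw g) (ac v) k) \<le> nl1w (fcoeff g) * nl2 (fcoeff v)"
proof (rule ennreal_square_le_cancel)
  have "(esum (\<lambda>k. ac v k * econv (acw g) (ac v) k))\<^sup>2 \<le> nl2 (fcoeff v) * ((nl1w (fcoeff g))\<^sup>2 * nl2 (fcoeff v))"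
    unfolding nl1w_def esum_ac_sq[symmetric] by (rule esum_mult_econv_sq_le) auto
  then show "(esum (\<lambda>k. ac v k * econv (acw g) (ac v) k))\<^sup>2 \<le> (nl1w (fcoeff g) * nl2 (fcoeff v))\<^sup>2"
    by (simp add: power_mult_distrib power2_eq_square mult_ac)
qed

text \<open>For the constant weight the commutator \<open>k - (k - j)\<close> is \<open>j\<close>
  and falls on \<open>g\<close>. The term linear in \<open>K\<close> comes from the cross term, the
  quadratic one from the squared norm of \<open>BB\<close>.\<close>

theorem nl2_stability:
  assumes ac: "a \<le> c" and g0: "fcoeff g 0 = 0" and v0: "fcoeff v 0 = 0"
    and K: "nl1w (fcoeff g) \<le> ennreal K" "0 \<le> K" and \<mu>: "0 \<le> \<mu>"
  shows "nl2 (\<lambda>k. fcoeff v k + 2 * of_real \<mu> * BB a c g v k)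
    \<le> ennreal (1 + (4 * \<mu> * K + 4 * \<mu>\<^sup>2 * K\<^sup>2) * (c - a)) * nl2 (fcoeff v)"
proof -
  let ?V = "(norm v)\<^sup>2"
  have V: "nl2 (fcoeff v) = ennreal ?V" by (rule nl2_fcoeff)
  have K1: "nl1 (fcoeff g) \<le> ennreal K" using nl1_le_nl1w K(1) by (rule order_trans)
  have fin: "esum (\<lambda>k. ennreal 1 * (ac v k * econv (ac g) (ac v) k)) < \<infinity>"
  proof -
    have "esum (\<lambda>k. ennreal 1 * (ac v k * econv (ac g) (ac v) k)) \<le> esum (\<lambda>k. ac v k * econv (acw g) (ac v) k)"
    proof (intro esum_mono)
      fix k
      have "econv (ac g) (ac v) k \<le> econv (acw g) (ac v) k"
      proof (rule econv_mono)
        fix j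
        have "1 * cmod (fcoeff g j) \<le> sqrt (jb j) * cmod (fcoeff g j)" using jb_ge_1[of j] by (intro mult_right_mono) auto
        then show "ac g j \<le> acw g j" by (simp add: ennreal_leI)
      qed simp
      then show "ennreal 1 * (ac v k * econv (ac g) (ac v) k) \<le> ac v k * econv (acw g) (ac v) k" by (simp add: mult_left_mono)
    qed
    also have "\<dots> \<le> nl1w (fcoeff g) * nl2 (fcoeff v)" by (rule nl2_energy_le)
    also have "\<dots> \<le> ennreal K * ennreal ?V" unfolding V by (intro mult_right_mono K) auto
    also have "\<dots> < \<infinity>" by (simp add: ennreal_mult_less_top)
    finally show ?thesis .
  qed
  have R: "esum (\<lambda>k. esum (\<lambda>j. ennreal \<bar>of_int k * 1 - of_int (k - j) * 1\<bar> * (ac v k * (ac g j * ac v (k - j)))))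
    \<le> ennreal (K * ?V)"
  proof -
    have "esum (\<lambda>k. esum (\<lambda>j. ennreal \<bar>of_int k * 1 - of_int (k - j) * 1\<bar> * (ac v k * (ac g j * ac v (k - j)))))
      \<le> esum (\<lambda>k. esum (\<lambda>j. ac v k * (acw g j * ac v (k - j))))"
    proof (intro esum_mono)
      fix k j
      have "\<bar>of_int j :: real\<bar> * (cmod (fcoeff v k) * (cmod (fcoeff g j) * cmod (fcoeff v (k - j))))
        \<le> sqrt (jb j) * (cmod (fcoeff v k) * (cmod (fcoeff g j) * cmod (fcoeff v (k - j))))"
        by (intro mult_right_mono abs_le_sqrt_jb) auto
      then show "ennreal \<bar>of_int k * 1 - of_int (k - j) * 1\<bar> * (ac v k * (ac g j * ac v (k - j)))
        \<le> ac v k * (acw g j * ac v (k - j))" using jb_pos[of j] by (simp add: ennreal_mult[symmetric] ennreal_leI mult_ac)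
    qed
    also have "\<dots> = esum (\<lambda>k. ac v k * econv (acw g) (ac v) k)" by (simp add: esum_cmult econv_def)
    also have "\<dots> \<le> nl1w (fcoeff g) * nl2 (fcoeff v)" by (rule nl2_energy_le)
    also have "\<dots> \<le> ennreal K * ennreal ?V" unfolding V by (intro mult_right_mono K) auto
    also have "\<dots> = ennreal (K * ?V)" using K by (simp add: ennreal_mult)
    finally show ?thesis .
  qed
  have B: "nl2 (BB a c g v) \<le> ennreal ((c - a) * (K\<^sup>2 * ?V))"
  proof -
    have "nl2 (BB a c g v) \<le> ennreal (c - a) * ((nl1 (fcoeff g))\<^sup>2 * nl2 (fcoeff v))" by (rule nl2_BB_le[OF ac g0 v0])
    also have "\<dots> \<le> ennreal (c - a) * ((ennreal K)\<^sup>2 * ennreal ?V)"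
      unfolding V by (intro mult_left_mono mult_right_mono power_mono K1) auto
    also have "\<dots> = ennreal ((c - a) * (K\<^sup>2 * ?V))" using K ac by (simp add: ennreal_mult ennreal_power)
    finally show ?thesis .
  qed
  note e = energy[where w = "\<lambda>_. 1", OF ac g0 v0 _ _ fin R]
  have "nl2 (\<lambda>k. fcoeff v k + 2 * of_real \<mu> * BB a c g v k)
     \<le> ennreal (?V + 4 * \<mu> * ((c - a) * (K * ?V)) + 4 * \<mu>\<^sup>2 * ((c - a) * (K\<^sup>2 * ?V)))"
    using K ac by (intro wl2_step_le[OF _ \<mu> V _ B] e) auto
  also have "?V + 4 * \<mu> * ((c - a) * (K * ?V)) + 4 * \<mu>\<^sup>2 * ((c - a) * (K\<^sup>2 * ?V))
    = (1 + (4 * \<mu> * K + 4 * \<mu>\<^sup>2 * K\<^sup>2) * (c - a)) * ?V" by (simp add: algebra_simps)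
  also have "ennreal \<dots> = ennreal (1 + (4 * \<mu> * K + 4 * \<mu>\<^sup>2 * K\<^sup>2) * (c - a)) * nl2 (fcoeff v)"
    unfolding V using K ac \<mu> by (intro ennreal_mult) auto
  finally show ?thesis .
qed

text \<open>With \<open>x = y - z\<close> one has
  \<open>y ^ 3 - z ^ 3 = 3 x y z + x\<^sup>2 (y - z)\<close>. In this form no copy of
  \<open>v\<close> carries more than one derivative and \<open>g\<close> carries at most two, as
  many as \<psi> has.\<close>

lemma weight_symbol_le:
  fixes k j :: int
  shows "\<bar>of_int k * jb k - of_int (k - j) * jb (k - j)\<bar>
    \<le> 3 * (sqrt (jb j) * (sqrt (jb k) * sqrt (jb (k - j)))) + jb j * (sqrt (jb k) + sqrt (jb (k - j)))"
proof -
  define x y z :: real where "x = of_int j" and "y = of_int k" and "z = of_int (k - j)"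
  have xyz: "x = y - z" by (simp add: x_def y_def z_def)
  have s: "\<bar>x\<bar> \<le> sqrt (jb j)" "\<bar>y\<bar> \<le> sqrt (jb k)" "\<bar>z\<bar> \<le> sqrt (jb (k - j))" unfolding x_def y_def z_def by (rule abs_le_sqrt_jb)+
  have id: "y * (1 + y\<^sup>2) - z * (1 + z\<^sup>2) = x * (1 + 3 * (y * z)) + x\<^sup>2 * (y - z)"
    unfolding xyz by (simp add: power2_eq_square algebra_simps)
  have m: "(1 + \<bar>y\<bar> * \<bar>z\<bar>) \<le> sqrt (jb k) * sqrt (jb (k - j))"
  proof -
    have "2 * (\<bar>y\<bar> * \<bar>z\<bar>) \<le> y\<^sup>2 + z\<^sup>2" using sum_squares_bound[of "\<bar>y\<bar>" "\<bar>z\<bar>"] by simp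
    then have "(1 + \<bar>y\<bar> * \<bar>z\<bar>)\<^sup>2 \<le> (1 + y\<^sup>2) * (1 + z\<^sup>2)" by (simp add: power2_sum power_mult_distrib algebra_simps)
    then have "(1 + \<bar>y\<bar> * \<bar>z\<bar>) \<le> sqrt ((1 + y\<^sup>2) * (1 + z\<^sup>2))" by (rule real_le_rsqrt)
    then show ?thesis by (simp add: real_sqrt_mult jb_def y_def z_def)
  qed
  have "\<bar>y * (1 + y\<^sup>2) - z * (1 + z\<^sup>2)\<bar> \<le> \<bar>x\<bar> * \<bar>1 + 3 * (y * z)\<bar> + x\<^sup>2 * \<bar>y - z\<bar>"
    unfolding id by (rule order_trans[OF abs_triangle_ineq]) (simp add: abs_mult)
  also have "\<dots> \<le> sqrt (jb j) * (3 * (sqrt (jb k) * sqrt (jb (k - j)))) + jb j * (sqrt (jb k) + sqrt (jb (k - j)))"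
  proof (intro add_mono mult_mono s)
    have "\<bar>1 + 3 * (y * z)\<bar> \<le> 1 + 3 * (\<bar>y\<bar> * \<bar>z\<bar>)" using abs_triangle_ineq[of 1 "3 * (y * z)"] by (simp add: abs_mult)
    also have "\<dots> \<le> 3 * (sqrt (jb k) * sqrt (jb (k - j)))" using m by simp
    finally show "\<bar>1 + 3 * (y * z)\<bar> \<le> 3 * (sqrt (jb k) * sqrt (jb (k - j)))" .
    show "x\<^sup>2 \<le> jb j" by (simp add: x_def jb_def)
    show "\<bar>y - z\<bar> \<le> sqrt (jb k) + sqrt (jb (k - j))" using s by linarith
  qed (use jb_pos[of j] in auto)
  finally show ?thesis by (simp add: x_def y_def z_def jb_def mult_ac)
qed

text \<open>The three trilinear forms left by \<open>weight_symbol_le\<close>. In each, one factor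
  is summed absolutely, either \<open>g\<close> with one derivative or \<open>v\<close> with none,
  and the other two are in \<open>\<ell>\<^sup>2\<close>; the absolute sums cost the same factor
  \<open>sqrt cjb\<close> each time.\<close>

lemma wl2_energy_le:
  assumes "hl2 (fcoeff g) \<le> ennreal (K\<^sup>2)" "0 \<le> K"
  shows "esum (\<lambda>k. acw v k * econv (acw g) (acw v) k) \<le> ennreal (sqrt cjb * K) * wl2 jb (fcoeff v)"
    and "esum (\<lambda>k. acw v k * econv (acj g) (ac v) k) \<le> ennreal (sqrt cjb * K) * wl2 jb (fcoeff v)"
    and "esum (\<lambda>k. ac v k * econv (acj g) (acw v) k) \<le> ennreal (sqrt cjb * K) * wl2 jb (fcoeff v)"
proof -
  let ?V = "wl2 jb (fcoeff v)" and ?W = "hl2 (fcoeff g)"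
  have sq: "x \<le> ennreal (sqrt cjb * K) * ?V" if "x\<^sup>2 \<le> Cjb * ?W * (?V)\<^sup>2" for x
  proof (rule ennreal_square_le_cancel)
    note that
    also have "Cjb * ?W * (?V)\<^sup>2 \<le> Cjb * ennreal (K\<^sup>2) * (?V)\<^sup>2" by (intro mult_left_mono mult_right_mono assms) auto
    also have "\<dots> = (ennreal (sqrt cjb * K) * ?V)\<^sup>2" using cjb_nonneg assms(2)
      by (simp add: Cjb_eq power_mult_distrib ennreal_power ennreal_mult[symmetric])
    finally show "x\<^sup>2 \<le> (ennreal (sqrt cjb * K) * ?V)\<^sup>2" .
  qed
  have l1w: "(nl1w (fcoeff g))\<^sup>2 \<le> Cjb * ?W" by (rule nl1w_sq_le)
  have l1: "(nl1 (fcoeff v))\<^sup>2 \<le> Cjb * ?V" by (rule nl1_sq_le)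
  show "esum (\<lambda>k. acw v k * econv (acw g) (acw v) k) \<le> ennreal (sqrt cjb * K) * ?V"
  proof (rule sq)
    have "(esum (\<lambda>k. acw v k * econv (acw g) (acw v) k))\<^sup>2 \<le> ?V * ((nl1w (fcoeff g))\<^sup>2 * ?V)"
      unfolding nl1w_def esum_acw_sq[symmetric] by (rule esum_mult_econv_sq_le) auto
    also have "\<dots> \<le> ?V * ((Cjb * ?W) * ?V)" by (intro mult_left_mono mult_right_mono l1w) auto
    finally show "(esum (\<lambda>k. acw v k * econv (acw g) (acw v) k))\<^sup>2 \<le> Cjb * ?W * (?V)\<^sup>2" by (simp add: power2_eq_square mult_ac)
  qed
  show "esum (\<lambda>k. acw v k * econv (acj g) (ac v) k) \<le> ennreal (sqrt cjb * K) * ?V"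
  proof (rule sq)
    have "(esum (\<lambda>k. acw v k * econv (ac v) (acj g) k))\<^sup>2 \<le> ?V * ((nl1 (fcoeff v))\<^sup>2 * ?W)"
      unfolding nl1_def esum_acw_sq[symmetric] esum_acj_sq[symmetric] by (rule esum_mult_econv_sq_le) auto
    also have "\<dots> \<le> ?V * ((Cjb * ?V) * ?W)" by (intro mult_left_mono mult_right_mono l1) auto
    finally show "(esum (\<lambda>k. acw v k * econv (acj g) (ac v) k))\<^sup>2 \<le> Cjb * ?W * (?V)\<^sup>2"
      by (simp add: econv_commute[of "acj g"] power2_eq_square mult_ac)
  qed
  show "esum (\<lambda>k. ac v k * econv (acj g) (acw v) k) \<le> ennreal (sqrt cjb * K) * ?V"
  proof (rule sq)
    have s: "(econv (acj g) (acw v) k)\<^sup>2 \<le> ?W * ?V" for k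
      unfolding esum_acj_sq[symmetric] esum_acw_sq[symmetric] by (rule econv_Cauchy_Schwarz)
    have "(esum (\<lambda>k. ac v k * econv (acj g) (acw v) k))\<^sup>2
       \<le> nl1 (fcoeff v) * esum (\<lambda>k. ac v k * (econv (acj g) (acw v) k)\<^sup>2)"
      unfolding nl1_def by (rule esum_weighted_Cauchy_Schwarz) auto
    also have "\<dots> \<le> nl1 (fcoeff v) * esum (\<lambda>k. ac v k * (?W * ?V))" by (intro mult_left_mono esum_mono s) auto
    also have "\<dots> = (nl1 (fcoeff v))\<^sup>2 * (?W * ?V)" unfolding esum_multc by (simp add: nl1_def power2_eq_square mult_ac)
    also have "\<dots> \<le> (Cjb * ?V) * (?W * ?V)" by (intro mult_right_mono l1) auto
    finally show "(esum (\<lambda>k. ac v k * econv (acj g) (acw v) k))\<^sup>2 \<le> Cjb * ?W * (?V)\<^sup>2" by (simp add: power2_eq_square mult_ac)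
  qed
qed

text \<open>As for \<open>L\<^sup>2\<close>, with the cross term controlled through the commutator
  of the weight \<open>jb\<close>. The constant 20 is 4 from the expanded square times the 5 below,
  and 16 is 4 times the 4 of \<open>wl2_BB_le\<close>.\<close>

theorem wl2_stability:
  assumes ac: "a \<le> c" and g0: "fcoeff g 0 = 0" and v0: "fcoeff v 0 = 0"
    and K: "hl2 (fcoeff g) \<le> ennreal (K\<^sup>2)" "0 \<le> K" and \<mu>: "0 \<le> \<mu>"
    and finV: "wl2 jb (fcoeff v) < \<infinity>"
  shows "wl2 jb (\<lambda>k. fcoeff v k + 2 * of_real \<mu> * BB a c g v k)
    \<le> ennreal (1 + (20 * \<mu> * (sqrt cjb * K) + 16 * \<mu>\<^sup>2 * (cjb * K\<^sup>2)) * (c - a)) * wl2 jb (fcoeff v)"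
proof -
  let ?W = "hl2 (fcoeff g)"
  obtain V where V: "wl2 jb (fcoeff v) = ennreal V" "0 \<le> V" using finV by (cases "wl2 jb (fcoeff v)") auto
  let ?L = "sqrt cjb * K"
  have L: "0 \<le> ?L" using K cjb_nonneg by simp
  have jb0: "0 \<le> jb k" for k using jb_pos[of k] by simp
  note e3 = wl2_energy_le[OF K(1,2), of v, unfolded V(1)]
  have l1w: "(nl1w (fcoeff g))\<^sup>2 \<le> ennreal (cjb * K\<^sup>2)"
  proof -
    have "(nl1w (fcoeff g))\<^sup>2 \<le> Cjb * ?W" by (rule nl1w_sq_le)
    also have "\<dots> \<le> ennreal cjb * ennreal (K\<^sup>2)" unfolding Cjb_eq by (intro mult_left_mono K) auto
    finally show ?thesis using cjb_nonneg by (simp add: ennreal_mult[symmetric])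
  qed
  \<comment> \<open>The 5 is 3 + 1 + 1, the multiplicities of the three forms in the bound of the
    symbol.\<close>
  have sum_eq: "esum (\<lambda>k. 3 * (acw v k * econv (acw g) (acw v) k) + (acw v k * econv (acj g) (ac v) k + ac v k * econv (acj g) (acw v) k))
      \<le> ennreal (5 * (?L * V))"
  proof -
    have "esum (\<lambda>k. 3 * (acw v k * econv (acw g) (acw v) k) + (acw v k * econv (acj g) (ac v) k + ac v k * econv (acj g) (acw v) k))
      = 3 * esum (\<lambda>k. acw v k * econv (acw g) (acw v) k)
        + (esum (\<lambda>k. acw v k * econv (acj g) (ac v) k) + esum (\<lambda>k. ac v k * econv (acj g) (acw v) k))"
      by (simp add: esum_add esum_cmult)
    also have "\<dots> \<le> 3 * (ennreal ?L * ennreal V) + (ennreal ?L * ennreal V + ennreal ?L * ennreal V)"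
      by (intro add_mono mult_left_mono e3) auto
    also have "\<dots> = 5 * (ennreal ?L * ennreal V)"
    proof -
      have "3 * z + (z + z) = 5 * z" for z :: ennreal by (simp flip: mult_2 distrib_right)
      then show ?thesis .
    qed
    also have "\<dots> = ennreal (5 * (?L * V))"
      using L V(2) by (simp only: ennreal_mult[symmetric] ennreal_numeral[symmetric] mult_nonneg_nonneg zero_le_numeral)
    finally show ?thesis .
  qed
  have R: "esum (\<lambda>k. esum (\<lambda>j. ennreal \<bar>of_int k * jb k - of_int (k - j) * jb (k - j)\<bar> * (ac v k * (ac g j * ac v (k - j)))))
    \<le> ennreal (5 * (?L * V))"
  proof (rule order_trans[OF _ sum_eq], intro esum_mono)
    fix k
    have "esum (\<lambda>j. ennreal \<bar>of_int k * jb k - of_int (k - j) * jb (k - j)\<bar> * (ac v k * (ac g j * ac v (k - j))))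
      \<le> esum (\<lambda>j. 3 * (acw v k * (acw g j * acw v (k - j))) + (acw v k * (acj g j * ac v (k - j)) + ac v k * (acj g j * acw v (k - j))))"
    proof (intro esum_mono)
      fix j
      let ?x = "cmod (fcoeff v k)" and ?y = "cmod (fcoeff g j)" and ?z = "cmod (fcoeff v (k - j))"
      have "\<bar>of_int k * jb k - of_int (k - j) * jb (k - j)\<bar> * (?x * (?y * ?z)) \<le>
        (3 * (sqrt (jb j) * (sqrt (jb k) * sqrt (jb (k - j)))) + jb j * (sqrt (jb k) + sqrt (jb (k - j)))) * (?x * (?y * ?z))"
        by (intro mult_right_mono weight_symbol_le) auto
      also have "\<dots> = 3 * ((sqrt (jb k) * ?x) * ((sqrt (jb j) * ?y) * (sqrt (jb (k - j)) * ?z)))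
         + ((sqrt (jb k) * ?x) * ((jb j * ?y) * ?z) + ?x * ((jb j * ?y) * (sqrt (jb (k - j)) * ?z)))" by (simp add: algebra_simps)
      finally have "ennreal (\<bar>of_int k * jb k - of_int (k - j) * jb (k - j)\<bar> * (?x * (?y * ?z))) \<le> ennreal \<dots>"
        by (rule ennreal_leI)
      then show "ennreal \<bar>of_int k * jb k - of_int (k - j) * jb (k - j)\<bar> * (ac v k * (ac g j * ac v (k - j)))
        \<le> 3 * (acw v k * (acw g j * acw v (k - j))) + (acw v k * (acj g j * ac v (k - j)) + ac v k * (acj g j * acw v (k - j)))"
        using jb0 by (simp add: ennreal_mult ennreal_plus)
    qed
    also have "\<dots> = 3 * (acw v k * econv (acw g) (acw v) k) + (acw v k * econv (acj g) (ac v) k + ac v k * econv (acj g) (acw v) k)"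
      by (simp add: esum_add esum_cmult econv_def)
    finally show "esum (\<lambda>j. ennreal \<bar>of_int k * jb k - of_int (k - j) * jb (k - j)\<bar> * (ac v k * (ac g j * ac v (k - j)))) \<le> \<dots>" .
  qed
  \<comment> \<open>Half of the weight is given to \<open>v\<close> and half to the convolution, so
    that Cauchy-Schwarz needs no more than \<open>H\<^sup>1\<close> of \<open>v\<close>.\<close>
  have fin: "esum (\<lambda>k. ennreal (jb k) * (ac v k * econv (ac g) (ac v) k)) < \<infinity>"
  proof -
    have "esum (\<lambda>k. ennreal (jb k) * (ac v k * econv (ac g) (ac v) k))
       = esum (\<lambda>k. acw v k * (ennreal (sqrt (jb k)) * econv (ac g) (ac v) k))"
    proof (intro nn_integral_cong)
      fix k
      have "ennreal (jb k) = ennreal (sqrt (jb k)) * ennreal (sqrt (jb k))" using jb0[of k] by (simp add: ennreal_mult[symmetric])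
      then show "ennreal (jb k) * (ac v k * econv (ac g) (ac v) k) = acw v k * (ennreal (sqrt (jb k)) * econv (ac g) (ac v) k)"
        using jb0[of k] by (simp add: ennreal_mult mult_ac)
    qed
    then have "(esum (\<lambda>k. ennreal (jb k) * (ac v k * econv (ac g) (ac v) k)))\<^sup>2
      \<le> wl2 jb (fcoeff v) * esum (\<lambda>k. (ennreal (sqrt (jb k)) * econv (ac g) (ac v) k)\<^sup>2)"
      unfolding esum_acw_sq[symmetric] by (simp only: esum_Cauchy_Schwarz)
    also have "\<dots> \<le> wl2 jb (fcoeff v) * (2 * ((nl1w (fcoeff g))\<^sup>2 * nl2 (fcoeff v) + (nl1 (fcoeff g))\<^sup>2 * wl2 jb (fcoeff v)))"
      by (intro mult_left_mono weighted_young) auto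
    also have "\<dots> \<le> wl2 jb (fcoeff v) * (2 * ((nl1w (fcoeff g))\<^sup>2 * wl2 jb (fcoeff v) + (nl1w (fcoeff g))\<^sup>2 * wl2 jb (fcoeff v)))"
      by (intro mult_left_mono add_mono mult_mono nl2_le_wl2_jb power_mono nl1_le_nl1w) auto
    also have "\<dots> \<le> ennreal V * (2 * (ennreal (cjb * K\<^sup>2) * ennreal V + ennreal (cjb * K\<^sup>2) * ennreal V))"
      unfolding V by (intro mult_left_mono add_mono mult_right_mono l1w) auto
    also have "\<dots> < \<infinity>" by (simp add: ennreal_mult_less_top)
    finally show ?thesis by (simp add: power_less_top_ennreal)
  qed
  have B: "wl2 jb (BB a c g v) \<le> ennreal ((c - a) * (4 * (cjb * K\<^sup>2 * V)))"
  proof -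
    have "wl2 jb (BB a c g v) \<le> ennreal (c - a) * (4 * ((nl1w (fcoeff g))\<^sup>2 * wl2 jb (fcoeff v)))"
      by (rule wl2_BB_le[OF ac g0 v0])
    also have "\<dots> \<le> ennreal (c - a) * (4 * (ennreal (cjb * K\<^sup>2) * ennreal V))"
      unfolding V by (intro mult_left_mono mult_right_mono l1w) auto
    also have "\<dots> = ennreal ((c - a) * (4 * (cjb * K\<^sup>2 * V)))" using ac cjb_nonneg V(2) by (simp add: ennreal_mult)
    finally show ?thesis .
  qed
  have R0: "0 \<le> 5 * (?L * V)" using L V(2) by simp
  note e = energy[where w = jb, OF ac g0 v0 jb0 jb_minus fin R R0]
  have "wl2 jb (\<lambda>k. fcoeff v k + 2 * of_real \<mu> * BB a c g v k)
     \<le> ennreal (V + 4 * \<mu> * ((c - a) * (5 * (?L * V))) + 4 * \<mu>\<^sup>2 * ((c - a) * (4 * (cjb * K\<^sup>2 * V))))"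
    using ac cjb_nonneg V(2) by (intro wl2_step_le[OF jb0 \<mu> V B _ e]) auto
  also have "V + 4 * \<mu> * ((c - a) * (5 * (?L * V))) + 4 * \<mu>\<^sup>2 * ((c - a) * (4 * (cjb * K\<^sup>2 * V)))
    = (1 + (20 * \<mu> * ?L + 16 * \<mu>\<^sup>2 * (cjb * K\<^sup>2)) * (c - a)) * V" by (simp add: algebra_simps)
  also have "ennreal \<dots> = ennreal (1 + (20 * \<mu> * ?L + 16 * \<mu>\<^sup>2 * (cjb * K\<^sup>2)) * (c - a)) * wl2 jb (fcoeff v)"
    unfolding V using L ac \<mu> V(2) cjb_nonneg by (intro ennreal_mult) auto
  finally show ?thesis .
qed

section \<open>The stochastic convolution\<close>

locale cyl_wiener = prob_space M for M :: "'w measure" +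
  fixes F :: "real \<Rightarrow> 'w measure" and \<beta> :: "nat \<Rightarrow> real \<Rightarrow> 'w \<Rightarrow> real" and e :: "nat \<Rightarrow> l2_torus"
  assumes filt: "complete_filtered_prob_space M F" and cyl: "cylindrical_wiener M F \<beta> e"
begin

lemma bm: "brownian_motion M F (\<beta> k)" using cyl by (simp add: cylindrical_wiener_def)

lemma bm_measurable_F: "0 \<le> t \<Longrightarrow> \<beta> k t \<in> borel_measurable (F t)" using bm[of k] by (simp add: brownian_motion_def)

lemma subalg: "0 \<le> t \<Longrightarrow> subalgebra M (F t)" using filt by (simp add: complete_filtered_prob_space_def)

lemma bm_measurable [measurable]: "0 \<le> t \<Longrightarrow> \<beta> k t \<in> borel_measurable M"
  using bm_measurable_F subalg measurable_from_subalg by blast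

lemma bm_incr_dist: "0 \<le> s \<Longrightarrow> s < t \<Longrightarrow>
    distributed M lborel (\<lambda>\<omega>. \<beta> k t \<omega> - \<beta> k s \<omega>) (normal_density 0 (sqrt (t - s)))"
  using bm[of k] by (simp add: brownian_motion_def)

lemma bm_incr_moments:
  assumes "0 \<le> s" "s < t"
  shows "integrable M (\<lambda>\<omega>. \<beta> k t \<omega> - \<beta> k s \<omega>)" "expectation (\<lambda>\<omega>. \<beta> k t \<omega> - \<beta> k s \<omega>) = 0"
    "integrable M (\<lambda>\<omega>. (\<beta> k t \<omega> - \<beta> k s \<omega>)\<^sup>2)" "expectation (\<lambda>\<omega>. (\<beta> k t \<omega> - \<beta> k s \<omega>)\<^sup>2) = t - s"
proof -
  have p: "0 < sqrt (t - s)" using assms by simp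
  note D = bm_incr_dist[OF assms, of k]
  show "integrable M (\<lambda>\<omega>. \<beta> k t \<omega> - \<beta> k s \<omega>)"
    using distributed_integrable[OF D, of "\<lambda>x. x"] integrable_normal_moment[OF p, of 0 1] by simp
  show "integrable M (\<lambda>\<omega>. (\<beta> k t \<omega> - \<beta> k s \<omega>)\<^sup>2)"
    using distributed_integrable[OF D, of "\<lambda>x. x\<^sup>2"] integrable_normal_moment[OF p, of 0 2] by simp
  show E: "expectation (\<lambda>\<omega>. \<beta> k t \<omega> - \<beta> k s \<omega>) = 0" by (rule normal_distributed_expectation[OF p D])
  show "expectation (\<lambda>\<omega>. (\<beta> k t \<omega> - \<beta> k s \<omega>)\<^sup>2) = t - s" using normal_distributed_variance[OF p D] E assms by simp
qed

lemma bm_zero: "AE \<omega> in M. \<beta> k 0 \<omega> = 0" using bm[of k] by (simp add: brownian_motion_def)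

lemma bm_moments:
  assumes t: "0 \<le> t"
  shows "integrable M (\<beta> k t)" "expectation (\<beta> k t) = 0"
    "integrable M (\<lambda>\<omega>. (\<beta> k t \<omega>)\<^sup>2)" "expectation (\<lambda>\<omega>. (\<beta> k t \<omega>)\<^sup>2) = t"
proof -
  have m: "\<beta> k t \<in> borel_measurable M" "\<beta> k 0 \<in> borel_measurable M" using t by auto
  have a1: "AE \<omega> in M. \<beta> k t \<omega> = \<beta> k t \<omega> - \<beta> k 0 \<omega>" and a2: "AE \<omega> in M. (\<beta> k t \<omega>)\<^sup>2 = (\<beta> k t \<omega> - \<beta> k 0 \<omega>)\<^sup>2"
    using bm_zero[of k] by (auto elim: eventually_mono)
  have "integrable M (\<lambda>\<omega>. \<beta> k t \<omega> - \<beta> k 0 \<omega>) \<and> expectation (\<lambda>\<omega>. \<beta> k t \<omega> - \<beta> k 0 \<omega>) = 0 \<and>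
    integrable M (\<lambda>\<omega>. (\<beta> k t \<omega> - \<beta> k 0 \<omega>)\<^sup>2) \<and> expectation (\<lambda>\<omega>. (\<beta> k t \<omega> - \<beta> k 0 \<omega>)\<^sup>2) = t"
    using bm_incr_moments[of 0 t k] t by (cases "t = 0") auto
  moreover have "integrable M (\<beta> k t) \<longleftrightarrow> integrable M (\<lambda>\<omega>. \<beta> k t \<omega> - \<beta> k 0 \<omega>)"
    "integrable M (\<lambda>\<omega>. (\<beta> k t \<omega>)\<^sup>2) \<longleftrightarrow> integrable M (\<lambda>\<omega>. (\<beta> k t \<omega> - \<beta> k 0 \<omega>)\<^sup>2)"
    using m a1 a2 by (intro integrable_cong_AE; simp)+
  moreover have "expectation (\<beta> k t) = expectation (\<lambda>\<omega>. \<beta> k t \<omega> - \<beta> k 0 \<omega>)"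
    "expectation (\<lambda>\<omega>. (\<beta> k t \<omega>)\<^sup>2) = expectation (\<lambda>\<omega>. (\<beta> k t \<omega> - \<beta> k 0 \<omega>)\<^sup>2)"
    using m a1 a2 by (intro integral_cong_AE; simp)+
  ultimately show "integrable M (\<beta> k t)" "expectation (\<beta> k t) = 0"
    "integrable M (\<lambda>\<omega>. (\<beta> k t \<omega>)\<^sup>2)" "expectation (\<lambda>\<omega>. (\<beta> k t \<omega>)\<^sup>2) = t" by simp_all
qed

text \<open>The definition makes the increment independent of \<open>F s\<close>. As
  \<open>\<beta> k s\<close> is measurable for \<open>F s\<close>, this restricts to the sigma
  algebras of the two variables.\<close>

lemma bm_indep_incr:
  assumes "0 \<le> s" "s < t"
  shows "indep_var borel (\<beta> k s) borel (\<lambda>\<omega>. \<beta> k t \<omega> - \<beta> k s \<omega>)" unfolding indep_var_eq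
proof (intro conjI)
  show "\<beta> k s \<in> borel_measurable M" "(\<lambda>\<omega>. \<beta> k t \<omega> - \<beta> k s \<omega>) \<in> borel_measurable M" using assms by auto
  let ?B = "{(\<lambda>\<omega>. \<beta> k t \<omega> - \<beta> k s \<omega>) -` A \<inter> space M | A. A \<in> sets borel}"
  have i: "indep_set (sets (F s)) ?B" using bm[of k] assms by (simp add: brownian_motion_def)
  have sp: "space (F s) = space M" using subalg[of s] assms by (simp add: subalgebra_def)
  have sub: "{\<beta> k s -` A \<inter> space M | A. A \<in> sets borel} \<subseteq> sets (F s)"
    using measurable_sets[OF bm_measurable_F[OF assms(1), of k]] sp by auto
  have "indep_set {\<beta> k s -` A \<inter> space M | A. A \<in> sets borel} ?B" using i sub unfolding indep_sets2_eq by blast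
  then show "indep_set (sigma_sets (space M) {\<beta> k s -` A \<inter> space M | A. A \<in> sets borel}) (sigma_sets (space M) ?B)"
  proof (rule indep_set_sigma_sets)
    have "Int_stable {X -` A \<inter> space M | A. A \<in> sets borel}" for X :: "'w \<Rightarrow> real" unfolding Int_stable_def
    proof (intro ballI)
      fix a b assume "a \<in> {X -` A \<inter> space M | A. A \<in> sets borel}" "b \<in> {X -` A \<inter> space M | A. A \<in> sets borel}"
      then obtain A B where "a = X -` A \<inter> space M" "b = X -` B \<inter> space M" "A \<in> sets borel" "B \<in> sets borel" by auto
      then have "a \<inter> b = X -` (A \<inter> B) \<inter> space M" "A \<inter> B \<in> sets borel" by auto
      then show "a \<inter> b \<in> {X -` A \<inter> space M | A. A \<in> sets borel}" by blast
    qed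
    then show "Int_stable {\<beta> k s -` A \<inter> space M | A. A \<in> sets borel}" "Int_stable ?B" by auto
  qed
qed

lemma bm_cov_le:
  assumes "0 \<le> s" "s \<le> t"
  shows "integrable M (\<lambda>\<omega>. \<beta> k s \<omega> * \<beta> k t \<omega>)" "expectation (\<lambda>\<omega>. \<beta> k s \<omega> * \<beta> k t \<omega>) = s"
proof -
  have "integrable M (\<lambda>\<omega>. \<beta> k s \<omega> * \<beta> k t \<omega>) \<and> expectation (\<lambda>\<omega>. \<beta> k s \<omega> * \<beta> k t \<omega>) = s"
  proof (cases "s = t")
    case True
    then show ?thesis using bm_moments[of s k] assms by (simp add: power2_eq_square)
  next
    case False
    then have st: "s < t" using assms by simp
    note m = bm_moments[OF assms(1), of k] and m' = bm_incr_moments[OF assms(1) st, of k]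
    note i = indep_var_lebesgue_integral[OF bm_indep_incr[OF assms(1) st] m(1) m'(1)]
      indep_var_integrable[OF bm_indep_incr[OF assms(1) st] m(1) m'(1)]
    have eq: "(\<lambda>\<omega>. \<beta> k s \<omega> * \<beta> k t \<omega>) = (\<lambda>\<omega>. \<beta> k s \<omega> * (\<beta> k t \<omega> - \<beta> k s \<omega>) + (\<beta> k s \<omega>)\<^sup>2)"
      by (simp add: algebra_simps power2_eq_square)
    show ?thesis unfolding eq using i m by simp
  qed
  then show "integrable M (\<lambda>\<omega>. \<beta> k s \<omega> * \<beta> k t \<omega>)" "expectation (\<lambda>\<omega>. \<beta> k s \<omega> * \<beta> k t \<omega>) = s" by auto
qed

lemma bm_cov:
  assumes "0 \<le> s" "0 \<le> t"
  shows "integrable M (\<lambda>\<omega>. \<beta> j s \<omega> * \<beta> k t \<omega>)"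
    "expectation (\<lambda>\<omega>. \<beta> j s \<omega> * \<beta> k t \<omega>) = (if j = k then min s t else 0)"
proof -
  have "integrable M (\<lambda>\<omega>. \<beta> j s \<omega> * \<beta> k t \<omega>) \<and>
    expectation (\<lambda>\<omega>. \<beta> j s \<omega> * \<beta> k t \<omega>) = (if j = k then min s t else 0)"
  proof (cases "j = k")
    case True
    show ?thesis
    proof (cases "s \<le> t")
      case st: True
      then show ?thesis using bm_cov_le[OF assms(1) st, of k] True by simp
    next
      case False
      then show ?thesis using bm_cov_le[OF assms(2), of s k] True by (simp add: mult.commute)
    qed
  next
    case False
    \<comment> \<open>One sampling time per index reads the two Brownian motions, at different
      times, off the single independent family of processes.\<close>
    define r where "r i = (if i = j then s else t)" for i
    have r: "r i \<in> {0..}" for i using assms by (simp add: r_def)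
    have "indep_vars (\<lambda>k. Pi\<^sub>M {0..} (\<lambda>t. borel)) (\<lambda>k \<omega>. \<lambda>t\<in>{0..}. \<beta> k t \<omega>) UNIV" using cyl by (simp add: cylindrical_wiener_def)
    then have "indep_vars (\<lambda>i. borel) (\<lambda>i \<omega>. (\<lambda>x. x (r i)) (\<lambda>t\<in>{0..}. \<beta> i t \<omega>)) UNIV"
      by (rule indep_vars_compose2) (rule measurable_component_singleton[OF r])
    then have "indep_vars (\<lambda>i. borel) (\<lambda>i \<omega>. (\<lambda>x. x (r i)) (\<lambda>t\<in>{0..}. \<beta> i t \<omega>)) {j, k}" by (rule indep_vars_subset) simp
    then have iv: "indep_vars (\<lambda>i. borel) (\<lambda>i. \<beta> i (r i)) {j, k}" using r by simp
    have int: "integrable M (\<beta> i (r i))" for i using bm_moments(1)[of "r i" i] r by simp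
    have "expectation (\<lambda>\<omega>. \<Prod>i\<in>{j,k}. \<beta> i (r i) \<omega>) = (\<Prod>i\<in>{j,k}. expectation (\<beta> i (r i)))"
      by (rule indep_vars_lebesgue_integral[OF _ iv int]) simp
    moreover have "integrable M (\<lambda>\<omega>. \<Prod>i\<in>{j,k}. \<beta> i (r i) \<omega>)" by (rule indep_vars_integrable[OF _ iv int]) simp
    moreover have "r j = s" "r k = t" using False by (auto simp: r_def)
    ultimately show ?thesis using False bm_moments(2)[OF assms(1), of j] by simp
  qed
  then show "integrable M (\<lambda>\<omega>. \<beta> j s \<omega> * \<beta> k t \<omega>)"
    "expectation (\<lambda>\<omega>. \<beta> j s \<omega> * \<beta> k t \<omega>) = (if j = k then min s t else 0)" by auto
qed

definition incr :: "nat \<times> real \<times> real \<Rightarrow> 'w \<Rightarrow> real" where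
  "incr = (\<lambda>(k, s, u) \<omega>. \<beta> k u \<omega> - \<beta> k s \<omega>)"

text \<open>The integrand of which \<open>incr\<close> is the integral, as a function on the
  disjoint union of one time axis per Brownian motion. Orthogonality of different Brownian motions
  becomes disjointness of supports.\<close>

definition hinc :: "nat \<times> real \<times> real \<Rightarrow> nat \<times> real \<Rightarrow> real" where
  "hinc = (\<lambda>(k, s, u) (k', r). if k' = k then indicator {s<..u} r else 0)"

definition okinc :: "nat \<times> real \<times> real \<Rightarrow> bool" where
  "okinc = (\<lambda>(k, s, u). 0 \<le> s \<and> s \<le> u)"

abbreviation NS :: "(nat \<times> real) measure" where
  "NS \<equiv> count_space UNIV \<Otimes>\<^sub>M lborel"

lemma measurable_NS:
  "(\<And>k. (\<lambda>r. f (k, r)) \<in> measurable lborel K) \<Longrightarrow> f \<in> measurable NS K" by (rule measurable_pair_measure_countable1) auto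

lemma nn_integral_NS: "f \<in> borel_measurable NS \<Longrightarrow> (\<integral>\<^sup>+p. f p \<partial>NS) = esum (\<lambda>k. \<integral>\<^sup>+r. f (k, r) \<partial>lborel)"
  by (rule lborel.nn_integral_fst[symmetric])

lemma hinc_measurable [measurable]: "hinc i \<in> borel_measurable NS" by (rule measurable_NS) (cases i, auto simp: hinc_def)

lemma incr_measurable: "okinc i \<Longrightarrow> incr i \<in> borel_measurable M" by (cases i) (auto simp: incr_def okinc_def)

text \<open>For equal indices both sides are the length of the overlap of the two intervals, and for
  different indices both vanish.\<close>

lemma cov_incr:
  assumes "okinc i" "okinc i'"
  shows "integrable M (\<lambda>\<omega>. incr i \<omega> * incr i' \<omega>)" "integrable NS (\<lambda>p. hinc i p * hinc i' p)"
    "(\<integral>\<omega>. incr i \<omega> * incr i' \<omega> \<partial>M) = (\<integral>p. hinc i p * hinc i' p \<partial>NS)"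
proof -
  obtain k s u where i: "i = (k, s, u)" by (cases i)
  obtain k' s' u' where i': "i' = (k', s', u')" by (cases i')
  have ok: "0 \<le> s" "s \<le> u" "0 \<le> s'" "s' \<le> u'" using assms by (auto simp: i i' okinc_def)
  let ?L = "if k = k' then max 0 (min u u' - max s s') else 0"
  have eq: "(\<lambda>\<omega>. incr i \<omega> * incr i' \<omega>) = (\<lambda>\<omega>. \<beta> k u \<omega> * \<beta> k' u' \<omega> - \<beta> k u \<omega> * \<beta> k' s' \<omega> - \<beta> k s \<omega> * \<beta> k' u' \<omega> + \<beta> k s \<omega> * \<beta> k' s' \<omega>)"
    by (auto simp: incr_def i i' algebra_simps)
  have cc: "integrable M (\<lambda>\<omega>. \<beta> k a \<omega> * \<beta> k' b \<omega>)" "expectation (\<lambda>\<omega>. \<beta> k a \<omega> * \<beta> k' b \<omega>) = (if k = k' then min a b else 0)"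
    if "a \<in> {s, u}" "b \<in> {s', u'}" for a b using bm_cov[of a b k k'] ok that by auto
  show "integrable M (\<lambda>\<omega>. incr i \<omega> * incr i' \<omega>)" unfolding eq using cc(1) by auto
  have E: "(\<integral>\<omega>. incr i \<omega> * incr i' \<omega> \<partial>M) = ?L" unfolding eq using cc ok by (auto simp: min_def max_def)
  have nn: "(\<integral>\<^sup>+p. ennreal (hinc i p * hinc i' p) \<partial>NS) = ennreal ?L"
  proof -
    have "(\<integral>\<^sup>+p. ennreal (hinc i p * hinc i' p) \<partial>NS) = esum (\<lambda>j. \<integral>\<^sup>+r. ennreal (hinc i (j, r) * hinc i' (j, r)) \<partial>lborel)"
      by (rule nn_integral_NS) measurable
    also have "\<dots> = esum (\<lambda>j. ennreal ?L * indicator {k} j)"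
    proof (intro nn_integral_cong)
      fix j
      show "(\<integral>\<^sup>+r. ennreal (hinc i (j, r) * hinc i' (j, r)) \<partial>lborel) = ennreal ?L * indicator {k} j"
      proof (cases "j = k \<and> k = k'")
        case True
        have "(\<integral>\<^sup>+r. ennreal (hinc i (j, r) * hinc i' (j, r)) \<partial>lborel) = (\<integral>\<^sup>+r. indicator {max s s'<..min u u'} r \<partial>lborel)"
          using True by (intro nn_integral_cong) (auto simp: hinc_def i i' indicator_def)
        also have "\<dots> = emeasure lborel {max s s'<..min u u'}" by simp
        also have "\<dots> = ennreal (max 0 (min u u' - max s s'))" by (cases "max s s' \<le> min u u'") (auto simp: max_def)
        finally show ?thesis using True by simp
      next
        case False
        then have "hinc i (j, r) * hinc i' (j, r) = 0" for r by (auto simp: hinc_def i i')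
        moreover have "ennreal ?L * indicator {k} j = 0" using False by auto
        ultimately show ?thesis by (simp only: ennreal_0 nn_integral_const mult_zero_left)
      qed
    qed
    also have "\<dots> = ennreal ?L" by (simp add: esum_cmult)
    finally show ?thesis .
  qed
  have nonneg: "0 \<le> hinc i p * hinc i' p" for p by (cases p) (auto simp: hinc_def i i')
  have "has_bochner_integral NS (\<lambda>p. hinc i p * hinc i' p) ?L" by (rule has_bochner_integral_nn_integral) (use nn nonneg in auto)
  then show "integrable NS (\<lambda>p. hinc i p * hinc i' p)" "(\<integral>\<omega>. incr i \<omega> * incr i' \<omega> \<partial>M) = (\<integral>p. hinc i p * hinc i' p \<partial>NS)"
    unfolding E by (auto simp: has_bochner_integral_iff)
qed

end

text \<open>The second moment depends on the Gram matrix only. Used on the probability space and on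
  \<open>NS\<close>, it reduces the isometry to equality of the Gram matrices.\<close>

lemma nn_integral_cmod_sq_sum:
  fixes f :: "'i \<Rightarrow> 'a \<Rightarrow> real" and c :: "'i \<Rightarrow> complex"
  assumes "finite I" "\<And>i j. i \<in> I \<Longrightarrow> j \<in> I \<Longrightarrow> integrable M (\<lambda>x. f i x * f j x)"
  shows "msq M (\<lambda>x. \<Sum>i\<in>I. c i * of_real (f i x))
    = ennreal (\<Sum>i\<in>I. \<Sum>j\<in>I. Re (c i * cnj (c j)) * (\<integral>x. f i x * f j x \<partial>M))"
proof -
  have eq: "(cmod (\<Sum>i\<in>I. c i * of_real (f i x)))\<^sup>2 = (\<Sum>i\<in>I. \<Sum>j\<in>I. Re (c i * cnj (c j)) * (f i x * f j x))" for x
  proof -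
    have "complex_of_real ((cmod (\<Sum>i\<in>I. c i * of_real (f i x)))\<^sup>2)
       = (\<Sum>i\<in>I. \<Sum>j\<in>I. (c i * of_real (f i x)) * cnj (c j * of_real (f j x)))"
      by (simp add: complex_norm_square sum_product del: of_real_power)
    then have "(cmod (\<Sum>i\<in>I. c i * of_real (f i x)))\<^sup>2 = Re (\<Sum>i\<in>I. \<Sum>j\<in>I. (c i * of_real (f i x)) * cnj (c j * of_real (f j x)))"
      by (metis Re_complex_of_real)
    also have "\<dots> = (\<Sum>i\<in>I. \<Sum>j\<in>I. Re (c i * cnj (c j)) * (f i x * f j x))" by (simp add: algebra_simps)
    finally show ?thesis .
  qed
  have int: "integrable M (\<lambda>x. \<Sum>i\<in>I. \<Sum>j\<in>I. Re (c i * cnj (c j)) * (f i x * f j x))"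
    using assms by (intro Bochner_Integration.integrable_sum integrable_mult_right) auto
  have "msq M (\<lambda>x. \<Sum>i\<in>I. c i * of_real (f i x))
     = ennreal (\<integral>x. (\<Sum>i\<in>I. \<Sum>j\<in>I. Re (c i * cnj (c j)) * (f i x * f j x)) \<partial>M)"
    unfolding eq by (rule nn_integral_eq_integral[OF int]) (rule AE_I2, subst eq[symmetric], simp)
  also have "(\<integral>x. (\<Sum>i\<in>I. \<Sum>j\<in>I. Re (c i * cnj (c j)) * (f i x * f j x)) \<partial>M)
     = (\<Sum>i\<in>I. \<Sum>j\<in>I. Re (c i * cnj (c j)) * (\<integral>x. f i x * f j x \<partial>M))"
    using assms by (simp add: Bochner_Integration.integral_sum Bochner_Integration.integrable_sum integrable_mult_right)
  finally show ?thesis .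
qed

section \<open>The isometry for elementary integrands and its extension\<close>

context cyl_wiener begin

text \<open>A relation between integral and integrand instead of a map: the representation by
  increments is not unique, and a relation raises no question of well-definedness.\<close>

definition elem :: "('w \<Rightarrow> complex) \<Rightarrow> (nat \<times> real \<Rightarrow> complex) \<Rightarrow> bool" where
  "elem X H \<longleftrightarrow> (\<exists>n i c. (\<forall>a<n. okinc (i a)) \<and>
     X = (\<lambda>\<omega>. \<Sum>a<n. c a * of_real (incr (i a) \<omega>)) \<and> H = (\<lambda>p. \<Sum>a<n::nat. c a * of_real (hinc (i a) p)))"

lemma elem_measurable: "elem X H \<Longrightarrow> X \<in> borel_measurable M \<and> H \<in> borel_measurable NS"
proof -
  assume "elem X H"
  then obtain n i c where i: "\<And>a. a < n \<Longrightarrow> okinc (i a)"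
     and X: "X = (\<lambda>\<omega>. \<Sum>a<n. c a * of_real (incr (i a) \<omega>))" and H: "H = (\<lambda>p. \<Sum>a<n::nat. c a * of_real (hinc (i a) p))"
    unfolding elem_def by blast
  have "(\<lambda>\<omega>. complex_of_real (incr (i a) \<omega>)) \<in> borel_measurable M" if "a < n" for a
    using incr_measurable[OF i[OF that]] by measurable
  then show ?thesis unfolding X H by (auto intro!: borel_measurable_sum borel_measurable_times)
qed

lemma elem_isometry:
  assumes "elem X H"
  shows "msq M X = msq NS H"
    "msq M X < \<infinity>"
proof -
  obtain n i c where i: "\<And>a. a < n \<Longrightarrow> okinc (i a)"
     and X: "X = (\<lambda>\<omega>. \<Sum>a<n. c a * of_real (incr (i a) \<omega>))" and H: "H = (\<lambda>p. \<Sum>a<n::nat. c a * of_real (hinc (i a) p))"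
    using assms unfolding elem_def by auto
  have "msq M X = ennreal (\<Sum>a<n. \<Sum>b<n. Re (c a * cnj (c b)) * (\<integral>x. incr (i a) x * incr (i b) x \<partial>M))"
    unfolding X by (rule nn_integral_cmod_sq_sum) (auto intro: cov_incr i)
  moreover have "msq NS H = ennreal (\<Sum>a<n. \<Sum>b<n. Re (c a * cnj (c b)) * (\<integral>x. hinc (i a) x * hinc (i b) x \<partial>NS))"
    unfolding H by (rule nn_integral_cmod_sq_sum) (auto intro: cov_incr i)
  moreover have "(\<Sum>a<n. \<Sum>b<n. Re (c a * cnj (c b)) * (\<integral>x. incr (i a) x * incr (i b) x \<partial>M))
    = (\<Sum>a<n. \<Sum>b<n. Re (c a * cnj (c b)) * (\<integral>x. hinc (i a) x * hinc (i b) x \<partial>NS))"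
    by (intro sum.cong refl) (simp add: cov_incr(3) i)
  ultimately show "msq M X = msq NS H"
    "msq M X < \<infinity>" by auto
qed

lemma elem_add: "elem X H \<Longrightarrow> elem X' H' \<Longrightarrow> elem (\<lambda>\<omega>. X \<omega> + X' \<omega>) (\<lambda>p. H p + H' p)"
proof -
  assume "elem X H" "elem X' H'"
  obtain n i c where i: "\<forall>a<n. okinc (i a)"
     and X: "X = (\<lambda>\<omega>. \<Sum>a<n. c a * of_real (incr (i a) \<omega>))" "H = (\<lambda>p. \<Sum>a<n::nat. c a * of_real (hinc (i a) p))"
    using \<open>elem X H\<close> unfolding elem_def by blast
  obtain n' i' c' where i': "\<forall>a<n'. okinc (i' a)"
     and X': "X' = (\<lambda>\<omega>. \<Sum>a<n'. c' a * of_real (incr (i' a) \<omega>))" "H' = (\<lambda>p. \<Sum>a<n'::nat. c' a * of_real (hinc (i' a) p))"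
    using \<open>elem X' H'\<close> unfolding elem_def by blast
  define i'' where "i'' a = (if a < n then i a else i' (a - n))" for a
  define c'' where "c'' a = (if a < n then c a else c' (a - n))" for a
  have split: "(\<Sum>a<n+n'. f (c'' a) (i'' a)) = (\<Sum>a<n. f (c a) (i a)) + (\<Sum>a<n'. f (c' a) (i' a))" for f :: "complex \<Rightarrow> nat \<times> real \<times> real \<Rightarrow> complex"
  proof -
    have "(\<Sum>a<n+n'. f (c'' a) (i'' a)) = (\<Sum>a<n. f (c'' a) (i'' a)) + (\<Sum>a=n..<n+n'. f (c'' a) (i'' a))"
      unfolding lessThan_atLeast0 by (rule sum.atLeastLessThan_concat[symmetric]) auto
    also have "(\<Sum>a=n..<n+n'. f (c'' a) (i'' a)) = (\<Sum>a<n'. f (c'' (a + n)) (i'' (a + n)))"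
      using sum.shift_bounds_nat_ivl[of "\<lambda>a. f (c'' a) (i'' a)" 0 n n'] by (simp add: lessThan_atLeast0 add.commute)
    finally show ?thesis by (simp add: i''_def c''_def)
  qed
  have "\<forall>a<n+n'. okinc (i'' a)" using i i' by (auto simp: i''_def)
  then show ?thesis unfolding elem_def X X'
    using split[of "\<lambda>c i. c * of_real (incr i \<omega>)" for \<omega>] split[of "\<lambda>c i. c * of_real (hinc i p)" for p]
    by (intro exI[of _ "n + n'"] exI[of _ i''] exI[of _ c'']) auto
qed

lemma elem_scale: "elem X H \<Longrightarrow> elem (\<lambda>\<omega>. z * X \<omega>) (\<lambda>p. z * H p)"
proof -
  assume "elem X H"
  then obtain n i c where "\<forall>a<n. okinc (i a)"
     "X = (\<lambda>\<omega>. \<Sum>a<n. c a * of_real (incr (i a) \<omega>))" "H = (\<lambda>p. \<Sum>a<n::nat. c a * of_real (hinc (i a) p))"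
    unfolding elem_def by blast
  then show "elem (\<lambda>\<omega>. z * X \<omega>) (\<lambda>p. z * H p)" unfolding elem_def
    by (intro exI[of _ n] exI[of _ i] exI[of _ "\<lambda>a. z * c a"]) (auto simp: sum_distrib_left mult.assoc)
qed

end

text \<open>Young's inequality with a free parameter. It is used with the parameter 1, with the
  parameter tending to 0 in the proof of the isometry, and with the step size in the error
  recursion.\<close>

lemma ennreal_cmod_sq_le:
  fixes x y :: "'a::real_normed_vector"
  assumes "0 < \<delta>"
  shows "ennreal ((norm x)\<^sup>2) \<le> ennreal (1 + \<delta>) * ennreal ((norm y)\<^sup>2) + ennreal (1 + 1 / \<delta>) * ennreal ((norm (x - y))\<^sup>2)"
proof -
  have n: "norm x \<le> norm y + norm (x - y)" using norm_triangle_ineq[of y "x - y"] by simp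
  have "2 * norm y * norm (x - y) \<le> \<delta> * (norm y)\<^sup>2 + (1 / \<delta>) * (norm (x - y))\<^sup>2"
  proof -
    have "0 \<le> (sqrt \<delta> * norm y - norm (x - y) / sqrt \<delta>)\<^sup>2" by simp
    also have "\<dots> = \<delta> * (norm y)\<^sup>2 + (1 / \<delta>) * (norm (x - y))\<^sup>2 - 2 * norm y * norm (x - y)"
      using assms by (simp add: power2_diff power_mult_distrib power_divide)
    finally show ?thesis by simp
  qed
  then have "(norm y + norm (x - y))\<^sup>2 \<le> (1 + \<delta>) * (norm y)\<^sup>2 + (1 + 1 / \<delta>) * (norm (x - y))\<^sup>2"
    by (simp add: power2_sum algebra_simps)
  moreover have "(norm x)\<^sup>2 \<le> (norm y + norm (x - y))\<^sup>2" using n by (intro power_mono) auto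
  ultimately have "ennreal ((norm x)\<^sup>2) \<le> ennreal ((1 + \<delta>) * (norm y)\<^sup>2 + (1 + 1 / \<delta>) * (norm (x - y))\<^sup>2)"
    by (intro ennreal_leI) linarith
  then show ?thesis using assms by (simp add: ennreal_mult ennreal_plus)
qed

lemma nn_sq_le_approx:
  fixes X X' :: "'a \<Rightarrow> 'b::{real_normed_vector, second_countable_topology}"
  assumes [measurable]: "X \<in> borel_measurable M" "X' \<in> borel_measurable M" and "0 < \<delta>"
  shows "msq M X \<le>
    ennreal (1 + \<delta>) * msq M X'
    + ennreal (1 + 1 / \<delta>) * msq M (\<lambda>x. X x - X' x)"
proof -
  have "msq M X \<le>
     (\<integral>\<^sup>+x. ennreal (1 + \<delta>) * ennreal ((norm (X' x))\<^sup>2) + ennreal (1 + 1 / \<delta>) * ennreal ((norm (X x - X' x))\<^sup>2) \<partial>M)"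
    by (intro nn_integral_mono ennreal_cmod_sq_le assms)
  also have "\<dots> = ennreal (1 + \<delta>) * msq M X'
    + ennreal (1 + 1 / \<delta>) * msq M (\<lambda>x. X x - X' x)" by (subst nn_integral_add) (auto simp: nn_integral_cmult)
  finally show ?thesis .
qed

lemma nn_sq_diff_le:
  fixes X Y Z :: "'a \<Rightarrow> 'b::{real_normed_vector, second_countable_topology}"
  assumes [measurable]: "X \<in> borel_measurable M" "Y \<in> borel_measurable M" "Z \<in> borel_measurable M"
  shows "msq M (\<lambda>x. X x - Z x) \<le>
    2 * msq M (\<lambda>x. X x - Y x) + 2 * msq M (\<lambda>x. Y x - Z x)" using nn_sq_le_approx[of "\<lambda>x. X x - Z x" M "\<lambda>x. X x - Y x" 1] by simp

context cyl_wiener begin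

text \<open>
  The Ito isometry is obtained by approximation in both components: \<open>X\<close> is the stochastic integral
  of the integrand \<open>H\<close>, whose first argument numbers the Brownian motions.
\<close>

definition ito :: "('w \<Rightarrow> complex) \<Rightarrow> (nat \<times> real \<Rightarrow> complex) \<Rightarrow> bool" where
  "ito X H \<longleftrightarrow> X \<in> borel_measurable M \<and> H \<in> borel_measurable NS \<and> (\<forall>\<epsilon>>0. \<exists>X' H'. elem X' H' \<and>
     msq M (\<lambda>\<omega>. X \<omega> - X' \<omega>) \<le> ennreal \<epsilon> \<and>
     msq NS (\<lambda>p. H p - H' p) \<le> ennreal \<epsilon>)"

lemma ito_measurable: "ito X H \<Longrightarrow> X \<in> borel_measurable M" "ito X H \<Longrightarrow> H \<in> borel_measurable NS" by (auto simp: ito_def)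

lemma ito_closure:
  assumes "X \<in> borel_measurable M" "H \<in> borel_measurable NS"
    and "\<And>\<epsilon>. \<epsilon> > 0 \<Longrightarrow> \<exists>X' H'. ito X' H' \<and>
     msq M (\<lambda>\<omega>. X \<omega> - X' \<omega>) \<le> ennreal \<epsilon> \<and>
     msq NS (\<lambda>p. H p - H' p) \<le> ennreal \<epsilon>"
  shows "ito X H" unfolding ito_def
proof (intro conjI allI impI assms(1,2))
  fix \<epsilon> :: real assume "0 < \<epsilon>"
  \<comment> \<open>The square of a sum of two errors costs a factor 2 for each of them, hence the
    quarter.\<close>
  then have e4: "0 < \<epsilon> / 4" by simp
  obtain X' H' where 1: "ito X' H'"
     "msq M (\<lambda>\<omega>. X \<omega> - X' \<omega>) \<le> ennreal (\<epsilon> / 4)"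
     "msq NS (\<lambda>p. H p - H' p) \<le> ennreal (\<epsilon> / 4)" using assms(3)[OF e4] by blast
  obtain X'' H'' where 2: "elem X'' H''"
     "msq M (\<lambda>\<omega>. X' \<omega> - X'' \<omega>) \<le> ennreal (\<epsilon> / 4)"
     "msq NS (\<lambda>p. H' p - H'' p) \<le> ennreal (\<epsilon> / 4)" using 1(1) e4 unfolding ito_def by blast
  have s: "2 * ennreal (\<epsilon> / 4) + 2 * ennreal (\<epsilon> / 4) = ennreal \<epsilon>"
    using e4 by (simp add: ennreal_plus[symmetric] ennreal_mult[symmetric] ennreal_numeral[symmetric] del: ennreal_plus ennreal_numeral)
  have "msq M (\<lambda>\<omega>. X \<omega> - X'' \<omega>) \<le> 2 * ennreal (\<epsilon> / 4) + 2 * ennreal (\<epsilon> / 4)"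
    using nn_sq_diff_le[OF assms(1) ito_measurable(1)[OF 1(1)] conjunct1[OF elem_measurable[OF 2(1)]]]
    by (rule order_trans) (intro add_mono mult_left_mono 1 2, auto)
  moreover have "msq NS (\<lambda>\<omega>. H \<omega> - H'' \<omega>) \<le> 2 * ennreal (\<epsilon> / 4) + 2 * ennreal (\<epsilon> / 4)"
    using nn_sq_diff_le[OF assms(2) ito_measurable(2)[OF 1(1)] conjunct2[OF elem_measurable[OF 2(1)]]]
    by (rule order_trans) (intro add_mono mult_left_mono 1 2, auto)
  ultimately show "\<exists>X' H'. elem X' H' \<and>
     msq M (\<lambda>\<omega>. X \<omega> - X' \<omega>) \<le> ennreal \<epsilon> \<and>
     msq NS (\<lambda>p. H p - H' p) \<le> ennreal \<epsilon>" using 2(1) unfolding s by blast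
qed

lemma ito_elem:
  assumes "elem X H"
  shows "ito X H" unfolding ito_def
proof (intro conjI allI impI)
  fix \<epsilon> :: real assume "0 < \<epsilon>"
  show "\<exists>X' H'. elem X' H' \<and>
     msq M (\<lambda>\<omega>. X \<omega> - X' \<omega>) \<le> ennreal \<epsilon> \<and>
     msq NS (\<lambda>p. H p - H' p) \<le> ennreal \<epsilon>" by (rule exI[of _ X], rule exI[of _ H]) (use assms in simp)
qed (use elem_measurable[OF assms] in auto)

lemma ito_add:
  assumes "ito X H" "ito Y G"
  shows "ito (\<lambda>\<omega>. X \<omega> + Y \<omega>) (\<lambda>p. H p + G p)" unfolding ito_def
proof (intro conjI allI impI)
  fix \<epsilon> :: real assume "0 < \<epsilon>"
  then have e4: "0 < \<epsilon> / 4" by simp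
  obtain X' H' where 1: "elem X' H'"
     "msq M (\<lambda>\<omega>. X \<omega> - X' \<omega>) \<le> ennreal (\<epsilon> / 4)"
     "msq NS (\<lambda>p. H p - H' p) \<le> ennreal (\<epsilon> / 4)" using assms(1) e4 unfolding ito_def by blast
  obtain Y' G' where 2: "elem Y' G'"
     "msq M (\<lambda>\<omega>. Y \<omega> - Y' \<omega>) \<le> ennreal (\<epsilon> / 4)"
     "msq NS (\<lambda>p. G p - G' p) \<le> ennreal (\<epsilon> / 4)" using assms(2) e4 unfolding ito_def by blast
  have [measurable]: "X \<in> borel_measurable M" "Y \<in> borel_measurable M" "X' \<in> borel_measurable M" "Y' \<in> borel_measurable M"
    "H \<in> borel_measurable NS" "G \<in> borel_measurable NS" "H' \<in> borel_measurable NS" "G' \<in> borel_measurable NS"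
    using ito_measurable assms elem_measurable 1 2 by auto
  have s: "2 * ennreal (\<epsilon> / 4) + 2 * ennreal (\<epsilon> / 4) = ennreal \<epsilon>"
    using e4 by (simp add: ennreal_plus[symmetric] ennreal_mult[symmetric] ennreal_numeral[symmetric] del: ennreal_plus ennreal_numeral)
  have a1: "msq M (\<lambda>\<omega>. X \<omega> + Y \<omega> - (X' \<omega> + Y' \<omega>)) \<le> 2 * ennreal (\<epsilon> / 4) + 2 * ennreal (\<epsilon> / 4)"
    using nn_sq_diff_le[of "\<lambda>\<omega>. X \<omega> + Y \<omega>" M "\<lambda>\<omega>. X' \<omega> + Y \<omega>" "\<lambda>\<omega>. X' \<omega> + Y' \<omega>"]
    by (rule order_trans) (simp_all, intro add_mono mult_left_mono 1 2, auto)
  have a2: "msq NS (\<lambda>\<omega>. H \<omega> + G \<omega> - (H' \<omega> + G' \<omega>)) \<le> 2 * ennreal (\<epsilon> / 4) + 2 * ennreal (\<epsilon> / 4)"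
    using nn_sq_diff_le[of "\<lambda>\<omega>. H \<omega> + G \<omega>" NS "\<lambda>\<omega>. H' \<omega> + G \<omega>" "\<lambda>\<omega>. H' \<omega> + G' \<omega>"]
    by (rule order_trans) (simp_all, intro add_mono mult_left_mono 1 2, auto)
  show "\<exists>X' H'. elem X' H' \<and>
     msq M (\<lambda>\<omega>. X \<omega> + Y \<omega> - X' \<omega>) \<le> ennreal \<epsilon> \<and>
     msq NS (\<lambda>p. H p + G p - H' p) \<le> ennreal \<epsilon>"
    by (intro exI conjI, rule elem_add[OF 1(1) 2(1)], rule a1[unfolded s], rule a2[unfolded s])
qed (use ito_measurable assms in auto)

lemma ito_scale:
  assumes "ito X H"
  shows "ito (\<lambda>\<omega>. z * X \<omega>) (\<lambda>p. z * H p)"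
proof (cases "z = 0")
  case True
  have "elem (\<lambda>\<omega>. 0) (\<lambda>p. 0)" unfolding elem_def by (intro exI[of _ 0]) simp
  then show ?thesis using True ito_elem by simp
next
  case False
  show ?thesis unfolding ito_def
  proof (intro conjI allI impI)
    fix \<epsilon> :: real assume "0 < \<epsilon>"
    let ?e = "\<epsilon> / (cmod z)\<^sup>2"
    have e: "0 < ?e" using \<open>0 < \<epsilon>\<close> False by simp
    obtain X' H' where 1: "elem X' H'"
       "msq M (\<lambda>\<omega>. X \<omega> - X' \<omega>) \<le> ennreal ?e"
       "msq NS (\<lambda>p. H p - H' p) \<le> ennreal ?e" using assms e unfolding ito_def by blast
    have [measurable]: "X \<in> borel_measurable M" "X' \<in> borel_measurable M" "H \<in> borel_measurable NS" "H' \<in> borel_measurable NS"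
      using ito_measurable assms elem_measurable 1 by auto
    have m: "ennreal ((cmod z)\<^sup>2) * ennreal ?e = ennreal \<epsilon>" using False e by (simp add: ennreal_mult[symmetric])
    have eq: "ennreal ((cmod (z * a - z * b))\<^sup>2) = ennreal ((cmod z)\<^sup>2) * ennreal ((cmod (a - b))\<^sup>2)" for a b
      by (simp add: right_diff_distrib[symmetric] norm_mult power_mult_distrib ennreal_mult)
    have a1: "msq M (\<lambda>\<omega>. z * X \<omega> - z * X' \<omega>) \<le> ennreal \<epsilon>"
      unfolding eq m[symmetric] using 1 by (subst nn_integral_cmult) (auto intro: mult_left_mono)
    have a2: "msq NS (\<lambda>\<omega>. z * H \<omega> - z * H' \<omega>) \<le> ennreal \<epsilon>"
      unfolding eq m[symmetric] using 1 by (subst nn_integral_cmult) (auto intro: mult_left_mono)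
    show "\<exists>X' H'. elem X' H' \<and>
       msq M (\<lambda>\<omega>. z * X \<omega> - X' \<omega>) \<le> ennreal \<epsilon> \<and>
       msq NS (\<lambda>p. z * H p - H' p) \<le> ennreal \<epsilon>" by (intro exI conjI, rule elem_scale[OF 1(1)], rule a1, rule a2)
  qed (use ito_measurable assms in auto)
qed

lemma ito_diff: "ito X H \<Longrightarrow> ito Y G \<Longrightarrow> ito (\<lambda>\<omega>. X \<omega> - Y \<omega>) (\<lambda>p. H p - G p)"
  using ito_add[OF _ ito_scale[of Y G "-1"], of X H] by simp

lemma ito_zero: "ito (\<lambda>\<omega>. 0) (\<lambda>p. 0)" by (rule ito_elem) (auto simp: elem_def intro: exI[of _ 0])

lemma ito_sum: "finite A \<Longrightarrow> (\<And>a. a \<in> A \<Longrightarrow> ito (X a) (H a)) \<Longrightarrow> ito (\<lambda>\<omega>. \<Sum>a\<in>A. X a \<omega>) (\<lambda>p. \<Sum>a\<in>A. H a p)"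
  by (induction A rule: finite_induct) (auto intro!: ito_zero ito_add)

end

text \<open>An accuracy of \<open>\<delta>\<^sup>2\<close> beats the constant
  \<open>1 + 1 / \<delta>\<close> of Young's inequality: their product
  \<open>\<delta>\<^sup>2 + \<delta>\<close> tends to 0.\<close>

lemma ennreal_le_approx:
  fixes a h :: ennreal
  assumes "\<And>\<delta>. 0 < \<delta> \<Longrightarrow> \<delta> \<le> 1 \<Longrightarrow> \<exists>b. a \<le> ennreal (1 + \<delta>) * b + ennreal (1 + 1 / \<delta>) * ennreal (\<delta>\<^sup>2) \<and>
    b \<le> ennreal (1 + \<delta>) * h + ennreal (1 + 1 / \<delta>) * ennreal (\<delta>\<^sup>2)"
  shows "a \<le> h"
proof (cases h)
  case (real r)
  have *: "a \<le> ennreal ((1 + \<delta>) * ((1 + \<delta>) * r + (\<delta>\<^sup>2 + \<delta>)) + (\<delta>\<^sup>2 + \<delta>))" if d0: "0 < \<delta>" "\<delta> \<le> 1" for \<delta>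
  proof -
    obtain b where b: "a \<le> ennreal (1 + \<delta>) * b + ennreal (1 + 1 / \<delta>) * ennreal (\<delta>\<^sup>2)"
      "b \<le> ennreal (1 + \<delta>) * h + ennreal (1 + 1 / \<delta>) * ennreal (\<delta>\<^sup>2)" using assms[OF d0] by blast
    have d: "ennreal (1 + 1 / \<delta>) * ennreal (\<delta>\<^sup>2) = ennreal (\<delta>\<^sup>2 + \<delta>)"
    proof -
      have "(1 + 1 / \<delta>) * \<delta>\<^sup>2 = \<delta>\<^sup>2 + \<delta>" using d0 by (simp add: field_simps power2_eq_square)
      then show ?thesis using d0 by (subst ennreal_mult[symmetric]) auto
    qed
    have "a \<le> ennreal (1 + \<delta>) * (ennreal (1 + \<delta>) * h + ennreal (\<delta>\<^sup>2 + \<delta>)) + ennreal (\<delta>\<^sup>2 + \<delta>)"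
      using b unfolding d by (meson add_right_mono mult_left_mono order_trans zero_le)
    also have "\<dots> = ennreal ((1 + \<delta>) * ((1 + \<delta>) * r + (\<delta>\<^sup>2 + \<delta>)) + (\<delta>\<^sup>2 + \<delta>))"
      using d0 real by (simp add: ennreal_mult ennreal_plus)
    finally show ?thesis .
  qed
  have lim: "(\<lambda>n. ennreal ((1 + 1 / real (Suc n)) * ((1 + 1 / real (Suc n)) * r + ((1 / real (Suc n))\<^sup>2 + 1 / real (Suc n))) + ((1 / real (Suc n))\<^sup>2 + 1 / real (Suc n))))
    \<longlonglongrightarrow> ennreal ((1 + 0) * ((1 + 0) * r + (0\<^sup>2 + 0)) + (0\<^sup>2 + 0))"
    by (intro tendsto_ennrealI tendsto_intros LIMSEQ_Suc[OF lim_1_over_n[where 'a = real]])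
  have "a \<le> ennreal ((1 + 0) * ((1 + 0) * r + (0\<^sup>2 + 0)) + (0\<^sup>2 + 0))"
    by (rule LIMSEQ_le_const[OF lim]) (intro exI[of _ 0] allI impI *, auto)
  then show ?thesis using real by simp
qed simp

context cyl_wiener begin

theorem ito_isometry:
  assumes "ito X H"
  shows "msq M X = msq NS H"
proof (rule antisym)
  have *: "\<exists>b. msq M X \<le> ennreal (1 + \<delta>) * b + ennreal (1 + 1 / \<delta>) * ennreal (\<delta>\<^sup>2) \<and>
    b \<le> ennreal (1 + \<delta>) * msq NS H + ennreal (1 + 1 / \<delta>) * ennreal (\<delta>\<^sup>2) \<and>
    msq NS H \<le> ennreal (1 + \<delta>) * b + ennreal (1 + 1 / \<delta>) * ennreal (\<delta>\<^sup>2) \<and>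
    b \<le> ennreal (1 + \<delta>) * msq M X + ennreal (1 + 1 / \<delta>) * ennreal (\<delta>\<^sup>2)"
    if "0 < \<delta>" for \<delta>
  proof -
    have "0 < \<delta>\<^sup>2" using that by simp
    then obtain X' H' where 1: "elem X' H'"
       "msq M (\<lambda>\<omega>. X \<omega> - X' \<omega>) \<le> ennreal (\<delta>\<^sup>2)"
       "msq NS (\<lambda>p. H p - H' p) \<le> ennreal (\<delta>\<^sup>2)" using assms unfolding ito_def by blast
    have m: "X \<in> borel_measurable M" "X' \<in> borel_measurable M" "H \<in> borel_measurable NS" "H' \<in> borel_measurable NS"
      using ito_measurable assms elem_measurable 1 by auto
    have 2: "msq M (\<lambda>\<omega>. X' \<omega> - X \<omega>) \<le> ennreal (\<delta>\<^sup>2)"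
       "msq NS (\<lambda>p. H' p - H p) \<le> ennreal (\<delta>\<^sup>2)" using 1 by (simp_all add: norm_minus_commute)
    have le: "u \<le> ennreal (1 + \<delta>) * v + ennreal (1 + 1 / \<delta>) * ennreal (\<delta>\<^sup>2)"
      if "u \<le> ennreal (1 + \<delta>) * v + ennreal (1 + 1 / \<delta>) * w" "w \<le> ennreal (\<delta>\<^sup>2)" for u v w
      using that by (meson add_left_mono mult_left_mono order_trans zero_le)
    show ?thesis using le[OF nn_sq_le_approx[OF m(1,2) that] 1(2)] le[OF nn_sq_le_approx[OF m(2,1) that] 2(1)]
        le[OF nn_sq_le_approx[OF m(3,4) that] 1(3)] le[OF nn_sq_le_approx[OF m(4,3) that] 2(2)]
      unfolding elem_isometry(1)[OF 1(1)] by blast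
  qed
  show "msq M X \<le> msq NS H" by (rule ennreal_le_approx) (use * in blast)
  show "msq NS H \<le> msq M X" by (rule ennreal_le_approx) (use * in blast)
qed

lemma bounded_linear_sq_le:
  assumes "bounded_linear \<phi>"
  shows "\<exists>K>0. \<forall>x. ennreal ((norm (\<phi> x))\<^sup>2) \<le> ennreal (K\<^sup>2) * ennreal ((norm x)\<^sup>2)"
proof -
  obtain K where K: "0 < K" "\<And>x. norm (\<phi> x) \<le> norm x * K" using bounded_linear.pos_bounded[OF assms] by blast
  have "ennreal ((norm (\<phi> x))\<^sup>2) \<le> ennreal (K\<^sup>2) * ennreal ((norm x)\<^sup>2)" for x
    using power_mono[OF K(2)[of x] norm_ge_zero, of 2]
    by (simp add: ennreal_mult[symmetric] power_mult_distrib mult.commute ennreal_leI)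
  with K(1) show ?thesis by blast
qed

lemma measurable_bounded_linear:
  assumes "bounded_linear \<phi>" "I \<in> borel_measurable N"
  shows "(\<lambda>\<omega>. \<phi> (I \<omega>)) \<in> borel_measurable N"
  using measurable_compose[OF assms(2) borel_measurable_continuous_onI[OF linear_continuous_on[OF assms(1)]]] .

lemma partition_bounds:
  assumes "is_partition a c m p" "i \<le> m"
  shows "a \<le> p i" "p i \<le> c"
proof -
  have mono: "p i \<le> p j" if "i \<le> j" "j \<le> m" for i j using that(1,2)
  proof (induction j rule: dec_induct)
    case (step j)
    then show ?case using assms(1) by (auto simp: is_partition_def intro: order_trans)
  qed simp
  show "a \<le> p i" "p i \<le> c" using mono[of 0 i] mono[of i m] assms by (auto simp: is_partition_def)
qed

text \<open>The isometry is scalar, so integrals with values in \<open>l2_torus\<close> are seen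
  through bounded functionals. These commute with step integrals and enlarge squared errors by at
  most \<open>K\<^sup>2\<close>, whence the accuracy \<open>\<epsilon> / K\<^sup>2\<close>.\<close>

lemma ito_wiener_integral:
  assumes w: "has_wiener_integral M (\<beta> k) a c f I" and a: "0 \<le> a" and \<phi>: "bounded_linear \<phi>"
  shows "ito (\<lambda>\<omega>. \<phi> (I \<omega>)) (\<lambda>(k', r). if k' = k then indicator {a..c} r *\<^sub>R \<phi> (f r) else 0)" (is "ito ?X ?H")
proof -
  interpret \<phi>: bounded_linear \<phi> by (rule \<phi>)
  obtain m p v where part: "\<And>j. is_partition a c (m j) (p j)"
    and l1: "(\<lambda>j. \<integral>\<^sup>+s\<in>{a..c}. ennreal ((norm (f s - step_fun (m j) (p j) (v j) s))\<^sup>2) \<partial>lborel) \<longlonglongrightarrow> 0"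
    and l2: "(\<lambda>j. msq M (\<lambda>\<omega>. I \<omega> - step_integral (\<beta> k) (m j) (p j) (v j) \<omega>)) \<longlonglongrightarrow> 0"
    and fm: "f \<in> borel_measurable (restrict_space lborel {a..c})" and Im: "I \<in> borel_measurable M"
    using w unfolding has_wiener_integral_def tendsto_L2_def by blast
  let ?s = "\<lambda>j. step_fun (m j) (p j) (v j)" and ?S = "\<lambda>j. step_integral (\<beta> k) (m j) (p j) (v j)"
  let ?e = "\<lambda>j. \<integral>\<^sup>+s\<in>{a..c}. ennreal ((norm (f s - ?s j s))\<^sup>2) \<partial>lborel" and ?E = "\<lambda>j. msq M (\<lambda>\<omega>. I \<omega> - ?S j \<omega>)"
  obtain K where K: "0 < K" and Ksq: "\<And>x. ennreal ((cmod (\<phi> x))\<^sup>2) \<le> ennreal (K\<^sup>2) * ennreal ((norm x)\<^sup>2)"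
    using bounded_linear_sq_le[OF \<phi>] by blast
  have fm': "(\<lambda>r. indicator {a..c} r *\<^sub>R \<phi> (f r)) \<in> borel_measurable lborel"
    using measurable_bounded_linear[OF \<phi> fm] by (subst (asm) borel_measurable_restrict_space_iff) auto
  have Hm: "?H \<in> borel_measurable NS" by (rule measurable_NS) (use fm' in \<open>auto simp: if_distrib\<close>)
  have Xm: "?X \<in> borel_measurable M" by (rule measurable_bounded_linear[OF \<phi> Im])
  show ?thesis unfolding ito_def
  proof (intro conjI allI impI Xm Hm)
    fix \<epsilon> :: real assume e: "0 < \<epsilon>"
    then have e': "0 < ennreal (\<epsilon> / K\<^sup>2)" using K by simp
    have "\<forall>\<^sub>F j in sequentially. ?e j < ennreal (\<epsilon> / K\<^sup>2)"
      "\<forall>\<^sub>F j in sequentially. ?E j < ennreal (\<epsilon> / K\<^sup>2)" using order_tendstoD(2)[OF l1 e'] order_tendstoD(2)[OF l2 e'] by auto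
    then have "\<forall>\<^sub>F j in sequentially. ?e j < ennreal (\<epsilon> / K\<^sup>2)
       \<and> ?E j < ennreal (\<epsilon> / K\<^sup>2)" by (rule eventually_conj)
    then obtain j where j1: "?e j < ennreal (\<epsilon> / K\<^sup>2)"
      and j2: "?E j < ennreal (\<epsilon> / K\<^sup>2)" by (auto simp: eventually_sequentially)
    have dm: "(\<lambda>\<omega>. ennreal ((norm (I \<omega> - ?S j \<omega>))\<^sup>2)) \<in> borel_measurable M"
    proof -
      have pj: "0 \<le> p j l" if "l \<le> m j" for l using partition_bounds(1)[OF part[of j] that] a by linarith
      have "(\<lambda>\<omega>. fcoeff (I \<omega> - ?S j \<omega>) q) \<in> borel_measurable M" for q
        unfolding step_integral_def fcoeff_diff fcoeff_sum fcoeff_scaleR of_real_diff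
        by (intro borel_measurable_diff measurable_fcoeff[OF Im] borel_measurable_sum borel_measurable_times
            borel_measurable_const measurable_compose[OF bm_measurable borel_measurable_continuous_onI[OF linear_continuous_on[OF bounded_linear_of_real]]] pj) auto
      then have "(\<lambda>\<omega>. I \<omega> - ?S j \<omega>) \<in> borel_measurable M" by (rule measurable_l2_from_fcoeff)
      then show ?thesis by measurable
    qed
    have dm': "(\<lambda>r. ennreal ((norm (f r - ?s j r))\<^sup>2) * indicator {a..c} r) \<in> borel_measurable lborel"
    proof -
      have "(\<lambda>r. fcoeff (f r - ?s j r) q) \<in> borel_measurable (restrict_space lborel {a..c})" for q
        unfolding step_fun_def fcoeff_diff fcoeff_sum fcoeff_scaleR
        by (intro borel_measurable_diff measurable_fcoeff[OF fm] borel_measurable_sum borel_measurable_times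
            borel_measurable_const measurable_restrict_space1) auto
      then have "(\<lambda>r. f r - ?s j r) \<in> borel_measurable (restrict_space lborel {a..c})" by (rule measurable_l2_from_fcoeff)
      then have "(\<lambda>r. ennreal ((norm (f r - ?s j r))\<^sup>2)) \<in> borel_measurable (restrict_space lborel {a..c})" by measurable
      then show ?thesis by (subst (asm) borel_measurable_restrict_space_iff_ennreal) auto
    qed
    have Ke: "ennreal (K\<^sup>2) * ennreal (\<epsilon> / K\<^sup>2) = ennreal \<epsilon>" using K e by (simp add: ennreal_mult[symmetric])
    define i where "i l = (k, p j l, p j (Suc l))" for l
    let ?X' = "\<lambda>\<omega>. \<Sum>l<m j. \<phi> (v j l) * of_real (incr (i l) \<omega>)" and ?H' = "\<lambda>q. \<Sum>l<m j. \<phi> (v j l) * of_real (hinc (i l) q)"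
    have ok: "okinc (i l)" if "l < m j" for l
      using partition_bounds[OF part[of j], of l] that a part[of j] by (auto simp: i_def okinc_def is_partition_def)
    have el: "elem ?X' ?H'" unfolding elem_def
      by (rule exI[of _ "m j"], rule exI[of _ i], rule exI[of _ "\<lambda>l. \<phi> (v j l)"]) (use ok in simp)
    have X': "?X' \<omega> = \<phi> (?S j \<omega>)" for \<omega>
      unfolding step_integral_def \<phi>.sum \<phi>.scaleR by (simp add: i_def incr_def scaleR_conv_of_real mult.commute)
    have H': "?H' (k', r) = (if k' = k then \<phi> (?s j r) else 0)" for k' r
      unfolding step_fun_def \<phi>.sum \<phi>.scaleR by (auto simp: i_def hinc_def scaleR_conv_of_real mult.commute)
    \<comment> \<open>The cells of the partition lie in \<open>{a..c}\<close>, so that step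
      functions vanish where the integrand is cut off.\<close>
    have out: "?s j r = 0" if "r \<notin> {a..c}" for r
    proof -
      have "indicator {p j l<..p j (Suc l)} r = (0::real)" if "l < m j" for l
        using partition_bounds[OF part[of j], of l] partition_bounds[OF part[of j], of "Suc l"] that \<open>r \<notin> {a..c}\<close>
        by (auto simp: indicator_def)
      then show ?thesis unfolding step_fun_def by (intro sum.neutral) auto
    qed
    have "msq M (\<lambda>\<omega>. ?X \<omega> - ?X' \<omega>) \<le>
       (\<integral>\<^sup>+\<omega>. ennreal (K\<^sup>2) * ennreal ((norm (I \<omega> - ?S j \<omega>))\<^sup>2) \<partial>M)"
      unfolding X' \<phi>.diff[symmetric] by (intro nn_integral_mono Ksq)
    also have "\<dots> \<le> ennreal (K\<^sup>2) * ?E j" using dm by (subst nn_integral_cmult) auto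
    also have "\<dots> \<le> ennreal \<epsilon>" unfolding Ke[symmetric] by (intro mult_left_mono less_imp_le j2) (use K in auto)
    finally have A: "msq M (\<lambda>\<omega>. ?X \<omega> - ?X' \<omega>) \<le> ennreal \<epsilon>" .
    have "msq NS (\<lambda>q. ?H q - ?H' q) = esum (\<lambda>k'. msq lborel (\<lambda>r. ?H (k', r) - ?H' (k', r)))"
      using Hm elem_measurable[OF el] by (intro nn_integral_NS) (auto intro!: borel_measurable_norm)
    also have "\<dots> \<le> esum (\<lambda>k'. ennreal \<epsilon> * indicator {k} k')"
    proof (intro esum_mono)
      fix k'
      show "msq lborel (\<lambda>r. ?H (k', r) - ?H' (k', r)) \<le> ennreal \<epsilon> * indicator {k} k'"
      proof (cases "k' = k")
        case True
        have "msq lborel (\<lambda>r. ?H (k', r) - ?H' (k', r))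
          \<le> (\<integral>\<^sup>+r. ennreal (K\<^sup>2) * (ennreal ((norm (f r - ?s j r))\<^sup>2) * indicator {a..c} r) \<partial>lborel)"
        proof (intro nn_integral_mono)
          fix r
          show "ennreal ((cmod (?H (k', r) - ?H' (k', r)))\<^sup>2) \<le> ennreal (K\<^sup>2) * (ennreal ((norm (f r - ?s j r))\<^sup>2) * indicator {a..c} r)"
            unfolding H' using True out[of r] Ksq[of "f r - ?s j r"] by (auto simp: indicator_def \<phi>.diff)
        qed
        also have "\<dots> = ennreal (K\<^sup>2) * (\<integral>\<^sup>+r. (ennreal ((norm (f r - ?s j r))\<^sup>2) * indicator {a..c} r) \<partial>lborel)"
          using dm' by (rule nn_integral_cmult)
        also have "\<dots> \<le> ennreal \<epsilon>" unfolding Ke[symmetric] by (intro mult_left_mono less_imp_le j1) (use K in auto)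
        finally show ?thesis using True by simp
      qed (unfold H', simp)
    qed
    also have "\<dots> = ennreal \<epsilon>" by (simp add: esum_cmult)
    finally have "msq NS (\<lambda>q. ?H q - ?H' q) \<le> ennreal \<epsilon>" .
    note B = this
    show "\<exists>X' H'. elem X' H' \<and>
       msq M (\<lambda>\<omega>. ?X \<omega> - X' \<omega>) \<le> ennreal \<epsilon> \<and>
       msq NS (\<lambda>q. ?H q - H' q) \<le> ennreal \<epsilon>" by (intro exI conjI, rule el, rule A, rule B)
  qed
qed

end

section \<open>The covariance of the noise in Fourier coefficients\<close>

lemma orthonormal_basis_parseval:
  assumes "orthonormal_basis e"
  shows "(\<lambda>k. (inner (e k) h)\<^sup>2) sums (norm h)\<^sup>2"
proof -
  have on: "inner (e j) (e k) = (if j = k then 1 else 0)" for j k using assms by (simp add: orthonormal_basis_def)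
  define P where "P n = (\<Sum>k<n. inner (e k) h *\<^sub>R e k)" for n
  have inP: "inner (e j) (P n) = (if j < n then inner (e j) h else 0)" for j n
    unfolding P_def inner_sum_right by (simp add: on sum.delta if_distrib cong: if_cong)
  have PP: "inner (P n) (P n) = (\<Sum>k<n. (inner (e k) h)\<^sup>2)" for n
  proof -
    have "inner (P n) (P n) = (\<Sum>k<n. inner (e k) h * inner (e k) (P n))" by (subst (1) P_def) (simp add: inner_sum_left)
    then show ?thesis by (simp add: inP power2_eq_square)
  qed
  have Ph: "inner (P n) h = (\<Sum>k<n. (inner (e k) h)\<^sup>2)" for n by (simp add: P_def inner_sum_left power2_eq_square)
  have diff: "(norm (h - P n))\<^sup>2 = (norm h)\<^sup>2 - (\<Sum>k<n. (inner (e k) h)\<^sup>2)" for n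
    unfolding power2_norm_eq_inner using PP[of n] Ph[of n] by (simp add: inner_diff inner_commute)
  show ?thesis unfolding sums_def
  proof (rule tendstoI)
    fix \<epsilon> :: real assume e0: "0 < \<epsilon>"
    have "h \<in> closure (span (range e))" using assms by (simp add: orthonormal_basis_def)
    then obtain y where y: "y \<in> span (range e)" "dist y h < sqrt \<epsilon>"
      using e0 unfolding closure_approachable by (meson real_sqrt_gt_zero)
    obtain t r where t: "finite t" "t \<subseteq> range e" "y = (\<Sum>v\<in>t. r v *\<^sub>R v)" using y(1) unfolding span_explicit by blast
    obtain N where N: "t \<subseteq> e ` {..<N}"
    proof -
      obtain A where A: "finite A" "t = e ` A" using finite_subset_image[OF t(1,2)] by blast
      then obtain N where "A \<subseteq> {..<N}" using finite_nat_bounded by blast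
      then show ?thesis using that A by blast
    qed
    have yn: "y \<in> span (e ` {..<n})" if "n \<ge> N" for n
      unfolding t(3) using N that by (intro span_sum span_scale span_base) fastforce
    show "\<forall>\<^sub>F n in sequentially. dist (\<Sum>k<n. (inner (e k) h)\<^sup>2) ((norm h)\<^sup>2) < \<epsilon>" using eventually_ge_at_top[of N]
    proof eventually_elim
      case (elim n)
      have Pn: "P n \<in> span (e ` {..<n})" unfolding P_def by (intro span_sum span_scale span_base) auto
      have "orthogonal (h - P n) x" if x: "x \<in> e ` {..<n}" for x
      proof -
        obtain j where j: "x = e j" "j < n" using x by auto
        have "inner (h - P n) (e j) = inner (e j) h - inner (e j) (P n)"
          unfolding inner_commute[of "h - P n" "e j"] by (rule inner_diff_right)
        then show ?thesis using j by (simp add: orthogonal_def inP)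
      qed
      then have orth: "orthogonal (h - P n) x" if "x \<in> e ` {..<n}" for x using that by blast
      have "P n - y \<in> span (e ` {..<n})" by (rule span_diff[OF Pn yn[OF elim]])
      then have "orthogonal (h - P n) (P n - y)" by (rule orthogonal_to_span[OF _ orth])
      \<comment> \<open>\<open>P n\<close> is the orthogonal projection to the span of the first
        \<open>n\<close> basis vectors, hence no farther from \<open>h\<close> than the
        approximation \<open>y\<close> in that span.\<close>
      then have "(norm (h - P n))\<^sup>2 + (norm (P n - y))\<^sup>2 = (norm (h - y))\<^sup>2"
        using norm_add_Pythagorean[of "h - P n" "P n - y"] by simp
      then have "(norm (h - P n))\<^sup>2 \<le> (norm (h - y))\<^sup>2" using zero_le_power2[of "norm (P n - y)"] by linarith
      also have "\<dots> < (sqrt \<epsilon>)\<^sup>2" using y(2) by (intro power_strict_mono) (auto simp: dist_norm norm_minus_commute)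
      finally have "(norm h)\<^sup>2 - (\<Sum>k<n. (inner (e k) h)\<^sup>2) < \<epsilon>" using e0 by (simp add: diff)
      moreover have "0 \<le> (norm h)\<^sup>2 - (\<Sum>k<n. (inner (e k) h)\<^sup>2)" unfolding diff[symmetric] by simp
      ultimately show ?case by (simp add: dist_real_def)
    qed
  qed
qed

lemma esum_orthonormal_basis:
  assumes "orthonormal_basis e"
  shows "esum (\<lambda>k. ennreal ((inner (e k) h)\<^sup>2)) = ennreal ((norm h)\<^sup>2)" unfolding nn_integral_count_space_nat
  using orthonormal_basis_parseval[OF assms, of h] by (intro suminf_ennreal_eq) auto

text \<open>The variance per unit time of the Fourier coefficient at \<open>l\<close> of the
  noise.\<close>

definition qq :: "(l2_torus \<Rightarrow> l2_torus) \<Rightarrow> (nat \<Rightarrow> l2_torus) \<Rightarrow> int \<Rightarrow> ennreal" where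
  "qq R e l = esum (\<lambda>k. ennreal ((cmod (fcoeff (R (e k)) l))\<^sup>2))"

text \<open>Self-adjointness moves the operator to the cosine and the sine, and Parseval removes the
  basis. The basis that witnesses \<open>hilbert_schmidt\<close> can thus be exchanged for that of
  the Wiener process, and \<open>Qh l2_one = 0\<close> switches off the zero mode.\<close>

lemma qq_eq:
  assumes R: "nonneg_selfadjoint R" and e: "orthonormal_basis e"
  shows "qq R e l = ennreal (1 / (2 * pi)) * (ennreal ((norm (R (l2_cos l)))\<^sup>2) + ennreal ((norm (R (l2_sin l)))\<^sup>2))"
proof -
  have sa: "inner (R f) g = inner f (R g)" for f g using R by (simp add: nonneg_selfadjoint_def)
  have "ennreal ((cmod (fcoeff (R (e k)) l))\<^sup>2) = ennreal (1 / (2 * pi)) * (ennreal ((inner (e k) (R (l2_cos l)))\<^sup>2) + ennreal ((inner (e k) (R (l2_sin l)))\<^sup>2))" for k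
  proof -
    have "(cmod (fcoeff (R (e k)) l))\<^sup>2 = (1 / (2 * pi)) * ((inner (e k) (R (l2_cos l)))\<^sup>2 + (inner (e k) (R (l2_sin l)))\<^sup>2)"
      unfolding fcoeff_eq_inner sa by (simp add: norm_divide power_divide cmod_power2)
    from arg_cong[OF this, of ennreal] show ?thesis by (subst (asm) ennreal_mult) auto
  qed
  then show ?thesis unfolding qq_def by (simp add: esum_cmult esum_add esum_orthonormal_basis[OF e])
qed

lemma qq_summable:
  assumes R: "nonneg_selfadjoint R" and e: "orthonormal_basis e" and hs: "hilbert_schmidt 1 R"
  shows "esum (\<lambda>l. ennreal (jb l) * qq R e l) < \<infinity>"
proof -
  obtain e' where e': "orthonormal_basis e'" and inH: "\<And>k. in_H 1 (R (e' k))"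
    and sm: "summable (\<lambda>k. (H_norm 1 (R (e' k)))\<^sup>2)" using hs unfolding hilbert_schmidt_def by blast
  have "esum (\<lambda>l. ennreal (jb l) * qq R e l) = esum (\<lambda>l. ennreal (jb l) * qq R e' l)" by (simp add: qq_eq[OF R e] qq_eq[OF R e'])
  also have "\<dots> = esum (\<lambda>l. esum (\<lambda>k. ennreal (jb l * (cmod (fcoeff (R (e' k)) l))\<^sup>2)))"
    using jb_pos by (simp add: qq_def esum_cmult[symmetric] ennreal_mult less_imp_le)
  also have "\<dots> = esum (\<lambda>k. wl2 jb (fcoeff (R (e' k))))" unfolding wl2_def by (rule esum_swap)
  also have "\<dots> = (\<Sum>k. ennreal ((H_norm 1 (R (e' k)))\<^sup>2))" by (simp add: H_norm_1[OF inH] nn_integral_count_space_nat)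
  also have "\<dots> < \<infinity>" using sm by (subst suminf_ennreal2) auto
  finally show ?thesis .
qed

lemma qq_zero:
  assumes R: "nonneg_selfadjoint R" and e: "orthonormal_basis e" and one: "R l2_one = 0"
  shows "qq R e 0 = 0"
proof -
  have "l2_cos 0 = l2_one" by (simp add: l2_cos_def l2_one_def)
  moreover have "l2_sin 0 = 0" by (simp add: l2_sin_def zero_l2_torus_def)
  moreover have "R 0 = 0" using R by (simp add: nonneg_selfadjoint_def linear_0 bounded_linear.linear)
  ultimately show ?thesis using one by (simp add: qq_eq[OF R e])
qed

lemma esum_nat_tail:
  fixes t :: "nat \<Rightarrow> ennreal"
  assumes "esum t < \<infinity>" "0 < \<epsilon>"
  shows "\<exists>N. \<forall>n\<ge>N. esum (\<lambda>k. t k * indicator {n..} k) \<le> ennreal \<epsilon>"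
proof -
  have fin: "t k < \<infinity>" for k using assms(1) sum_le_esum[of "{k}" t] by (auto simp: less_top top_unique)
  define r where "r k = enn2real (t k)" for k
  have tr: "t k = ennreal (r k)" and r0: "0 \<le> r k" for k using fin[of k] by (auto simp: r_def)
  have sm: "summable r"
  proof (rule summable_suminf_not_top[OF r0])
    show "(\<Sum>k. ennreal (r k)) \<noteq> \<top>" using assms(1) unfolding nn_integral_count_space_nat tr[symmetric] by simp
  qed
  then obtain N where N: "\<And>n. n \<ge> N \<Longrightarrow> norm (\<Sum>i. r (i + n)) < \<epsilon>" using suminf_exist_split[OF assms(2) sm] by blast
  show ?thesis
  proof (intro exI[of _ N] allI impI)
    fix n assume n: "n \<ge> N"
    have "esum (\<lambda>k. t k * indicator {n..} k) = (\<integral>\<^sup>+k. t k \<partial>count_space {n..})"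
      by (subst nn_integral_count_space_indicator[of "{n..}"]) auto
    also have "\<dots> = esum (\<lambda>i. t (i + n))"
    proof (rule nn_integral_bij_count_space[symmetric])
      show "bij_betw (\<lambda>i. i + n) UNIV {n..}" by (rule bij_betwI[where g = "\<lambda>k. k - n"]) auto
    qed
    also have "\<dots> = ennreal (\<Sum>i. r (i + n))" unfolding nn_integral_count_space_nat tr using r0 sm
      by (intro suminf_ennreal2) (auto simp: summable_iff_shift)
    also have "\<dots> \<le> ennreal \<epsilon>" using N[OF n] by (intro ennreal_leI) auto
    finally show "esum (\<lambda>k. t k * indicator {n..} k) \<le> ennreal \<epsilon>" .
  qed
qed

context cyl_wiener begin

text \<open>Two tails are cut off at the same index: that of the integrals, small by the definition
  of the stochastic integral, and that of the integrands, small by \<open>fin\<close>.\<close>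

lemma ito_stoch_integral:
  assumes w: "has_stoch_integral M \<beta> e a c \<Phi> I" and a: "0 \<le> a" and \<phi>: "bounded_linear \<phi>"
    and fin: "esum (\<lambda>k. msq lborel (\<lambda>r. indicator {a..c} r *\<^sub>R \<phi> (\<Phi> r (e k)))) < \<infinity>"
  shows "ito (\<lambda>\<omega>. \<phi> (I \<omega>)) (\<lambda>(k, r). indicator {a..c} r *\<^sub>R \<phi> (\<Phi> r (e k)))" (is "ito ?X ?H")
proof -
  interpret \<phi>: bounded_linear \<phi> by (rule \<phi>)
  obtain J where J: "\<And>k. has_wiener_integral M (\<beta> k) a c (\<lambda>s. \<Phi> s (e k)) (J k)"
    and lim: "(\<lambda>n. msq M (\<lambda>\<omega>. I \<omega> - (\<Sum>k<n. J k \<omega>))) \<longlonglongrightarrow> 0" and Im: "I \<in> borel_measurable M"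
    using w unfolding has_stoch_integral_def tendsto_L2_def by blast
  obtain K where K: "0 < K" and Ksq: "\<And>x. ennreal ((cmod (\<phi> x))\<^sup>2) \<le> ennreal (K\<^sup>2) * ennreal ((norm x)\<^sup>2)"
    using bounded_linear_sq_le[OF \<phi>] by blast
  have Jm: "J k \<in> borel_measurable M" for k using J[of k] by (simp add: has_wiener_integral_def)
  have Hk: "(\<lambda>r. indicator {a..c} r *\<^sub>R \<phi> (\<Phi> r (e k))) \<in> borel_measurable lborel" for k
  proof -
    have "(\<lambda>s. \<Phi> s (e k)) \<in> borel_measurable (restrict_space lborel {a..c})" using J[of k] by (simp add: has_wiener_integral_def)
    from measurable_bounded_linear[OF \<phi> this] show ?thesis by (subst (asm) borel_measurable_restrict_space_iff) auto
  qed
  have Hm: "?H \<in> borel_measurable NS" by (rule measurable_NS) (use Hk in simp)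
  have Xm: "?X \<in> borel_measurable M" by (rule measurable_bounded_linear[OF \<phi> Im])
  let ?Hk = "\<lambda>k. \<lambda>(k', r). if k' = k then indicator {a..c} r *\<^sub>R \<phi> (\<Phi> r (e k)) else 0"
  show ?thesis
  proof (rule ito_closure[OF Xm Hm])
    fix \<epsilon> :: real assume e: "0 < \<epsilon>"
    then have e': "0 < ennreal (\<epsilon> / K\<^sup>2)" using K by simp
    have Ke: "ennreal (K\<^sup>2) * ennreal (\<epsilon> / K\<^sup>2) = ennreal \<epsilon>" using K e by (simp add: ennreal_mult[symmetric])
    obtain N1 where N1: "\<And>n. n \<ge> N1 \<Longrightarrow> msq M (\<lambda>\<omega>. I \<omega> - (\<Sum>k<n. J k \<omega>)) < ennreal (\<epsilon> / K\<^sup>2)"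
      using order_tendstoD(2)[OF lim e'] unfolding eventually_sequentially by blast
    obtain N2 where N2: "\<And>n. n \<ge> N2 \<Longrightarrow> esum (\<lambda>k. msq lborel (\<lambda>r. indicator {a..c} r *\<^sub>R \<phi> (\<Phi> r (e k))) * indicator {n..} k) \<le> ennreal \<epsilon>"
      using esum_nat_tail[OF fin e] by blast
    define n where "n = max N1 N2"
    have it: "ito (\<lambda>\<omega>. \<Sum>k<n. \<phi> (J k \<omega>)) (\<lambda>p. \<Sum>k<n. ?Hk k p)" by (intro ito_sum ito_wiener_integral[OF J a \<phi>]) auto
    have sumH: "(\<Sum>k<n. ?Hk k (k', r)) = (if k' < n then indicator {a..c} r *\<^sub>R \<phi> (\<Phi> r (e k')) else 0)" for k' r
      by (simp add: sum.delta' if_distrib cong: if_cong)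
    have dm: "(\<lambda>\<omega>. ennreal ((norm (I \<omega> - (\<Sum>k<n. J k \<omega>)))\<^sup>2)) \<in> borel_measurable M"
    proof -
      have "(\<lambda>\<omega>. fcoeff (I \<omega> - (\<Sum>k<n. J k \<omega>)) q) \<in> borel_measurable M" for q unfolding fcoeff_diff fcoeff_sum
        by (intro borel_measurable_diff measurable_fcoeff Im Jm borel_measurable_sum)
      then have "(\<lambda>\<omega>. I \<omega> - (\<Sum>k<n. J k \<omega>)) \<in> borel_measurable M" by (rule measurable_l2_from_fcoeff)
      then show ?thesis by measurable
    qed
    have "msq M (\<lambda>\<omega>. ?X \<omega> - (\<Sum>k<n. \<phi> (J k \<omega>)))
       \<le> (\<integral>\<^sup>+\<omega>. ennreal (K\<^sup>2) * ennreal ((norm (I \<omega> - (\<Sum>k<n. J k \<omega>)))\<^sup>2) \<partial>M)"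
      unfolding \<phi>.sum[symmetric] \<phi>.diff[symmetric] by (intro nn_integral_mono Ksq)
    also have "\<dots> = ennreal (K\<^sup>2) * msq M (\<lambda>\<omega>. I \<omega> - (\<Sum>k<n. J k \<omega>))" using dm by (rule nn_integral_cmult)
    also have "\<dots> \<le> ennreal \<epsilon>" unfolding Ke[symmetric] using N1[of n] by (intro mult_left_mono less_imp_le) (auto simp: n_def)
    finally have A: "msq M (\<lambda>\<omega>. ?X \<omega> - (\<Sum>k<n. \<phi> (J k \<omega>))) \<le> ennreal \<epsilon>" .
    have "msq NS (\<lambda>p. ?H p - (\<Sum>k<n. ?Hk k p)) = esum (\<lambda>k'. msq lborel (\<lambda>r. ?H (k', r) - (\<Sum>k<n. ?Hk k (k', r))))"
      using Hm ito_measurable(2)[OF it] by (intro nn_integral_NS) (auto intro!: borel_measurable_norm)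
    also have "\<dots> = esum (\<lambda>k. msq lborel (\<lambda>r. indicator {a..c} r *\<^sub>R \<phi> (\<Phi> r (e k))) * indicator {n..} k)"
      unfolding sumH by (intro nn_integral_cong) (auto simp: indicator_def)
    also have "\<dots> \<le> ennreal \<epsilon>" by (rule N2) (simp add: n_def)
    finally have B: "msq NS (\<lambda>p. ?H p - (\<Sum>k<n. ?Hk k p)) \<le> ennreal \<epsilon>" .
    show "\<exists>X' H'. ito X' H' \<and> msq M (\<lambda>\<omega>. ?X \<omega> - X' \<omega>) \<le> ennreal \<epsilon> \<and>
       msq NS (\<lambda>p. ?H p - H' p) \<le> ennreal \<epsilon>" by (intro exI conjI, rule it, rule A, rule B)
  qed
qed

lemma nn_sq_0_imp_AE:
  assumes "X \<in> borel_measurable M" "msq M X = 0"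
  shows "AE \<omega> in M. X \<omega> = 0" using assms by (subst (asm) nn_integral_0_iff_AE) auto

end

section \<open>Stochastic convolutions in the moving frame\<close>

locale airy_noise = cyl_wiener M F \<beta> e for M :: "'w measure" and F \<beta> e +
  fixes Qh :: "l2_torus \<Rightarrow> l2_torus"
  assumes Qsa: "nonneg_selfadjoint Qh" and Qhs: "hilbert_schmidt 1 Qh" and Qone: "Qh l2_one = 0"
begin

lemma onb: "orthonormal_basis e" using cyl by (simp add: cylindrical_wiener_def)

abbreviation q :: "int \<Rightarrow> ennreal" where "q \<equiv> qq Qh e"

lemma esum_q: "esum (\<lambda>l. ennreal (jb l) * q l) < \<infinity>" by (rule qq_summable[OF Qsa onb Qhs])

lemma q_zero: "q 0 = 0" by (rule qq_zero[OF Qsa onb Qone])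

lemma esum_norm_Qe: "esum (\<lambda>k. ennreal ((norm (Qh (e k)))\<^sup>2)) < \<infinity>"
proof -
  have "esum (\<lambda>k. ennreal ((norm (Qh (e k)))\<^sup>2)) = esum (\<lambda>k. esum (\<lambda>l. ennreal ((cmod (fcoeff (Qh (e k)) l))\<^sup>2)))"
    by (simp add: nl2_fcoeff[symmetric] wl2_def)
  also have "\<dots> = esum (\<lambda>l. q l)" unfolding qq_def by (rule esum_swap)
  also have "\<dots> \<le> esum (\<lambda>l. ennreal (jb l) * q l)"
  proof (intro esum_mono)
    fix l
    have "1 * q l \<le> ennreal (jb l) * q l" using jb_ge_1[of l] by (intro mult_right_mono) auto
    then show "q l \<le> ennreal (jb l) * q l" by simp
  qed
  also have "\<dots> < \<infinity>" by (rule esum_q)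
  finally show ?thesis .
qed

text \<open>The stochastic convolution over \<open>[a, c]\<close>, transported back to time \<open>0\<close> by the Airy group.\<close>

definition twisted_noise :: "real \<Rightarrow> real \<Rightarrow> ('w \<Rightarrow> l2_torus) \<Rightarrow> bool" where
  "twisted_noise a c z \<longleftrightarrow> (\<forall>\<phi> :: l2_torus \<Rightarrow> complex. bounded_linear \<phi> \<longrightarrow>
     ito (\<lambda>\<omega>. \<phi> (z \<omega>)) (\<lambda>(k, r). indicator {a<..c} r *\<^sub>R \<phi> (airy (- r) (Qh (e k)))))"

lemma fin_airy:
  assumes \<phi>: "bounded_linear (\<phi> :: l2_torus \<Rightarrow> complex)"
  shows "esum (\<lambda>k. msq lborel (\<lambda>r. indicator {a..c} r *\<^sub>R \<phi> (airy (t - r) (Qh (e k))))) < \<infinity>"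
proof -
  obtain K where K: "0 < K" "\<And>x. cmod (\<phi> x) \<le> norm x * K" using bounded_linear.pos_bounded[OF \<phi>] by blast
  have "esum (\<lambda>k. msq lborel (\<lambda>r. indicator {a..c} r *\<^sub>R \<phi> (airy (t - r) (Qh (e k)))))
     \<le> esum (\<lambda>k. ennreal ((norm (Qh (e k)))\<^sup>2) * (ennreal (K\<^sup>2) * emeasure lborel {a..c}))"
  proof (intro esum_mono)
    fix k
    have "msq lborel (\<lambda>r. indicator {a..c} r *\<^sub>R \<phi> (airy (t - r) (Qh (e k))))
      \<le> (\<integral>\<^sup>+r. ennreal ((norm (Qh (e k)) * K)\<^sup>2) * indicator {a..c} r \<partial>lborel)"
    proof (intro nn_integral_mono)
      fix r
      have "(cmod (\<phi> (airy (t - r) (Qh (e k)))))\<^sup>2 \<le> (norm (Qh (e k)) * K)\<^sup>2"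
        using K(2)[of "airy (t - r) (Qh (e k))"] by (intro power_mono) (auto simp: norm_airy)
      then show "ennreal ((cmod (indicator {a..c} r *\<^sub>R \<phi> (airy (t - r) (Qh (e k)))))\<^sup>2) \<le> ennreal ((norm (Qh (e k)) * K)\<^sup>2) * indicator {a..c} r"
        by (auto simp: indicator_def ennreal_leI)
    qed
    also have "\<dots> = ennreal ((norm (Qh (e k)) * K)\<^sup>2) * emeasure lborel {a..c}" by (rule nn_integral_cmult_indicator) simp
    also have "ennreal ((norm (Qh (e k)) * K)\<^sup>2) = ennreal ((norm (Qh (e k)))\<^sup>2) * ennreal (K\<^sup>2)"
      by (simp add: power_mult_distrib ennreal_mult)
    finally show "msq lborel (\<lambda>r. indicator {a..c} r *\<^sub>R \<phi> (airy (t - r) (Qh (e k))))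
      \<le> ennreal ((norm (Qh (e k)))\<^sup>2) * (ennreal (K\<^sup>2) * emeasure lborel {a..c})" by (simp add: mult.assoc)
  qed
  also have "\<dots> < \<infinity>" unfolding esum_multc using esum_norm_Qe by (auto simp: ennreal_mult_less_top emeasure_lborel_Icc_eq)
  finally show ?thesis .
qed

lemma ito_cong_AE:
  assumes "ito X H" "H' \<in> borel_measurable NS" "AE p in NS. H p = H' p"
  shows "ito X H'"
proof (rule ito_closure[OF ito_measurable(1)[OF assms(1)] assms(2)])
  fix \<epsilon> :: real assume "0 < \<epsilon>"
  have z: "msq NS (\<lambda>p. H' p - H p) = (\<integral>\<^sup>+p. 0 \<partial>NS)" using assms(3) by (intro nn_integral_cong_AE) (auto elim!: eventually_mono)
  have z': "msq M (\<lambda>\<omega>. X \<omega> - X \<omega>) \<le> ennreal \<epsilon>" by simp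
  have z'': "msq NS (\<lambda>p. H' p - H p) \<le> ennreal \<epsilon>" unfolding z by simp
  show "\<exists>X' H. ito X' H \<and> msq M (\<lambda>\<omega>. X \<omega> - X' \<omega>) \<le> ennreal \<epsilon> \<and>
       msq NS (\<lambda>p. H' p - H p) \<le> ennreal \<epsilon>" by (intro exI conjI, rule assms(1), rule z', rule z'')
qed

text \<open>Transport by \<open>airy (- c)\<close> turns \<open>airy (c - r)\<close> into
  \<open>airy (- r)\<close>. The integrand no longer depends on the right end point, so convolutions
  over different intervals become increments of one process.\<close>

lemma twisted_noise_stoch_integral:
  assumes J: "has_stoch_integral M \<beta> e a c (\<lambda>s. airy (c - s) \<circ> Qh) J" and a: "0 \<le> a"
  shows "twisted_noise a c (\<lambda>\<omega>. airy (- c) (J \<omega>))" unfolding twisted_noise_def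
proof (intro allI impI)
  fix \<phi> :: "l2_torus \<Rightarrow> complex" assume \<phi>: "bounded_linear \<phi>"
  have \<psi>: "bounded_linear (\<lambda>x. \<phi> (airy (- c) x))" using bounded_linear_compose[OF \<phi> bounded_linear_airy] .
  have i: "ito (\<lambda>\<omega>. \<phi> (airy (- c) (J \<omega>))) (\<lambda>(k, r). indicator {a..c} r *\<^sub>R \<phi> (airy (- c) ((airy (c - r) \<circ> Qh) (e k))))"
    by (rule ito_stoch_integral[OF J a \<psi>]) (use fin_airy[OF \<psi>, of a c c] in simp)
  have rm: "(\<lambda>r. indicator {a<..c} r *\<^sub>R \<phi> (airy (- r) (Qh (e k)))) \<in> borel_measurable lborel" for k
  proof -
    have "continuous_on UNIV (\<lambda>r. \<phi> (airy (- r) (Qh (e k))))"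
      by (intro bounded_linear.continuous_on[OF \<phi>] continuous_on_airy continuous_intros)
    then have "(\<lambda>r. \<phi> (airy (- r) (Qh (e k)))) \<in> borel_measurable borel" by (rule borel_measurable_continuous_onI)
    then show ?thesis by simp
  qed
  show "ito (\<lambda>\<omega>. \<phi> (airy (- c) (J \<omega>))) (\<lambda>(k, r). indicator {a<..c} r *\<^sub>R \<phi> (airy (- r) (Qh (e k))))"
  proof (rule ito_cong_AE[OF i])
    show "(\<lambda>(k, r). indicator {a<..c} r *\<^sub>R \<phi> (airy (- r) (Qh (e k)))) \<in> borel_measurable NS"
      by (rule measurable_NS) (use rm in simp)
    \<comment> \<open>The stochastic integral lives on the closed interval, while half-open
      intervals fit together without overlap; they differ on the null set
      \<open>r = a\<close>.\<close>
    have nul: "{p \<in> space NS. snd p = a} \<in> null_sets NS"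
    proof (rule null_setsI)
      show m: "{p \<in> space NS. snd p = a} \<in> sets NS" by measurable
      have "emeasure NS {p \<in> space NS. snd p = a} = (\<integral>\<^sup>+p. indicator {p \<in> space NS. snd p = a} p \<partial>NS)" using m by simp
      also have "\<dots> = esum (\<lambda>k. \<integral>\<^sup>+r. indicator {p \<in> space NS. snd p = a} (k, r) \<partial>lborel)" using m by (intro nn_integral_NS) simp
      also have "\<dots> = esum (\<lambda>k::nat. \<integral>\<^sup>+r. indicator {a} r \<partial>lborel)"
        by (intro nn_integral_cong) (auto simp: indicator_def space_pair_measure)
      also have "\<dots> = 0" by simp
      finally show "emeasure NS {p \<in> space NS. snd p = a} = 0" .
    qed
    show "AE p in NS. (case p of (k, r) \<Rightarrow> indicator {a..c} r *\<^sub>R \<phi> (airy (- c) ((airy (c - r) \<circ> Qh) (e k))))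
        = (case p of (k, r) \<Rightarrow> indicator {a<..c} r *\<^sub>R \<phi> (airy (- r) (Qh (e k))))"
    proof (rule AE_I'[OF nul])
      show "{p \<in> space NS. (case p of (k, r) \<Rightarrow> indicator {a..c} r *\<^sub>R \<phi> (airy (- c) ((airy (c - r) \<circ> Qh) (e k))))
        \<noteq> (case p of (k, r) \<Rightarrow> indicator {a<..c} r *\<^sub>R \<phi> (airy (- r) (Qh (e k))))} \<subseteq> {p \<in> space NS. snd p = a}"
        by (auto simp: airy_airy indicator_def of_bool_def split: if_splits)
    qed
  qed
qed

end

text \<open>Both the equation and the scheme hold only almost surely. Completeness is what makes the
  processes that they determine up to null sets measurable.\<close>

lemma complete_measure_AE_measurable:
  assumes M: "complete_measure M" and g: "g \<in> measurable M N" and eq: "AE \<omega> in M. f \<omega> = g \<omega>"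
    and sp: "\<And>\<omega>. \<omega> \<in> space M \<Longrightarrow> f \<omega> \<in> space N"
  shows "f \<in> measurable M N"
proof (rule measurableI)
  interpret complete_measure M by (rule M)
  obtain D where D: "{\<omega> \<in> space M. f \<omega> \<noteq> g \<omega>} \<subseteq> D" "D \<in> null_sets M" using eq by (auto elim!: AE_E simp: null_sets_def)
  fix A assume A: "A \<in> sets N"
  have sub: "B \<in> sets M" if "B \<subseteq> D" for B using complete[OF that D(2)] .
  have eq: "f -` A \<inter> space M = ((g -` A \<inter> space M) - D) \<union> (f -` A \<inter> space M \<inter> D)" using D(1) by auto
  have "(g -` A \<inter> space M) - D \<in> sets M" using measurable_sets[OF g A] sub[of D] by auto
  moreover have "f -` A \<inter> space M \<inter> D \<in> sets M" by (rule sub) auto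
  ultimately have "((g -` A \<inter> space M) - D) \<union> (f -` A \<inter> space M \<inter> D) \<in> sets M" by (rule sets.Un)
  then show "f -` A \<inter> space M \<in> sets M" by (simp only: eq[symmetric])
qed (rule sp)

context cyl_wiener begin

lemma complete_M: "complete_measure M" using filt by (simp add: complete_filtered_prob_space_def)

lemma AE_eq_measurable:
  assumes "g \<in> borel_measurable M" "AE \<omega> in M. f \<omega> = g \<omega>"
  shows "f \<in> borel_measurable M" by (rule complete_measure_AE_measurable[OF complete_M assms]) simp

lemma ito_cong_AE_left:
  assumes "ito X H" "AE \<omega> in M. Y \<omega> = X \<omega>"
  shows "ito Y H"
proof (rule ito_closure[OF AE_eq_measurable[OF ito_measurable(1)[OF assms(1)] assms(2)] ito_measurable(2)[OF assms(1)]])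
  fix \<epsilon> :: real assume "0 < \<epsilon>"
  have z: "msq M (\<lambda>\<omega>. Y \<omega> - X \<omega>) = (\<integral>\<^sup>+\<omega>. 0 \<partial>M)" using assms(2) by (intro nn_integral_cong_AE) (auto elim!: eventually_mono)
  have z': "msq M (\<lambda>\<omega>. Y \<omega> - X \<omega>) \<le> ennreal \<epsilon>" unfolding z by simp
  have z'': "msq NS (\<lambda>p. H p - H p) \<le> ennreal \<epsilon>" by simp
  show "\<exists>X' H'. ito X' H' \<and> msq M (\<lambda>\<omega>. Y \<omega> - X' \<omega>) \<le> ennreal \<epsilon> \<and>
       msq NS (\<lambda>p. H p - H' p) \<le> ennreal \<epsilon>" by (intro exI conjI, rule assms(1), rule z', rule z'')
qed

lemma AE_eq_l2I:
  assumes "\<And>l. AE \<omega> in M. fcoeff (Y \<omega>) l = fcoeff (Z \<omega>) l"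
  shows "AE \<omega> in M. Y \<omega> = Z \<omega>"
proof -
  have "AE \<omega> in M. \<forall>l. fcoeff (Y \<omega>) l = fcoeff (Z \<omega>) l" using assms by (simp add: AE_all_countable)
  then show ?thesis by eventually_elim (auto intro: fcoeff_inject)
qed

lemma measurable_l2_diff:
  assumes "Y \<in> borel_measurable M" "Z \<in> borel_measurable M"
  shows "(\<lambda>\<omega>. Y \<omega> - Z \<omega> :: l2_torus) \<in> borel_measurable M" "(\<lambda>\<omega>. Y \<omega> + Z \<omega> :: l2_torus) \<in> borel_measurable M"
  by (rule measurable_l2_from_fcoeff, unfold fcoeff_diff fcoeff_add,
      intro borel_measurable_diff borel_measurable_add measurable_fcoeff assms)+

end

context airy_noise begin

lemma twisted_noise_measurable: "twisted_noise a c z \<Longrightarrow> z \<in> borel_measurable M" unfolding twisted_noise_def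
  by (rule measurable_l2_from_fcoeff) (use bounded_linear_fcoeff ito_measurable(1) in blast)

lemma twisted_noise_cong:
  assumes "twisted_noise a c z" "AE \<omega> in M. z' \<omega> = z \<omega>"
  shows "twisted_noise a c z'" unfolding twisted_noise_def
proof (intro allI impI)
  fix \<phi> :: "l2_torus \<Rightarrow> complex" assume "bounded_linear \<phi>"
  then have "ito (\<lambda>\<omega>. \<phi> (z \<omega>)) (\<lambda>(k, r). indicator {a<..c} r *\<^sub>R \<phi> (airy (- r) (Qh (e k))))"
    using assms(1) by (simp add: twisted_noise_def)
  then show "ito (\<lambda>\<omega>. \<phi> (z' \<omega>)) (\<lambda>(k, r). indicator {a<..c} r *\<^sub>R \<phi> (airy (- r) (Qh (e k))))"
    by (rule ito_cong_AE_left) (use assms(2) in \<open>auto elim!: eventually_mono\<close>)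
qed

lemma twisted_noise_diff:
  assumes "twisted_noise 0 t z" "twisted_noise 0 s z'" "0 \<le> s" "s \<le> t"
  shows "twisted_noise s t (\<lambda>\<omega>. z \<omega> - z' \<omega>)" unfolding twisted_noise_def
proof (intro allI impI)
  fix \<phi> :: "l2_torus \<Rightarrow> complex" assume \<phi>: "bounded_linear \<phi>"
  have "ito (\<lambda>\<omega>. \<phi> (z \<omega>) - \<phi> (z' \<omega>)) (\<lambda>p. (case p of (k, r) \<Rightarrow> indicator {0<..t} r *\<^sub>R \<phi> (airy (- r) (Qh (e k))))
    - (case p of (k, r) \<Rightarrow> indicator {0<..s} r *\<^sub>R \<phi> (airy (- r) (Qh (e k)))))"
    using assms \<phi> by (intro ito_diff) (auto simp: twisted_noise_def)
  moreover have "(\<lambda>p. (case p of (k, r) \<Rightarrow> indicator {0<..t} r *\<^sub>R \<phi> (airy (- r) (Qh (e k))))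
    - (case p of (k, r) \<Rightarrow> indicator {0<..s} r *\<^sub>R \<phi> (airy (- r) (Qh (e k)))))
    = (\<lambda>(k, r). indicator {s<..t} r *\<^sub>R \<phi> (airy (- r) (Qh (e k))))" using assms(3,4) by (auto simp: fun_eq_iff indicator_def)
  ultimately show "ito (\<lambda>\<omega>. \<phi> (z \<omega> - z' \<omega>)) (\<lambda>(k, r). indicator {s<..t} r *\<^sub>R \<phi> (airy (- r) (Qh (e k))))"
    using linear_diff[OF bounded_linear.linear[OF \<phi>]] by simp
qed

text \<open>The difference has integrand 0, and the isometry makes it vanish. Thus each stochastic
  integral in the scheme, of which only existence is given, is identified with an increment of the
  process \<open>z\<close> of the exact equation.\<close>

lemma twisted_noise_unique:
  assumes "twisted_noise a c z" "twisted_noise a c w"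
  shows "AE \<omega> in M. z \<omega> = w \<omega>"
proof (rule AE_eq_l2I)
  fix l
  have "ito (\<lambda>\<omega>. fcoeff (z \<omega>) l - fcoeff (w \<omega>) l) (\<lambda>p. (case p of (k, r) \<Rightarrow> indicator {a<..c} r *\<^sub>R fcoeff (airy (- r) (Qh (e k))) l)
    - (case p of (k, r) \<Rightarrow> indicator {a<..c} r *\<^sub>R fcoeff (airy (- r) (Qh (e k))) l))"
    using assms bounded_linear_fcoeff[of l] unfolding twisted_noise_def by (intro ito_diff) blast+
  then have i: "ito (\<lambda>\<omega>. fcoeff (z \<omega>) l - fcoeff (w \<omega>) l) (\<lambda>p. 0)" by simp
  have "AE \<omega> in M. fcoeff (z \<omega>) l - fcoeff (w \<omega>) l = 0"
    by (rule nn_sq_0_imp_AE[OF ito_measurable(1)[OF i]]) (simp add: ito_isometry[OF i])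
  then show "AE \<omega> in M. fcoeff (z \<omega>) l = fcoeff (w \<omega>) l" by eventually_elim simp
qed

lemma twisted_noise_moment:
  assumes "twisted_noise a c z" "a \<le> c"
  shows "msq M (\<lambda>\<omega>. fcoeff (z \<omega>) l) = ennreal (c - a) * q l"
proof -
  let ?H = "\<lambda>(k, r). indicator {a<..c} r *\<^sub>R fcoeff (airy (- r) (Qh (e k))) l"
  have i: "ito (\<lambda>\<omega>. fcoeff (z \<omega>) l) ?H" using assms(1) bounded_linear_fcoeff[of l] unfolding twisted_noise_def by blast
  have "msq M (\<lambda>\<omega>. fcoeff (z \<omega>) l) = msq NS (\<lambda>p. ?H p)" by (rule ito_isometry[OF i])
  also have "\<dots> = esum (\<lambda>k. msq lborel (\<lambda>r. ?H (k, r)))"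
    using ito_measurable(2)[OF i] by (intro nn_integral_NS) (auto intro!: borel_measurable_norm)
  also have "\<dots> = esum (\<lambda>k. ennreal (c - a) * ennreal ((cmod (fcoeff (Qh (e k)) l))\<^sup>2))"
  proof (intro nn_integral_cong)
    fix k
    have "msq lborel (\<lambda>r. ?H (k, r)) = (\<integral>\<^sup>+r. ennreal ((cmod (fcoeff (Qh (e k)) l))\<^sup>2) * indicator {a<..c} r \<partial>lborel)"
      by (intro nn_integral_cong) (auto simp: indicator_def)
    also have "\<dots> = ennreal ((cmod (fcoeff (Qh (e k)) l))\<^sup>2) * emeasure lborel {a<..c}" by (rule nn_integral_cmult_indicator) simp
    finally show "msq lborel (\<lambda>r. ?H (k, r)) = ennreal (c - a) * ennreal ((cmod (fcoeff (Qh (e k)) l))\<^sup>2)"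
      using assms(2) by (simp add: mult.commute)
  qed
  finally show ?thesis by (simp add: esum_cmult qq_def)
qed

lemma twisted_noise_zero_mean:
  assumes "twisted_noise a c z" "a \<le> c"
  shows "AE \<omega> in M. fcoeff (z \<omega>) 0 = 0" by (rule nn_sq_0_imp_AE)
     (use twisted_noise_moment[OF assms, of 0] q_zero measurable_fcoeff[OF twisted_noise_measurable[OF assms(1)]] in auto)

lemma nn_integral_wl2:
  assumes "\<And>k. (\<lambda>\<omega>. Y \<omega> k) \<in> borel_measurable N" and w: "\<And>k. 0 \<le> w k"
  shows "(\<integral>\<^sup>+\<omega>. wl2 w (Y \<omega>) \<partial>N) = esum (\<lambda>k. ennreal (w k) * msq N (\<lambda>\<omega>. Y \<omega> k))"
proof -
  have [measurable]: "(\<lambda>\<omega>. Y \<omega> k) \<in> borel_measurable N" for k by (rule assms)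
  have "(\<integral>\<^sup>+\<omega>. wl2 w (Y \<omega>) \<partial>N) = esum (\<lambda>k. \<integral>\<^sup>+\<omega>. ennreal (w k * (cmod (Y \<omega> k))\<^sup>2) \<partial>N)"
    unfolding wl2_def by (rule nn_integral_count_space_nn_integral) auto
  also have "\<dots> = esum (\<lambda>k. ennreal (w k) * msq N (\<lambda>\<omega>. Y \<omega> k))" using w by (simp add: ennreal_mult nn_integral_cmult)
  finally show ?thesis .
qed

text \<open>The squared Hilbert-Schmidt norm of \<open>Qh\<close> from \<open>L\<^sup>2\<close> to
  \<open>H\<^sup>1\<close>, the rate at which the noise adds to the second moment in
  \<open>H\<^sup>1\<close>.\<close>

definition CQ :: ennreal where "CQ = esum (\<lambda>l. ennreal (jb l) * q l)"

lemma twisted_noise_H1: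
  assumes "twisted_noise a c z" "a \<le> c"
  shows "mh1 M z = ennreal (c - a) * CQ"
proof -
  have jb0: "0 \<le> jb k" for k using jb_pos[of k] by simp
  have "mh1 M z = esum (\<lambda>k. ennreal (jb k) * (ennreal (c - a) * q k))" unfolding twisted_noise_moment[OF assms, symmetric]
    by (rule nn_integral_wl2[OF measurable_fcoeff[OF twisted_noise_measurable[OF assms(1)]] jb0])
  also have "\<dots> = ennreal (c - a) * CQ" unfolding CQ_def esum_cmult[symmetric] by (intro nn_integral_cong) (simp add: mult_ac)
  finally show ?thesis .
qed

text \<open>\<open>Y\<close> is a linear functional of the noise up to time \<open>t\<close>.\<close>

definition past :: "real \<Rightarrow> ('w \<Rightarrow> l2_torus) \<Rightarrow> bool" where
  "past t Y \<longleftrightarrow> (\<forall>\<phi> :: l2_torus \<Rightarrow> complex. bounded_linear \<phi> \<longrightarrow>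
     (\<exists>H. ito (\<lambda>\<omega>. \<phi> (Y \<omega>)) H \<and> (\<forall>k r. r \<notin> {0<..t} \<longrightarrow> H (k, r) = 0)))"

lemma past_measurable: "past t Y \<Longrightarrow> Y \<in> borel_measurable M" unfolding past_def
  by (rule measurable_l2_from_fcoeff) (use bounded_linear_fcoeff ito_measurable(1) in blast)

lemma past_zero: "past t (\<lambda>\<omega>. 0)" unfolding past_def
proof (intro allI impI)
  fix \<phi> :: "l2_torus \<Rightarrow> complex" assume "bounded_linear \<phi>"
  then have "\<phi> 0 = 0" by (simp add: linear_0 bounded_linear.linear)
  then show "\<exists>H. ito (\<lambda>\<omega>. \<phi> 0) H \<and> (\<forall>k r. r \<notin> {0<..t} \<longrightarrow> H (k, r) = 0)" using ito_zero by (intro exI[of _ "\<lambda>p. 0"]) simp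
qed

lemma past_add:
  assumes "past t Y" "past t Z"
  shows "past t (\<lambda>\<omega>. Y \<omega> + Z \<omega>)" unfolding past_def
proof (intro allI impI)
  fix \<phi> :: "l2_torus \<Rightarrow> complex" assume \<phi>: "bounded_linear \<phi>"
  obtain H where H: "ito (\<lambda>\<omega>. \<phi> (Y \<omega>)) H" "\<forall>k r. r \<notin> {0<..t} \<longrightarrow> H (k, r) = 0" using assms(1) \<phi> unfolding past_def by blast
  obtain G where G: "ito (\<lambda>\<omega>. \<phi> (Z \<omega>)) G" "\<forall>k r. r \<notin> {0<..t} \<longrightarrow> G (k, r) = 0" using assms(2) \<phi> unfolding past_def by blast
  show "\<exists>H. ito (\<lambda>\<omega>. \<phi> (Y \<omega> + Z \<omega>)) H \<and> (\<forall>k r. r \<notin> {0<..t} \<longrightarrow> H (k, r) = 0)"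
    using ito_add[OF H(1) G(1)] H(2) G(2) linear_add[OF bounded_linear.linear[OF \<phi>]] by (intro exI[of _ "\<lambda>p. H p + G p"]) simp
qed

lemma past_bounded_linear:
  assumes "past t Y" "bounded_linear L"
  shows "past t (\<lambda>\<omega>. L (Y \<omega>))" using assms(1) bounded_linear_compose[OF _ assms(2)] unfolding past_def by blast

lemma past_mono: "past s Y \<Longrightarrow> s \<le> t \<Longrightarrow> past t Y" unfolding past_def
proof (intro allI impI)
  fix \<phi> :: "l2_torus \<Rightarrow> complex"
  assume Y: "\<forall>\<phi> :: l2_torus \<Rightarrow> complex. bounded_linear \<phi> \<longrightarrow>
     (\<exists>H. ito (\<lambda>\<omega>. \<phi> (Y \<omega>)) H \<and> (\<forall>k r. r \<notin> {0<..s} \<longrightarrow> H (k, r) = 0))" and st: "s \<le> t" and \<phi>: "bounded_linear \<phi>"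
  obtain H where H: "ito (\<lambda>\<omega>. \<phi> (Y \<omega>)) H" "\<forall>k r. r \<notin> {0<..s} \<longrightarrow> H (k, r) = 0" using Y \<phi> by blast
  show "\<exists>H. ito (\<lambda>\<omega>. \<phi> (Y \<omega>)) H \<and> (\<forall>k r. r \<notin> {0<..t} \<longrightarrow> H (k, r) = 0)" by (rule exI[of _ H]) (use H st in auto)
qed

lemma past_twisted_noise:
  assumes "twisted_noise a c z" "0 \<le> a"
  shows "past c z" unfolding past_def
proof (intro allI impI)
  fix \<phi> :: "l2_torus \<Rightarrow> complex" assume \<phi>: "bounded_linear \<phi>"
  show "\<exists>H. ito (\<lambda>\<omega>. \<phi> (z \<omega>)) H \<and> (\<forall>k r. r \<notin> {0<..c} \<longrightarrow> H (k, r) = 0)" using assms \<phi> unfolding twisted_noise_def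
    by (intro exI[of _ "\<lambda>(k, r). indicator {a<..c} r *\<^sub>R \<phi> (airy (- r) (Qh (e k)))"]) (auto simp: indicator_def)
qed

text \<open>The integrands live on the disjoint intervals up to \<open>a\<close> and after
  \<open>a\<close>, so the isometry adds the squares. As the auxiliary recursion is linear with
  deterministic coefficients, this does the work of conditional expectations.\<close>

lemma past_orthogonal:
  assumes Y: "past a Y" and w: "twisted_noise a c w"
  shows "msq M (\<lambda>\<omega>. fcoeff (Y \<omega> + w \<omega>) l)
    = msq M (\<lambda>\<omega>. fcoeff (Y \<omega>) l) + msq M (\<lambda>\<omega>. fcoeff (w \<omega>) l)"
proof -
  let ?G = "\<lambda>(k, r). indicator {a<..c} r *\<^sub>R fcoeff (airy (- r) (Qh (e k))) l"
  obtain H where H: "ito (\<lambda>\<omega>. fcoeff (Y \<omega>) l) H" "\<forall>k r. r \<notin> {0<..a} \<longrightarrow> H (k, r) = 0"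
    using Y bounded_linear_fcoeff[of l] unfolding past_def by blast
  have G: "ito (\<lambda>\<omega>. fcoeff (w \<omega>) l) ?G" using w bounded_linear_fcoeff[of l] unfolding twisted_noise_def by blast
  have [measurable]: "H \<in> borel_measurable NS" "?G \<in> borel_measurable NS" using H G ito_measurable by auto
  have "ito (\<lambda>\<omega>. fcoeff (Y \<omega> + w \<omega>) l) (\<lambda>p. H p + ?G p)" unfolding fcoeff_add by (rule ito_add[OF H(1) G])
  then have "msq M (\<lambda>\<omega>. fcoeff (Y \<omega> + w \<omega>) l) = msq NS (\<lambda>p. H p + ?G p)" by (rule ito_isometry)
  also have "\<dots> = (\<integral>\<^sup>+p. ennreal ((cmod (H p))\<^sup>2) + ennreal ((cmod (?G p))\<^sup>2) \<partial>NS)"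
  proof (intro nn_integral_cong)
    fix p :: "nat \<times> real"
    obtain k r where p: "p = (k, r)" by (cases p)
    have "H p = 0 \<or> ?G p = 0" using H(2) by (cases "r \<le> a") (auto simp: p)
    then show "ennreal ((cmod (H p + ?G p))\<^sup>2) = ennreal ((cmod (H p))\<^sup>2) + ennreal ((cmod (?G p))\<^sup>2)" by auto
  qed
  also have "\<dots> = msq NS H + msq NS (\<lambda>p. ?G p)" by (rule nn_integral_add) measurable
  finally show ?thesis by (simp only: ito_isometry[OF H(1)] ito_isometry[OF G])
qed

lemma past_orthogonal_H1:
  assumes Y: "past a Y" and w: "twisted_noise a c w"
  shows "mh1 M (\<lambda>\<omega>. Y \<omega> + w \<omega>)
    = mh1 M Y + mh1 M w"
proof -
  have jb0: "0 \<le> jb k" for k using jb_pos[of k] by simp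
  have m: "(\<lambda>\<omega>. fcoeff (Y \<omega>) k) \<in> borel_measurable M" "(\<lambda>\<omega>. fcoeff (w \<omega>) k) \<in> borel_measurable M"
    "(\<lambda>\<omega>. fcoeff (Y \<omega> + w \<omega>) k) \<in> borel_measurable M" for k
    using measurable_fcoeff[OF past_measurable[OF Y], of k] measurable_fcoeff[OF twisted_noise_measurable[OF w], of k]
    unfolding fcoeff_add by (auto intro: borel_measurable_add)
  show ?thesis unfolding nn_integral_wl2[OF m(1) jb0] nn_integral_wl2[OF m(2) jb0] nn_integral_wl2[OF m(3) jb0]
      past_orthogonal[OF assms] distrib_left by (rule esum_add)
qed

end

section \<open>Second moments of integrals over time\<close>

lemma riemann_sum_tendsto:
  fixes g :: "real \<Rightarrow> complex"
  assumes ac: "a \<le> c" and g: "continuous_on {a..c} g"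
  shows "(\<lambda>n. \<Sum>i<Suc n. of_real ((c - a) / real (Suc n)) * g (a + real i * ((c - a) / real (Suc n)))) \<longlonglongrightarrow> integral {a..c} g"
proof (rule LIMSEQ_I)
  fix e :: real assume e: "0 < e"
  define d where "d = e / (c - a + 1)"
  have d: "0 < d" using e ac by (simp add: d_def)
  obtain \<delta> where \<delta>: "0 < \<delta>" "\<And>x y. x \<in> {a..c} \<Longrightarrow> y \<in> {a..c} \<Longrightarrow> dist x y < \<delta> \<Longrightarrow> dist (g x) (g y) < d"
    using compact_uniformly_continuous[OF g compact_Icc] d unfolding uniformly_continuous_on_def by metis
  obtain N :: nat where N: "(c - a) / \<delta> < real N" using reals_Archimedean2 by blast
  show "\<exists>no. \<forall>n\<ge>no. norm ((\<Sum>i<Suc n. of_real ((c - a) / real (Suc n)) * g (a + real i * ((c - a) / real (Suc n)))) - integral {a..c} g) < e"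
  proof (intro exI[of _ N] allI impI)
    fix n assume n: "n \<ge> N"
    define h where "h = (c - a) / real (Suc n)"
    have h0: "0 \<le> h" using ac by (simp add: h_def)
    have "(c - a) / \<delta> < real (Suc n)" using N n by linarith
    then have h\<delta>: "h < \<delta>" using \<delta>(1) by (simp add: h_def field_simps)
    have hn: "real (Suc n) * h = c - a" by (simp add: h_def)
    have le: "norm ((\<Sum>i<m. of_real h * g (a + real i * h)) - integral {a..a + real m * h} g) \<le> real m * (h * d)"
      if "m \<le> Suc n" for m using that
    proof (induction m)
      case (Suc m)
      have mh: "a + real (Suc m) * h \<le> c"
      proof -
        have "real (Suc m) * h \<le> real (Suc n) * h" using Suc.prems h0 by (intro mult_right_mono) auto
        then show ?thesis using hn by simp
      qed
      let ?u = "a + real m * h" and ?v = "a + real (Suc m) * h"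
      have uv: "a \<le> ?u" "?u \<le> ?v" "?v - ?u = h" using h0 by (auto simp: algebra_simps)
      have gi: "g integrable_on {a..?v}" using mh by (intro integrable_continuous_real continuous_on_subset[OF g]) auto
      have gi': "g integrable_on {?u..?v}" using uv by (intro integrable_subinterval_real[OF gi]) auto
      have split: "integral {a..?v} g = integral {a..?u} g + integral {?u..?v} g"
        using uv gi by (intro Henstock_Kurzweil_Integration.integral_combine[symmetric]) auto
      have "norm (of_real h * g ?u - integral {?u..?v} g) = norm (integral {?u..?v} (\<lambda>x. g ?u - g x))"
        using gi' uv by (subst integral_diff) (auto simp: scaleR_conv_of_real)
      also have "\<dots> \<le> d * (?v - ?u)"
      proof (intro integral_bound uv)
        show "continuous_on {?u..?v} (\<lambda>x. g ?u - g x)" using uv mh by (intro continuous_intros continuous_on_subset[OF g]) auto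
        fix x assume x: "x \<in> {?u..?v}"
        have "?u \<le> x" "x \<le> ?v" using x by auto
        then have "a \<le> x" "x \<le> c" "?u \<le> c" "dist ?u x < \<delta>" using uv mh h\<delta> unfolding dist_real_def by linarith+
        then have "dist (g ?u) (g x) < d" using uv(1) by (intro \<delta>(2)) auto
        then show "norm (g ?u - g x) \<le> d" by (simp add: dist_norm)
      qed
      finally have 1: "norm (of_real h * g ?u - integral {?u..?v} g) \<le> h * d" using uv by (simp add: mult.commute)
      have "norm ((\<Sum>i<Suc m. of_real h * g (a + real i * h)) - integral {a..?v} g)
        = norm (((\<Sum>i<m. of_real h * g (a + real i * h)) - integral {a..?u} g) + (of_real h * g ?u - integral {?u..?v} g))"
        unfolding split by (simp add: algebra_simps)
      also have "\<dots> \<le> real m * (h * d) + h * d" using Suc 1 by (intro norm_triangle_mono) auto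
      finally show ?case by (simp add: algebra_simps)
    qed simp
    have "norm ((\<Sum>i<Suc n. of_real h * g (a + real i * h)) - integral {a..c} g) \<le> (real (Suc n) * h) * d"
      using le[OF order_refl] unfolding hn by (simp only: mult.assoc[symmetric] hn) simp
    also have "\<dots> < e" unfolding hn d_def using ac e by (simp add: field_simps)
    finally show "norm ((\<Sum>i<Suc n. of_real ((c - a) / real (Suc n)) * g (a + real i * ((c - a) / real (Suc n)))) - integral {a..c} g) < e"
      by (simp add: h_def)
  qed
qed

lemma cmod_sum_sq_le:
  fixes f :: "'i \<Rightarrow> complex"
  shows "(cmod (\<Sum>i\<in>I. f i))\<^sup>2 \<le> real (card I) * (\<Sum>i\<in>I. (cmod (f i))\<^sup>2)"
proof -
  have "(cmod (\<Sum>i\<in>I. f i))\<^sup>2 \<le> (\<Sum>i\<in>I. cmod (f i))\<^sup>2" by (intro power_mono norm_sum) auto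
  also have "\<dots> \<le> (\<Sum>i\<in>I. (cmod (f i))\<^sup>2) * real (card I)" by (rule sum_squared_le_sum_of_squares)
  finally show ?thesis by (simp add: mult.commute)
qed

lemma measurable_wl2:
  assumes "\<And>k. (\<lambda>\<omega>. Y \<omega> k) \<in> borel_measurable M"
  shows "(\<lambda>\<omega>. wl2 w (Y \<omega>)) \<in> borel_measurable M"
proof -
  have [measurable]: "(\<lambda>\<omega>. Y \<omega> k) \<in> borel_measurable M" for k by (rule assms)
  have "wl2 w c = (\<Sum>n. ennreal (w (int_decode n) * (cmod (c (int_decode n)))\<^sup>2))" for c
    unfolding wl2_def nn_integral_count_space_nat[symmetric] by (rule esum_reindex[OF bij_int_decode, symmetric])
  then show ?thesis by simp
qed

text \<open>Riemann sums and Fatou's lemma avoid any joint measurability in time and randomness.\<close>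

theorem nn_integral_wl2_integral_le:
  fixes G :: "int \<Rightarrow> real \<Rightarrow> 'w \<Rightarrow> complex"
  assumes ac: "a \<le> c" and w: "\<And>k. 0 \<le> w k"
    and cont: "\<And>k. AE \<omega> in M. continuous_on {a..c} (\<lambda>s. G k s \<omega>)"
    and meas: "\<And>k s. s \<in> {a..c} \<Longrightarrow> (\<lambda>\<omega>. G k s \<omega>) \<in> borel_measurable M"
    and bd: "\<And>s. s \<in> {a..c} \<Longrightarrow> (\<integral>\<^sup>+\<omega>. wl2 w (\<lambda>k. G k s \<omega>) \<partial>M) \<le> K"
  shows "(\<integral>\<^sup>+\<omega>. wl2 w (\<lambda>k. integral {a..c} (\<lambda>s. G k s \<omega>)) \<partial>M) \<le> ennreal ((c - a)\<^sup>2) * K"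
proof -
  define h where "h n = (c - a) / real (Suc n)" for n
  define pt where "pt n i = a + real i * h n" for n i
  define R where "R n k \<omega> = (\<Sum>i<Suc n. of_real (h n) * G k (pt n i) \<omega>)" for n k \<omega>
  have pt: "pt n i \<in> {a..c}" if "i < Suc n" for n i
  proof -
    have h0: "0 \<le> h n" using ac by (simp add: h_def)
    have "real i * h n \<le> real (Suc n) * h n" using that h0 by (intro mult_right_mono) auto
    also have "\<dots> = c - a" by (simp add: h_def)
    finally show ?thesis using h0 by (simp add: pt_def)
  qed
  have Gm: "(\<lambda>\<omega>. G k (pt n i) \<omega>) \<in> borel_measurable M" if "i < Suc n" for k n i by (rule meas[OF pt[OF that]])
  have Rm: "(\<lambda>\<omega>. R n k \<omega>) \<in> borel_measurable M" for n k
    unfolding R_def by (intro borel_measurable_sum borel_measurable_times Gm) auto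
  have "AE \<omega> in M. \<forall>k. continuous_on {a..c} (\<lambda>s. G k s \<omega>)" using cont by (simp add: AE_all_countable)
  then have lim: "AE \<omega> in M. \<forall>k. (\<lambda>n. R n k \<omega>) \<longlonglongrightarrow> integral {a..c} (\<lambda>s. G k s \<omega>)"
  proof eventually_elim
    case (elim \<omega>)
    show ?case
    proof
      fix k
      show "(\<lambda>n. R n k \<omega>) \<longlonglongrightarrow> integral {a..c} (\<lambda>s. G k s \<omega>)"
        unfolding R_def h_def pt_def using elim by (intro riemann_sum_tendsto[OF ac]) blast
    qed
  qed
  have Rle: "(\<integral>\<^sup>+\<omega>. wl2 w (\<lambda>k. R n k \<omega>) \<partial>M) \<le> ennreal ((c - a)\<^sup>2) * K" for n
  proof -
    \<comment> \<open>Cauchy-Schwarz over the cells gives the squared mesh times the number of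
      cells; the sum over the cells contributes this number once more, and together they give
      \<open>(c - a)\<^sup>2\<close>.\<close>
    let ?C = "(h n)\<^sup>2 * real (Suc n)"
    have p: "ennreal (w k * (cmod (R n k \<omega>))\<^sup>2) \<le> (\<Sum>i<Suc n. ennreal ?C * ennreal (w k * (cmod (G k (pt n i) \<omega>))\<^sup>2))" for k \<omega>
    proof -
      have "(cmod (R n k \<omega>))\<^sup>2 \<le> real (Suc n) * (\<Sum>i<Suc n. (cmod (of_real (h n) * G k (pt n i) \<omega>))\<^sup>2)"
        unfolding R_def using cmod_sum_sq_le[of "\<lambda>i. of_real (h n) * G k (pt n i) \<omega>" "{..<Suc n}"] by simp
      also have "\<dots> = ?C * (\<Sum>i<Suc n. (cmod (G k (pt n i) \<omega>))\<^sup>2)"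
        by (simp add: norm_mult power_mult_distrib sum_distrib_left mult_ac del: of_nat_Suc sum.lessThan_Suc)
      finally have "w k * (cmod (R n k \<omega>))\<^sup>2 \<le> w k * (?C * (\<Sum>i<Suc n. (cmod (G k (pt n i) \<omega>))\<^sup>2))"
        using w by (intro mult_left_mono) auto
      also have "\<dots> = (\<Sum>i<Suc n. ?C * (w k * (cmod (G k (pt n i) \<omega>))\<^sup>2))"
        by (simp add: sum_distrib_left mult_ac del: of_nat_Suc sum.lessThan_Suc)
      finally have "ennreal (w k * (cmod (R n k \<omega>))\<^sup>2) \<le> ennreal (\<Sum>i<Suc n. ?C * (w k * (cmod (G k (pt n i) \<omega>))\<^sup>2))"
        by (rule ennreal_leI)
      also have "\<dots> = (\<Sum>i<Suc n. ennreal ?C * ennreal (w k * (cmod (G k (pt n i) \<omega>))\<^sup>2))"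
        using w by (subst sum_ennreal[symmetric]) (auto simp: ennreal_mult simp del: of_nat_Suc sum.lessThan_Suc)
      finally show ?thesis .
    qed
    have "wl2 w (\<lambda>k. R n k \<omega>) \<le> (\<Sum>i<Suc n. ennreal ?C * wl2 w (\<lambda>k. G k (pt n i) \<omega>))" for \<omega>
    proof -
      have "wl2 w (\<lambda>k. R n k \<omega>) \<le> esum (\<lambda>k. \<Sum>i<Suc n. ennreal ?C * ennreal (w k * (cmod (G k (pt n i) \<omega>))\<^sup>2))"
        unfolding wl2_def by (intro esum_mono p)
      also have "\<dots> = (\<Sum>i<Suc n. ennreal ?C * wl2 w (\<lambda>k. G k (pt n i) \<omega>))"
        by (subst nn_integral_sum) (simp_all add: esum_cmult wl2_def del: sum.lessThan_Suc)
      finally show ?thesis .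
    qed
    then have "(\<integral>\<^sup>+\<omega>. wl2 w (\<lambda>k. R n k \<omega>) \<partial>M) \<le> (\<integral>\<^sup>+\<omega>. (\<Sum>i<Suc n. ennreal ?C * wl2 w (\<lambda>k. G k (pt n i) \<omega>)) \<partial>M)"
      by (intro nn_integral_mono)
    also have "\<dots> = (\<Sum>i<Suc n. ennreal ?C * (\<integral>\<^sup>+\<omega>. wl2 w (\<lambda>k. G k (pt n i) \<omega>) \<partial>M))"
    proof -
      have m: "(\<lambda>\<omega>. wl2 w (\<lambda>k. G k (pt n i) \<omega>)) \<in> borel_measurable M" if "i \<in> {..<Suc n}" for i
        by (rule measurable_wl2) (use Gm that in simp)
      show ?thesis using m by (subst nn_integral_sum) (auto simp: nn_integral_cmult simp del: sum.lessThan_Suc)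
    qed
    also have "\<dots> \<le> (\<Sum>i<Suc n. ennreal ?C * K)" by (intro sum_mono mult_left_mono bd pt) auto
    also have "\<dots> = of_nat (Suc n) * (ennreal ?C * K)" by simp
    also have "\<dots> = (ennreal (real (Suc n)) * ennreal ?C) * K" by (simp only: ennreal_of_nat_eq_real_of_nat mult.assoc)
    also have "ennreal (real (Suc n)) * ennreal ?C = ennreal ((c - a)\<^sup>2)"
      by (simp add: ennreal_mult[symmetric] h_def power_divide power2_eq_square del: of_nat_Suc)
    finally show ?thesis .
  qed
  have "(\<integral>\<^sup>+\<omega>. wl2 w (\<lambda>k. integral {a..c} (\<lambda>s. G k s \<omega>)) \<partial>M)
      = (\<integral>\<^sup>+\<omega>. esum (\<lambda>k. liminf (\<lambda>n. ennreal (w k * (cmod (R n k \<omega>))\<^sup>2))) \<partial>M)"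
  proof (intro nn_integral_cong_AE, use lim in eventually_elim)
    case (elim \<omega>)
    have "ennreal (w k * (cmod (integral {a..c} (\<lambda>s. G k s \<omega>)))\<^sup>2) = liminf (\<lambda>n. ennreal (w k * (cmod (R n k \<omega>))\<^sup>2))" for k
      by (intro lim_imp_Liminf[symmetric] tendsto_ennrealI tendsto_intros) (use elim in auto)
    then show ?case by (simp add: wl2_def)
  qed
  also have "\<dots> \<le> (\<integral>\<^sup>+\<omega>. liminf (\<lambda>n. wl2 w (\<lambda>k. R n k \<omega>)) \<partial>M)"
    unfolding wl2_def by (intro nn_integral_mono nn_integral_liminf) auto
  also have "\<dots> \<le> liminf (\<lambda>n. \<integral>\<^sup>+\<omega>. wl2 w (\<lambda>k. R n k \<omega>) \<partial>M)"
  proof (rule nn_integral_liminf)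
    fix n
    show "(\<lambda>\<omega>. wl2 w (\<lambda>k. R n k \<omega>)) \<in> borel_measurable M" by (rule measurable_wl2) (rule Rm)
  qed
  also have "\<dots> \<le> liminf (\<lambda>n. ennreal ((c - a)\<^sup>2) * K)" by (intro Liminf_mono always_eventually allI Rle)
  finally show ?thesis by (simp add: Liminf_const)
qed

text \<open>The deterministic estimate is the random one on a space with a single point.\<close>

lemma wl2_integral_le:
  fixes G :: "int \<Rightarrow> real \<Rightarrow> complex"
  assumes "a \<le> c" "\<And>k. 0 \<le> w k" "\<And>k. continuous_on {a..c} (G k)"
    and "\<And>s. s \<in> {a..c} \<Longrightarrow> wl2 w (\<lambda>k. G k s) \<le> K"
  shows "wl2 w (\<lambda>k. integral {a..c} (G k)) \<le> ennreal ((c - a)\<^sup>2) * K"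
  using nn_integral_wl2_integral_le[where M = "count_space {()}" and G = "\<lambda>k s \<omega>. G k s" and a = a and c = c and w = w and K = K] assms
  by (simp add: nn_integral_count_space_finite)

section \<open>The derivative of a product of \<open>H\<^sup>1\<close> functions\<close>

lemma in_H_nonpos: "s \<le> 0 \<Longrightarrow> in_H s f"
proof -
  assume s: "s \<le> 0"
  have "wl2 (\<lambda>k. jb k powr s) (fcoeff f) \<le> nl2 (fcoeff f)"
  proof (rule wl2_mono)
    fix k show "jb k powr s \<le> 1" using powr_mono[OF s jb_ge_1[of k]] jb_pos[of k] by simp
  qed
  then show "in_H s f" by (simp add: in_H_iff nl2_fcoeff le_less_trans)
qed

lemma wl2_jb_Lam: "wl2 jb (fcoeff (Lam (-1) g)) = ennreal ((norm g)\<^sup>2)"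
proof -
  have "jb k * (cmod (of_real (jb k powr (-1 / 2)) * fcoeff g k))\<^sup>2 = (cmod (fcoeff g k))\<^sup>2" for k
  proof -
    define x where "x = jb k powr (-1 / 2)"
    have "x\<^sup>2 = 1 / jb k" using jb_pos[of k] by (simp add: x_def power2_eq_square powr_add[symmetric] powr_minus_divide)
    moreover have "jb k * (cmod (of_real x * fcoeff g k))\<^sup>2 = jb k * x\<^sup>2 * (cmod (fcoeff g k))\<^sup>2"
      by (simp add: norm_mult power_mult_distrib)
    ultimately show ?thesis using jb_pos[of k] by (simp add: x_def)
  qed
  then show ?thesis by (simp add: wl2_def fcoeff_Lam in_H_nonpos nl2_fcoeff[symmetric])
qed

lemma Lam_Lam: "in_H 1 f \<Longrightarrow> Lam (-1) (Lam 1 f) = f"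
  by (rule fcoeff_inject) (simp add: fcoeff_Lam in_H_nonpos mult.assoc[symmetric] of_real_mult[symmetric] powr_add[symmetric] less_imp_neq[OF jb_pos, symmetric] del: of_real_mult)

lemma bounded_linear_Lam: "bounded_linear (Lam (-1))"
proof (rule bounded_linear_intro[where K = 1])
  fix g
  have "ennreal ((norm (Lam (-1) g))\<^sup>2) \<le> ennreal ((norm g)\<^sup>2)"
    using nl2_le_wl2_jb[of "fcoeff (Lam (-1) g)"] by (simp only: wl2_jb_Lam nl2_fcoeff)
  then show "norm (Lam (-1) g) \<le> norm g * 1" by (simp add: ennreal_le_iff power2_le_iff_abs_le)
qed (auto intro!: fcoeff_inject simp: fcoeff_Lam in_H_nonpos fcoeff_add fcoeff_scaleR algebra_simps)

lemma sconv_cnj: "sconv (fcoeff f) (fcoeff g) (- k) = cnj (sconv (fcoeff f) (fcoeff g) k)"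
proof -
  have "bij_betw uminus (UNIV :: int set) UNIV" by (rule bij_uminus)
  then have "(\<Sum>\<^sub>\<infinity>j. fcoeff f (- j) * fcoeff g (- k - - j)) = sconv (fcoeff f) (fcoeff g) (- k)"
    unfolding sconv_def by (rule infsum_reindex_bij_betw)
  moreover have "fcoeff g (- k - - j) = cnj (fcoeff g (k - j))" for j using fcoeff_cnj[of g "k - j"] by (simp add: algebra_simps)
  ultimately have "sconv (fcoeff f) (fcoeff g) (- k) = (\<Sum>\<^sub>\<infinity>j. cnj (fcoeff f j * fcoeff g (k - j)))" by (simp add: fcoeff_cnj)
  also have "\<dots> = cnj (sconv (fcoeff f) (fcoeff g) k)" unfolding sconv_def
    using has_sum_bounded_linear[OF bounded_linear_cnj has_sum_infsum[OF sconv_fcoeff_summable]]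
    by (intro infsumI) (simp add: o_def)
  finally show ?thesis .
qed

lemma conj_sym_NN: "conj_sym (NN s g v)" by (simp add: conj_sym_def NN_def sconv_cnj cis_cnj)

text \<open>The derivative of the product of two \<open>H\<^sup>1\<close> functions, as a bounded bilinear map on \<open>L\<^sup>2\<close>.\<close>

definition DM :: "l2_torus \<Rightarrow> l2_torus \<Rightarrow> l2_torus" where
  "DM g v = fourier_series (NN 0 (Lam (-1) g) (Lam (-1) v))"

lemma nl2_NN_Lam: "nl2 (NN 0 (Lam (-1) g) (Lam (-1) v)) \<le> ennreal (4 * cjb * ((norm g)\<^sup>2 * (norm v)\<^sup>2))"
proof -
  have "nl2 (NN 0 (Lam (-1) g) (Lam (-1) v)) \<le> 4 * Cjb * (ennreal ((norm g)\<^sup>2) * ennreal ((norm v)\<^sup>2))"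
    using nl2_NN_le[of 0 "Lam (-1) g" "Lam (-1) v"] by (simp only: wl2_jb_Lam)
  also have "\<dots> = ennreal (4 * cjb * ((norm g)\<^sup>2 * (norm v)\<^sup>2))" using cjb_nonneg by (simp add: Cjb_eq ennreal_mult)
  finally show ?thesis .
qed

lemma fcoeff_DM: "fcoeff (DM g v) k = NN 0 (Lam (-1) g) (Lam (-1) v) k" unfolding DM_def
  by (rule fcoeff_fourier_series[OF conj_sym_NN]) (simp add: sq_summable_iff le_less_trans[OF nl2_NN_Lam])

lemma bounded_bilinear_DM: "bounded_bilinear DM"
proof
  note b = bounded_bilinear.comp[OF bounded_bilinear_NN bounded_linear_Lam bounded_linear_Lam]
  fix g g' v v' :: l2_torus and r :: real
  show "DM (g + g') v = DM g v + DM g' v" "DM g (v + v') = DM g v + DM g v'"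
    "DM (r *\<^sub>R g) v = r *\<^sub>R DM g v" "DM g (r *\<^sub>R v) = r *\<^sub>R DM g v"
    by (rule fcoeff_inject, simp add: fcoeff_DM fcoeff_add fcoeff_scaleR bounded_bilinear.add_left[OF b] bounded_bilinear.add_right[OF b]
      bounded_bilinear.scaleR_left[OF b] bounded_bilinear.scaleR_right[OF b] scaleR_conv_of_real)+
next
  have "norm (DM g v) \<le> norm g * norm v * sqrt (4 * cjb)" for g v
  proof -
    have "ennreal ((norm (DM g v))\<^sup>2) \<le> ennreal (4 * cjb * ((norm g)\<^sup>2 * (norm v)\<^sup>2))"
      using nl2_NN_Lam[of g v] unfolding nl2_fcoeff[symmetric] by (simp add: wl2_def fcoeff_DM)
    then have "(norm (DM g v))\<^sup>2 \<le> 4 * cjb * ((norm g)\<^sup>2 * (norm v)\<^sup>2)" using cjb_nonneg by (subst (asm) ennreal_le_iff) auto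
    also have "\<dots> = (norm g * norm v * sqrt (4 * cjb))\<^sup>2" using cjb_nonneg by (simp add: power_mult_distrib)
    finally show ?thesis by (rule power2_le_imp_le) (use cjb_nonneg in simp)
  qed
  then show "\<exists>K. \<forall>g v. norm (DM g v) \<le> norm g * norm v * K" by blast
qed

lemma in_H_1_nl1: "in_H 1 f \<Longrightarrow> nl1 (fcoeff f) < \<infinity>"
proof -
  assume "in_H 1 f"
  then have "Cjb * wl2 jb (fcoeff f) < \<infinity>" by (simp add: in_H_1_iff Cjb_eq ennreal_mult_less_top)
  then have "(nl1 (fcoeff f))\<^sup>2 < \<infinity>" using nl1_sq_le by (rule le_less_trans[rotated])
  then show ?thesis by (simp add: power_less_top_ennreal)
qed

text \<open>The coefficients in question are those of \<open>DM\<close>, an element of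
  \<open>L\<^sup>2\<close>. They are therefore square summable, and the limit that defines
  \<open>Dx\<close> exists.\<close>

lemma Dx_mult:
  assumes "in_H 1 g" "in_H 1 v"
  shows "Dx (g \<odot> v) = DM (Lam 1 g) (Lam 1 v)" "fcoeff (Dx (g \<odot> v)) k = NN 0 g v k"
proof -
  have e: "\<i> * of_int l * fcoeff (g \<odot> v) l = NN 0 g v l" for l
    by (simp add: fcoeff_mult[OF in_H_1_nl1[OF assms(1)]] NN_def airy_0)
  have DM: "fcoeff (DM (Lam 1 g) (Lam 1 v)) l = NN 0 g v l" for l by (simp add: fcoeff_DM Lam_Lam assms)
  have s: "sq_summable (\<lambda>l. \<i> * of_int l * fcoeff (g \<odot> v) l)" unfolding e DM[symmetric] by (rule sq_summable_fcoeff)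
  show *: "fcoeff (Dx (g \<odot> v)) k = NN 0 g v k" for k by (simp add: fcoeff_Dx[OF s] e)
  show "Dx (g \<odot> v) = DM (Lam 1 g) (Lam 1 v)" by (rule fcoeff_inject) (simp add: * DM)
qed

lemma NN_airy: "NN s (airy (- s) g) (airy (- s) v) k = cis (- (s * of_int k ^ 3)) * NN 0 g v k"
  by (simp add: NN_def airy_airy airy_0)

section \<open>The fluctuation equation in the moving frame\<close>

text \<open>Extended by 0 from the closed triangle the integrand is integrable on the plane, so
  Fubini's theorem applies.\<close>

lemma integral_triangle_swap:
  fixes h :: "real \<Rightarrow> real \<Rightarrow> complex"
  assumes h: "continuous_on ({a..c} \<times> {a..c}) (\<lambda>(s, r). h s r)"
  shows "integral {a..c} (\<lambda>s. integral {a..s} (\<lambda>r. h s r)) = integral {a..c} (\<lambda>r. integral {r..c} (\<lambda>s. h s r))"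
proof -
  define S where "S = {p :: real \<times> real. a \<le> snd p \<and> snd p \<le> fst p \<and> fst p \<le> c}"
  have sub: "S \<subseteq> {a..c} \<times> {a..c}" by (auto simp: S_def)
  have "closed S" unfolding S_def by (intro closed_Collect_conj closed_Collect_le continuous_intros)
  moreover have "compact ({a..c} \<times> {a..c})" by (intro compact_Times) auto
  ultimately have cS: "compact S" using sub by (metis compact_Int_closed inf.absorb_iff2 inf_commute)
  define g where "g p = indicator S p *\<^sub>R (case p of (s, r) \<Rightarrow> h s r)" for p
  have "integrable lborel g" unfolding g_def by (intro borel_integrable_compact cS continuous_on_subset[OF h sub])
  then have int: "integrable (lborel \<Otimes>\<^sub>M lborel) (\<lambda>(s, r). g (s, r))" by (simp add: lborel_prod)
  have fub: "(\<integral>r. (\<integral>s. g (s, r) \<partial>lborel) \<partial>lborel) = (\<integral>s. (\<integral>r. g (s, r) \<partial>lborel) \<partial>lborel)"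
    using lborel_pair.Fubini_integral[of "\<lambda>s r. g (s, r)"] int by simp
  have i1: "integrable lborel (\<lambda>s. \<integral>r. g (s, r) \<partial>lborel)" and i2: "integrable lborel (\<lambda>r. \<integral>s. g (s, r) \<partial>lborel)"
    using lborel_pair.integrable_fst'[of g] lborel_pair.integrable_snd[of "\<lambda>s r. g (s, r)"] int by (auto simp: split_def)
  have L: "(\<integral>r. indicator {p..q} r *\<^sub>R u r \<partial>lborel) = integral {p..q} u" if "continuous_on {p..q} u" for p q and u :: "real \<Rightarrow> complex"
    using set_borel_integral_eq_integral(2)[OF borel_integrable_atLeastAtMost'[OF that]] by (simp add: set_lebesgue_integral_def)
  have in1: "(\<integral>r. g (s, r) \<partial>lborel) = indicator {a..c} s *\<^sub>R integral {a..s} (\<lambda>r. h s r)" for s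
  proof (cases "s \<in> {a..c}")
    case True
    have "continuous_on {a..s} (\<lambda>r. h s r)"
      by (rule continuous_on_compose2[OF h, of "{a..s}" "\<lambda>r. (s, r)", simplified]) (use True in \<open>auto intro!: continuous_intros\<close>)
    moreover have "g (s, r) = indicator {a..s} r *\<^sub>R h s r" for r using True by (auto simp: g_def S_def indicator_def)
    ultimately show ?thesis using True by (simp add: L)
  next
    case False
    then have "g (s, r) = 0" for r by (auto simp: g_def S_def)
    then show ?thesis using False by simp
  qed
  have in2: "(\<integral>s. g (s, r) \<partial>lborel) = indicator {a..c} r *\<^sub>R integral {r..c} (\<lambda>s. h s r)" for r
  proof (cases "r \<in> {a..c}")
    case True
    have "continuous_on {r..c} (\<lambda>s. h s r)"
      by (rule continuous_on_compose2[OF h, of "{r..c}" "\<lambda>s. (s, r)", simplified]) (use True in \<open>auto intro!: continuous_intros\<close>)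
    moreover have "g (s, r) = indicator {r..c} s *\<^sub>R h s r" for s using True by (auto simp: g_def S_def indicator_def)
    ultimately show ?thesis using True by (simp add: L)
  next
    case False
    then have "g (s, r) = 0" for s by (auto simp: g_def S_def)
    then show ?thesis using False by simp
  qed
  have "integral {a..c} (\<lambda>s. integral {a..s} (\<lambda>r. h s r)) = (LINT s:{a..c}|lborel. integral {a..s} (\<lambda>r. h s r))"
    by (rule set_borel_integral_eq_integral(2)[symmetric]) (use i1 in \<open>simp add: set_integrable_def in1\<close>)
  also have "\<dots> = (LINT r:{a..c}|lborel. integral {r..c} (\<lambda>s. h s r))" using fub by (simp add: in1 in2 set_lebesgue_integral_def)
  also have "\<dots> = integral {a..c} (\<lambda>r. integral {r..c} (\<lambda>s. h s r))"
    by (rule set_borel_integral_eq_integral(2)) (use i2 in \<open>simp add: set_integrable_def in2\<close>)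
  finally show ?thesis .
qed

text \<open>Meant for the drift part of an increment of \<open>x\<close>, whose rate
  \<open>y\<close> is controlled in \<open>L\<^sup>2\<close> only, whereas \<open>NN\<close> costs a
  derivative. Integrating first over the later time replaces \<open>NN\<close> by \<open>BB\<close>,
  which costs none.\<close>

lemma integral_NN_integral:
  assumes u: "continuous_on {a..c} u" and ac: "a \<le> c"
  shows "integral {a..c} (\<lambda>s. NN s g (integral {a..s} u) k) = integral {a..c} (\<lambda>r. BB r c g (u r) k)"
proof -
  have "NN s g (integral {a..s} u) k = integral {a..s} (\<lambda>r. NN s g (u r) k)" if "s \<in> {a..c}" for s
  proof -
    have "u integrable_on {a..s}" using that by (intro integrable_continuous_real continuous_on_subset[OF u]) auto
    from integral_linear[OF this bounded_bilinear.bounded_linear_right[OF bounded_bilinear_NN], of s g k]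
    show ?thesis by (simp add: o_def)
  qed
  then have "integral {a..c} (\<lambda>s. NN s g (integral {a..s} u) k) = integral {a..c} (\<lambda>s. integral {a..s} (\<lambda>r. NN s g (u r) k))"
    by (intro integral_cong) auto
  also have "\<dots> = integral {a..c} (\<lambda>r. integral {r..c} (\<lambda>s. NN s g (u r) k))"
  proof (rule integral_triangle_swap)
    have "continuous_on ({a..c} \<times> {a..c}) (\<lambda>p. NN (fst p) g (u (snd p)) k)"
      by (intro continuous_on_NN continuous_intros continuous_on_compose2[OF u]) auto
    then show "continuous_on ({a..c} \<times> {a..c}) (\<lambda>(s, r). NN s g (u r) k)" by (simp add: split_def)
  qed
  finally show ?thesis by (simp add: BB_eq_integral)
qed

lemma BB_linear:
  "BB a c (g - g') v k = BB a c g v k - BB a c g' v k" "BB a c g (v - v') k = BB a c g v k - BB a c g v' k"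
  "BB a c g (v + v') k = BB a c g v k + BB a c g v' k" "BB a c g (r *\<^sub>R v) k = of_real r * BB a c g v k"
proof -
  note b = bounded_bilinear_NN
  have i: "(\<lambda>s. NN s g v k) integrable_on {a..c}" for g v by (intro integrable_continuous_real continuous_on_NN continuous_intros)
  show "BB a c (g - g') v k = BB a c g v k - BB a c g' v k" "BB a c g (v - v') k = BB a c g v k - BB a c g v' k"
    "BB a c g (v + v') k = BB a c g v k + BB a c g v' k"
    unfolding BB_eq_integral bounded_bilinear.diff_left[OF b] bounded_bilinear.diff_right[OF b] bounded_bilinear.add_right[OF b]
    by (simp_all add: integral_diff integral_add i)
  show "BB a c g (r *\<^sub>R v) k = of_real r * BB a c g v k"
    unfolding BB_eq_integral bounded_bilinear.scaleR_right[OF b] by (simp add: scaleR_conv_of_real)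
qed

lemma continuous_on_H_2_imp_1:
  assumes "continuous_on_H 2 A u"
  shows "continuous_on_H 1 A u"
proof -
  have H: "in_H 1 v" "H_norm 1 v \<le> H_norm 2 v" if v: "in_H 2 v" for v
  proof -
    show i: "in_H 1 v" using v wl2_jb_le_jb2[of "fcoeff v"] by (auto simp: in_H_1_iff in_H_2_iff)
    have "ennreal ((H_norm 1 v)\<^sup>2) \<le> ennreal ((H_norm 2 v)\<^sup>2)" unfolding H_norm_1[OF i] H_norm_2[OF v] by (rule wl2_jb_le_jb2)
    then have "(H_norm 1 v)\<^sup>2 \<le> (H_norm 2 v)\<^sup>2" by (subst (asm) ennreal_le_iff) auto
    then show "H_norm 1 v \<le> H_norm 2 v" by (rule power2_le_imp_le) (metis norm_Lam norm_ge_zero v)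
  qed
  show ?thesis unfolding continuous_on_H_def
  proof (intro conjI ballI)
    fix t assume t: "t \<in> A"
    show "in_H 1 (u t)" using assms t H by (simp add: continuous_on_H_def)
    have "((\<lambda>r. H_norm 2 (u r - u t)) \<longlongrightarrow> 0) (at t within A)" using assms t by (simp add: continuous_on_H_def)
    moreover have "\<forall>\<^sub>F r in at t within A. norm (H_norm 1 (u r - u t)) \<le> H_norm 2 (u r - u t)" unfolding eventually_at_filter
    proof (rule always_eventually, intro allI impI)
      fix r assume r: "r \<in> A"
      have "in_H 2 (u r - u t)" using assms r t by (intro in_H_diff) (auto simp: continuous_on_H_def)
      moreover from this have "0 \<le> H_norm 1 (u r - u t)" using H(1) norm_Lam by (metis norm_ge_zero)
      ultimately show "norm (H_norm 1 (u r - u t)) \<le> H_norm 2 (u r - u t)" using H by simp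
    qed
    ultimately show "((\<lambda>r. H_norm 1 (u r - u t)) \<longlongrightarrow> 0) (at t within A)" by (rule Lim_null_comparison[rotated])
  qed
qed

lemma wl2_airy [simp]: "wl2 w (fcoeff (airy s u)) = wl2 w (fcoeff u)" by (rule wl2_cong_cmod) simp

section \<open>The deterministic and the random solution in the moving frame\<close>

locale kdv_fluct = airy_noise M F \<beta> e Qh for M :: "'w measure" and F \<beta> e Qh +
  fixes T \<mu> :: real and \<xi> :: l2_torus and \<psi> :: "real \<Rightarrow> l2_torus" and chi :: "real \<Rightarrow> 'w \<Rightarrow> l2_torus"
  assumes T: "0 < T" and \<mu>: "0 < \<mu>" and \<xi>0: "fcoeff \<xi> 0 = 0"
    and kdv: "kdv_solution T \<mu> \<xi> \<psi>" and fluct: "fluctuation_solution M \<beta> e T \<mu> Qh \<psi> chi"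
begin

lemma psi_H2: "continuous_on_H 2 {0..T} \<psi>" using kdv by (simp add: kdv_solution_def)

lemma psi_in_H2: "t \<in> {0..T} \<Longrightarrow> in_H 2 (\<psi> t)" and psi_in_H1: "t \<in> {0..T} \<Longrightarrow> in_H 1 (\<psi> t)"
  using psi_H2 continuous_on_H_2_imp_1[OF psi_H2] by (auto simp: continuous_on_H_def)

lemma psi_bounded: "\<exists>K\<ge>0. \<forall>t\<in>{0..T}. hl2 (fcoeff (\<psi> t)) \<le> ennreal (K\<^sup>2)"
proof -
  have "compact ((\<lambda>t. Lam 2 (\<psi> t)) ` {0..T})" by (intro compact_continuous_image continuous_on_H_Lam psi_H2) auto
  then obtain K where K: "\<And>t. t \<in> {0..T} \<Longrightarrow> norm (Lam 2 (\<psi> t)) \<le> K" using compact_imp_bounded bounded_iff by (metis imageI)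
  have "hl2 (fcoeff (\<psi> t)) \<le> ennreal (\<bar>K\<bar>\<^sup>2)" if "t \<in> {0..T}" for t
  proof -
    have "hl2 (fcoeff (\<psi> t)) = ennreal ((norm (Lam 2 (\<psi> t)))\<^sup>2)" using psi_in_H2[OF that] by (simp add: norm_Lam H_norm_2)
    also have "\<dots> \<le> ennreal (\<bar>K\<bar>\<^sup>2)" using K[OF that] by (intro ennreal_leI power_mono) auto
    finally show ?thesis .
  qed
  then show ?thesis by (intro exI[of _ "\<bar>K\<bar>"]) simp
qed

definition KP :: real where
  "KP = (SOME K. 0 \<le> K \<and> (\<forall>t\<in>{0..T}. hl2 (fcoeff (\<psi> t)) \<le> ennreal (K\<^sup>2)))"

lemma KP: "0 \<le> KP" "t \<in> {0..T} \<Longrightarrow> hl2 (fcoeff (\<psi> t)) \<le> ennreal (KP\<^sup>2)"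
  using someI_ex[OF psi_bounded[unfolded Bex_def], folded KP_def] unfolding KP_def[symmetric] by auto

definition f :: "real \<Rightarrow> l2_torus" where "f t = airy (- t) (\<psi> t)"

lemma f_H2: "t \<in> {0..T} \<Longrightarrow> hl2 (fcoeff (f t)) \<le> ennreal (KP\<^sup>2)" by (simp add: f_def KP)

lemma f_H1: "t \<in> {0..T} \<Longrightarrow> wl2 jb (fcoeff (f t)) \<le> ennreal (KP\<^sup>2)" using f_H2 wl2_jb_le_jb2 order_trans by blast

lemma psi_Lam_continuous: "continuous_on {0..T} (\<lambda>t. Lam 1 (\<psi> t))"
  by (rule continuous_on_H_Lam[OF continuous_on_H_2_imp_1[OF psi_H2]])

lemma psi_continuous: "continuous_on {0..T} \<psi>"
proof -
  have "continuous_on {0..T} (\<lambda>t. Lam (-1) (Lam 1 (\<psi> t)))"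
    by (rule bounded_linear.continuous_on[OF bounded_linear_Lam psi_Lam_continuous])
  then show ?thesis by (rule continuous_on_eq) (simp add: Lam_Lam psi_in_H1)
qed

lemma f_continuous: "continuous_on {0..T} f" unfolding f_def by (intro continuous_on_airy psi_continuous continuous_intros)

lemma NN_f: "NN t (f t) (f t) k = cis (- (t * of_int k ^ 3)) * NN 0 (\<psi> t) (\<psi> t) k" unfolding f_def by (rule NN_airy)

text \<open>The Airy phase is an integrating factor for each coefficient: the third derivative
  cancels, and what remains makes sense for \<open>H\<^sup>2\<close> solutions.\<close>

lemma f_increment:
  assumes "0 \<le> s" "s \<le> t" "t \<le> T"
  shows "fcoeff (f t) k - fcoeff (f s) k = of_real \<mu> * integral {s..t} (\<lambda>r. NN r (f r) (f r) k)"
proof -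
  have "((\<lambda>r. fcoeff (f r) k) has_vector_derivative of_real \<mu> * NN r (f r) (f r) k) (at r within {s..t})"
    if r: "r \<in> {s..t}" for r
  proof -
    have rT: "r \<in> {0..T}" using r assms by auto
    have d: "((\<lambda>r. fcoeff (\<psi> r) k) has_vector_derivative
           - ((\<i> * of_int k) ^ 3 * fcoeff (\<psi> r) k) + of_real \<mu> * (\<i> * of_int k * fcoeff (\<psi> r \<odot> \<psi> r) k)) (at r within {s..t})"
    proof (rule has_vector_derivative_within_subset)
      show "((\<lambda>r. fcoeff (\<psi> r) k) has_vector_derivative
           - ((\<i> * of_int k) ^ 3 * fcoeff (\<psi> r) k) + of_real \<mu> * (\<i> * of_int k * fcoeff (\<psi> r \<odot> \<psi> r) k)) (at r within {0..T})"
        using kdv rT unfolding kdv_solution_def by blast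
    qed (use assms in auto)
    have c: "((\<lambda>r. cis (- (r * of_int k ^ 3))) has_vector_derivative
        - (\<i> * of_int k ^ 3) * cis (- (r * of_int k ^ 3))) (at r within {s..t})"
    proof -
      have e: "cis (- (r * of_int k ^ 3)) = exp (- (\<i> * of_int k ^ 3) * of_real r)" for r by (simp add: cis_conv_exp mult_ac)
      have "((\<lambda>w. exp (- (\<i> * of_int k ^ 3) * w)) has_field_derivative - (\<i> * of_int k ^ 3) * exp (- (\<i> * of_int k ^ 3) * of_real r)) (at (of_real r))"
        by (auto intro!: derivative_eq_intros)
      then show ?thesis unfolding e by (rule has_vector_derivative_real_field)
    qed
    have p: "fcoeff (\<psi> r \<odot> \<psi> r) k = sconv (fcoeff (\<psi> r)) (fcoeff (\<psi> r)) k / r2p"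
      by (rule fcoeff_mult[OF in_H_1_nl1[OF psi_in_H1[OF rT]]])
    have i3: "(\<i> * of_int k) ^ 3 = - \<i> * complex_of_int k ^ 3" by (simp add: power_mult_distrib power3_eq_cube[of \<i>])
    have "((\<lambda>r. cis (- (r * of_int k ^ 3)) * fcoeff (\<psi> r) k) has_vector_derivative
       (cis (- (r * of_int k ^ 3)) * (- ((\<i> * of_int k) ^ 3 * fcoeff (\<psi> r) k) + of_real \<mu> * (\<i> * of_int k * fcoeff (\<psi> r \<odot> \<psi> r) k))
         + (- (\<i> * of_int k ^ 3) * cis (- (r * of_int k ^ 3))) * fcoeff (\<psi> r) k)) (at r within {s..t})"
      by (rule has_vector_derivative_mult[OF c d])
    moreover have "(cis (- (r * of_int k ^ 3)) * (- ((\<i> * of_int k) ^ 3 * fcoeff (\<psi> r) k) + of_real \<mu> * (\<i> * of_int k * fcoeff (\<psi> r \<odot> \<psi> r) k))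
         + (- (\<i> * of_int k ^ 3) * cis (- (r * of_int k ^ 3))) * fcoeff (\<psi> r) k) = of_real \<mu> * NN r (f r) (f r) k"
      unfolding NN_f unfolding NN_def airy_0 p i3 by (simp add: algebra_simps)
    ultimately show ?thesis by (simp add: f_def fcoeff_airy)
  qed
  then have "((\<lambda>r. of_real \<mu> * NN r (f r) (f r) k) has_integral fcoeff (f t) k - fcoeff (f s) k) {s..t}"
    by (rule fundamental_theorem_of_calculus[OF assms(2)])
  then show ?thesis by (metis integral_unique integral_mult_right)
qed

lemma NN_zero_mode [simp]: "NN s g v 0 = 0" by (simp add: NN_def)

lemma f_zero_mean: "t \<in> {0..T} \<Longrightarrow> fcoeff (f t) 0 = 0"
  using f_increment[of 0 t 0] kdv \<xi>0 by (simp add: f_def fcoeff_airy kdv_solution_def)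

definition LF :: real where "LF = \<mu>\<^sup>2 * (16 * cjb * (KP\<^sup>2 * KP\<^sup>2))"

lemma LF_nonneg: "0 \<le> LF" using cjb_nonneg by (simp add: LF_def)

text \<open>The rate of change is a derivative of a product of \<open>H\<^sup>2\<close> functions,
  hence bounded in \<open>H\<^sup>1\<close>. In the original frame the third derivative would spoil
  this.\<close>

lemma f_lipschitz:
  assumes "0 \<le> s" "s \<le> t" "t \<le> T"
  shows "wl2 jb (fcoeff (f t - f s)) \<le> ennreal (LF * (t - s)\<^sup>2)"
proof -
  have jb0: "0 \<le> jb k" for k using jb_pos[of k] by simp
  have "wl2 jb (\<lambda>k. integral {s..t} (\<lambda>r. NN r (f r) (f r) k)) \<le> ennreal ((t - s)\<^sup>2) * ennreal (16 * cjb * (KP\<^sup>2 * KP\<^sup>2))"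
  proof (rule wl2_integral_le[OF assms(2) jb0])
    show "continuous_on {s..t} (\<lambda>r. NN r (f r) (f r) k)" for k
      using assms by (intro continuous_on_NN continuous_intros continuous_on_subset[OF f_continuous]) auto
    fix r assume "r \<in> {s..t}"
    then have r: "r \<in> {0..T}" using assms by auto
    have "wl2 jb (NN r (f r) (f r)) \<le> 16 * Cjb * (hl2 (fcoeff (f r)) * hl2 (fcoeff (f r)))" by (rule wl2_NN_le)
    also have "\<dots> \<le> 16 * ennreal cjb * (ennreal (KP\<^sup>2) * ennreal (KP\<^sup>2))"
      unfolding Cjb_eq by (intro mult_left_mono mult_mono f_H2 r) auto
    also have "\<dots> = ennreal (16 * cjb * (KP\<^sup>2 * KP\<^sup>2))"
      using cjb_nonneg by (simp only: ennreal_mult zero_le_mult_iff zero_le_power2 zero_le_numeral ennreal_numeral simp_thms mult_nonneg_nonneg)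
    finally show "wl2 jb (\<lambda>k. NN r (f r) (f r) k) \<le> ennreal (16 * cjb * (KP\<^sup>2 * KP\<^sup>2))" .
  qed
  then have "ennreal (\<mu>\<^sup>2) * wl2 jb (\<lambda>k. integral {s..t} (\<lambda>r. NN r (f r) (f r) k)) \<le> ennreal (\<mu>\<^sup>2) * (ennreal ((t - s)\<^sup>2) * ennreal (16 * cjb * (KP\<^sup>2 * KP\<^sup>2)))"
    by (intro mult_left_mono) auto
  moreover have "wl2 jb (fcoeff (f t - f s)) = ennreal (\<mu>\<^sup>2) * wl2 jb (\<lambda>k. integral {s..t} (\<lambda>r. NN r (f r) (f r) k))"
  proof -
    have "fcoeff (f t - f s) = (\<lambda>k. of_real \<mu> * integral {s..t} (\<lambda>r. NN r (f r) (f r) k))"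
      by (rule ext) (simp only: fcoeff_diff f_increment[OF assms])
    then show ?thesis by (simp only: wl2_scale norm_of_real power2_abs)
  qed
  moreover have "ennreal (\<mu>\<^sup>2) * (ennreal ((t - s)\<^sup>2) * ennreal (16 * cjb * (KP\<^sup>2 * KP\<^sup>2))) = ennreal (LF * (t - s)\<^sup>2)"
    using cjb_nonneg by (simp add: LF_def ennreal_mult[symmetric] mult_ac)
  ultimately show ?thesis by simp
qed

text \<open>A single almost sure event for all pathwise arguments, so that no exceptional set
  depends on the time.\<close>

definition good :: "'w \<Rightarrow> bool" where
  "good \<omega> \<longleftrightarrow> continuous_on_H 1 {0..T} (\<lambda>t. chi t \<omega>) \<and> chi 0 \<omega> = 0"

lemma AE_good: "AE \<omega> in M. good \<omega>" using fluct by (auto simp: fluctuation_solution_def good_def)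

text \<open>
  Below, \<open>f\<close> and \<open>x\<close> are \<open>\<psi>\<close> and the fluctuation in the frame moving with the Airy group, \<open>y\<close> is the nonlinear term of the
  equation for \<open>x\<close>, and \<open>z\<close> is a version of the stochastic convolution with continuous paths.
\<close>

definition x :: "real \<Rightarrow> 'w \<Rightarrow> l2_torus" where "x t \<omega> = airy (- t) (chi t \<omega>)"

definition y :: "real \<Rightarrow> 'w \<Rightarrow> l2_torus" where
  "y t \<omega> = airy (- t) (DM (Lam 1 (\<psi> t)) (Lam 1 (chi t \<omega>)))"

definition z :: "real \<Rightarrow> 'w \<Rightarrow> l2_torus" where
  "z t \<omega> = x t \<omega> - (2 * \<mu>) *\<^sub>R integral {0..t} (\<lambda>s. y s \<omega>)"

lemma good_in_H1: "good \<omega> \<Longrightarrow> t \<in> {0..T} \<Longrightarrow> in_H 1 (chi t \<omega>)" by (simp add: good_def continuous_on_H_def)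

lemma good_Lam: "good \<omega> \<Longrightarrow> continuous_on {0..T} (\<lambda>t. Lam 1 (chi t \<omega>))" by (rule continuous_on_H_Lam) (simp add: good_def)

lemma good_chi_continuous: "good \<omega> \<Longrightarrow> continuous_on {0..T} (\<lambda>t. chi t \<omega>)"
proof -
  assume g: "good \<omega>"
  have "continuous_on {0..T} (\<lambda>t. Lam (-1) (Lam 1 (chi t \<omega>)))"
    by (rule bounded_linear.continuous_on[OF bounded_linear_Lam good_Lam[OF g]])
  then show ?thesis by (rule continuous_on_eq) (simp add: Lam_Lam good_in_H1 g)
qed

lemma x_continuous: "good \<omega> \<Longrightarrow> continuous_on {0..T} (\<lambda>t. x t \<omega>)"
  unfolding x_def by (intro continuous_on_airy good_chi_continuous continuous_intros)

lemma y_continuous: "good \<omega> \<Longrightarrow> continuous_on {0..T} (\<lambda>t. y t \<omega>)" unfolding y_def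
  by (intro continuous_on_airy bounded_bilinear.continuous_on[OF bounded_bilinear_DM] psi_Lam_continuous good_Lam continuous_intros)

lemma y_integrable: "good \<omega> \<Longrightarrow> 0 \<le> a \<Longrightarrow> c \<le> T \<Longrightarrow> (\<lambda>t. y t \<omega>) integrable_on {a..c}"
  by (intro integrable_continuous_real continuous_on_subset[OF y_continuous]) auto

lemma z_continuous: "good \<omega> \<Longrightarrow> continuous_on {0..T} (\<lambda>t. z t \<omega>)"
  unfolding z_def using T by (intro continuous_intros x_continuous indefinite_integral_continuous_1 y_integrable) auto

lemma fcoeff_y:
  assumes "good \<omega>" "t \<in> {0..T}"
  shows "fcoeff (y t \<omega>) k = NN t (f t) (x t \<omega>) k" unfolding f_def x_def NN_airy y_def
  by (simp add: fcoeff_airy fcoeff_DM Lam_Lam[OF psi_in_H1[OF assms(2)]] Lam_Lam[OF good_in_H1[OF assms]])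

lemma chi_measurable: "t \<in> {0..T} \<Longrightarrow> chi t \<in> borel_measurable M" using fluct by (simp add: fluctuation_solution_def)

lemma x_measurable: "t \<in> {0..T} \<Longrightarrow> x t \<in> borel_measurable M" unfolding x_def
  by (rule measurable_l2_from_fcoeff) (simp add: fcoeff_airy borel_measurable_times measurable_fcoeff chi_measurable)

text \<open>The integral equation has an exceptional set for each \<open>t\<close>. Since
  \<open>z\<close> is defined by the equation itself, its paths are continuous on
  \<open>good\<close>, and it agrees almost surely with the stochastic convolution at each fixed
  time.\<close>

lemma z_noise:
  assumes t: "t \<in> {0..T}"
  shows "twisted_noise 0 t (z t)"
proof -
  obtain J where J: "has_stoch_integral M \<beta> e 0 t (\<lambda>s. airy (t - s) \<circ> Qh) J"
    and eq: "AE \<omega> in M. chi t \<omega> = (2 * \<mu>) *\<^sub>R integral {0..t} (\<lambda>s. airy (t - s) (Dx (\<psi> s \<odot> chi s \<omega>))) + J \<omega>"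
    using fluct t unfolding fluctuation_solution_def by blast
  have "twisted_noise 0 t (\<lambda>\<omega>. airy (- t) (J \<omega>))" by (rule twisted_noise_stoch_integral[OF J]) simp
  then show ?thesis
  proof (rule twisted_noise_cong)
    show "AE \<omega> in M. z t \<omega> = airy (- t) (J \<omega>)" using eq AE_good
    proof eventually_elim
      case (elim \<omega>)
      have "integral {0..t} (\<lambda>s. airy (t - s) (Dx (\<psi> s \<odot> chi s \<omega>))) = integral {0..t} (\<lambda>s. airy t (y s \<omega>))"
      proof (rule integral_cong)
        fix s assume "s \<in> {0..t}"
        then have s: "s \<in> {0..T}" using t by auto
        show "airy (t - s) (Dx (\<psi> s \<odot> chi s \<omega>)) = airy t (y s \<omega>)"
          using elim s by (simp add: y_def Dx_mult(1) psi_in_H1 good_in_H1 airy_airy)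
      qed
      also have "\<dots> = airy t (integral {0..t} (\<lambda>s. y s \<omega>))"
        using integral_linear[OF y_integrable[OF elim(2), of 0 t] bounded_linear_airy, of t] t by (simp add: o_def)
      finally have "chi t \<omega> = (2 * \<mu>) *\<^sub>R airy t (integral {0..t} (\<lambda>s. y s \<omega>)) + J \<omega>" using elim by simp
      then have "x t \<omega> = (2 * \<mu>) *\<^sub>R integral {0..t} (\<lambda>s. y s \<omega>) + airy (- t) (J \<omega>)"
        by (simp add: x_def airy_add airy_scaleR airy_airy airy_0)
      then show ?case by (simp add: z_def)
    qed
  qed
qed

lemma z_increment_noise: "0 \<le> s \<Longrightarrow> s \<le> t \<Longrightarrow> t \<le> T \<Longrightarrow> twisted_noise s t (\<lambda>\<omega>. z t \<omega> - z s \<omega>)"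
  by (rule twisted_noise_diff[OF z_noise z_noise]) auto

lemma x_increment:
  assumes g: "good \<omega>" and ac: "0 \<le> a" "a \<le> c" "c \<le> T"
  shows "x c \<omega> - x a \<omega> = (2 * \<mu>) *\<^sub>R integral {a..c} (\<lambda>s. y s \<omega>) + (z c \<omega> - z a \<omega>)"
proof -
  have "integral {0..c} (\<lambda>s. y s \<omega>) = integral {0..a} (\<lambda>s. y s \<omega>) + integral {a..c} (\<lambda>s. y s \<omega>)"
    using ac by (intro Henstock_Kurzweil_Integration.integral_combine[symmetric] y_integrable[OF g]) auto
  then show ?thesis by (simp add: z_def scaleR_add_right)
qed

lemma x_zero_mean:
  assumes t: "t \<in> {0..T}"
  shows "AE \<omega> in M. fcoeff (x t \<omega>) 0 = 0"
proof -
  have zm: "AE \<omega> in M. fcoeff (z t \<omega>) 0 = 0" using twisted_noise_zero_mean[OF z_noise[OF t]] t by simp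
  show ?thesis using zm AE_good
proof eventually_elim
  case (elim \<omega>)
  have "fcoeff (integral {0..t} (\<lambda>s. y s \<omega>)) 0 = integral {0..t} (\<lambda>s. fcoeff (y s \<omega>) 0)"
    using integral_linear[OF y_integrable[OF elim(2), of 0 t] bounded_linear_fcoeff, of 0] t by (simp add: o_def)
  also have "\<dots> = integral {0..t} (\<lambda>s. 0)" using t by (intro integral_cong) (simp add: fcoeff_y elim)
  finally show ?case using elim t by (simp add: z_def fcoeff_diff fcoeff_scaleR)
qed
qed

lemma x_0: "good \<omega> \<Longrightarrow> x 0 \<omega> = 0" by (simp add: x_def good_def)

abbreviation defect_f :: "real \<Rightarrow> real \<Rightarrow> 'w \<Rightarrow> int \<Rightarrow> complex" where
  "defect_f a c \<omega> k \<equiv> integral {a..c} (\<lambda>s. NN s (f s - f a) (x s \<omega>) k)"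

abbreviation defect_x :: "real \<Rightarrow> real \<Rightarrow> 'w \<Rightarrow> int \<Rightarrow> complex" where
  "defect_x a c \<omega> k \<equiv> integral {a..c} (\<lambda>s. NN s (f a) (x s \<omega> - x a \<omega>) k)"

abbreviation defect_z :: "real \<Rightarrow> real \<Rightarrow> 'w \<Rightarrow> int \<Rightarrow> complex" where
  "defect_z a c \<omega> k \<equiv> integral {a..c} (\<lambda>s. NN s (f a) (z s \<omega> - z a \<omega>) k)"

text \<open>Freezing both arguments at \<open>a\<close> leaves the exact bilinear step and two
  defects. In the defect from \<open>x\<close> the increment splits again: the noise part can stay
  under \<open>NN\<close>, as it is small in \<open>H\<^sup>1\<close>, and the drift part is handed
  to \<open>integral_NN_integral\<close>.\<close>

lemma local_error:
  assumes g: "good \<omega>" and ac: "0 \<le> a" "a \<le> c" "c \<le> T"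
  shows "fcoeff (x c \<omega> - x a \<omega> - (z c \<omega> - z a \<omega>)) k - 2 * of_real \<mu> * BB a c (f a) (x a \<omega>) k
     = 2 * of_real \<mu> * (defect_f a c \<omega> k + defect_x a c \<omega> k)"
  and "defect_x a c \<omega> k
     = defect_z a c \<omega> k + 2 * of_real \<mu> * integral {a..c} (\<lambda>r. BB r c (f a) (y r \<omega>) k)"
proof -
  note b = bounded_bilinear_NN
  have sub: "{a..c} \<subseteq> {0..T}" using ac by auto
  note cx = continuous_on_subset[OF x_continuous[OF g] sub] and cz = continuous_on_subset[OF z_continuous[OF g] sub]
    and cf = continuous_on_subset[OF f_continuous sub] and cy = continuous_on_subset[OF y_continuous[OF g] sub]
  have i: "(\<lambda>s. NN s (p s) (q s) k) integrable_on {a..c}" if "continuous_on {a..c} p" "continuous_on {a..c} q" for p q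
    using that by (intro integrable_continuous_real continuous_on_NN continuous_intros)
  have "fcoeff (x c \<omega> - x a \<omega> - (z c \<omega> - z a \<omega>)) k = 2 * of_real \<mu> * integral {a..c} (\<lambda>s. fcoeff (y s \<omega>) k)"
    unfolding x_increment[OF g ac]
    using integral_linear[OF y_integrable[OF g ac(1,3)] bounded_linear_fcoeff, of k] by (simp add: o_def fcoeff_scaleR)
  also have "integral {a..c} (\<lambda>s. fcoeff (y s \<omega>) k) = integral {a..c} (\<lambda>s. (NN s (f s - f a) (x s \<omega>) k + NN s (f a) (x s \<omega> - x a \<omega>) k) + NN s (f a) (x a \<omega>) k)"
  proof (rule integral_cong)
    fix s assume "s \<in> {a..c}"
    then have "s \<in> {0..T}" using sub by auto
    then show "fcoeff (y s \<omega>) k = (NN s (f s - f a) (x s \<omega>) k + NN s (f a) (x s \<omega> - x a \<omega>) k) + NN s (f a) (x a \<omega>) k"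
      by (simp add: fcoeff_y[OF g] bounded_bilinear.diff_left[OF b] bounded_bilinear.diff_right[OF b])
  qed
  also have "\<dots> = integral {a..c} (\<lambda>s. NN s (f s - f a) (x s \<omega>) k + NN s (f a) (x s \<omega> - x a \<omega>) k) + BB a c (f a) (x a \<omega>) k"
    unfolding BB_eq_integral by (intro integral_add integrable_add i continuous_intros cx cf)
  also have "integral {a..c} (\<lambda>s. NN s (f s - f a) (x s \<omega>) k + NN s (f a) (x s \<omega> - x a \<omega>) k)
    = defect_f a c \<omega> k + defect_x a c \<omega> k" by (intro integral_add i continuous_intros cx cf)
  finally show "fcoeff (x c \<omega> - x a \<omega> - (z c \<omega> - z a \<omega>)) k - 2 * of_real \<mu> * BB a c (f a) (x a \<omega>) k
     = 2 * of_real \<mu> * (defect_f a c \<omega> k + defect_x a c \<omega> k)" by (simp add: algebra_simps)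
  have cI: "continuous_on {a..c} (\<lambda>s. integral {a..s} (\<lambda>r. y r \<omega>))"
    by (rule indefinite_integral_continuous_1[OF y_integrable[OF g ac(1,3)]])
  have "defect_x a c \<omega> k
    = integral {a..c} (\<lambda>s. NN s (f a) (z s \<omega> - z a \<omega>) k + 2 * of_real \<mu> * NN s (f a) (integral {a..s} (\<lambda>r. y r \<omega>)) k)"
  proof (rule integral_cong)
    fix s assume s: "s \<in> {a..c}"
    then have "x s \<omega> - x a \<omega> = (2 * \<mu>) *\<^sub>R integral {a..s} (\<lambda>r. y r \<omega>) + (z s \<omega> - z a \<omega>)"
      using ac by (intro x_increment[OF g]) auto
    then show "NN s (f a) (x s \<omega> - x a \<omega>) k = NN s (f a) (z s \<omega> - z a \<omega>) k + 2 * of_real \<mu> * NN s (f a) (integral {a..s} (\<lambda>r. y r \<omega>)) k"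
      by (simp add: bounded_bilinear.add_right[OF b] bounded_bilinear.scaleR_right[OF b] scaleR_conv_of_real)
  qed
  also have "\<dots> = defect_z a c \<omega> k + integral {a..c} (\<lambda>s. 2 * of_real \<mu> * NN s (f a) (integral {a..s} (\<lambda>r. y r \<omega>)) k)"
    by (intro integral_add i integrable_continuous_real continuous_on_mult continuous_on_NN continuous_intros cz cI)
  also have "integral {a..c} (\<lambda>s. 2 * of_real \<mu> * NN s (f a) (integral {a..s} (\<lambda>r. y r \<omega>)) k) = 2 * of_real \<mu> * integral {a..c} (\<lambda>r. BB r c (f a) (y r \<omega>) k)"
    using integral_NN_integral[OF cy ac(2), of "f a" k] by simp
  finally show "defect_x a c \<omega> k
     = defect_z a c \<omega> k + 2 * of_real \<mu> * integral {a..c} (\<lambda>r. BB r c (f a) (y r \<omega>) k)" .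
qed

end

section \<open>Moments of the fluctuation\<close>

text \<open>The recursion starts from 0, so the bound keeps the factor \<open>real n * h\<close>
  that adds up the sources; the growth uses \<open>1 + C * h \<le> exp (C * h)\<close>. Extended
  values allow moments that are not yet known to be finite.\<close>

lemma ennreal_gronwall:
  fixes a :: "nat \<Rightarrow> ennreal"
  assumes a0: "a 0 = 0" and step: "\<And>n. n < N \<Longrightarrow> a (Suc n) \<le> ennreal (1 + C * h) * a n + ennreal h * B"
    and C: "0 \<le> C" and h: "0 \<le> h" and n: "n \<le> N"
  shows "a n \<le> ennreal (exp (C * (real n * h)) * (real n * h)) * B" using n
proof (induction n)
  case 0
  then show ?case by (simp add: a0)
next
  case (Suc n)
  let ?e = "exp (C * (real n * h))"
  have "a (Suc n) \<le> ennreal (1 + C * h) * a n + ennreal h * B" using Suc by (intro step) simp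
  also have "\<dots> \<le> ennreal (1 + C * h) * (ennreal (?e * (real n * h)) * B) + ennreal h * B"
    using Suc by (intro add_right_mono mult_left_mono) auto
  also have "\<dots> = ennreal ((1 + C * h) * (?e * (real n * h)) + h) * B"
    using C h by (simp add: ennreal_plus ennreal_mult distrib_right mult.assoc del: ennreal_plus[symmetric])
  also have "\<dots> \<le> ennreal (exp (C * (real (Suc n) * h)) * (real (Suc n) * h)) * B"
  proof (intro mult_right_mono ennreal_leI)
    have e: "exp (C * (real (Suc n) * h)) = exp (C * h) * ?e" by (simp add: exp_add[symmetric] algebra_simps)
    have 1: "(1 + C * h) * (?e * (real n * h)) \<le> exp (C * h) * (?e * (real n * h))"
      using C h by (intro mult_right_mono exp_ge_add_one_self) auto
    have "1 * h \<le> exp (C * (real (Suc n) * h)) * h" using C h by (intro mult_right_mono) auto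
    with 1 show "(1 + C * h) * (?e * (real n * h)) + h \<le> exp (C * (real (Suc n) * h)) * (real (Suc n) * h)"
      unfolding e by (simp add: algebra_simps)
  qed simp
  finally show ?case .
qed

lemma nl2_young:
  assumes h: "0 < h"
  shows "nl2 (\<lambda>k. c k + d k) \<le> ennreal (1 + h) * nl2 c + ennreal (1 + 1 / h) * nl2 d"
proof -
  have "nl2 (\<lambda>k. c k + d k) \<le> esum (\<lambda>k. ennreal (1 + h) * ennreal ((cmod (c k))\<^sup>2) + ennreal (1 + 1 / h) * ennreal ((cmod (d k))\<^sup>2))"
    unfolding wl2_def using ennreal_cmod_sq_le[OF h, of "c k + d k" "c k" for k] by (intro esum_mono) simp
  then show ?thesis unfolding esum_add esum_cmult by (simp add: wl2_def)
qed

text \<open>Young's inequality with the step size as parameter: the factor \<open>1 + h\<close> is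
  harmless next to the stability constant and is absorbed in \<open>C\<close>, while the defect is
  enlarged by \<open>1 + 1 / h\<close>. The latter is written as \<open>h\<close> times
  \<open>(1 + h) / h\<^sup>2\<close>, so that the recursion has the form of
  \<open>ennreal_gronwall\<close>.\<close>

lemma perturbed_step_le:
  assumes h: "0 < c - a" "c - a \<le> T" and g0: "fcoeff g 0 = 0" and v0: "fcoeff v 0 = 0"
    and K: "nl1w (fcoeff g) \<le> ennreal K" "0 \<le> K" and \<mu>: "0 \<le> \<mu>"
    and C: "C = 1 + (4 * \<mu> * K + 4 * \<mu>\<^sup>2 * K\<^sup>2) * (1 + T)"
  shows "nl2 (\<lambda>k. (fcoeff v k + 2 * of_real \<mu> * BB a c g v k) + d k)
    \<le> ennreal (1 + C * (c - a)) * nl2 (fcoeff v) + ennreal (c - a) * (ennreal ((1 + T) / (c - a)\<^sup>2) * nl2 d)"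
proof -
  let ?h = "c - a" and ?A = "4 * \<mu> * K + 4 * \<mu>\<^sup>2 * K\<^sup>2"
  have A: "0 \<le> ?A" using K \<mu> by simp
  have "nl2 (\<lambda>k. (fcoeff v k + 2 * of_real \<mu> * BB a c g v k) + d k)
    \<le> ennreal (1 + ?h) * nl2 (\<lambda>k. fcoeff v k + 2 * of_real \<mu> * BB a c g v k) + ennreal (1 + 1 / ?h) * nl2 d"
    by (rule nl2_young[OF h(1)])
  also have "\<dots> \<le> ennreal (1 + ?h) * (ennreal (1 + ?A * ?h) * nl2 (fcoeff v)) + ennreal (1 + 1 / ?h) * nl2 d"
    using h by (intro add_right_mono mult_left_mono nl2_stability g0 v0 K \<mu>) auto
  also have "ennreal (1 + ?h) * (ennreal (1 + ?A * ?h) * nl2 (fcoeff v)) = ennreal ((1 + ?h) * (1 + ?A * ?h)) * nl2 (fcoeff v)"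
    using h A by (subst ennreal_mult) (auto simp: mult.assoc)
  also have "ennreal (1 + 1 / ?h) * nl2 d = ennreal ?h * (ennreal ((1 + ?h) / ?h\<^sup>2) * nl2 d)"
  proof -
    have "1 + 1 / r = r * ((1 + r) / r\<^sup>2)" if "0 < r" for r :: real using that by (simp add: power2_eq_square field_simps)
    then have "ennreal (1 + 1 / ?h) = ennreal ?h * ennreal ((1 + ?h) / ?h\<^sup>2)"
      using h by (simp only: ennreal_mult[symmetric] less_imp_le zero_le_power2 divide_nonneg_nonneg add_nonneg_nonneg zero_le_one)
    then show ?thesis by (simp only: mult.assoc)
  qed
  also have "ennreal ((1 + ?h) * (1 + ?A * ?h)) * nl2 (fcoeff v) + ennreal ?h * (ennreal ((1 + ?h) / ?h\<^sup>2) * nl2 d)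
    \<le> ennreal (1 + C * ?h) * nl2 (fcoeff v) + ennreal ?h * (ennreal ((1 + T) / ?h\<^sup>2) * nl2 d)"
  proof (intro add_mono mult_left_mono mult_right_mono ennreal_leI divide_right_mono)
    have "?A * ?h * ?h \<le> ?A * T * ?h" using h A by (intro mult_right_mono mult_left_mono) auto
    then show "(1 + ?h) * (1 + ?A * ?h) \<le> 1 + C * ?h" unfolding C by (simp add: algebra_simps)
  qed (use h in auto)
  finally show ?thesis .
qed

lemma conj_sym_BB: "conj_sym (BB a c g v)" using conj_sym_NN[of _ g v] by (simp add: conj_sym_def BB_eq_integral integral_cnj)

definition P0 :: "l2_torus \<Rightarrow> l2_torus" where
  "P0 = fourier_mult (\<lambda>k. if k = 0 then 0 else 1)"

lemma fcoeff_P0: "fcoeff (P0 v) k = (if k = 0 then 0 else fcoeff v k)"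
  unfolding P0_def by (subst fcoeff_fourier_mult_bounded[where C = 1]) (auto simp: conj_sym_def)

lemma P0_id: "fcoeff v 0 = 0 \<Longrightarrow> P0 v = v" by (rule fcoeff_inject) (simp add: fcoeff_P0)

lemma P0_linear: "P0 (v + w) = P0 v + P0 w" "P0 (r *\<^sub>R v) = r *\<^sub>R P0 v"
  by (rule fcoeff_inject, simp add: fcoeff_P0 fcoeff_add fcoeff_scaleR)+

lemma nl2_P0_le: "nl2 (fcoeff (P0 v)) \<le> nl2 (fcoeff v)" by (rule wl2_mono_seq) (auto simp: fcoeff_P0)

text \<open>The bilinear step gains only on functions of zero mean, which the random arguments have
  only almost surely. Projecting first gives a bounded linear operator on the whole space, to which
  measurability and \<open>past\<close> apply everywhere.\<close>

definition BBop :: "real \<Rightarrow> real \<Rightarrow> l2_torus \<Rightarrow> l2_torus \<Rightarrow> l2_torus" where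
  "BBop a c g v = fourier_series (BB a c g (P0 v))"

lemma
  assumes ac: "a \<le> c" and g0: "fcoeff g 0 = 0" and g: "nl1 (fcoeff g) < \<infinity>"
  shows fcoeff_BBop: "fcoeff (BBop a c g v) k = BB a c g (P0 v) k"
    and bounded_linear_BBop: "bounded_linear (BBop a c g)"
proof -
  obtain K where K: "nl1 (fcoeff g) = ennreal K" "0 \<le> K" using g by (cases "nl1 (fcoeff g)") auto
  have le: "nl2 (BB a c g (P0 v)) \<le> ennreal ((c - a) * (K\<^sup>2 * (norm v)\<^sup>2))" for v
  proof -
    have "nl2 (BB a c g (P0 v)) \<le> ennreal (c - a) * ((nl1 (fcoeff g))\<^sup>2 * nl2 (fcoeff (P0 v)))"
      by (rule nl2_BB_le(1)[OF ac g0]) (simp add: fcoeff_P0)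
    also have "\<dots> \<le> ennreal (c - a) * ((nl1 (fcoeff g))\<^sup>2 * nl2 (fcoeff v))" by (intro mult_left_mono nl2_P0_le) auto
    also have "\<dots> = ennreal ((c - a) * (K\<^sup>2 * (norm v)\<^sup>2))"
      unfolding K(1) nl2_fcoeff using ac K(2) by (simp add: ennreal_mult ennreal_power)
    finally show ?thesis .
  qed
  have fc: "fcoeff (BBop a c g v) k = BB a c g (P0 v) k" for v k unfolding BBop_def
    by (rule fcoeff_fourier_series[OF conj_sym_BB]) (simp add: sq_summable_iff le_less_trans[OF le])
  then show "fcoeff (BBop a c g v) k = BB a c g (P0 v) k" .
  show "bounded_linear (BBop a c g)"
  proof (rule bounded_linear_intro[where K = "sqrt (c - a) * K"])
    fix v
    have "ennreal ((norm (BBop a c g v))\<^sup>2) = nl2 (BB a c g (P0 v))" by (simp add: nl2_fcoeff[symmetric] fc[abs_def])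
    also have "\<dots> \<le> ennreal ((c - a) * (K\<^sup>2 * (norm v)\<^sup>2))" by (rule le)
    finally have "(norm (BBop a c g v))\<^sup>2 \<le> (norm v * (sqrt (c - a) * K))\<^sup>2" using ac by (simp add: power_mult_distrib mult_ac)
    then show "norm (BBop a c g v) \<le> norm v * (sqrt (c - a) * K)" by (rule power2_le_imp_le) (use ac K in auto)
  qed (rule fcoeff_inject, simp add: fc fcoeff_add fcoeff_scaleR P0_linear BB_linear scaleR_conv_of_real)+
qed

lemma BB_zero_mode [simp]: "BB a c g v 0 = 0" by (simp add: BB_def)

section \<open>The recursion with exact coefficients and the \<open>H\<^sup>1\<close> moment\<close>

context kdv_fluct begin

definition KN :: real where "KN = sqrt cjb * KP"

lemma KN_nonneg: "0 \<le> KN" using cjb_nonneg KP(1) by (simp add: KN_def)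

lemma f_nl1w: "t \<in> {0..T} \<Longrightarrow> nl1w (fcoeff (f t)) \<le> ennreal KN"
proof -
  assume t: "t \<in> {0..T}"
  have "(nl1w (fcoeff (f t)))\<^sup>2 \<le> Cjb * hl2 (fcoeff (f t))" by (rule nl1w_sq_le)
  also have "\<dots> \<le> ennreal cjb * ennreal (KP\<^sup>2)" unfolding Cjb_eq by (intro mult_left_mono f_H2 t) auto
  also have "\<dots> = (ennreal KN)\<^sup>2"
    using cjb_nonneg KP(1) by (simp add: KN_def ennreal_mult[symmetric] ennreal_power power_mult_distrib)
  finally show ?thesis by (rule ennreal_square_le_cancel)
qed

lemma f_nl1: "t \<in> {0..T} \<Longrightarrow> nl1 (fcoeff (f t)) < \<infinity>"
  using f_nl1w nl1_le_nl1w[of "fcoeff (f t)"] by (metis ennreal_less_top infinity_ennreal_def le_less_trans)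

text \<open>
  The scheme with the exact \<open>\<psi>\<close>. It is linear in the noise, which gives its moments; the moments of the fluctuation
  itself then follow from pathwise convergence and Fatou's lemma.
\<close>

primrec Xh :: "real \<Rightarrow> nat \<Rightarrow> 'w \<Rightarrow> l2_torus" where
  "Xh h 0 \<omega> = 0"
| "Xh h (Suc n) \<omega> = (Xh h n \<omega> + (2 * \<mu>) *\<^sub>R BBop (real n * h) (real (Suc n) * h) (f (real n * h)) (Xh h n \<omega>))
     + (z (real (Suc n) * h) \<omega> - z (real n * h) \<omega>)"

lemma grid:
  assumes "0 \<le> h" "real (Suc n) * h \<le> T"
  shows "real n * h \<in> {0..T}" "real (Suc n) * h \<in> {0..T}" "real n * h \<le> real (Suc n) * h" "0 \<le> real n * h"
proof -
  have s: "real (Suc n) * h = real n * h + h" by (simp add: algebra_simps)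
  show "real n * h \<in> {0..T}" "real (Suc n) * h \<in> {0..T}" "real n * h \<le> real (Suc n) * h" "0 \<le> real n * h"
    unfolding s using assms unfolding s by (auto intro: order_trans[of _ "real n * h + h"])
qed

lemma grid_lt:
  assumes "0 \<le> h" "real N * h \<le> T" "n < N"
  shows "real n * h \<in> {0..T}" "real (Suc n) * h \<in> {0..T}" "real n * h \<le> real (Suc n) * h" "0 \<le> real n * h"
    "real (Suc n) * h - real n * h = h"
proof -
  have "real (Suc n) * h \<le> real N * h" using assms by (intro mult_right_mono) auto
  then have "real (Suc n) * h \<le> T" using assms(2) by linarith
  from grid[OF assms(1) this]
  show "real n * h \<in> {0..T}" "real (Suc n) * h \<in> {0..T}" "real n * h \<le> real (Suc n) * h" "0 \<le> real n * h" .
  show "real (Suc n) * h - real n * h = h" by (simp add: algebra_simps)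
qed

text \<open>A step is a deterministic bounded linear map followed by an increment of
  \<open>z\<close> over the step, and both keep functionals of the past noise in this class.\<close>

lemma past_Xh:
  assumes h: "0 \<le> h"
  shows "real n * h \<le> T \<Longrightarrow> past (real n * h) (Xh h n)"
proof (induction n)
  case 0
  have "Xh h 0 = (\<lambda>\<omega>. 0)" by (rule ext) simp
  then show ?case by (simp add: past_zero)
next
  case (Suc n)
  note g = grid[OF h Suc.prems]
  have p: "past (real (Suc n) * h) (Xh h n)" using Suc.IH g by (intro past_mono[OF _ g(3)]) auto
  have bl: "bounded_linear (\<lambda>v. v + (2 * \<mu>) *\<^sub>R BBop (real n * h) (real (Suc n) * h) (f (real n * h)) v)"
    using g by (intro bounded_linear_add bounded_linear_ident bounded_linear_const_scaleR bounded_linear_BBop f_zero_mean f_nl1) auto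
  have "past (real (Suc n) * h) (\<lambda>\<omega>. (Xh h n \<omega> + (2 * \<mu>) *\<^sub>R BBop (real n * h) (real (Suc n) * h) (f (real n * h)) (Xh h n \<omega>))
     + (z (real (Suc n) * h) \<omega> - z (real n * h) \<omega>))"
    using g by (intro past_add past_bounded_linear[OF p bl] past_twisted_noise[OF z_increment_noise]) auto
  then show ?case by (simp add: Xh.simps(2)[abs_def] del: of_nat_Suc)
qed

lemma Xh_zero_mean:
  assumes h: "0 \<le> h"
  shows "real n * h \<le> T \<Longrightarrow> AE \<omega> in M. fcoeff (Xh h n \<omega>) 0 = 0"
proof (induction n)
  case 0
  then show ?case by (simp add: fcoeff_0)
next
  case (Suc n)
  note g = grid[OF h Suc.prems]
  have "AE \<omega> in M. fcoeff (z (real (Suc n) * h) \<omega> - z (real n * h) \<omega>) 0 = 0"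
    using g by (intro twisted_noise_zero_mean[OF z_increment_noise]) auto
  moreover have "AE \<omega> in M. fcoeff (Xh h n \<omega>) 0 = 0" using Suc.IH g by auto
  ultimately show ?case
  proof eventually_elim
    case (elim \<omega>)
    then show ?case
      using g by (simp add: fcoeff_add[of "_ + _"] fcoeff_add fcoeff_scaleR fcoeff_BBop[OF g(3) f_zero_mean[OF g(1)] f_nl1[OF g(1)]] del: of_nat_Suc)
  qed
qed

definition CH :: real where "CH = 20 * \<mu> * (sqrt cjb * KP) + 16 * \<mu>\<^sup>2 * (cjb * KP\<^sup>2)"

lemma CH_nonneg: "0 \<le> CH" using cjb_nonneg KP(1) \<mu> by (simp add: CH_def)

text \<open>Orthogonality lets the noise add its own moment, of order \<open>h\<close>, with no
  cross term. Young's inequality would instead leave a contribution of order one in every step, and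
  the sum would diverge as \<open>h\<close> tends to 0.\<close>

lemma Xh_H1_step:
  assumes h: "0 \<le> h" and n: "real (Suc n) * h \<le> T"
  shows "mh1 M (\<lambda>\<omega>. Xh h (Suc n) \<omega>)
    \<le> ennreal (1 + CH * h) * mh1 M (\<lambda>\<omega>. Xh h n \<omega>) + ennreal h * CQ"
proof -
  note g = grid[OF h n]
  let ?a = "real n * h" and ?c = "real (Suc n) * h"
  have ca: "?c - ?a = h" by (simp add: algebra_simps)
  have bl: "bounded_linear (\<lambda>v. v + (2 * \<mu>) *\<^sub>R BBop ?a ?c (f ?a) v)"
    using g by (intro bounded_linear_add bounded_linear_ident bounded_linear_const_scaleR bounded_linear_BBop f_zero_mean f_nl1) auto
  have p: "past ?a (Xh h n)" using g by (intro past_Xh h) auto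
  have pm: "past ?a (\<lambda>\<omega>. Xh h n \<omega> + (2 * \<mu>) *\<^sub>R BBop ?a ?c (f ?a) (Xh h n \<omega>))" by (rule past_bounded_linear[OF p bl])
  have zn: "twisted_noise ?a ?c (\<lambda>\<omega>. z ?c \<omega> - z ?a \<omega>)" using g by (intro z_increment_noise) auto
  have eq: "mh1 M (\<lambda>\<omega>. Xh h (Suc n) \<omega>)
    = mh1 M (\<lambda>\<omega>. Xh h n \<omega> + (2 * \<mu>) *\<^sub>R BBop ?a ?c (f ?a) (Xh h n \<omega>)) + ennreal h * CQ"
    unfolding Xh.simps(2) past_orthogonal_H1[OF pm zn] twisted_noise_H1[OF zn g(3)] ca ..
  have "mh1 M (\<lambda>\<omega>. Xh h n \<omega> + (2 * \<mu>) *\<^sub>R BBop ?a ?c (f ?a) (Xh h n \<omega>))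
    \<le> (\<integral>\<^sup>+\<omega>. ennreal (1 + CH * h) * wl2 jb (fcoeff (Xh h n \<omega>)) \<partial>M)"
  proof (rule nn_integral_mono_AE)
    have "AE \<omega> in M. fcoeff (Xh h n \<omega>) 0 = 0" using g by (intro Xh_zero_mean h) auto
    then show "AE \<omega> in M. wl2 jb (fcoeff (Xh h n \<omega> + (2 * \<mu>) *\<^sub>R BBop ?a ?c (f ?a) (Xh h n \<omega>)))
       \<le> ennreal (1 + CH * h) * wl2 jb (fcoeff (Xh h n \<omega>))"
    proof eventually_elim
      case (elim \<omega>)
      show ?case
      proof (cases "wl2 jb (fcoeff (Xh h n \<omega>)) < \<infinity>")
        case True
        have "fcoeff (Xh h n \<omega> + (2 * \<mu>) *\<^sub>R BBop ?a ?c (f ?a) (Xh h n \<omega>)) = (\<lambda>k. fcoeff (Xh h n \<omega>) k + 2 * of_real \<mu> * BB ?a ?c (f ?a) (Xh h n \<omega>) k)"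
          using g by (intro ext) (simp add: fcoeff_add fcoeff_scaleR fcoeff_BBop[OF g(3) f_zero_mean[OF g(1)] f_nl1[OF g(1)]] P0_id elim scaleR_conv_of_real del: of_nat_Suc)
        then show ?thesis using wl2_stability[OF g(3) f_zero_mean[OF g(1)] elim f_H2[OF g(1)] KP(1) less_imp_le[OF \<mu>] True]
          unfolding ca CH_def by simp
      next
        \<comment> \<open>The bound is trivial where the norm is infinite, because the factor is
          positive; so finiteness is not a prerequisite of the induction.\<close>
        case False
        then have "wl2 jb (fcoeff (Xh h n \<omega>)) = \<top>" by (simp add: not_less top_unique)
        moreover have "0 < 1 + CH * h" using CH_nonneg h by (simp add: add_pos_nonneg)
        ultimately show ?thesis by (simp add: ennreal_mult_top)
      qed
    qed
  qed
  also have "\<dots> = ennreal (1 + CH * h) * mh1 M (\<lambda>\<omega>. Xh h n \<omega>)"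
    by (rule nn_integral_cmult[OF measurable_wl2[OF measurable_fcoeff[OF past_measurable[OF p]]]])
  finally show ?thesis unfolding eq by (rule add_right_mono)
qed

lemma Xh_H1:
  assumes h: "0 \<le> h" and n: "real n * h \<le> T"
  shows "mh1 M (\<lambda>\<omega>. Xh h n \<omega>) \<le> ennreal (exp (CH * T) * T) * CQ"
proof -
  have "mh1 M (\<lambda>\<omega>. Xh h n \<omega>) \<le> ennreal (exp (CH * (real n * h)) * (real n * h)) * CQ"
  proof (rule ennreal_gronwall[where N = n])
    show "mh1 M (\<lambda>\<omega>. Xh h 0 \<omega>) = 0" by (simp add: fcoeff_0 wl2_def)
    fix m assume m: "m < n"
    then have "real (Suc m) * h \<le> real n * h" using h by (intro mult_right_mono) auto
    then show "mh1 M (\<lambda>\<omega>. Xh h (Suc m) \<omega>)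
      \<le> ennreal (1 + CH * h) * mh1 M (\<lambda>\<omega>. Xh h m \<omega>) + ennreal h * CQ" using n by (intro Xh_H1_step h) linarith
  qed (use CH_nonneg h in auto)
  also have "\<dots> \<le> ennreal (exp (CH * T) * T) * CQ"
  proof (intro mult_right_mono ennreal_leI mult_mono)
    show "exp (CH * (real n * h)) \<le> exp (CH * T)" using n CH_nonneg by (simp add: mult_left_mono)
  qed (use n h in auto)
  finally show ?thesis .
qed

text \<open>\<open>x\<close> lifted by the Bessel potential: distances of \<open>u\<close> in
  \<open>L\<^sup>2\<close> are distances of \<open>x\<close> in \<open>H\<^sup>1\<close>, and
  continuity of paths in \<open>H\<^sup>1\<close> becomes continuity in norm.\<close>

definition u :: "real \<Rightarrow> 'w \<Rightarrow> l2_torus" where "u t \<omega> = airy (- t) (Lam 1 (chi t \<omega>))"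

lemma u_continuous: "good \<omega> \<Longrightarrow> continuous_on {0..T} (\<lambda>t. u t \<omega>)"
  unfolding u_def by (intro continuous_on_airy good_Lam continuous_intros)

lemma x_eq_Lam: "good \<omega> \<Longrightarrow> t \<in> {0..T} \<Longrightarrow> x t \<omega> = Lam (-1) (u t \<omega>)"
proof (rule fcoeff_inject)
  fix k assume a: "good \<omega>" "t \<in> {0..T}"
  have "fcoeff (chi t \<omega>) k = fcoeff (Lam (-1) (Lam 1 (chi t \<omega>))) k" by (simp only: Lam_Lam[OF good_in_H1[OF a]])
  then show "fcoeff (x t \<omega>) k = fcoeff (Lam (-1) (u t \<omega>)) k" by (simp add: x_def u_def fcoeff_airy fcoeff_Lam[OF in_H_nonpos])
qed

lemma wl2_x:
  assumes "good \<omega>" "t \<in> {0..T}"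
  shows "wl2 jb (fcoeff (x t \<omega>)) = ennreal ((norm (u t \<omega>))\<^sup>2)"
    and "s \<in> {0..T} \<Longrightarrow> wl2 jb (fcoeff (x t \<omega> - x s \<omega>)) = ennreal ((norm (u t \<omega> - u s \<omega>))\<^sup>2)"
  by (simp_all only: x_eq_Lam[OF assms] x_eq_Lam[OF assms(1)] wl2_jb_Lam linear_diff[OF bounded_linear.linear[OF bounded_linear_Lam], symmetric])

lemma nl2_NN_le_real:
  assumes "wl2 jb (fcoeff g) \<le> ennreal A" "wl2 jb (fcoeff v) \<le> ennreal B" "0 \<le> A" "0 \<le> B"
  shows "nl2 (NN s g v) \<le> ennreal (4 * cjb * (A * B))"
proof -
  have "nl2 (NN s g v) \<le> 4 * Cjb * (wl2 jb (fcoeff g) * wl2 jb (fcoeff v))" by (rule nl2_NN_le)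
  also have "\<dots> \<le> 4 * ennreal cjb * (ennreal A * ennreal B)" unfolding Cjb_eq by (intro mult_left_mono mult_mono assms) auto
  also have "\<dots> = ennreal (4 * cjb * (A * B))" using cjb_nonneg assms by (simp add: ennreal_mult)
  finally show ?thesis .
qed

text \<open>A pathwise bound with the modulus of continuity \<eta> in place of a rate. Beyond the
  factor \<open>(c - a)\<^sup>2\<close>, which Young's inequality consumes, it only has to tend to
  0, so both defects are treated as products in \<open>H\<^sup>1\<close>.\<close>

lemma path_defect_le:
  assumes g: "good \<omega>" and ac: "0 \<le> a" "a \<le> c" "c \<le> T"
    and S: "\<And>s. s \<in> {a..c} \<Longrightarrow> wl2 jb (fcoeff (x s \<omega>)) \<le> ennreal S" "0 \<le> S"
    and \<eta>: "\<And>s. s \<in> {a..c} \<Longrightarrow> wl2 jb (fcoeff (x s \<omega> - x a \<omega>)) \<le> ennreal \<eta>" "0 \<le> \<eta>"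
  shows "nl2 (\<lambda>k. 2 * of_real \<mu> * (defect_f a c \<omega> k + defect_x a c \<omega> k))
    \<le> ennreal ((c - a)\<^sup>2 * (32 * \<mu>\<^sup>2 * cjb * (LF * (c - a)\<^sup>2 * S + KP\<^sup>2 * \<eta>)))" (is "?L \<le> _")
proof -
  have sub: "{a..c} \<subseteq> {0..T}" using ac by auto
  have aT: "a \<in> {0..T}" using ac by auto
  note cx = continuous_on_subset[OF x_continuous[OF g] sub] and cf = continuous_on_subset[OF f_continuous sub]
  have 1: "nl2 (\<lambda>k. defect_f a c \<omega> k) \<le> ennreal ((c - a)\<^sup>2) * ennreal (4 * cjb * (LF * (c - a)\<^sup>2 * S))"
  proof (rule wl2_integral_le[OF ac(2)])
    show "continuous_on {a..c} (\<lambda>s. NN s (f s - f a) (x s \<omega>) k)" for k by (intro continuous_on_NN continuous_intros cx cf)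
    fix s assume s: "s \<in> {a..c}"
    have "wl2 jb (fcoeff (f s - f a)) \<le> ennreal (LF * (s - a)\<^sup>2)" using s ac by (intro f_lipschitz) auto
    also have "\<dots> \<le> ennreal (LF * (c - a)\<^sup>2)" using s by (intro ennreal_leI mult_left_mono power_mono LF_nonneg) auto
    finally show "nl2 (\<lambda>k. NN s (f s - f a) (x s \<omega>) k) \<le> ennreal (4 * cjb * (LF * (c - a)\<^sup>2 * S))"
      by (rule nl2_NN_le_real[OF _ S(1)[OF s] _ S(2)]) (simp add: LF_nonneg)
  qed simp
  have 2: "nl2 (\<lambda>k. defect_x a c \<omega> k) \<le> ennreal ((c - a)\<^sup>2) * ennreal (4 * cjb * (KP\<^sup>2 * \<eta>))"
  proof (rule wl2_integral_le[OF ac(2)])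
    show "continuous_on {a..c} (\<lambda>s. NN s (f a) (x s \<omega> - x a \<omega>) k)" for k by (intro continuous_on_NN continuous_intros cx cf)
    fix s assume s: "s \<in> {a..c}"
    show "nl2 (\<lambda>k. NN s (f a) (x s \<omega> - x a \<omega>) k) \<le> ennreal (4 * cjb * (KP\<^sup>2 * \<eta>))"
      by (rule nl2_NN_le_real[OF f_H1[OF aT] \<eta>(1)[OF s] _ \<eta>(2)]) simp
  qed simp
  have "?L = ennreal (4 * \<mu>\<^sup>2) * nl2 (\<lambda>k. defect_f a c \<omega> k + defect_x a c \<omega> k)"
    unfolding wl2_scale by (simp add: norm_mult power_mult_distrib)
  also have "\<dots> \<le> ennreal (4 * \<mu>\<^sup>2) * (2 * (ennreal ((c - a)\<^sup>2) * ennreal (4 * cjb * (LF * (c - a)\<^sup>2 * S)) + ennreal ((c - a)\<^sup>2) * ennreal (4 * cjb * (KP\<^sup>2 * \<eta>))))"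
    by (intro mult_left_mono order_trans[OF wl2_add_le] add_mono 1 2) auto
  also have "\<dots> = ennreal ((4 * \<mu>\<^sup>2) * (2 * ((c - a)\<^sup>2 * (4 * cjb * (LF * (c - a)\<^sup>2 * S)) + (c - a)\<^sup>2 * (4 * cjb * (KP\<^sup>2 * \<eta>)))))"
    using cjb_nonneg LF_nonneg S(2) \<eta>(2)
    by (simp only: ennreal_mult ennreal_plus ennreal_numeral zero_le_power2 mult_nonneg_nonneg add_nonneg_nonneg zero_le_numeral)
  also have "\<dots> = ennreal ((c - a)\<^sup>2 * (32 * \<mu>\<^sup>2 * cjb * (LF * (c - a)\<^sup>2 * S + KP\<^sup>2 * \<eta>)))"
    by (rule arg_cong[where f = ennreal]) (simp add: algebra_simps)
  finally show ?thesis .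
qed

definition CE :: "real" where "CE = 1 + (4 * \<mu> * KN + 4 * \<mu>\<^sup>2 * KN\<^sup>2) * (1 + T)"

lemma CE_nonneg: "0 \<le> CE" using KN_nonneg \<mu> T by (simp add: CE_def)

text \<open>Both sequences carry the same increments of \<open>z\<close>, which cancel: the error
  satisfies the deterministic stable recursion with the defect as source, for each good
  path.\<close>

lemma Xh_path_error:
  assumes g: "good \<omega>" and zm: "\<And>n. n \<le> N \<Longrightarrow> fcoeff (x (real n * h) \<omega>) 0 = 0"
    and h: "0 < h" "real N * h \<le> T"
    and S: "\<And>s. s \<in> {0..T} \<Longrightarrow> wl2 jb (fcoeff (x s \<omega>)) \<le> ennreal S" "0 \<le> S"
    and \<eta>: "\<And>s r. s \<in> {0..T} \<Longrightarrow> r \<in> {0..T} \<Longrightarrow> \<bar>s - r\<bar> \<le> h \<Longrightarrow> wl2 jb (fcoeff (x s \<omega> - x r \<omega>)) \<le> ennreal \<eta>" "0 \<le> \<eta>"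
  shows "nl2 (fcoeff (x (real N * h) \<omega> - Xh h N \<omega>))
    \<le> ennreal (exp (CE * T) * T * ((1 + T) * (32 * \<mu>\<^sup>2 * cjb * (LF * h\<^sup>2 * S + KP\<^sup>2 * \<eta>))))"
proof -
  let ?e = "\<lambda>n. x (real n * h) \<omega> - Xh h n \<omega>" and ?D = "32 * \<mu>\<^sup>2 * cjb * (LF * h\<^sup>2 * S + KP\<^sup>2 * \<eta>)"
  have D: "0 \<le> ?D" using cjb_nonneg LF_nonneg S(2) \<eta>(2) by simp
  define d where "d n k = 2 * of_real \<mu> * (defect_f (real n * h) (real (Suc n) * h) \<omega> k
     + defect_x (real n * h) (real (Suc n) * h) \<omega> k)" for n k
  note gr = grid_lt[OF less_imp_le[OF h(1)] h(2)]
  have step: "fcoeff (?e (Suc n)) = (\<lambda>k. (fcoeff (?e n) k + 2 * of_real \<mu> * BB (real n * h) (real (Suc n) * h) (f (real n * h)) (?e n) k) + d n k)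
      \<and> fcoeff (?e n) 0 = 0" if n: "n < N" and e0: "fcoeff (?e n) 0 = 0" for n
  proof (intro conjI ext e0)
    fix k
    note G = gr[OF n]
    have BB_X: "BB (real n * h) (real (Suc n) * h) (f (real n * h)) (P0 (Xh h n \<omega>)) k = BB (real n * h) (real (Suc n) * h) (f (real n * h)) (Xh h n \<omega>) k"
    proof -
      have "fcoeff (Xh h n \<omega>) 0 = 0" using e0 zm[of n] n by (simp add: fcoeff_diff)
      then show ?thesis by (simp add: P0_id)
    qed
    have le: "real (Suc n) * h \<le> T" using G(2) by simp
    have X: "fcoeff (Xh h (Suc n) \<omega>) k = fcoeff (Xh h n \<omega>) k + 2 * of_real \<mu> * BB (real n * h) (real (Suc n) * h) (f (real n * h)) (Xh h n \<omega>) k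
      + fcoeff (z (real (Suc n) * h) \<omega> - z (real n * h) \<omega>) k"
      unfolding Xh.simps(2) fcoeff_add fcoeff_scaleR fcoeff_BBop[OF G(3) f_zero_mean[OF G(1)] f_nl1[OF G(1)]] BB_X by simp
    have "fcoeff (x (real (Suc n) * h) \<omega> - x (real n * h) \<omega> - (z (real (Suc n) * h) \<omega> - z (real n * h) \<omega>)) k
      - 2 * of_real \<mu> * BB (real n * h) (real (Suc n) * h) (f (real n * h)) (x (real n * h) \<omega>) k = d n k"
      unfolding d_def by (rule local_error(1)[OF g G(4) G(3) le])
    then show "fcoeff (?e (Suc n)) k = (fcoeff (?e n) k + 2 * of_real \<mu> * BB (real n * h) (real (Suc n) * h) (f (real n * h)) (?e n) k) + d n k"
      unfolding fcoeff_diff X BB_linear by (simp add: algebra_simps del: of_nat_Suc)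
  qed
  have e0: "fcoeff (?e n) 0 = 0" if "n \<le> N" for n using that
  proof (induction n)
    case 0
    then show ?case by (simp add: x_0[OF g] fcoeff_0)
  next
    case (Suc n)
    then have n: "n < N" by simp
    have dz: "d n 0 = 0" by (simp add: d_def)
    from step[OF n] Suc.IH n show ?case by (simp add: dz del: of_nat_Suc)
  qed
  have "nl2 (fcoeff (?e N)) \<le> ennreal (exp (CE * (real N * h)) * (real N * h)) * ennreal ((1 + T) * ?D)"
  proof (rule ennreal_gronwall[where N = N])
    show "nl2 (fcoeff (?e 0)) = 0" by (simp add: x_0[OF g] fcoeff_0 wl2_def)
    fix n assume n: "n < N"
    note G = gr[OF n]
    have st: "fcoeff (?e (Suc n)) = (\<lambda>k. (fcoeff (?e n) k + 2 * of_real \<mu> * BB (real n * h) (real (Suc n) * h) (f (real n * h)) (?e n) k) + d n k)"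
      using step[OF n e0] n by simp
    have hT: "h \<le> T" using G(2) G(4) G(5) unfolding atLeastAtMost_iff by linarith
    have le1: "nl2 (fcoeff (?e (Suc n))) \<le> ennreal (1 + CE * h) * nl2 (fcoeff (?e n)) + ennreal h * (ennreal ((1 + T) / h\<^sup>2) * nl2 (d n))"
      unfolding st using perturbed_step_le[where a = "real n * h" and c = "real (Suc n) * h" and T = T and g = "f (real n * h)" and K = KN and \<mu> = \<mu> and C = CE and v = "?e n" and d = "d n", unfolded G(5),
          OF h(1) hT f_zero_mean[OF G(1)] e0 f_nl1w[OF G(1)] KN_nonneg less_imp_le[OF \<mu>] CE_def] n by simp
    have le2: "nl2 (d n) \<le> ennreal (h\<^sup>2 * ?D)"
    proof -
      have "nl2 (\<lambda>k. d n k) \<le> ennreal ((real (Suc n) * h - real n * h)\<^sup>2 * (32 * \<mu>\<^sup>2 * cjb * (LF * (real (Suc n) * h - real n * h)\<^sup>2 * S + KP\<^sup>2 * \<eta>)))"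
        unfolding d_def
      proof (rule path_defect_le[OF g G(4) G(3) _ _ S(2) _ \<eta>(2)])
        show "real (Suc n) * h \<le> T" using G(2) by simp
        fix s assume s: "s \<in> {real n * h..real (Suc n) * h}"
        then have sT: "s \<in> {0..T}" using G(2,4) unfolding atLeastAtMost_iff by linarith
        show "wl2 jb (fcoeff (x s \<omega>)) \<le> ennreal S" by (rule S(1)[OF sT])
        show "wl2 jb (fcoeff (x s \<omega> - x (real n * h) \<omega>)) \<le> ennreal \<eta>"
          using s G(5) by (intro \<eta>(1)[OF sT G(1)]) (auto simp del: of_nat_Suc)
      qed
      then show ?thesis unfolding G(5) by simp
    qed
    have eq: "ennreal ((1 + T) / h\<^sup>2) * ennreal (h\<^sup>2 * ?D) = ennreal ((1 + T) * ?D)"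
    proof -
      have "(1 + T) / h\<^sup>2 * (h\<^sup>2 * ?D) = (1 + T) * ?D" using h by simp
      then show ?thesis using T D by (metis add_nonneg_nonneg divide_nonneg_nonneg ennreal_mult less_imp_le mult_nonneg_nonneg zero_le_one zero_le_power2)
    qed
    show "nl2 (fcoeff (?e (Suc n))) \<le> ennreal (1 + CE * h) * nl2 (fcoeff (?e n)) + ennreal h * ennreal ((1 + T) * ?D)"
      unfolding eq[symmetric] by (rule order_trans[OF le1 add_left_mono[OF mult_left_mono[OF mult_left_mono[OF le2]]]]) auto
  qed (use CE_nonneg h in auto)
  also have "\<dots> \<le> ennreal (exp (CE * T) * T) * ennreal ((1 + T) * ?D)"
  proof (intro mult_right_mono ennreal_leI mult_mono)
    show "exp (CE * (real N * h)) \<le> exp (CE * T)" using h CE_nonneg by (simp add: mult_left_mono)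
  qed (use h in auto)
  also have "\<dots> = ennreal (exp (CE * T) * T * ((1 + T) * ?D))"
    using T by (intro ennreal_mult[symmetric] mult_nonneg_nonneg[OF _ D]) auto
  finally show ?thesis .
qed

text \<open>Along a fixed path \<open>u\<close> is bounded and uniformly continuous, so the source
  tends to 0 with the step size. No rate is obtained here, and none enters the moment bound.\<close>

lemma Xh_tendsto:
  assumes g: "good \<omega>" and t: "0 < t" "t \<le> T"
    and zm: "\<And>N n. n \<le> Suc N \<Longrightarrow> fcoeff (x (real n * (t / real (Suc N))) \<omega>) 0 = 0"
  shows "(\<lambda>N. Xh (t / real (Suc N)) (Suc N) \<omega>) \<longlonglongrightarrow> x t \<omega>"
proof -
  have cu: "continuous_on {0..T} (\<lambda>s. u s \<omega>)" by (rule u_continuous[OF g])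
  have "compact ((\<lambda>s. u s \<omega>) ` {0..T})" by (intro compact_continuous_image cu) auto
  then obtain R where R: "\<And>s. s \<in> {0..T} \<Longrightarrow> norm (u s \<omega>) \<le> R" using compact_imp_bounded bounded_iff by (metis imageI)
  have S: "wl2 jb (fcoeff (x s \<omega>)) \<le> ennreal (R\<^sup>2)" if "s \<in> {0..T}" for s
    unfolding wl2_x(1)[OF g that] using R[OF that] by (intro ennreal_leI power_mono) auto
  have uc: "uniformly_continuous_on {0..T} (\<lambda>s. u s \<omega>)" by (rule compact_uniformly_continuous[OF cu]) simp
  define Q where "Q = exp (CE * T) * T * ((1 + T) * (32 * \<mu>\<^sup>2 * cjb))"
  have Q: "0 \<le> Q" using T cjb_nonneg by (simp add: Q_def)
  have ht: "(\<lambda>N. t / real (Suc N)) \<longlonglongrightarrow> 0" by (intro LIMSEQ_Suc lim_const_over_n)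
  have "(\<lambda>N. (norm (x t \<omega> - Xh (t / real (Suc N)) (Suc N) \<omega>))\<^sup>2) \<longlonglongrightarrow> 0"
  proof (rule tendstoI)
    fix r :: real assume r: "0 < r"
    \<comment> \<open>\<open>Q\<close> times \<open>1 + KP\<^sup>2\<close> is the final constant;
      adding 1 keeps the denominator positive and the resulting inequality strict.\<close>
    define \<eta> where "\<eta> = r / (Q * (1 + KP\<^sup>2) + 1)"
    have pos: "0 < Q * (1 + KP\<^sup>2) + 1" using Q by (simp add: add_nonneg_pos)
    have \<eta>: "0 < \<eta>" "Q * ((1 + KP\<^sup>2) * \<eta>) < r"
    proof -
      show "0 < \<eta>" using r pos by (simp add: \<eta>_def)
      then have "Q * ((1 + KP\<^sup>2) * \<eta>) < (Q * (1 + KP\<^sup>2) + 1) * \<eta>" by (simp add: algebra_simps)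
      also have "\<dots> = r" using pos by (simp add: \<eta>_def)
      finally show "Q * ((1 + KP\<^sup>2) * \<eta>) < r" .
    qed
    obtain \<delta> where \<delta>: "0 < \<delta>" "\<And>s r. s \<in> {0..T} \<Longrightarrow> r \<in> {0..T} \<Longrightarrow> dist s r < \<delta> \<Longrightarrow> dist (u s \<omega>) (u r \<omega>) < sqrt \<eta>"
      using uc \<eta>(1) unfolding uniformly_continuous_on_def by (metis real_sqrt_gt_zero)
    have "(\<lambda>N. LF * (t / real (Suc N))\<^sup>2 * R\<^sup>2) \<longlonglongrightarrow> LF * 0\<^sup>2 * R\<^sup>2" by (intro tendsto_intros ht)
    then have "\<forall>\<^sub>F N in sequentially. LF * (t / real (Suc N))\<^sup>2 * R\<^sup>2 < \<eta>"
      using \<eta>(1) by (intro order_tendstoD(2)[where y = 0]) auto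
    moreover have "\<forall>\<^sub>F N in sequentially. t / real (Suc N) < \<delta>" using \<delta>(1) by (intro order_tendstoD(2)[OF ht]) auto
    ultimately show "\<forall>\<^sub>F N in sequentially. dist ((norm (x t \<omega> - Xh (t / real (Suc N)) (Suc N) \<omega>))\<^sup>2) 0 < r"
    proof eventually_elim
      case (elim N)
      let ?h = "t / real (Suc N)"
      have hN: "real (Suc N) * ?h = t" by simp
      have "nl2 (fcoeff (x (real (Suc N) * ?h) \<omega> - Xh ?h (Suc N) \<omega>))
        \<le> ennreal (exp (CE * T) * T * ((1 + T) * (32 * \<mu>\<^sup>2 * cjb * (LF * ?h\<^sup>2 * R\<^sup>2 + KP\<^sup>2 * \<eta>))))"
      proof (rule Xh_path_error[OF g zm _ _ S])
        fix s r assume sr: "s \<in> {0..T}" "r \<in> {0..T}" "\<bar>s - r\<bar> \<le> ?h"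
        then have "norm (u s \<omega> - u r \<omega>) \<le> sqrt \<eta>" using \<delta>(2)[OF sr(1,2)] elim(2) by (simp add: dist_norm less_imp_le)
        then have "(norm (u s \<omega> - u r \<omega>))\<^sup>2 \<le> (sqrt \<eta>)\<^sup>2" by (intro power_mono) auto
        then show "wl2 jb (fcoeff (x s \<omega> - x r \<omega>)) \<le> ennreal \<eta>"
          unfolding wl2_x(2)[OF g sr(1,2)] using \<eta>(1) by (intro ennreal_leI) simp
      qed (use t \<eta>(1) hN in auto)
      also have "\<dots> = ennreal (Q * (LF * ?h\<^sup>2 * R\<^sup>2 + KP\<^sup>2 * \<eta>))"
        by (rule arg_cong[where f = ennreal]) (simp only: Q_def mult.assoc)
      finally have "(norm (x t \<omega> - Xh ?h (Suc N) \<omega>))\<^sup>2 \<le> Q * (LF * ?h\<^sup>2 * R\<^sup>2 + KP\<^sup>2 * \<eta>)"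
        unfolding hN nl2_fcoeff using Q LF_nonneg \<eta>(1) by (subst (asm) ennreal_le_iff) (auto simp del: of_nat_Suc)
      also have "\<dots> \<le> Q * ((1 + KP\<^sup>2) * \<eta>)" using elim(1) by (intro mult_left_mono Q) (simp add: algebra_simps del: of_nat_Suc)
      finally show ?case using \<eta>(2) by (simp del: of_nat_Suc)
    qed
  qed
  then have "(\<lambda>N. sqrt ((norm (x t \<omega> - Xh (t / real (Suc N)) (Suc N) \<omega>))\<^sup>2)) \<longlonglongrightarrow> sqrt 0" by (rule tendsto_real_sqrt)
  then have "(\<lambda>N. norm (Xh (t / real (Suc N)) (Suc N) \<omega> - x t \<omega>)) \<longlonglongrightarrow> 0" by (simp add: norm_minus_commute)
  then show ?thesis by (rule LIM_zero_cancel[OF tendsto_norm_zero_cancel])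
qed

text \<open>Fatou's lemma is used twice: over the frequencies, because the recursion converges in
  \<open>L\<^sup>2\<close> while the bound is in \<open>H\<^sup>1\<close>, and over the probability
  space.\<close>

lemma x_H1_moment:
  assumes t: "t \<in> {0..T}"
  shows "mh1 M (\<lambda>\<omega>. x t \<omega>) \<le> ennreal (exp (CH * T) * T) * CQ"
proof (cases "t = 0")
  case True
  have "mh1 M (\<lambda>\<omega>. x t \<omega>) = (\<integral>\<^sup>+\<omega>. 0 \<partial>M)"
    using AE_good by (intro nn_integral_cong_AE) (auto elim!: eventually_mono simp: True x_0 fcoeff_0 wl2_def)
  then show ?thesis by simp
next
  case False
  then have t0: "0 < t" using t by simp
  let ?X = "\<lambda>N \<omega>. Xh (t / real (Suc N)) (Suc N) \<omega>"
  have p: "past (real (Suc N) * (t / real (Suc N))) (Xh (t / real (Suc N)) (Suc N))" for N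
    using t t0 by (intro past_Xh) (auto simp del: of_nat_Suc)
  \<comment> \<open>The grid points of all the grids together are countable, so zero mean holds at
    all of them at once.\<close>
  have zm: "AE \<omega> in M. \<forall>N n. n \<le> Suc N \<longrightarrow> fcoeff (x (real n * (t / real (Suc N))) \<omega>) 0 = 0" unfolding AE_all_countable
  proof (intro allI)
    fix N n
    show "AE \<omega> in M. n \<le> Suc N \<longrightarrow> fcoeff (x (real n * (t / real (Suc N))) \<omega>) 0 = 0"
    proof (cases "n \<le> Suc N")
      case True
      then have "real n * (t / real (Suc N)) \<le> real (Suc N) * (t / real (Suc N))" using t0 by (intro mult_right_mono) auto
      then have "real n * (t / real (Suc N)) \<in> {0..T}" using t t0 by (simp del: of_nat_Suc)
      from x_zero_mean[OF this] show ?thesis by eventually_elim simp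
    qed simp
  qed
  have "AE \<omega> in M. wl2 jb (fcoeff (x t \<omega>)) \<le> liminf (\<lambda>N. wl2 jb (fcoeff (?X N \<omega>)))" using zm AE_good
  proof eventually_elim
    case (elim \<omega>)
    have lim: "(\<lambda>N. ?X N \<omega>) \<longlonglongrightarrow> x t \<omega>" using elim t t0 by (intro Xh_tendsto) auto
    have "ennreal (jb k * (cmod (fcoeff (x t \<omega>) k))\<^sup>2) = liminf (\<lambda>N. ennreal (jb k * (cmod (fcoeff (?X N \<omega>) k))\<^sup>2))" for k
    proof (rule lim_imp_Liminf[symmetric])
      show "(\<lambda>N. ennreal (jb k * (cmod (fcoeff (?X N \<omega>) k))\<^sup>2)) \<longlonglongrightarrow> ennreal (jb k * (cmod (fcoeff (x t \<omega>) k))\<^sup>2)"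
        by (intro tendsto_ennrealI tendsto_intros bounded_linear.tendsto[OF bounded_linear_fcoeff] lim)
    qed simp
    then have "wl2 jb (fcoeff (x t \<omega>)) = esum (\<lambda>k. liminf (\<lambda>N. ennreal (jb k * (cmod (fcoeff (?X N \<omega>) k))\<^sup>2)))"
      by (simp add: wl2_def)
    also have "\<dots> \<le> liminf (\<lambda>N. wl2 jb (fcoeff (?X N \<omega>)))" unfolding wl2_def by (rule nn_integral_liminf) simp
    finally show ?case .
  qed
  then have "mh1 M (\<lambda>\<omega>. x t \<omega>) \<le> (\<integral>\<^sup>+\<omega>. liminf (\<lambda>N. wl2 jb (fcoeff (?X N \<omega>))) \<partial>M)" by (rule nn_integral_mono_AE)
  also have "\<dots> \<le> liminf (\<lambda>N. mh1 M (\<lambda>\<omega>. ?X N \<omega>))"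
    by (rule nn_integral_liminf) (rule measurable_wl2[OF measurable_fcoeff[OF past_measurable[OF p]]])
  also have "\<dots> \<le> liminf (\<lambda>N. ennreal (exp (CH * T) * T) * CQ)"
  proof (rule Liminf_mono, rule always_eventually, rule allI)
    fix N
    show "mh1 M (\<lambda>\<omega>. ?X N \<omega>) \<le> ennreal (exp (CH * T) * T) * CQ" using t t0 by (intro Xh_H1) (auto simp del: of_nat_Suc)
  qed
  also have "\<dots> = ennreal (exp (CH * T) * T) * CQ" by (simp add: Liminf_const)
  finally show ?thesis .
qed

end

section \<open>The scheme\<close>

text \<open>A square is nonnegative, so testing against it preserves the upper bound of
  \<open>g\<close>. This is how the bound in \<open>L\<^sup>\<infinity>\<close> enters the sums of
  coefficients.\<close>

lemma inner_mult_self_le: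
  assumes "Linf_le g K" "nl1 (fcoeff w) < \<infinity>"
  shows "inner g (w \<odot> w) \<le> K * inner w w"
proof -
  obtain G where G: "sq_int G" "g = abs_l2_torus G" by (rule l2_torus_cases)
  obtain W where W: "sq_int W" "w = abs_l2_torus W" by (rule l2_torus_cases)
  have WW: "sq_int (\<lambda>x. W x * W x)" using sq_int_mult_of_nl1[of W W] assms(2) W by simp
  have r: "l2_rel G G" "l2_rel W W" "l2_rel (\<lambda>x. W x * W x) (\<lambda>x. W x * W x)" using G W WW by (auto simp: l2_rel_def)
  have p: "w \<odot> w = abs_l2_torus (\<lambda>x. W x * W x)" unfolding W(2) using WW r by (subst l2_mult.abs_eq) auto
  have K: "AE x in torus. \<bar>G x\<bar> \<le> K" using assms(1) r by (simp add: G(2) Linf_le.abs_eq)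
  have "inner g (w \<odot> w) = (\<integral>x. G x * (W x * W x) \<partial>torus)" unfolding p G(2) by (simp add: inner_l2_torus.abs_eq r)
  also have "\<dots> \<le> (\<integral>x. K * (W x * W x) \<partial>torus)"
  proof (rule integral_mono_AE)
    show "AE x in torus. G x * (W x * W x) \<le> K * (W x * W x)" using K by eventually_elim (intro mult_right_mono, auto)
  qed (use sq_int_mult_integrable[OF G(1) WW] sq_int_mult_integrable[OF W(1) W(1)] in auto)
  also have "\<dots> = K * inner w w" unfolding W(2) by (simp add: inner_l2_torus.abs_eq r)
  finally show ?thesis .
qed

definition dirichlet :: "nat \<Rightarrow> int \<Rightarrow> complex" where
  "dirichlet n j = (if \<bar>j\<bar> \<le> int n then 1 else 0)"

lemma dirichlet_has_sum: "((\<lambda>j. dirichlet n j * c j) has_sum (\<Sum>j=-int n..int n. c j)) UNIV"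
proof -
  have "((\<lambda>j. dirichlet n j * c j) has_sum (\<Sum>j=-int n..int n. c j)) {-int n..int n}"
    by (rule has_sum_finiteI) (auto simp: dirichlet_def intro!: sum.cong)
  then show ?thesis by (rule has_sum_cong_neutral[THEN iffD1, rotated -1]) (auto simp: dirichlet_def)
qed

lemma fcoeff_dirichlet: "fcoeff (fourier_series (dirichlet n)) = dirichlet n"
  and nl1_dirichlet: "nl1 (dirichlet n) < \<infinity>"
  and inner_dirichlet: "inner (fourier_series (dirichlet n)) (fourier_series (dirichlet n)) = 2 * real n + 1"
proof -
  have sq: "dirichlet n j = of_real ((cmod (dirichlet n j))\<^sup>2)" "dirichlet n j = of_real (cmod (dirichlet n j))" for j
    by (auto simp: dirichlet_def)
  have hs: "(dirichlet n has_sum of_real (2 * real n + 1)) UNIV" using dirichlet_has_sum[of n "\<lambda>_. 1"] by simp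
  have s1: "((\<lambda>j. (cmod (dirichlet n j))\<^sup>2) has_sum (2 * real n + 1)) UNIV"
    using hs by (subst (asm) sq(1)[abs_def], subst (asm) has_sum_of_real_iff)
  have s2: "((\<lambda>j. cmod (dirichlet n j)) has_sum (2 * real n + 1)) UNIV"
    using hs by (subst (asm) sq(2)[abs_def], subst (asm) has_sum_of_real_iff)
  show "nl1 (dirichlet n) < \<infinity>"
    unfolding nl1_def by (subst summable_on_iff_esum_finite[symmetric]) (auto intro: has_sum_imp_summable[OF s2])
  show fd: "fcoeff (fourier_series (dirichlet n)) = dirichlet n"
    using has_sum_imp_summable[OF s1] by (intro ext fcoeff_fourier_series) (auto simp: conj_sym_def sq_summable_def dirichlet_def)
  have "((\<lambda>l. (cmod (dirichlet n l))\<^sup>2) has_sum inner (fourier_series (dirichlet n)) (fourier_series (dirichlet n))) UNIV"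
    using parseval[of "fourier_series (dirichlet n)"] by (simp add: fd power2_norm_eq_inner)
  then show "inner (fourier_series (dirichlet n)) (fourier_series (dirichlet n)) = 2 * real n + 1"
    using s1 has_sum_unique by blast
qed

text \<open>The function is tested against the square of a Dirichlet kernel.\<close>

lemma sum_nonneg_fcoeff_le:
  assumes g: "Linf_le g K" and c: "\<And>l. fcoeff g l = of_real (c l)" "\<And>l. 0 \<le> c l"
  shows "(\<Sum>l=-int m..int m. c l) \<le> 2 * sqrt (2 * pi) * K"
proof -
  let ?w = "fourier_series (dirichlet (2 * m))"
  define s where "s k = real (card {j. \<bar>j\<bar> \<le> 2 * int m \<and> \<bar>k - j\<bar> \<le> 2 * int m})" for k
  have sc: "sconv (dirichlet (2 * m)) (dirichlet (2 * m)) k = of_real (s k)" for k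
  proof -
    have "sconv (dirichlet (2 * m)) (dirichlet (2 * m)) k = (\<Sum>j=-int (2 * m)..int (2 * m). dirichlet (2 * m) (k - j))"
      unfolding sconv_def by (rule infsumI[OF dirichlet_has_sum])
    also have "\<dots> = (\<Sum>j | j \<in> {-int (2 * m)..int (2 * m)} \<and> \<bar>k - j\<bar> \<le> 2 * int m. 1)"
      unfolding sum.inter_filter[OF finite_atLeastAtMost_int] by (rule sum.cong) (auto simp: dirichlet_def)
    also have "{j. j \<in> {-int (2 * m)..int (2 * m)} \<and> \<bar>k - j\<bar> \<le> 2 * int m} = {j. \<bar>j\<bar> \<le> 2 * int m \<and> \<bar>k - j\<bar> \<le> 2 * int m}" by auto
    finally show ?thesis by (simp add: s_def)
  qed
  \<comment> \<open>The kernel has order \<open>2 * m\<close> so that for \<open>|k| \<le> m\<close>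
    every \<open>j\<close> with \<open>|j| \<le> m\<close> is counted: the coefficients of the
    square are then large on the whole range to be summed.\<close>
  have slow: "2 * real m + 1 \<le> s k" if "k \<in> {-int m..int m}" for k
  proof -
    have fin: "finite {j. \<bar>j\<bar> \<le> 2 * int m \<and> \<bar>k - j\<bar> \<le> 2 * int m}" by (rule finite_subset[of _ "{-2 * int m..2 * int m}"]) auto
    have "card {-int m..int m} \<le> card {j. \<bar>j\<bar> \<le> 2 * int m \<and> \<bar>k - j\<bar> \<le> 2 * int m}" by (rule card_mono[OF fin]) (use that in auto)
    moreover have "real (card {-int m..int m}) = 2 * real m + 1" by simp
    ultimately show ?thesis unfolding s_def by (metis of_nat_le_iff)
  qed
  have fc: "fcoeff (?w \<odot> ?w) k = of_real (s k / sqrt (2 * pi))" for k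
    using fcoeff_mult[of ?w ?w k] nl1_dirichlet[of "2 * m"] by (simp add: fcoeff_dirichlet sc)
  have hs: "((\<lambda>l. c l * (s l / sqrt (2 * pi))) has_sum inner g (?w \<odot> ?w)) UNIV"
    using inner_has_sum[of g "?w \<odot> ?w"] unfolding fc c(1) complex_cnj_complex_of_real of_real_mult[symmetric] has_sum_of_real_iff .
  have "(\<Sum>l=-int m..int m. c l) * ((2 * real m + 1) / sqrt (2 * pi)) \<le> (\<Sum>l=-int m..int m. c l * (s l / sqrt (2 * pi)))"
    unfolding sum_distrib_right by (intro sum_mono mult_left_mono divide_right_mono slow c(2)) auto
  also have "\<dots> \<le> (\<Sum>\<^sub>\<infinity>l. c l * (s l / sqrt (2 * pi)))"
    by (rule finite_sum_le_infsum[OF has_sum_imp_summable[OF hs]]) (auto simp: s_def c(2))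
  also have "\<dots> = inner g (?w \<odot> ?w)" by (rule infsumI[OF hs])
  also have "\<dots> \<le> K * (4 * real m + 1)"
    using inner_mult_self_le[OF g, of ?w] nl1_dirichlet[of "2 * m"] inner_dirichlet[of "2 * m"] by (simp add: fcoeff_dirichlet)
  finally have le: "(\<Sum>l=-int m..int m. c l) * ((2 * real m + 1) / sqrt (2 * pi)) \<le> K * (4 * real m + 1)" .
  have "0 \<le> (\<Sum>l=-int m..int m. c l) * ((2 * real m + 1) / sqrt (2 * pi))" by (intro mult_nonneg_nonneg sum_nonneg c(2)) auto
  with le have "0 \<le> K * (4 * real m + 1)" by linarith
  then have K: "0 \<le> K" by (simp add: zero_le_mult_iff)
  \<comment> \<open>The squared norm of the kernel is \<open>4 * m + 1\<close> and the lower bound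
    of the coefficients is \<open>2 * m + 1\<close>; their ratio stays below 2, which makes the
    bound uniform in \<open>m\<close>.\<close>
  have "K * (4 * real m + 1) \<le> 2 * K * (2 * real m + 1)" using K by (simp add: algebra_simps)
  with le have "(\<Sum>l=-int m..int m. c l) * ((2 * real m + 1) / sqrt (2 * pi)) \<le> 2 * K * (2 * real m + 1)" by linarith
  then have "(\<Sum>l=-int m..int m. c l) / sqrt (2 * pi) * (2 * real m + 1) \<le> 2 * K * (2 * real m + 1)" by (simp add: mult.commute)
  then have "(\<Sum>l=-int m..int m. c l) / sqrt (2 * pi) \<le> 2 * K" by (rule mult_right_le_imp_le) simp
  then show ?thesis by (simp add: field_simps)
qed

text \<open>This is where the moduli in \<open>abs_deriv\<close> matter: for a bounded function with
  nonnegative coefficients the coefficients are summable. The stability constant of the scheme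
  thereby becomes uniform in the step size.\<close>

theorem nl1w_le_of_Linf_abs_deriv:
  assumes p: "in_H 1 p" "fcoeff p 0 = 0" and K: "Linf_le (abs_deriv 1 p) K"
  shows "nl1w (fcoeff p) \<le> ennreal (4 * sqrt (2 * pi) * K)" "0 \<le> K"
proof -
  define c where "c l = \<bar>of_int l\<bar> * cmod (fcoeff p l)" for l
  have c0: "0 \<le> c l" for l by (simp add: c_def)
  have sq: "sq_summable (\<lambda>l. of_real (c l))"
  proof -
    have "nl2 (\<lambda>l. of_real (c l)) \<le> wl2 jb (fcoeff p)"
      unfolding wl2_def by (intro esum_mono ennreal_leI) (auto simp: c_def norm_mult power_mult_distrib jb_def intro!: mult_right_mono)
    then show ?thesis using p(1) by (simp add: sq_summable_iff in_H_1_iff le_less_trans)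
  qed
  have fc: "fcoeff (abs_deriv 1 p) l = of_real (c l)" for l
  proof -
    have "fourier_series (\<lambda>l. of_real (\<bar>of_int l\<bar> ^ 1 * cmod (fcoeff p l))) = fourier_series (\<lambda>l. of_real (c l))"
      by (simp add: c_def)
    then show ?thesis
      unfolding abs_deriv_def by (simp only:) (rule fcoeff_fourier_series[OF _ sq], simp add: conj_sym_def c_def fcoeff_cnj)
  qed
  let ?B = "2 * sqrt (2 * pi) * K"
  note le = sum_nonneg_fcoeff_le[OF K fc c0]
  have "c 0 \<le> 2 * sqrt (2 * pi) * K" using le[of 0] by simp
  then have "0 \<le> 2 * sqrt (2 * pi) * K" by (rule order_trans[OF c0])
  then show K0: "0 \<le> K" using pi_gt_zero by (simp add: zero_le_mult_iff)
  have fin: "sum c F \<le> ?B" if F: "finite F" for F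
  proof -
    obtain m where m: "F \<subseteq> {-int m..int m}"
    proof
      show "F \<subseteq> {- int (nat (Max (insert 0 (abs ` F))))..int (nat (Max (insert 0 (abs ` F))))}"
      proof
        fix l assume "l \<in> F"
        then have "\<bar>l\<bar> \<le> Max (insert 0 (abs ` F))" using F by (intro Max_ge) auto
        then show "l \<in> {- int (nat (Max (insert 0 (abs ` F))))..int (nat (Max (insert 0 (abs ` F))))}" by auto
      qed
    qed
    have "sum c F \<le> (\<Sum>l=-int m..int m. c l)" by (rule sum_mono2[OF _ m]) (auto simp: c0)
    then show ?thesis using le by (rule order_trans)
  qed
  have sm: "c summable_on UNIV" by (rule nonneg_bdd_above_summable_on) (use c0 fin in \<open>auto intro!: bdd_aboveI[where M = ?B]\<close>)
  have "(\<Sum>\<^sub>\<infinity>l. c l) \<le> ?B" by (rule infsum_le_finite_sums[OF sm]) (use fin in auto)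
  then have ec: "esum (\<lambda>l. ennreal (c l)) \<le> ennreal ?B" by (simp add: esum_eq_infsum[OF c0 sm] ennreal_leI)
  have "nl1w (fcoeff p) \<le> esum (\<lambda>l. 2 * ennreal (c l))" unfolding nl1w_def
  proof (intro esum_mono)
    fix l
    show "ennreal (sqrt (jb l) * cmod (fcoeff p l)) \<le> 2 * ennreal (c l)"
    proof (cases "l = 0")
      case False
      then have "1 \<le> \<bar>l\<bar>" by linarith
      then have "1 \<le> \<bar>of_int l :: real\<bar>" by (simp only: of_int_abs[symmetric] of_int_1_le_iff)
      then have q: "1\<^sup>2 \<le> \<bar>of_int l :: real\<bar>\<^sup>2" by (intro power_mono) auto
      \<comment> \<open>Away from the zero mode, which \<open>p\<close> lacks, the weight is at most
        twice the modulus of the frequency; this 2 and the 2 from the kernel make up the constant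
        4.\<close>
      have "sqrt (jb l) \<le> 2 * \<bar>of_int l\<bar>" by (rule real_le_lsqrt) (use q in \<open>simp_all add: jb_def power_mult_distrib\<close>)
      then have "sqrt (jb l) * cmod (fcoeff p l) \<le> 2 * c l" unfolding c_def mult.assoc[symmetric] by (intro mult_right_mono) auto
      then show ?thesis using c0[of l] by (metis ennreal_leI ennreal_mult ennreal_numeral zero_le_numeral)
    qed (simp add: p(2))
  qed
  also have "\<dots> \<le> 2 * ennreal ?B" unfolding esum_cmult by (intro mult_left_mono ec) auto
  also have "\<dots> = ennreal (2 * ?B)" by (simp only: ennreal_mult'[of 2 ?B] ennreal_numeral zero_le_numeral)
  also have "2 * ?B = 4 * sqrt (2 * pi) * K" by simp
  finally show "nl1w (fcoeff p) \<le> ennreal (4 * sqrt (2 * pi) * K)" .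
qed

section \<open>The step of the scheme as an exact integral in time\<close>

lemma in_H_1_Dx_inv: "in_H 1 (Dx_inv p)"
proof -
  have "wl2 jb (fcoeff (Dx_inv p)) \<le> 2 * nl2 (fcoeff p)" unfolding wl2_def esum_cmult[symmetric]
  proof (intro esum_mono)
    fix l
    have "jb l * (cmod (fcoeff (Dx_inv p) l))\<^sup>2 \<le> 2 * (cmod (fcoeff p l))\<^sup>2"
    proof (cases "l = 0")
      case False
      then have "0 < \<bar>l\<bar>" by simp
      then have "1 \<le> \<bar>l\<bar>" by linarith
      then have "1\<^sup>2 \<le> \<bar>l\<bar>\<^sup>2" by (rule power_mono) simp
      then have "1 \<le> (of_int l :: real)\<^sup>2" by (simp only: power2_abs one_power2 of_int_power[symmetric] of_int_1_le_iff)
      then have "jb l * (1 / (of_int l)\<^sup>2) \<le> 2" using False by (simp add: jb_def field_simps)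
      then have "jb l * (1 / (of_int l)\<^sup>2) * (cmod (fcoeff p l))\<^sup>2 \<le> 2 * (cmod (fcoeff p l))\<^sup>2" by (rule mult_right_mono) simp
      then show ?thesis by (simp add: fcoeff_Dx_inv False norm_mult norm_divide power_mult_distrib power_divide mult.assoc)
    qed (simp add: fcoeff_Dx_inv)
    then show "ennreal (jb l * (cmod (fcoeff (Dx_inv p) l))\<^sup>2) \<le> 2 * ennreal (1 * (cmod (fcoeff p l))\<^sup>2)"
      by (metis ennreal_leI ennreal_mult ennreal_numeral mult_1 zero_le_numeral zero_le_power2)
  qed
  also have "\<dots> < \<infinity>" by (simp add: nl2_fcoeff ennreal_mult_less_top)
  finally show ?thesis by (simp add: in_H_1_iff)
qed

definition NL :: "real \<Rightarrow> l2_torus \<Rightarrow> l2_torus \<Rightarrow> l2_torus" where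
  "NL \<tau> p w = (airy \<tau> (Dx_inv p) \<odot> airy \<tau> (Dx_inv w)) - airy \<tau> (Dx_inv p \<odot> Dx_inv w)"

lemma nl1_Dx_inv: "nl1 (fcoeff (Dx_inv p)) < \<infinity>" and nl1_airy: "nl1 (fcoeff (airy s u)) = nl1 (fcoeff u)"
  by (rule in_H_1_nl1[OF in_H_1_Dx_inv]) (simp add: nl1_def)

lemma bounded_linear_NL: "bounded_linear (NL \<tau> p)" unfolding NL_def
  by (intro bounded_linear_sub bounded_linear_compose[OF bounded_linear_airy] bounded_linear_compose[OF bounded_linear_l2_mult]
      bounded_linear_Dx_inv bounded_linear_airy) (simp_all only: nl1_airy nl1_Dx_inv)

text \<open>The antiderivatives supply \<open>1 / (\<i> j)\<close> and \<open>1 / (\<i> m)\<close>,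
  and integrating the phase supplies \<open>1 / (3 \<i> (j + m) j m)\<close>. The derivative cancels
  \<open>j + m\<close>, so the two sides agree up to the 3, the reciprocal of the 1/3 in the scheme.
  The initial time \<open>a\<close> only changes the phases of the arguments.\<close>

lemma scheme_phase:
  fixes a \<tau> :: real and j m :: int and p w :: complex
  assumes \<tau>: "0 \<le> \<tau>" and p: "j = 0 \<Longrightarrow> p = 0" and w: "m = 0 \<Longrightarrow> w = 0"
  defines "P \<equiv> (if j = 0 then 0 else 1 / (\<i> * of_int j)) * p" and "W \<equiv> (if m = 0 then 0 else 1 / (\<i> * of_int m)) * w"
  shows "cis (- ((a + \<tau>) * of_int (j + m) ^ 3)) * (cis (\<tau> * of_int j ^ 3) * P * (cis (\<tau> * of_int m ^ 3) * W) - cis (\<tau> * of_int (j + m) ^ 3) * (P * W))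
    = 3 * (\<i> * of_int (j + m)) * (JJ a (a + \<tau>) ((j + m) * j * m) * (cis (- (a * of_int j ^ 3)) * p * (cis (- (a * of_int m ^ 3)) * w)))"
proof (cases "j = 0 \<or> m = 0")
  case True
  then show ?thesis using p w by (auto simp: P_def W_def)
next
  case False
  then have jm: "j \<noteq> 0" "m \<noteq> 0" by auto
  have PW: "P * W = - (p * w) / (of_int j * of_int m)" using jm by (simp add: P_def W_def field_simps)
  have L: "cis (- ((a + \<tau>) * of_int (j + m) ^ 3)) * (cis (\<tau> * of_int j ^ 3) * P * (cis (\<tau> * of_int m ^ 3) * W) - cis (\<tau> * of_int (j + m) ^ 3) * (P * W))
    = (cis (- ((a + \<tau>) * of_int (j + m) ^ 3) + \<tau> * of_int j ^ 3 + \<tau> * of_int m ^ 3) - cis (- (a * of_int (j + m) ^ 3))) * (P * W)"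
  proof -
    have c2: "cis (- (a * of_int (j + m) ^ 3)) = cis (- ((a + \<tau>) * of_int (j + m) ^ 3)) * cis (\<tau> * of_int (j + m) ^ 3)"
      unfolding cis_mult by (rule arg_cong[where f = cis]) (simp add: algebra_simps)
    have c1: "cis (r + s + t) = cis r * (cis s * cis t)" for r s t by (simp add: cis_mult add.assoc)
    have "\<alpha> * (\<beta> * P * (\<gamma> * W) - \<kappa> * (P * W)) = (\<alpha> * (\<beta> * \<gamma>) - \<alpha> * \<kappa>) * (P * W)" for \<alpha> \<beta> \<gamma> \<kappa> :: complex
      by (simp add: algebra_simps)
    then show ?thesis unfolding c1 c2 .
  qed
  show ?thesis
  proof (cases "j + m = 0")
    \<comment> \<open>Opposite frequencies: on the left the two phases coincide, on the right the
      derivative vanishes.\<close>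
    case True
    then have "m = - j" by simp
    then show ?thesis unfolding L by simp
  next
    case k: False
    let ?k = "j + m"
    have n: "?k * j * m \<noteq> 0" using k jm by simp
    have e1: "cis (- (3 * (a + \<tau>) * of_int (?k * j * m))) * (cis (- (a * of_int j ^ 3)) * cis (- (a * of_int m ^ 3)))
      = cis (- ((a + \<tau>) * of_int ?k ^ 3) + \<tau> * of_int j ^ 3 + \<tau> * of_int m ^ 3)"
      unfolding cis_mult by (rule arg_cong[where f = cis]) (simp add: algebra_simps power3_eq_cube)
    have e2: "cis (- (3 * a * of_int (?k * j * m))) * (cis (- (a * of_int j ^ 3)) * cis (- (a * of_int m ^ 3))) = cis (- (a * of_int ?k ^ 3))"
      unfolding cis_mult by (rule arg_cong[where f = cis]) (simp add: algebra_simps power3_eq_cube)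
    have "3 * (\<i> * of_int ?k) * (JJ a (a + \<tau>) (?k * j * m) * (cis (- (a * of_int j ^ 3)) * p * (cis (- (a * of_int m ^ 3)) * w)))
      = 3 * (\<i> * of_int ?k) / (- 3 * \<i> * of_int (?k * j * m)) * (p * w) *
         (cis (- (3 * (a + \<tau>) * of_int (?k * j * m))) * (cis (- (a * of_int j ^ 3)) * cis (- (a * of_int m ^ 3)))
          - cis (- (3 * a * of_int (?k * j * m))) * (cis (- (a * of_int j ^ 3)) * cis (- (a * of_int m ^ 3))))"
      using \<tau> by (subst JJ_eq[OF _ n]) (simp_all add: algebra_simps diff_divide_distrib)
    also have "3 * (\<i> * of_int ?k) / (- 3 * \<i> * of_int (?k * j * m)) * (p * w) = P * W"
    proof -
      have "complex_of_int ?k \<noteq> 0" using k by (metis of_int_eq_0_iff)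
      then have "3 * (\<i> * of_int ?k) / (- 3 * \<i> * of_int (?k * j * m)) = - 1 / (of_int j * of_int m)"
        using jm by (simp only: of_int_mult) (simp add: divide_simps)
      then show ?thesis unfolding PW by simp
    qed
    finally show ?thesis unfolding e1 e2 L by (simp only: mult.commute)
  qed
qed

text \<open>Summing \<open>scheme_phase\<close> over the frequencies. With the prefactor
  \<open>2 * \<mu> / 3\<close> the scheme step is thus exactly \<open>2 * \<mu>\<close> times the
  integrated bilinear term with frozen arguments.\<close>

theorem fcoeff_NL:
  assumes \<tau>: "0 \<le> \<tau>" and p: "fcoeff p 0 = 0" and w: "fcoeff w 0 = 0"
  shows "fcoeff (airy (- (a + \<tau>)) (NL \<tau> p w)) k = 3 * BB a (a + \<tau>) (airy (- a) p) (airy (- a) w) k"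
proof -
  let ?c = "cis (- ((a + \<tau>) * of_int k ^ 3))" and ?ck = "cis (\<tau> * of_int k ^ 3)"
  let ?A = "\<lambda>j. fcoeff (airy \<tau> (Dx_inv p)) j * fcoeff (airy \<tau> (Dx_inv w)) (k - j)"
  let ?P = "\<lambda>j. fcoeff (Dx_inv p) j * fcoeff (Dx_inv w) (k - j)"
  have "fcoeff (airy (- (a + \<tau>)) (NL \<tau> p w)) k = ?c * ((\<Sum>\<^sub>\<infinity>j. ?A j) / r2p - ?ck * ((\<Sum>\<^sub>\<infinity>j. ?P j) / r2p))"
  proof -
    have f1: "fcoeff (airy \<tau> (Dx_inv p) \<odot> airy \<tau> (Dx_inv w)) k = (\<Sum>\<^sub>\<infinity>j. ?A j) / r2p"
      unfolding sconv_def[symmetric] by (rule fcoeff_mult) (simp only: nl1_airy nl1_Dx_inv)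
    have f2: "fcoeff (Dx_inv p \<odot> Dx_inv w) k = (\<Sum>\<^sub>\<infinity>j. ?P j) / r2p"
      unfolding sconv_def[symmetric] by (rule fcoeff_mult[OF nl1_Dx_inv])
    show ?thesis unfolding NL_def fcoeff_airy[of "- (a + \<tau>)"] fcoeff_diff f1 fcoeff_airy[of \<tau> "_ \<odot> _"] f2 mult_minus_left ..
  qed
  also have "\<dots> = (\<Sum>\<^sub>\<infinity>j. ?c * (?A j - ?ck * ?P j)) / r2p"
  proof -
    have s: "(?A has_sum (\<Sum>\<^sub>\<infinity>j. ?A j)) UNIV" "(?P has_sum (\<Sum>\<^sub>\<infinity>j. ?P j)) UNIV" by (intro has_sum_infsum sconv_fcoeff_summable)+
    have "((\<lambda>j. ?c * (?A j + - ?ck * ?P j)) has_sum ?c * ((\<Sum>\<^sub>\<infinity>j. ?A j) + - ?ck * (\<Sum>\<^sub>\<infinity>j. ?P j))) UNIV"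
      by (intro has_sum_cmult_right has_sum_add s)
    then have "(\<Sum>\<^sub>\<infinity>j. ?c * (?A j - ?ck * ?P j)) = ?c * ((\<Sum>\<^sub>\<infinity>j. ?A j) - ?ck * (\<Sum>\<^sub>\<infinity>j. ?P j))" by (intro infsumI) simp
    then show ?thesis by (simp add: right_diff_distrib diff_divide_distrib)
  qed
  also have "(\<Sum>\<^sub>\<infinity>j. ?c * (?A j - ?ck * ?P j))
    = (\<Sum>\<^sub>\<infinity>j. 3 * (\<i> * of_int k) * (JJ a (a + \<tau>) (k * j * (k - j)) * (fcoeff (airy (- a) p) j * fcoeff (airy (- a) w) (k - j))))"
  proof (rule infsum_cong)
    fix j
    show "?c * (?A j - ?ck * ?P j) = 3 * (\<i> * of_int k) * (JJ a (a + \<tau>) (k * j * (k - j)) * (fcoeff (airy (- a) p) j * fcoeff (airy (- a) w) (k - j)))"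
      using scheme_phase[OF \<tau>, of j "fcoeff p j" "k - j" "fcoeff w (k - j)" a] p w
      by (simp only: fcoeff_airy fcoeff_Dx_inv mult_minus_left add.commute[of j] diff_add_cancel)
  qed
  also have "\<dots> = 3 * (\<i> * of_int k) * (\<Sum>\<^sub>\<infinity>j. JJ a (a + \<tau>) (k * j * (k - j)) * (fcoeff (airy (- a) p) j * fcoeff (airy (- a) w) (k - j)))"
  proof (rule infsum_cmult_right, rule abs_summable_summable)
    show "(\<lambda>j. norm (JJ a (a + \<tau>) (k * j * (k - j)) * (fcoeff (airy (- a) p) j * fcoeff (airy (- a) w) (k - j)))) summable_on UNIV"
    proof (rule summable_on_comparison_test[OF summable_on_cmult_right[OF sconv_fcoeff_abs_summable[of "airy (- a) p" "airy (- a) w" k], of "\<tau>"]])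
      fix j
      show "norm (JJ a (a + \<tau>) (k * j * (k - j)) * (fcoeff (airy (- a) p) j * fcoeff (airy (- a) w) (k - j)))
        \<le> \<tau> * norm (fcoeff (airy (- a) p) j * fcoeff (airy (- a) w) (k - j))"
        unfolding norm_mult[of "JJ _ _ _"] using norm_JJ_le[of a "a + \<tau>"] \<tau> by (intro mult_right_mono) auto
    qed simp
  qed
  finally show ?thesis by (simp add: BB_def)
qed

lemma nn_integral_cmult_add:
  assumes "u \<in> borel_measurable M" "v \<in> borel_measurable M"
  shows "(\<integral>\<^sup>+\<omega>. A * u \<omega> + B * v \<omega> \<partial>M) = A * (\<integral>\<^sup>+\<omega>. u \<omega> \<partial>M) + B * (\<integral>\<^sup>+\<omega>. v \<omega> \<partial>M)"
  using assms by (simp add: nn_integral_add nn_integral_cmult)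

text \<open>The moving lower limit is traded for a fixed interval: evaluated at
  \<open>max r s\<close> the integrand is jointly continuous, and the surplus over
  \<open>{a..r}\<close> is constant in \<open>s\<close> and can be subtracted explicitly.\<close>

lemma continuous_on_BB_lower:
  assumes v: "continuous_on {a..c} v"
  shows "continuous_on {a..c} (\<lambda>r. BB r c g (v r) k)"
proof -
  have "continuous_on ({a..c} \<times> cbox a c) (\<lambda>(r, s). NN (max r s) g (v r) k)"
    unfolding split_def by (intro continuous_on_NN continuous_intros continuous_on_compose2[OF v]) auto
  then have 1: "continuous_on {a..c} (\<lambda>r. integral (cbox a c) (\<lambda>s. NN (max r s) g (v r) k))"
    by (rule integral_continuous_on_param)
  have "continuous_on {a..c} (\<lambda>r. integral (cbox a c) (\<lambda>s. NN (max r s) g (v r) k) - of_real (r - a) * NN r g (v r) k)"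
    by (intro continuous_intros 1 continuous_on_NN v)
  then show ?thesis
  proof (rule continuous_on_eq)
    fix r assume r: "r \<in> {a..c}"
    have "(\<lambda>s. NN (max r s) g (v r) k) integrable_on {a..c}"
      by (intro integrable_continuous_real continuous_on_NN continuous_intros)
    then have "integral {a..c} (\<lambda>s. NN (max r s) g (v r) k)
      = integral {a..r} (\<lambda>s. NN (max r s) g (v r) k) + integral {r..c} (\<lambda>s. NN (max r s) g (v r) k)"
      using r by (intro Henstock_Kurzweil_Integration.integral_combine[symmetric]) auto
    also have "integral {a..r} (\<lambda>s. NN (max r s) g (v r) k) = integral {a..r} (\<lambda>s. NN r g (v r) k)"
      by (intro integral_cong) (auto simp: max_def)
    also have "integral {r..c} (\<lambda>s. NN (max r s) g (v r) k) = integral {r..c} (\<lambda>s. NN s g (v r) k)"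
      by (intro integral_cong) (auto simp: max_def)
    finally show "integral (cbox a c) (\<lambda>s. NN (max r s) g (v r) k) - of_real (r - a) * NN r g (v r) k = BB r c g (v r) k"
      using r by (simp add: BB_eq_integral scaleR_conv_of_real)
  qed
qed

lemma nl2_NN_le_left:
  assumes "wl2 jb (fcoeff g) \<le> ennreal A" "0 \<le> A"
  shows "nl2 (NN s g v) \<le> ennreal (4 * cjb * A) * wl2 jb (fcoeff v)"
proof -
  have "nl2 (NN s g v) \<le> 4 * Cjb * (wl2 jb (fcoeff g) * wl2 jb (fcoeff v))" by (rule nl2_NN_le)
  also have "\<dots> \<le> 4 * Cjb * (ennreal A * wl2 jb (fcoeff v))" by (intro mult_left_mono mult_right_mono assms) auto
  also have "\<dots> = ennreal (4 * cjb * A) * wl2 jb (fcoeff v)" using cjb_nonneg assms by (simp add: Cjb_eq ennreal_mult mult.assoc)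
  finally show ?thesis .
qed

section \<open>Local errors in mean square and the recursion of the scheme\<close>

context kdv_fluct begin

definition cq :: real where "cq = enn2real CQ"

lemma CQ_eq: "CQ = ennreal cq" and cq_nonneg: "0 \<le> cq" using esum_q by (auto simp: cq_def CQ_def)

definition CX :: real where "CX = exp (CH * T) * T * cq"

lemma CX_nonneg: "0 \<le> CX" using T cq_nonneg by (simp add: CX_def)

lemma x_moment: "t \<in> {0..T} \<Longrightarrow> mh1 M (\<lambda>\<omega>. x t \<omega>) \<le> ennreal CX"
  using x_H1_moment[of t] T cq_nonneg by (simp add: CX_def CQ_eq ennreal_mult)

lemma z_moment: "0 \<le> a \<Longrightarrow> a \<le> s \<Longrightarrow> s \<le> T \<Longrightarrow> mh1 M (\<lambda>\<omega>. z s \<omega> - z a \<omega>) = ennreal ((s - a) * cq)"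
  using twisted_noise_H1[OF z_increment_noise] cq_nonneg by (simp add: CQ_eq ennreal_mult)

lemma NN_measurable: "Y \<in> borel_measurable M \<Longrightarrow> (\<lambda>\<omega>. NN s g (Y \<omega>) k) \<in> borel_measurable M"
  by (rule measurable_bounded_linear[OF bounded_bilinear.bounded_linear_right[OF bounded_bilinear_NN]])

text \<open>Almost surely the argument has zero mean, and there \<open>BB\<close> coincides with the
  bounded operator \<open>BBop\<close>; completeness of the measure does the rest.\<close>

lemma BB_measurable:
  assumes "a \<le> c" "fcoeff g 0 = 0" "nl1 (fcoeff g) < \<infinity>" "Y \<in> borel_measurable M" "AE \<omega> in M. fcoeff (Y \<omega>) 0 = 0"
  shows "(\<lambda>\<omega>. BB a c g (Y \<omega>) k) \<in> borel_measurable M"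
proof (rule AE_eq_measurable)
  show "(\<lambda>\<omega>. fcoeff (BBop a c g (Y \<omega>)) k) \<in> borel_measurable M"
    by (rule measurable_fcoeff[OF measurable_bounded_linear[OF bounded_linear_BBop[OF assms(1-3)] assms(4)]])
  show "AE \<omega> in M. BB a c g (Y \<omega>) k = fcoeff (BBop a c g (Y \<omega>)) k"
    using assms(5) by eventually_elim (simp only: fcoeff_BBop[OF assms(1-3)] P0_id)
qed

lemma z_measurable: "t \<in> {0..T} \<Longrightarrow> z t \<in> borel_measurable M" by (rule twisted_noise_measurable[OF z_noise])

lemma y_measurable:
  assumes t: "t \<in> {0..T}"
  shows "y t \<in> borel_measurable M" "AE \<omega> in M. fcoeff (y t \<omega>) 0 = 0"
proof -
  have e: "AE \<omega> in M. fcoeff (y t \<omega>) k = NN t (f t) (x t \<omega>) k" for k using AE_good by eventually_elim (rule fcoeff_y[OF _ t])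
  show "y t \<in> borel_measurable M"
    by (rule measurable_l2_from_fcoeff, rule AE_eq_measurable[OF NN_measurable[OF x_measurable[OF t]] e])
  show "AE \<omega> in M. fcoeff (y t \<omega>) 0 = 0" using e[of 0] by simp
qed

text \<open>
  Of the increments of \<open>x\<close>, the noise part is of order \<open>(c - a)\<^sup>1\<^sup>/\<^sup>2\<close> in mean square, and the drift part is so after integration
  against the oscillating phases.
\<close>

definition GG :: "real \<Rightarrow> real \<Rightarrow> int \<Rightarrow> real \<Rightarrow> 'w \<Rightarrow> complex" where
  "GG a c k s \<omega> = (NN s (f s - f a) (x s \<omega>) k + NN s (f a) (z s \<omega> - z a \<omega>) k) + 2 * of_real \<mu> * BB s c (f a) (y s \<omega>) k"

lemma GG_integral:
  assumes g: "good \<omega>" and ac: "0 \<le> a" "a \<le> c" "c \<le> T"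
  shows "fcoeff (x c \<omega> - x a \<omega> - (z c \<omega> - z a \<omega>)) k - 2 * of_real \<mu> * BB a c (f a) (x a \<omega>) k
    = 2 * of_real \<mu> * integral {a..c} (\<lambda>s. GG a c k s \<omega>)" (is "?L = _")
    and "continuous_on {a..c} (\<lambda>s. GG a c k s \<omega>)"
proof -
  have sub: "{a..c} \<subseteq> {0..T}" using ac by auto
  note cx = continuous_on_subset[OF x_continuous[OF g] sub] and cz = continuous_on_subset[OF z_continuous[OF g] sub]
    and cf = continuous_on_subset[OF f_continuous sub] and cy = continuous_on_subset[OF y_continuous[OF g] sub]
  have 1: "continuous_on {a..c} (\<lambda>s. NN s (f s - f a) (x s \<omega>) k)" and 2: "continuous_on {a..c} (\<lambda>s. NN s (f a) (z s \<omega> - z a \<omega>) k)"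
    by (intro continuous_on_NN continuous_intros cx cz cf)+
  have 3: "continuous_on {a..c} (\<lambda>s. 2 * of_real \<mu> * BB s c (f a) (y s \<omega>) k)"
    by (intro continuous_intros continuous_on_BB_lower cy)
  show "continuous_on {a..c} (\<lambda>s. GG a c k s \<omega>)" unfolding GG_def by (intro continuous_on_add 1 2 3)
  have "integral {a..c} (\<lambda>s. GG a c k s \<omega>) = integral {a..c} (\<lambda>s. NN s (f s - f a) (x s \<omega>) k + NN s (f a) (z s \<omega> - z a \<omega>) k)
      + integral {a..c} (\<lambda>s. 2 * of_real \<mu> * BB s c (f a) (y s \<omega>) k)"
    unfolding GG_def by (intro integral_add integrable_continuous_real continuous_on_add 1 2 3)
  also have "integral {a..c} (\<lambda>s. NN s (f s - f a) (x s \<omega>) k + NN s (f a) (z s \<omega> - z a \<omega>) k)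
      = defect_f a c \<omega> k + defect_z a c \<omega> k" by (intro integral_add integrable_continuous_real 1 2)
  finally have I: "integral {a..c} (\<lambda>s. GG a c k s \<omega>) = defect_f a c \<omega> k
      + defect_z a c \<omega> k + 2 * of_real \<mu> * integral {a..c} (\<lambda>s. BB s c (f a) (y s \<omega>) k)" by simp
  show "?L = 2 * of_real \<mu> * integral {a..c} (\<lambda>s. GG a c k s \<omega>)"
    unfolding I local_error(1)[OF g ac] local_error(2)[OF g ac] by (simp only: add.assoc)
qed

lemma GG_measurable:
  assumes ac: "0 \<le> a" "a \<le> c" "c \<le> T" and s: "s \<in> {a..c}"
  shows "(\<lambda>\<omega>. GG a c k s \<omega>) \<in> borel_measurable M"
proof -
  have sT: "s \<in> {0..T}" and aT: "a \<in> {0..T}" and sc: "s \<le> c" using ac s by auto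
  show ?thesis unfolding GG_def
    by (intro borel_measurable_add borel_measurable_times borel_measurable_const NN_measurable x_measurable sT
        measurable_l2_diff z_measurable aT BB_measurable sc f_zero_mean f_nl1 y_measurable)
qed

lemma nl2_GG_le:
  assumes g: "good \<omega>" and ac: "0 \<le> a" "a \<le> c" "c \<le> T" and s: "s \<in> {a..c}"
  shows "nl2 (\<lambda>k. GG a c k s \<omega>)
    \<le> ennreal (4 * (4 * cjb * (LF * (c - a)\<^sup>2)) + 2 * (4 * \<mu>\<^sup>2 * ((c - a) * (KN\<^sup>2 * (4 * cjb * KP\<^sup>2))))) * wl2 jb (fcoeff (x s \<omega>))
      + ennreal (4 * (4 * cjb * KP\<^sup>2)) * wl2 jb (fcoeff (z s \<omega> - z a \<omega>))"
proof -
  have sT: "s \<in> {0..T}" and aT: "a \<in> {0..T}" and sc: "s \<le> c" using ac s by auto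
  let ?X = "wl2 jb (fcoeff (x s \<omega>))" and ?Z = "wl2 jb (fcoeff (z s \<omega> - z a \<omega>))"
  let ?a1 = "4 * cjb * (LF * (c - a)\<^sup>2)" and ?b1 = "4 * cjb * KP\<^sup>2" and ?c1 = "4 * \<mu>\<^sup>2 * ((c - a) * (KN\<^sup>2 * (4 * cjb * KP\<^sup>2)))"
  have nn: "0 \<le> ?a1" "0 \<le> ?b1" "0 \<le> ?c1" using cjb_nonneg LF_nonneg ac by auto
  have "wl2 jb (fcoeff (f s - f a)) \<le> ennreal (LF * (s - a)\<^sup>2)" using s ac by (intro f_lipschitz) auto
  also have "\<dots> \<le> ennreal (LF * (c - a)\<^sup>2)" using s by (intro ennreal_leI mult_left_mono power_mono LF_nonneg) auto
  finally have A: "nl2 (NN s (f s - f a) (x s \<omega>)) \<le> ennreal ?a1 * ?X" by (rule nl2_NN_le_left) (simp add: LF_nonneg)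
  have B: "nl2 (NN s (f a) (z s \<omega> - z a \<omega>)) \<le> ennreal ?b1 * ?Z" by (rule nl2_NN_le_left[OF f_H1[OF aT]]) simp
  \<comment> \<open>The drift contribution: \<open>y\<close> is bounded in \<open>L\<^sup>2\<close>
    by \<open>x\<close> in \<open>H\<^sup>1\<close>, and the oscillation gives the factor
    \<open>c - s\<close> without asking for a derivative of \<open>y\<close>.\<close>
  have C: "nl2 (\<lambda>k. 2 * of_real \<mu> * BB s c (f a) (y s \<omega>) k) \<le> ennreal ?c1 * ?X"
  proof -
    have fy: "fcoeff (y s \<omega>) = NN s (f s) (x s \<omega>)" by (rule ext) (rule fcoeff_y[OF g sT])
    have "nl2 (BB s c (f a) (y s \<omega>)) \<le> ennreal (c - s) * ((nl1 (fcoeff (f a)))\<^sup>2 * nl2 (fcoeff (y s \<omega>)))"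
      by (rule nl2_BB_le(1)[OF sc f_zero_mean[OF aT]]) (simp add: fy)
    also have "\<dots> \<le> ennreal (c - a) * ((ennreal KN)\<^sup>2 * (ennreal (4 * cjb * KP\<^sup>2) * ?X))"
      unfolding fy using s by (intro mult_mono ennreal_leI power_mono order_trans[OF nl1_le_nl1w f_nl1w[OF aT]] nl2_NN_le_left[OF f_H1[OF sT]]) auto
    finally have "ennreal (4 * \<mu>\<^sup>2) * nl2 (BB s c (f a) (y s \<omega>)) \<le> ennreal (4 * \<mu>\<^sup>2) * (ennreal (c - a) * ((ennreal KN)\<^sup>2 * (ennreal (4 * cjb * KP\<^sup>2) * ?X)))"
      by (rule mult_left_mono) simp
    also have "\<dots> = ennreal ?c1 * ?X"
    proof -
      have "ennreal ?c1 = ennreal (4 * \<mu>\<^sup>2) * (ennreal (c - a) * (ennreal (KN\<^sup>2) * ennreal (4 * cjb * KP\<^sup>2)))"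
        using cjb_nonneg ac by (simp only: ennreal_mult mult_nonneg_nonneg zero_le_power2 zero_le_numeral diff_ge_0_iff_ge)
      then show ?thesis using KN_nonneg by (simp only: mult.assoc ennreal_power)
    qed
    finally show ?thesis unfolding wl2_scale by (simp add: norm_mult power_mult_distrib)
  qed
  have "nl2 (\<lambda>k. GG a c k s \<omega>) \<le> 2 * (nl2 (\<lambda>k. NN s (f s - f a) (x s \<omega>) k + NN s (f a) (z s \<omega> - z a \<omega>) k) + nl2 (\<lambda>k. 2 * of_real \<mu> * BB s c (f a) (y s \<omega>) k))"
    unfolding GG_def by (rule wl2_add_le) simp
  also have "\<dots> \<le> 2 * (2 * (nl2 (NN s (f s - f a) (x s \<omega>)) + nl2 (NN s (f a) (z s \<omega> - z a \<omega>))) + nl2 (\<lambda>k. 2 * of_real \<mu> * BB s c (f a) (y s \<omega>) k))"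
    by (intro mult_left_mono add_right_mono wl2_add_le) auto
  also have "\<dots> \<le> 2 * (2 * (ennreal ?a1 * ?X + ennreal ?b1 * ?Z) + ennreal ?c1 * ?X)" by (intro mult_left_mono add_mono A B C) auto
  also have "\<dots> = ennreal (4 * ?a1 + 2 * ?c1) * ?X + ennreal (4 * ?b1) * ?Z"
  proof -
    have e1: "ennreal (4 * ?a1 + 2 * ?c1) = 4 * ennreal ?a1 + 2 * ennreal ?c1"
      using nn by (simp only: ennreal_plus ennreal_mult'[of 4] ennreal_mult'[of 2] ennreal_numeral zero_le_numeral mult_nonneg_nonneg)
    have e2: "ennreal (4 * ?b1) = 4 * ennreal ?b1" by (simp only: ennreal_mult'[of 4 ?b1] ennreal_numeral zero_le_numeral)
    have "2 * (2 * (p * X + q * Z) + r * X) = (4 * p + 2 * r) * X + (4 * q) * Z" for p q r X Z :: ennreal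
      by (simp add: algebra_simps)
    then show ?thesis unfolding e1 e2 .
  qed
  finally show ?thesis .
qed

definition CG :: real where
  "CG = (16 * cjb * LF * T + 32 * \<mu>\<^sup>2 * KN\<^sup>2 * cjb * KP\<^sup>2) * CX + 16 * cjb * KP\<^sup>2 * cq"

lemma CG_nonneg: "0 \<le> CG" using cjb_nonneg LF_nonneg T CX_nonneg cq_nonneg by (simp add: CG_def)

text \<open>Each of the three parts carries a factor \<open>c - a\<close>: the Lipschitz bound of
  \<open>f\<close> even gives its square, one power of which is replaced by \<open>T\<close>; the
  noise gives it as a variance and the drift through the oscillation.\<close>

lemma GG_moment:
  assumes ac: "0 \<le> a" "a \<le> c" "c \<le> T" and s: "s \<in> {a..c}"
  shows "(\<integral>\<^sup>+\<omega>. nl2 (\<lambda>k. GG a c k s \<omega>) \<partial>M) \<le> ennreal ((c - a) * CG)"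
proof -
  have sT: "s \<in> {0..T}" and aT: "a \<in> {0..T}" using ac s by auto
  let ?\<alpha> = "4 * (4 * cjb * (LF * (c - a)\<^sup>2)) + 2 * (4 * \<mu>\<^sup>2 * ((c - a) * (KN\<^sup>2 * (4 * cjb * KP\<^sup>2))))" and ?\<beta> = "4 * (4 * cjb * KP\<^sup>2)"
  have nn: "0 \<le> ?\<alpha>" "0 \<le> ?\<beta>" using cjb_nonneg LF_nonneg ac by auto
  have "(\<integral>\<^sup>+\<omega>. nl2 (\<lambda>k. GG a c k s \<omega>) \<partial>M)
    \<le> (\<integral>\<^sup>+\<omega>. ennreal ?\<alpha> * wl2 jb (fcoeff (x s \<omega>)) + ennreal ?\<beta> * wl2 jb (fcoeff (z s \<omega> - z a \<omega>)) \<partial>M)"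
    by (rule nn_integral_mono_AE, rule eventually_mono[OF AE_good nl2_GG_le[OF _ ac s]])
  also have "\<dots> = ennreal ?\<alpha> * mh1 M (\<lambda>\<omega>. x s \<omega>) + ennreal ?\<beta> * mh1 M (\<lambda>\<omega>. z s \<omega> - z a \<omega>)"
  proof -
    have m: "(\<lambda>\<omega>. wl2 jb (fcoeff (x s \<omega>))) \<in> borel_measurable M" "(\<lambda>\<omega>. wl2 jb (fcoeff (z s \<omega> - z a \<omega>))) \<in> borel_measurable M"
      by (rule measurable_wl2[OF measurable_fcoeff[OF x_measurable[OF sT]]],
          rule measurable_wl2[OF measurable_fcoeff[OF measurable_l2_diff(1)[OF z_measurable[OF sT] z_measurable[OF aT]]]])
    then show ?thesis by (rule nn_integral_cmult_add)
  qed
  also have "\<dots> \<le> ennreal ?\<alpha> * ennreal CX + ennreal ?\<beta> * ennreal ((s - a) * cq)"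
    using ac s by (intro add_mono mult_left_mono x_moment sT) (auto simp: z_moment)
  also have "\<dots> = ennreal (?\<alpha> * CX + ?\<beta> * ((s - a) * cq))"
    using nn CX_nonneg cq_nonneg s by (simp only: ennreal_mult ennreal_plus mult_nonneg_nonneg diff_ge_0_iff_ge atLeastAtMost_iff)
  also have "\<dots> \<le> ennreal ((c - a) * CG)"
  proof (rule ennreal_leI)
    have "(c - a) * (c - a) \<le> (c - a) * T" using ac by (intro mult_left_mono) auto
    then have 1: "cjb * LF * ((c - a) * (c - a)) * CX \<le> cjb * LF * ((c - a) * T) * CX"
      by (intro mult_right_mono mult_left_mono[of "(c - a) * (c - a)"] mult_nonneg_nonneg cjb_nonneg LF_nonneg CX_nonneg)
    have 2: "cjb * KP\<^sup>2 * ((s - a) * cq) \<le> cjb * KP\<^sup>2 * ((c - a) * cq)"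
      using s by (intro mult_right_mono mult_left_mono mult_nonneg_nonneg cjb_nonneg cq_nonneg) auto
    have poly1: "(4 * (4 * u * (l * h\<^sup>2)) + 2 * (4 * m * (h * (n * (4 * u * k))))) * X + 4 * (4 * u * k) * w
        = 16 * (u * l * (h * h) * X) + h * (32 * m * n * u * k) * X + 16 * (u * k * w)" for u l h m n k X w :: real
      by (simp add: power2_eq_square algebra_simps)
    have poly2: "16 * (u * l * (h * t) * X) + h * (32 * m * n * u * k) * X + 16 * (u * k * (h * w))
        = h * ((16 * u * l * t + 32 * m * n * u * k) * X + 16 * u * k * w)" for u l h m n k t X w :: real
      by (simp add: algebra_simps)
    have "?\<alpha> * CX + ?\<beta> * ((s - a) * cq) = 16 * (cjb * LF * ((c - a) * (c - a)) * CX) + (c - a) * (32 * \<mu>\<^sup>2 * KN\<^sup>2 * cjb * KP\<^sup>2) * CX + 16 * (cjb * KP\<^sup>2 * ((s - a) * cq))"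
      by (rule poly1)
    also have "\<dots> \<le> 16 * (cjb * LF * ((c - a) * T) * CX) + (c - a) * (32 * \<mu>\<^sup>2 * KN\<^sup>2 * cjb * KP\<^sup>2) * CX + 16 * (cjb * KP\<^sup>2 * ((c - a) * cq))"
      using 1 2 by linarith
    also have "\<dots> = (c - a) * CG" unfolding CG_def by (rule poly2)
    finally show "?\<alpha> * CX + ?\<beta> * ((s - a) * cq) \<le> (c - a) * CG" .
  qed
  finally show ?thesis .
qed

text \<open>The defect of the exact solution in the scheme with \<open>\<psi>(a)\<close> replaced by an approximation \<open>p\<close>.\<close>

definition defect :: "real \<Rightarrow> real \<Rightarrow> l2_torus \<Rightarrow> 'w \<Rightarrow> int \<Rightarrow> complex" where
  "defect a c p \<omega> k = fcoeff (x c \<omega> - x a \<omega> - (z c \<omega> - z a \<omega>)) k - 2 * of_real \<mu> * BB a c p (x a \<omega>) k"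

lemma defect_measurable:
  assumes ac: "0 \<le> a" "a \<le> c" "c \<le> T" and p: "fcoeff p 0 = 0" "nl1 (fcoeff p) < \<infinity>"
  shows "(\<lambda>\<omega>. defect a c p \<omega> k) \<in> borel_measurable M"
proof -
  have aT: "a \<in> {0..T}" and cT: "c \<in> {0..T}" using ac by auto
  show ?thesis unfolding defect_def
    by (intro borel_measurable_diff borel_measurable_times borel_measurable_const measurable_fcoeff measurable_l2_diff x_measurable z_measurable
        aT cT BB_measurable ac p x_zero_mean)
qed

text \<open>Two powers of the length come from squaring the integral over time, the third from
  \<open>GG_moment\<close>.\<close>

lemma defect_f_moment:
  assumes ac: "0 \<le> a" "a \<le> c" "c \<le> T"
  shows "(\<integral>\<^sup>+\<omega>. nl2 (defect a c (f a) \<omega>) \<partial>M) \<le> ennreal (4 * \<mu>\<^sup>2 * ((c - a) ^ 3 * CG))"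
proof -
  have "(\<integral>\<^sup>+\<omega>. nl2 (defect a c (f a) \<omega>) \<partial>M) = (\<integral>\<^sup>+\<omega>. ennreal (4 * \<mu>\<^sup>2) * nl2 (\<lambda>k. integral {a..c} (\<lambda>s. GG a c k s \<omega>)) \<partial>M)"
  proof (rule nn_integral_cong_AE, rule eventually_mono[OF AE_good])
    fix \<omega> assume g: "good \<omega>"
    have "defect a c (f a) \<omega> = (\<lambda>k. 2 * of_real \<mu> * integral {a..c} (\<lambda>s. GG a c k s \<omega>))"
      by (rule ext) (simp only: defect_def GG_integral(1)[OF g ac])
    then show "nl2 (defect a c (f a) \<omega>) = ennreal (4 * \<mu>\<^sup>2) * nl2 (\<lambda>k. integral {a..c} (\<lambda>s. GG a c k s \<omega>))"
      by (simp only: wl2_scale) (simp add: norm_mult power_mult_distrib)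
  qed
  also have "\<dots> = ennreal (4 * \<mu>\<^sup>2) * (\<integral>\<^sup>+\<omega>. nl2 (\<lambda>k. integral {a..c} (\<lambda>s. GG a c k s \<omega>)) \<partial>M)"
  proof (rule nn_integral_cmult, rule measurable_wl2)
    fix k
    have "(\<lambda>\<omega>. defect a c (f a) \<omega> k / (2 * of_real \<mu>)) \<in> borel_measurable M"
      using ac by (intro borel_measurable_divide borel_measurable_const defect_measurable f_zero_mean f_nl1) auto
    then show "(\<lambda>\<omega>. integral {a..c} (\<lambda>s. GG a c k s \<omega>)) \<in> borel_measurable M"
    proof (rule AE_eq_measurable, intro eventually_mono[OF AE_good])
      fix \<omega> assume g: "good \<omega>"
      show "integral {a..c} (\<lambda>s. GG a c k s \<omega>) = defect a c (f a) \<omega> k / (2 * of_real \<mu>)"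
        unfolding defect_def GG_integral(1)[OF g ac] using \<mu> by simp
    qed
  qed
  also have "\<dots> \<le> ennreal (4 * \<mu>\<^sup>2) * (ennreal ((c - a)\<^sup>2) * ennreal ((c - a) * CG))"
  proof (intro mult_left_mono nn_integral_wl2_integral_le[OF ac(2)] GG_measurable[OF ac] GG_moment[OF ac])
    show "AE \<omega> in M. continuous_on {a..c} (\<lambda>s. GG a c k s \<omega>)" for k by (rule eventually_mono[OF AE_good GG_integral(2)[OF _ ac]])
  qed auto
  also have "\<dots> = ennreal (4 * \<mu>\<^sup>2 * ((c - a)\<^sup>2 * ((c - a) * CG)))"
    using ac CG_nonneg by (simp only: ennreal_mult mult_nonneg_nonneg zero_le_power2 zero_le_numeral diff_ge_0_iff_ge)
  also have "(c - a)\<^sup>2 * ((c - a) * CG) = (c - a) ^ 3 * CG" by (simp add: power2_eq_square power3_eq_cube)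
  finally show ?thesis .
qed

text \<open>Replacing \<open>f a\<close> by \<open>p\<close> adds the bilinear step of their
  difference. The difference is measured in \<open>L\<^sup>2\<close> and \<open>x a\<close> by
  absolute sums, which its \<open>H\<^sup>1\<close> moment controls; the gain is one power of the
  length.\<close>

lemma defect_moment:
  assumes ac: "0 \<le> a" "a \<le> c" "c \<le> T" and p: "fcoeff p 0 = 0" "nl1 (fcoeff p) < \<infinity>" and D: "norm (f a - p) \<le> D"
  shows "(\<integral>\<^sup>+\<omega>. nl2 (defect a c p \<omega>) \<partial>M) \<le> ennreal (8 * \<mu>\<^sup>2 * ((c - a) ^ 3 * CG + (c - a) * (D\<^sup>2 * (cjb * CX))))"
proof -
  have aT: "a \<in> {0..T}" using ac by auto
  let ?B = "\<lambda>\<omega>. BB a c (f a - p) (x a \<omega>)"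
  have fp: "fcoeff (f a - p) 0 = 0" by (simp add: fcoeff_diff p f_zero_mean[OF aT])
  have m1: "(\<lambda>\<omega>. nl2 (defect a c (f a) \<omega>)) \<in> borel_measurable M"
    by (rule measurable_wl2[OF defect_measurable[OF ac f_zero_mean[OF aT] f_nl1[OF aT]]])
  have m2: "(\<lambda>\<omega>. nl2 (?B \<omega>)) \<in> borel_measurable M" unfolding BB_linear
    by (intro measurable_wl2 borel_measurable_diff BB_measurable[OF ac(2)] f_zero_mean f_nl1 aT p x_measurable x_zero_mean)
  have le: "nl2 (defect a c p \<omega>) \<le> 2 * nl2 (defect a c (f a) \<omega>) + ennreal (8 * \<mu>\<^sup>2) * nl2 (?B \<omega>)" for \<omega>
  proof -
    have "defect a c p \<omega> = (\<lambda>k. defect a c (f a) \<omega> k + 2 * of_real \<mu> * ?B \<omega> k)"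
      by (rule ext) (simp add: defect_def BB_linear algebra_simps)
    then have "nl2 (defect a c p \<omega>) \<le> 2 * (nl2 (defect a c (f a) \<omega>) + nl2 (\<lambda>k. 2 * of_real \<mu> * ?B \<omega> k))"
      by (simp only:) (rule wl2_add_le, simp)
    also have "nl2 (\<lambda>k. 2 * of_real \<mu> * ?B \<omega> k) = ennreal (4 * \<mu>\<^sup>2) * nl2 (?B \<omega>)"
      unfolding wl2_scale by (simp add: norm_mult power_mult_distrib)
    also have "2 * (nl2 (defect a c (f a) \<omega>) + ennreal (4 * \<mu>\<^sup>2) * nl2 (?B \<omega>)) = 2 * nl2 (defect a c (f a) \<omega>) + ennreal (8 * \<mu>\<^sup>2) * nl2 (?B \<omega>)"
    proof -
      have "ennreal (8 * \<mu>\<^sup>2) = 2 * ennreal (4 * \<mu>\<^sup>2)" using ennreal_mult'[of 2 "4 * \<mu>\<^sup>2"] by simp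
      then show ?thesis by (simp only: distrib_left mult.assoc)
    qed
    finally show ?thesis .
  qed
  have B: "(\<integral>\<^sup>+\<omega>. nl2 (?B \<omega>) \<partial>M) \<le> ennreal ((c - a) * (D\<^sup>2 * (cjb * CX)))"
  proof -
    have "(\<integral>\<^sup>+\<omega>. nl2 (?B \<omega>) \<partial>M) \<le> (\<integral>\<^sup>+\<omega>. ennreal ((c - a) * (D\<^sup>2 * cjb)) * wl2 jb (fcoeff (x a \<omega>)) \<partial>M)"
    proof (rule nn_integral_mono_AE, rule eventually_mono[OF x_zero_mean[OF aT]])
      fix \<omega> assume x0: "fcoeff (x a \<omega>) 0 = 0"
      have "nl2 (?B \<omega>) \<le> ennreal (c - a) * (nl2 (fcoeff (f a - p)) * (nl1 (fcoeff (x a \<omega>)))\<^sup>2)"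
        by (rule nl2_BB_le(2)[OF ac(2) fp x0])
      also have "\<dots> \<le> ennreal (c - a) * (ennreal (D\<^sup>2) * (ennreal cjb * wl2 jb (fcoeff (x a \<omega>))))"
        unfolding nl2_fcoeff Cjb_eq[symmetric] using D by (intro mult_left_mono mult_mono ennreal_leI power_mono nl1_sq_le) auto
      also have "\<dots> = ennreal ((c - a) * (D\<^sup>2 * cjb)) * wl2 jb (fcoeff (x a \<omega>))"
        using ac cjb_nonneg by (simp add: ennreal_mult mult.assoc)
      finally show "nl2 (?B \<omega>) \<le> ennreal ((c - a) * (D\<^sup>2 * cjb)) * wl2 jb (fcoeff (x a \<omega>))" .
    qed
    also have "\<dots> = ennreal ((c - a) * (D\<^sup>2 * cjb)) * mh1 M (\<lambda>\<omega>. x a \<omega>)"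
      by (rule nn_integral_cmult[OF measurable_wl2[OF measurable_fcoeff[OF x_measurable[OF aT]]]])
    also have "\<dots> \<le> ennreal ((c - a) * (D\<^sup>2 * cjb)) * ennreal CX" by (intro mult_left_mono x_moment aT) auto
    also have "\<dots> = ennreal ((c - a) * (D\<^sup>2 * (cjb * CX)))"
      using ac cjb_nonneg CX_nonneg by (subst ennreal_mult[symmetric]) (auto simp: mult.assoc)
    finally show ?thesis .
  qed
  have "(\<integral>\<^sup>+\<omega>. nl2 (defect a c p \<omega>) \<partial>M) \<le> (\<integral>\<^sup>+\<omega>. 2 * nl2 (defect a c (f a) \<omega>) + ennreal (8 * \<mu>\<^sup>2) * nl2 (?B \<omega>) \<partial>M)"
    by (intro nn_integral_mono le)
  also have "\<dots> = 2 * (\<integral>\<^sup>+\<omega>. nl2 (defect a c (f a) \<omega>) \<partial>M) + ennreal (8 * \<mu>\<^sup>2) * (\<integral>\<^sup>+\<omega>. nl2 (?B \<omega>) \<partial>M)"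
    by (rule nn_integral_cmult_add[OF m1 m2])
  also have "\<dots> \<le> ennreal 2 * ennreal (4 * \<mu>\<^sup>2 * ((c - a) ^ 3 * CG)) + ennreal (8 * \<mu>\<^sup>2) * ennreal ((c - a) * (D\<^sup>2 * (cjb * CX)))"
    unfolding ennreal_numeral by (intro add_mono mult_left_mono defect_f_moment[OF ac] B) auto
  also have "\<dots> = ennreal (2 * (4 * \<mu>\<^sup>2 * ((c - a) ^ 3 * CG)) + 8 * \<mu>\<^sup>2 * ((c - a) * (D\<^sup>2 * (cjb * CX))))"
    using ac cjb_nonneg CX_nonneg CG_nonneg
    by (simp only: ennreal_mult ennreal_plus mult_nonneg_nonneg zero_le_power zero_le_power2 zero_le_numeral diff_ge_0_iff_ge)
  also have "2 * (4 * \<mu>\<^sup>2 * ((c - a) ^ 3 * CG)) + 8 * \<mu>\<^sup>2 * ((c - a) * (D\<^sup>2 * (cjb * CX))) = 8 * \<mu>\<^sup>2 * ((c - a) ^ 3 * CG + (c - a) * (D\<^sup>2 * (cjb * CX)))"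
    by (simp add: distrib_left)
  finally show ?thesis .
qed

text \<open>The scheme is given by almost sure identities, so each step uses a bounded linear map,
  the measurable integral and completeness of the measure.\<close>

lemma scheme_measurable:
  assumes sch: "fluctuation_scheme M \<beta> e \<mu> Qh \<tau> N p X"
  shows "n \<le> N \<Longrightarrow> X n \<in> borel_measurable M"
proof (induction n)
  case 0
  have "AE \<omega> in M. X 0 \<omega> = 0" using sch by (simp add: fluctuation_scheme_def)
  then show ?case by (rule AE_eq_measurable[OF borel_measurable_const])
next
  case (Suc n)
  then have "n < N" by simp
  then obtain J where J: "has_stoch_integral M \<beta> e (real n * \<tau>) (real (Suc n) * \<tau>) (\<lambda>s. airy (real (Suc n) * \<tau> - s) \<circ> Qh) J"
    and eq: "AE \<omega> in M. X (Suc n) \<omega> = airy \<tau> (X n \<omega>)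
           + (2 * \<mu> / 3) *\<^sub>R (airy \<tau> (Dx_inv (p n)) \<odot> airy \<tau> (Dx_inv (X n \<omega>)))
           - (2 * \<mu> / 3) *\<^sub>R airy \<tau> (Dx_inv (p n) \<odot> Dx_inv (X n \<omega>)) + J \<omega>" using sch unfolding fluctuation_scheme_def by blast
  have Xn: "X n \<in> borel_measurable M" using Suc by simp
  have Jm: "J \<in> borel_measurable M" using J by (simp add: has_stoch_integral_def)
  have bl: "bounded_linear (\<lambda>v. airy \<tau> v + (2 * \<mu> / 3) *\<^sub>R NL \<tau> (p n) v)"
    by (intro bounded_linear_add bounded_linear_const_scaleR bounded_linear_airy bounded_linear_NL)
  show ?case by (rule AE_eq_measurable[OF measurable_l2_diff(2)[OF measurable_bounded_linear[OF bl Xn] Jm]])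
       (rule eventually_mono[OF eq], simp add: NL_def scaleR_diff_right)
qed

text \<open>In the moving frame the linear propagation disappears, \<open>fcoeff_NL\<close> turns
  the bracket into \<open>BB\<close>, and uniqueness of the noise replaces the stochastic integral
  by an increment of \<open>z\<close>. The scheme now has the same form as the exact
  solution.\<close>

lemma scheme_recursion:
  assumes sch: "fluctuation_scheme M \<beta> e \<mu> Qh \<tau> N p X" and \<tau>: "0 \<le> \<tau>" "real N * \<tau> \<le> T"
    and p0: "\<forall>n\<le>N. fcoeff (p n) 0 = 0" and n: "n < N" and X0: "AE \<omega> in M. fcoeff (X n \<omega>) 0 = 0"
  shows "AE \<omega> in M. \<forall>k. fcoeff (airy (- (real (Suc n) * \<tau>)) (X (Suc n) \<omega>)) k
    = fcoeff (airy (- (real n * \<tau>)) (X n \<omega>)) k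
      + 2 * of_real \<mu> * BB (real n * \<tau>) (real (Suc n) * \<tau>) (airy (- (real n * \<tau>)) (p n)) (airy (- (real n * \<tau>)) (X n \<omega>)) k
      + fcoeff (z (real (Suc n) * \<tau>) \<omega> - z (real n * \<tau>) \<omega>) k"
proof -
  let ?a = "real n * \<tau>" and ?c = "real (Suc n) * \<tau>"
  note g = grid_lt[OF \<tau> n]
  have cT: "?c \<le> T" using g(2) by simp
  have ca: "?c = ?a + \<tau>" by (simp add: algebra_simps)
  obtain J where J: "has_stoch_integral M \<beta> e ?a ?c (\<lambda>s. airy (?c - s) \<circ> Qh) J"
    and eq: "AE \<omega> in M. X (Suc n) \<omega> = airy \<tau> (X n \<omega>)
           + (2 * \<mu> / 3) *\<^sub>R (airy \<tau> (Dx_inv (p n)) \<odot> airy \<tau> (Dx_inv (X n \<omega>)))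
           - (2 * \<mu> / 3) *\<^sub>R airy \<tau> (Dx_inv (p n) \<odot> Dx_inv (X n \<omega>)) + J \<omega>" using sch n unfolding fluctuation_scheme_def by blast
  have noise: "AE \<omega> in M. airy (- ?c) (J \<omega>) = z ?c \<omega> - z ?a \<omega>"
    by (rule twisted_noise_unique[OF twisted_noise_stoch_integral[OF J g(4)] z_increment_noise[OF g(4) g(3) cT]])
  show ?thesis using eq noise X0
  proof eventually_elim
    case (elim \<omega>)
    have X: "X (Suc n) \<omega> = airy \<tau> (X n \<omega>) + (2 * \<mu> / 3) *\<^sub>R NL \<tau> (p n) (X n \<omega>) + J \<omega>"
      using elim(1) by (simp add: NL_def scaleR_diff_right)
    have "airy (- ?c) (X (Suc n) \<omega>) = airy (- ?a) (X n \<omega>) + (2 * \<mu> / 3) *\<^sub>R airy (- ?c) (NL \<tau> (p n) (X n \<omega>)) + (z ?c \<omega> - z ?a \<omega>)"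
    proof -
      have "- ?c + \<tau> = - ?a" unfolding ca by simp
      then show ?thesis unfolding X airy_add airy_scaleR airy_airy elim(2) by simp
    qed
    moreover have "fcoeff (airy (- ?c) (NL \<tau> (p n) (X n \<omega>))) k = 3 * BB ?a ?c (airy (- ?a) (p n)) (airy (- ?a) (X n \<omega>)) k" for k
      unfolding ca using n p0 by (intro fcoeff_NL \<tau> elim) simp
    ultimately show ?case by (simp add: fcoeff_add fcoeff_scaleR del: of_nat_Suc)
  qed
qed

lemma scheme_zero_mean:
  assumes sch: "fluctuation_scheme M \<beta> e \<mu> Qh \<tau> N p X" and \<tau>: "0 \<le> \<tau>" "real N * \<tau> \<le> T"
    and p0: "\<forall>n\<le>N. fcoeff (p n) 0 = 0"
  shows "n \<le> N \<Longrightarrow> AE \<omega> in M. fcoeff (X n \<omega>) 0 = 0"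
proof (induction n)
  case 0
  have "AE \<omega> in M. X 0 \<omega> = 0" using sch by (simp add: fluctuation_scheme_def)
  then show ?case by eventually_elim (simp add: fcoeff_0)
next
  case (Suc n)
  then have n: "n < N" and X0: "AE \<omega> in M. fcoeff (X n \<omega>) 0 = 0" by auto
  note g = grid_lt[OF \<tau> n]
  have cT: "real (Suc n) * \<tau> \<le> T" using g(2) by simp
  have "AE \<omega> in M. fcoeff (z (real (Suc n) * \<tau>) \<omega> - z (real n * \<tau>) \<omega>) 0 = 0"
    by (rule twisted_noise_zero_mean[OF z_increment_noise[OF g(4) g(3) cT] g(3)])
  with X0 scheme_recursion[OF sch \<tau> p0 n X0] show ?case
  proof eventually_elim
    case (elim \<omega>)
    from spec[OF elim(2), of 0] show ?case unfolding elim(3) BB_zero_mode by (simp add: fcoeff_airy elim(1))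
  qed
qed

end

lemma nl1w_airy: "nl1w (fcoeff (airy s u)) = nl1w (fcoeff u)" by (simp add: nl1w_def)

text \<open>Integrability is concluded as well, because the integral in \<open>L2_Omega_norm\<close>
  is 0 by convention where it fails.\<close>

lemma L2_Omega_norm_le:
  assumes Y: "Y \<in> borel_measurable M" and le: "msq M Y \<le> ennreal (r\<^sup>2)" and r: "0 \<le> r"
  shows "in_L2_Omega M Y" "L2_Omega_norm M Y \<le> r"
proof -
  have m: "(\<lambda>\<omega>. (norm (Y \<omega>))\<^sup>2) \<in> borel_measurable M"
    using measurable_compose[OF Y borel_measurable_norm] by (intro borel_measurable_power) simp
  have "integrable M (\<lambda>\<omega>. (norm (Y \<omega>))\<^sup>2)" by (rule integrableI_bounded[OF m]) (use le in \<open>simp add: le_less_trans\<close>)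
  then show "in_L2_Omega M Y" using Y by (simp add: in_L2_Omega_def)
  have "(\<integral>\<omega>. (norm (Y \<omega>))\<^sup>2 \<partial>M) = enn2real (msq M Y)" by (rule integral_eq_nn_integral[OF m]) simp
  also have "\<dots> \<le> r\<^sup>2" by (rule enn2real_leI[OF _ le]) simp
  finally show "L2_Omega_norm M Y \<le> r" unfolding L2_Omega_norm_def using r by (simp add: real_le_lsqrt)
qed

section \<open>The global error\<close>

context kdv_fluct begin

text \<open>The noise cancels in the difference, and the error obeys the stable step with
  \<open>defect\<close> as its source. The division by \<tau> beside \<open>D\<^sup>2\<close> is the
  price of Young's inequality.\<close>

lemma scheme_error:
  assumes sch: "fluctuation_scheme M \<beta> e \<mu> Qh \<tau> N p X" and \<tau>: "0 < \<tau>" "real N * \<tau> \<le> T"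
    and p0: "\<forall>n\<le>N. fcoeff (p n) 0 = 0" and K: "\<forall>n\<le>N. nl1w (fcoeff (p n)) \<le> ennreal K" "0 \<le> K"
    and D: "\<forall>n\<le>N. norm (\<psi> (real n * \<tau>) - p n) \<le> D"
    and C: "C = 1 + (4 * \<mu> * K + 4 * \<mu>\<^sup>2 * K\<^sup>2) * (1 + T)" and n: "n \<le> N"
  shows "msq M (\<lambda>\<omega>. chi (real n * \<tau>) \<omega> - X n \<omega>)
    \<le> ennreal (exp (C * T) * T * ((1 + T) * (8 * \<mu>\<^sup>2 * (\<tau> * CG + D\<^sup>2 / \<tau> * (cjb * CX)))))"
proof -
  \<comment> \<open>The error in the moving frame; the Airy group is isometric, so its norm is that
    of the error itself.\<close>
  define E where "E n \<omega> = x (real n * \<tau>) \<omega> - airy (- (real n * \<tau>)) (X n \<omega>)" for n \<omega>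
  have C0: "0 \<le> C" unfolding C using K(2) \<mu> T by simp
  let ?d = "8 * \<mu>\<^sup>2 * (\<tau> ^ 3 * CG + \<tau> * (D\<^sup>2 * (cjb * CX)))" and ?D = "8 * \<mu>\<^sup>2 * (\<tau> * CG + D\<^sup>2 / \<tau> * (cjb * CX))"
  have d0: "0 \<le> ?d" "0 \<le> ?D" using \<tau>(1) cjb_nonneg CX_nonneg CG_nonneg by auto
  note gr = grid_lt[OF less_imp_le[OF \<tau>(1)] \<tau>(2)]
  have "(\<integral>\<^sup>+\<omega>. nl2 (fcoeff (E n \<omega>)) \<partial>M) \<le> ennreal (exp (C * (real n * \<tau>)) * (real n * \<tau>)) * ennreal ((1 + T) * ?D)"
  proof (rule ennreal_gronwall[where N = N])
    have "AE \<omega> in M. X 0 \<omega> = 0" using sch by (simp add: fluctuation_scheme_def)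
    with AE_good have "AE \<omega> in M. nl2 (fcoeff (E 0 \<omega>)) = 0" by eventually_elim (simp add: E_def x_0 airy_0 nl2_fcoeff)
    then have "(\<integral>\<^sup>+\<omega>. nl2 (fcoeff (E 0 \<omega>)) \<partial>M) = (\<integral>\<^sup>+\<omega>. 0 \<partial>M)" by (rule nn_integral_cong_AE)
    then show "(\<integral>\<^sup>+\<omega>. nl2 (fcoeff (E 0 \<omega>)) \<partial>M) = 0" by simp
    fix n assume n: "n < N"
    note G = gr[OF n]
    have nN: "n \<le> N" using n by simp
    have cT: "real (Suc n) * \<tau> \<le> T" using G(2) by simp
    let ?a = "real n * \<tau>" and ?c = "real (Suc n) * \<tau>" and ?q = "airy (- (real n * \<tau>)) (p n)"
    have q0: "fcoeff ?q 0 = 0" using p0 nN by (simp add: fcoeff_airy)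
    have qK: "nl1w (fcoeff ?q) \<le> ennreal K" using K nN by (simp add: nl1w_airy)
    have q1: "nl1 (fcoeff ?q) < \<infinity>" using order_trans[OF nl1_le_nl1w qK] by (simp add: le_less_trans)
    have qD: "norm (f ?a - ?q) \<le> D" using D nN unfolding f_def airy_diff[symmetric] norm_airy by simp
    have hT: "\<tau> \<le> T" using G(2) G(4) G(5) unfolding atLeastAtMost_iff by linarith
    have X0: "AE \<omega> in M. fcoeff (X n \<omega>) 0 = 0" by (rule scheme_zero_mean[OF sch less_imp_le[OF \<tau>(1)] \<tau>(2) p0 nN])
    have Em: "E n \<in> borel_measurable M" unfolding E_def
      by (rule measurable_l2_diff(1)[OF x_measurable[OF G(1)] measurable_bounded_linear[OF bounded_linear_airy scheme_measurable[OF sch nN]]])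
    have "AE \<omega> in M. nl2 (fcoeff (E (Suc n) \<omega>))
      \<le> ennreal (1 + C * \<tau>) * nl2 (fcoeff (E n \<omega>)) + (ennreal \<tau> * ennreal ((1 + T) / \<tau>\<^sup>2)) * nl2 (defect ?a ?c ?q \<omega>)"
      using scheme_recursion[OF sch less_imp_le[OF \<tau>(1)] \<tau>(2) p0 n X0] x_zero_mean[OF G(1)] X0
    proof eventually_elim
      case (elim \<omega>)
      have E0: "fcoeff (E n \<omega>) 0 = 0" by (simp add: E_def fcoeff_diff fcoeff_airy elim)
      have "fcoeff (E (Suc n) \<omega>) = (\<lambda>k. (fcoeff (E n \<omega>) k + 2 * of_real \<mu> * BB ?a ?c ?q (E n \<omega>) k) + defect ?a ?c ?q \<omega> k)"
      proof
        fix k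
        show "fcoeff (E (Suc n) \<omega>) k = (fcoeff (E n \<omega>) k + 2 * of_real \<mu> * BB ?a ?c ?q (E n \<omega>) k) + defect ?a ?c ?q \<omega> k"
          unfolding E_def defect_def fcoeff_diff BB_linear spec[OF elim(1), of k] by (simp add: algebra_simps del: of_nat_Suc)
      qed
      then show ?case
        using perturbed_step_le[where a = ?a and c = ?c and T = T and g = ?q and K = K and \<mu> = \<mu> and C = C and v = "E n \<omega>" and d = "defect ?a ?c ?q \<omega>",
          unfolded G(5), OF \<tau>(1) hT q0 E0 qK K(2) less_imp_le[OF \<mu>] C] by (simp only: mult.assoc)
    qed
    then have "(\<integral>\<^sup>+\<omega>. nl2 (fcoeff (E (Suc n) \<omega>)) \<partial>M)
      \<le> (\<integral>\<^sup>+\<omega>. ennreal (1 + C * \<tau>) * nl2 (fcoeff (E n \<omega>)) + (ennreal \<tau> * ennreal ((1 + T) / \<tau>\<^sup>2)) * nl2 (defect ?a ?c ?q \<omega>) \<partial>M)"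
      by (rule nn_integral_mono_AE)
    also have "\<dots> = ennreal (1 + C * \<tau>) * (\<integral>\<^sup>+\<omega>. nl2 (fcoeff (E n \<omega>)) \<partial>M) + (ennreal \<tau> * ennreal ((1 + T) / \<tau>\<^sup>2)) * (\<integral>\<^sup>+\<omega>. nl2 (defect ?a ?c ?q \<omega>) \<partial>M)"
      by (rule nn_integral_cmult_add[OF measurable_wl2[OF measurable_fcoeff[OF Em]] measurable_wl2[OF defect_measurable[OF G(4) G(3) cT q0 q1]]])
    also have "\<dots> \<le> ennreal (1 + C * \<tau>) * (\<integral>\<^sup>+\<omega>. nl2 (fcoeff (E n \<omega>)) \<partial>M) + (ennreal \<tau> * ennreal ((1 + T) / \<tau>\<^sup>2)) * ennreal ?d"
      using defect_moment[OF G(4) G(3) cT q0 q1 qD] unfolding G(5) by (intro add_left_mono mult_left_mono) auto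
    also have "(ennreal \<tau> * ennreal ((1 + T) / \<tau>\<^sup>2)) * ennreal ?d = ennreal \<tau> * ennreal ((1 + T) * ?D)"
    proof -
      \<comment> \<open>Of the three powers of \<tau> in the consistency part of the defect one
        survives, and the single power beside \<open>D\<^sup>2\<close> becomes
        \<open>1 / \<tau>\<close>.\<close>
      have "(1 + T) / \<tau>\<^sup>2 * ?d = (1 + T) * ?D" using \<tau>(1) by (simp add: field_simps power2_eq_square power3_eq_cube)
      then have "ennreal ((1 + T) / \<tau>\<^sup>2) * ennreal ?d = ennreal ((1 + T) * ?D)"
        using T d0(1) by (metis add_nonneg_nonneg divide_nonneg_nonneg ennreal_mult less_imp_le zero_le_one zero_le_power2)
      then show ?thesis by (simp only: mult.assoc)
    qed
    finally show "(\<integral>\<^sup>+\<omega>. nl2 (fcoeff (E (Suc n) \<omega>)) \<partial>M) \<le> ennreal (1 + C * \<tau>) * (\<integral>\<^sup>+\<omega>. nl2 (fcoeff (E n \<omega>)) \<partial>M) + ennreal \<tau> * ennreal ((1 + T) * ?D)" .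
  qed (use C0 \<tau> n in auto)
  also have "\<dots> \<le> ennreal (exp (C * T) * T) * ennreal ((1 + T) * ?D)"
  proof (intro mult_right_mono ennreal_leI mult_mono)
    have "real n * \<tau> \<le> real N * \<tau>" using n \<tau> by (intro mult_right_mono) auto
    then show "real n * \<tau> \<le> T" using \<tau> by linarith
    then show "exp (C * (real n * \<tau>)) \<le> exp (C * T)" using C0 by (simp add: mult_left_mono)
  qed (use \<tau> in auto)
  also have "\<dots> = ennreal (exp (C * T) * T * ((1 + T) * ?D))"
    using T by (intro ennreal_mult[symmetric] mult_nonneg_nonneg[OF _ d0(2)]) auto
  finally show ?thesis unfolding E_def x_def airy_diff[symmetric] nl2_fcoeff norm_airy .
qed

end

theorem theorem5p6:
  fixes T \<mu> \<tau>\<^sub>0 b :: real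
    and M :: "'w measure" and F :: "real \<Rightarrow> 'w measure"
    and \<beta> :: "nat \<Rightarrow> real \<Rightarrow> 'w \<Rightarrow> real" and e :: "nat \<Rightarrow> l2_torus"
    and Q Qh :: "l2_torus \<Rightarrow> l2_torus" and \<xi> :: l2_torus
    and \<psi> :: "real \<Rightarrow> l2_torus" and chi :: "real \<Rightarrow> 'w \<Rightarrow> l2_torus"
    and psi_n :: "nat \<Rightarrow> nat \<Rightarrow> l2_torus" and chi_n :: "nat \<Rightarrow> nat \<Rightarrow> 'w \<Rightarrow> l2_torus"
  assumes "T > 0" and "\<mu> > 0"
    and "complete_filtered_prob_space M F" and "cylindrical_wiener M F \<beta> e"
    and "nonneg_selfadjoint Q" and "is_op_sqrt Qh Q"
    and "hilbert_schmidt 1 Qh" and "in_H 2 \<xi>"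
    and "fcoeff \<xi> 0 = 0" and "Qh l2_one = 0"
    and "kdv_solution T \<mu> \<xi> \<psi>"
    and "fluctuation_solution M \<beta> e T \<mu> Qh \<psi> chi"
    and "\<tau>\<^sub>0 > 0" and "1/2 < b" and "b \<le> 1"
    and zero_mean: "\<And>N n. N > 0 \<Longrightarrow> T / real N < \<tau>\<^sub>0 \<Longrightarrow> n \<le> N \<Longrightarrow> fcoeff (psi_n N n) 0 = 0"
    and Linf: "\<exists>K. \<forall>N>0. T / real N < \<tau>\<^sub>0 \<longrightarrow>
      (\<forall>n\<le>N. in_H 1 (psi_n N n) \<and> Linf_le (abs_deriv 1 (psi_n N n)) K)"
    and approx: "\<exists>C'. \<forall>N>0. T / real N < \<tau>\<^sub>0 \<longrightarrow>
      (MAX n\<in>{0..N}. norm (\<psi> (real n * (T / real N)) - psi_n N n)) \<le> C' * (T / real N) powr b"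
    and scheme: "\<And>N. N > 0 \<Longrightarrow> T / real N < \<tau>\<^sub>0 \<Longrightarrow>
      fluctuation_scheme M \<beta> e \<mu> Qh (T / real N) N (psi_n N) (chi_n N)"
  shows "\<exists>C. \<forall>N>0. T / real N < \<tau>\<^sub>0 \<longrightarrow>
      (\<forall>n\<le>N. in_L2_Omega M (\<lambda>\<omega>. chi (real n * (T / real N)) \<omega> - chi_n N n \<omega>)) \<and>
      (MAX n\<in>{0..N}. L2_Omega_norm M (\<lambda>\<omega>. chi (real n * (T / real N)) \<omega> - chi_n N n \<omega>))
        \<le> C * (T / real N) powr (min (1/2) (b - 1/2))"
proof -
  interpret prob_space M using assms(3) by (simp add: complete_filtered_prob_space_def)
  interpret kdv_fluct M F \<beta> e Qh T \<mu> \<xi> \<psi> chi by unfold_locales (use assms in \<open>simp_all add: is_op_sqrt_def\<close>)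
  obtain L where L: "\<And>N n. N > 0 \<Longrightarrow> T / real N < \<tau>\<^sub>0 \<Longrightarrow> n \<le> N \<Longrightarrow> in_H 1 (psi_n N n)"
    "\<And>N n. N > 0 \<Longrightarrow> T / real N < \<tau>\<^sub>0 \<Longrightarrow> n \<le> N \<Longrightarrow> Linf_le (abs_deriv 1 (psi_n N n)) L" using Linf by blast
  obtain C' where C': "\<And>N. N > 0 \<Longrightarrow> T / real N < \<tau>\<^sub>0 \<Longrightarrow>
      (MAX n\<in>{0..N}. norm (\<psi> (real n * (T / real N)) - psi_n N n)) \<le> C' * (T / real N) powr b" using approx by blast
  \<comment> \<open>The factor is that of \<open>nl1w_le_of_Linf_abs_deriv\<close>; the absolute
    value makes \<open>K\<close> nonnegative before any step size is chosen.\<close>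
  define K where "K = 4 * sqrt (2 * pi) * \<bar>L\<bar>"
  define CK where "CK = 1 + (4 * \<mu> * K + 4 * \<mu>\<^sup>2 * K\<^sup>2) * (1 + T)"
  define A where "A = exp (CK * T) * T * ((1 + T) * (8 * \<mu>\<^sup>2))"
  define R where "R = A * (T powr (2 - 2 * b) * CG + C'\<^sup>2 * (cjb * CX))"
  have K0: "0 \<le> K" by (simp add: K_def)
  have A0: "0 \<le> A" using T by (simp add: A_def)
  have R0: "0 \<le> R" using A0 CG_nonneg CX_nonneg cjb_nonneg by (simp add: R_def)
  have main: "in_L2_Omega M (\<lambda>\<omega>. chi (real n * (T / real N)) \<omega> - chi_n N n \<omega>) \<and>
      L2_Omega_norm M (\<lambda>\<omega>. chi (real n * (T / real N)) \<omega> - chi_n N n \<omega>) \<le> sqrt R * (T / real N) powr (b - 1/2)"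
    if N: "N > 0" "T / real N < \<tau>\<^sub>0" and n: "n \<le> N" for N n
  proof -
    define \<tau> where "\<tau> = T / real N"
    have \<tau>: "0 < \<tau>" "\<tau> \<le> T" "real N * \<tau> = T" using N(1) T by (auto simp: \<tau>_def divide_le_eq)
    have sch: "fluctuation_scheme M \<beta> e \<mu> Qh \<tau> N (psi_n N) (chi_n N)" unfolding \<tau>_def by (rule scheme[OF N])
    have pK: "\<forall>n\<le>N. nl1w (fcoeff (psi_n N n)) \<le> ennreal K"
    proof (intro allI impI)
      fix n assume n: "n \<le> N"
      have "nl1w (fcoeff (psi_n N n)) \<le> ennreal (4 * sqrt (2 * pi) * L)"
        by (rule nl1w_le_of_Linf_abs_deriv[OF L(1)[OF N n] zero_mean[OF N n] L(2)[OF N n]])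
      also have "\<dots> \<le> ennreal K" unfolding K_def by (intro ennreal_leI mult_left_mono) auto
      finally show "nl1w (fcoeff (psi_n N n)) \<le> ennreal K" .
    qed
    have pD: "\<forall>n\<le>N. norm (\<psi> (real n * \<tau>) - psi_n N n) \<le> C' * \<tau> powr b"
    proof (intro allI impI)
      fix n assume "n \<le> N"
      then have "norm (\<psi> (real n * \<tau>) - psi_n N n) \<le> (MAX n\<in>{0..N}. norm (\<psi> (real n * \<tau>) - psi_n N n))" by (intro Max_ge) auto
      also have "\<dots> \<le> C' * \<tau> powr b" unfolding \<tau>_def by (rule C'[OF N])
      finally show "norm (\<psi> (real n * \<tau>) - psi_n N n) \<le> C' * \<tau> powr b" .
    qed
    have p0: "\<forall>n\<le>N. fcoeff (psi_n N n) 0 = 0" using zero_mean[OF N] by blast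
    have tn: "real n * \<tau> \<in> {0..T}" using n \<tau> mult_right_mono[of "real n" "real N" \<tau>] by auto
    have bound: "exp (CK * T) * T * ((1 + T) * (8 * \<mu>\<^sup>2 * (\<tau> * CG + (C' * \<tau> powr b)\<^sup>2 / \<tau> * (cjb * CX)))) \<le> (sqrt R * \<tau> powr (b - 1/2))\<^sup>2"
    proof -
      \<comment> \<open>The consistency part is of order \<tau>, which by \<open>b \<le> 1\<close>
        and \<open>\<tau> \<le> T\<close> is at most a constant times
        \<open>\<tau> powr (2 * b - 1)\<close>. This is where the power of \<open>T\<close> in
        \<open>R\<close> comes from.\<close>
      have "\<tau> = \<tau> powr (2 * b - 1) * \<tau> powr (2 - 2 * b)" using \<tau>(1) by (simp add: powr_add[symmetric])
      also have "\<dots> \<le> \<tau> powr (2 * b - 1) * T powr (2 - 2 * b)" using \<tau> \<open>b \<le> 1\<close> by (intro mult_left_mono powr_mono2) auto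
      finally have 1: "\<tau> * CG \<le> \<tau> powr (2 * b - 1) * T powr (2 - 2 * b) * CG" by (rule mult_right_mono[OF _ CG_nonneg])
      have "(\<tau> powr b)\<^sup>2 = \<tau> powr (2 * b - 1) * \<tau>"
        using \<tau>(1) powr_add[of \<tau> "2 * b - 1" 1] powr_add[of \<tau> b b] by (simp add: power2_eq_square)
      then have 2: "(C' * \<tau> powr b)\<^sup>2 / \<tau> = C'\<^sup>2 * \<tau> powr (2 * b - 1)" using \<tau>(1) by (simp add: power_mult_distrib)
      have 3: "(sqrt R * \<tau> powr (b - 1/2))\<^sup>2 = R * \<tau> powr (2 * b - 1)"
        using R0 powr_add[of \<tau> "b - 1/2" "b - 1/2"] by (simp add: power_mult_distrib power2_eq_square[of "_ powr _"])
      have "exp (CK * T) * T * ((1 + T) * (8 * \<mu>\<^sup>2 * (\<tau> * CG + (C' * \<tau> powr b)\<^sup>2 / \<tau> * (cjb * CX))))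
        = A * (\<tau> * CG + C'\<^sup>2 * \<tau> powr (2 * b - 1) * (cjb * CX))" unfolding 2 A_def by (simp only: mult.assoc)
      also have "\<dots> \<le> A * (\<tau> powr (2 * b - 1) * T powr (2 - 2 * b) * CG + C'\<^sup>2 * \<tau> powr (2 * b - 1) * (cjb * CX))"
        by (intro mult_left_mono[OF _ A0] add_right_mono 1)
      also have "\<dots> = R * \<tau> powr (2 * b - 1)" unfolding R_def by (simp add: algebra_simps)
      finally show ?thesis unfolding 3 .
    qed
    have Ym: "(\<lambda>\<omega>. chi (real n * \<tau>) \<omega> - chi_n N n \<omega>) \<in> borel_measurable M"
      by (rule measurable_l2_diff(1)[OF chi_measurable[OF tn] scheme_measurable[OF sch n]])
    have Yle: "msq M (\<lambda>\<omega>. chi (real n * \<tau>) \<omega> - chi_n N n \<omega>) \<le> ennreal ((sqrt R * \<tau> powr (b - 1/2))\<^sup>2)"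
      by (rule order_trans[OF scheme_error[OF sch \<tau>(1) eq_refl[OF \<tau>(3)] p0 pK K0 pD CK_def n] ennreal_leI[OF bound]])
    have r0: "0 \<le> sqrt R * \<tau> powr (b - 1/2)" using R0 by simp
    show ?thesis using L2_Omega_norm_le[OF Ym Yle r0] unfolding \<tau>_def by blast
  qed
  \<comment> \<open>As \<open>b \<le> 1\<close>, the exponent is determined by the approximation of
    \<psi>, with 1/2 attained for \<open>b = 1\<close>.\<close>
  have m: "min (1/2) (b - 1/2) = b - 1/2" using \<open>b \<le> 1\<close> by simp
  show ?thesis unfolding m
  proof (intro exI[of _ "sqrt R"] allI impI conjI)
    fix N :: nat assume N: "N > 0" "T / real N < \<tau>\<^sub>0"
    show "in_L2_Omega M (\<lambda>\<omega>. chi (real n * (T / real N)) \<omega> - chi_n N n \<omega>)" if "n \<le> N" for n using main[OF N that] by blast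
    show "(MAX n\<in>{0..N}. L2_Omega_norm M (\<lambda>\<omega>. chi (real n * (T / real N)) \<omega> - chi_n N n \<omega>)) \<le> sqrt R * (T / real N) powr (b - 1/2)"
      using main[OF N] by (subst Max_le_iff) auto
  qed
qed

end
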